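(* Let $n,d\in\mathbb{N}$, $\Lambda=n/d$, and let initial vectors $\mathbf{u}_1\in\mathbb{R}^n$, $\mathbf{v}_1\in\mathbb{R}^d$ and a sequence of first-order or saddle updates (as described in the context) be given. For each $k\in\mathbb{N}$, there is a unique pair of joint distributions $\mathsf{Law}(\mathbf{G}_k^{\mathrm{SE}},\mathbf{V}_k^{\mathrm{SE}},\widehat{\mathbf{V}}_k^{\mathrm{SE}})$ (on $(\mathbb{R}^{d\times k})^3$) and $\mathsf{Law}(\mathbf{H}_k^{\mathrm{SE}},\mathbf{U}_k^{\mathrm{SE}},\widehat{\mathbf{U}}_k^{\mathrm{SE}})$ (on $(\mathbb{R}^{n\times k})^3$) that satisfies the state evolution equations (SE-a)–(SE-e) given in the context.
   Context: Updates. For each $k\ge 2$ the update at iteration $k$ is designated either first-order or saddle. If it is first-order, we are given functions $f_k^u:\mathbb{R}^n\times\mathbb{R}^{n\times(k-1)}\to\mathbb{R}^n$ and $f_k^v:\mathbb{R}^d\times\mathbb{R}^{d\times(k-1)}\to\mathbb{R}^d$ which are $L$-Lipschitz. If it is saddle, we are given functions $\phi_k^u:\mathbb{R}^n\times\mathbb{R}^{n\times(k-1)}\to\mathbb{R}$ and $\phi_k^v:\mathbb{R}^d\times\mathbb{R}^{d\times(k-1)}\to\mathbb{R}$, written $\phi_k^u(\mathbf{u};\mathbf{U})$, $\phi_k^v(\mathbf{v};\mathbf{V})$, which are $\mu$-strongly convex ($\mu>0$) and $L$-smooth in the first argument, with gradients $\nabla\phi_k^u,\nabla\phi_k^v$ (always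 taken in the first argument) Lipschitz in all arguments. (No separability is assumed. The functions may additionally depend on auxiliary randomness independent of everything else, which is regarded as fixed and suppressed.) Notation. For matrices $\mathbf{A},\mathbf{B}$ with the same shape, $\langle\!\langle \mathbf{A},\mathbf{B}\rangle\!\rangle=\mathbf{A}^\top\mathbf{B}$ and $\langle\!\langle\mathbf{A},\mathbf{B}\rangle\!\rangle_{L^2}=\mathbb{E}[\mathbf{A}^\top\mathbf{B}]$ (entrywise). $\mathbf{z}_1,\dots,\mathbf{z}_k\sim\mathsf{N}(0,\mathbf{K}\otimes \mathbf{I}_m/m)$ means that these are jointly Gaussian, centered, with $\mathbb{E}[\mathbf{z}_\ell\mathbf{z}_{\ell'}^\top]=K_{\ell,\ell'}\mathbf{I}_m/m$. $\mathrm{span}$ denotes linear combinations with deterministic real coefficients. State evolution. $\mathbf{G}_k^{\mathrm{SE}},\mathbf{V}_k^{\mathrm{SE}},\widehat{\mathbf{V}}_k^{\mathrm{SE}}\in\mathbb{R}^{d\times k}$ are random matrices with columns $\mathbf{g}_\ell^{\mathrm{SE}},\mathbf{v}_\ell^{\mathrm{SE}},\widehat{\mathbf{v}}_\ell^{\mathrm{SE}}$, $\ell\le k$, on one probability space, and $\mathbf{H}_k^{\mathrm{SE}},\mathbf{U}_k^{\mathrm{SE}},\widehat{\mathbf{U}}_k^{\mathrm{SE}}\in\mathbb{R}^{n\times k}$ are random matrices with columns $\mathbf{h}_\ell^{\mathrm{SE}},\mathbf{u}_\ell^{\mathrm{SE}},\widehat{\mathbf{u}}_\ell^{\mathrm{SE}}$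 on another. The columns are square-integrable vectors regarded as elements of $L^2((\mathbb{R}^d)^k,\mathcal{B},\mathsf{N}(0,\mathbf{I}_d)^{\otimes k})$, respectively $L^2((\mathbb{R}^n)^k,\mathcal{B},\mathsf{N}(0,\mathbf{I}_n)^{\otimes k})$. The state evolution equations are: (SE-a) (Base case) $\mathbf{v}_1^{\mathrm{SE}}=\mathbf{v}_1$, $\mathbf{u}_1^{\mathrm{SE}}=\mathbf{u}_1$, $\widehat{\mathbf{u}}_1^{\mathrm{SE}}=0$, $\widehat{\mathbf{v}}_1^{\mathrm{SE}}=0$, $\mathbf{g}_1^{\mathrm{SE}}\sim\mathsf{N}(0,\|\mathbf{u}_1\|_2^2\mathbf{I}_d/d)$, $\mathbf{h}_1^{\mathrm{SE}}\sim\mathsf{N}(0,\|\mathbf{v}_1\|_2^2\mathbf{I}_n/n)$. (SE-b) For some covariance matrices $\mathbf{K}_k^g,\mathbf{K}_k^h\in\mathbb{R}^{k\times k}$: $\mathbf{g}_1^{\mathrm{SE}},\dots,\mathbf{g}_k^{\mathrm{SE}}\sim\mathsf{N}(0,\mathbf{K}_k^g\otimes\mathbf{I}_d/d)$, $\mathbf{h}_1^{\mathrm{SE}},\dots,\mathbf{h}_k^{\mathrm{SE}}\sim\mathsf{N}(0,\mathbf{K}_k^h\otimes\mathbf{I}_n/n)$; and for every $\ell\le k$, $\widehat{\mathbf{u}}_\ell^{\mathrm{SE}}\in\mathrm{span}(\{\mathbf{u}_{j}^{\mathrm{SE}}\}_{j\le\ell})$ and $\widehat{\mathbf{v}}_\ell^{\mathrm{SE}}\in\mathrm{span}(\{\mathbf{v}_{j}^{\mathrm{SE}}\}_{j\le\ell})$.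 (SE-c) For every $2\le\ell\le k$ with a first-order update: $\mathbf{u}_\ell^{\mathrm{SE}}=f_\ell^u(\sqrt{\Lambda}\,\mathbf{h}_{\ell-1}^{\mathrm{SE}}-\widehat{\mathbf{u}}_{\ell-1}^{\mathrm{SE}};\mathbf{U}_{\ell-1}^{\mathrm{SE}})$ and $\mathbf{v}_\ell^{\mathrm{SE}}=f_\ell^v(\mathbf{g}_{\ell-1}^{\mathrm{SE}}-\widehat{\mathbf{v}}_{\ell-1}^{\mathrm{SE}};\mathbf{V}_{\ell-1}^{\mathrm{SE}})$. (SE-d) For every $2\le\ell\le k$ with a saddle update: $\sqrt{\Lambda}\,\mathbf{h}_\ell^{\mathrm{SE}}-\widehat{\mathbf{u}}_\ell^{\mathrm{SE}}=\nabla\phi_\ell^u(\mathbf{u}_\ell^{\mathrm{SE}};\mathbf{U}_{\ell-1}^{\mathrm{SE}})$ and $\mathbf{g}_\ell^{\mathrm{SE}}-\widehat{\mathbf{v}}_\ell^{\mathrm{SE}}=\nabla\phi_\ell^v(\mathbf{v}_\ell^{\mathrm{SE}};\mathbf{V}_{\ell-1}^{\mathrm{SE}})$. (SE-e) $\mathbf{K}_k^g=\langle\!\langle\mathbf{G}_k^{\mathrm{SE}},\mathbf{G}_k^{\mathrm{SE}}\rangle\!\rangle_{L^2}=\langle\!\langle\mathbf{U}_k^{\mathrm{SE}},\mathbf{U}_k^{\mathrm{SE}}\rangle\!\rangle_{L^2}$, $\mathbf{K}_k^h=\langle\!\langle\mathbf{H}_k^{\mathrm{SE}},\mathbf{H}_k^{\mathrm{SE}}\rangle\!\rangle_{L^2}=\langle\!\langle\mathbf{V}_k^{\mathrm{SE}},\mathbf{V}_k^{\mathrm{SE}}\rangle\!\rangle_{L^2}$,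 $\langle\!\langle\mathbf{G}_k^{\mathrm{SE}},\mathbf{V}_k^{\mathrm{SE}}\rangle\!\rangle_{L^2}=\langle\!\langle\mathbf{U}_k^{\mathrm{SE}},\widehat{\mathbf{U}}_k^{\mathrm{SE}}\rangle\!\rangle_{L^2}$, and $\langle\!\langle\sqrt{\Lambda}\,\mathbf{H}_k^{\mathrm{SE}},\mathbf{U}_k^{\mathrm{SE}}\rangle\!\rangle_{L^2}=\langle\!\langle\mathbf{V}_k^{\mathrm{SE}},\widehat{\mathbf{V}}_k^{\mathrm{SE}}\rangle\!\rangle_{L^2}$. *)

theory Defs
  imports "HOL-Probability.Probability"
begin

section \<open>Updates\<close>

text \<open>
  A real matrix with rows indexed by the type \<open>'m\<close> and \<open>k\<close> columns is given by its columns, a function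
  \<open>nat \<Rightarrow> real^'m\<close> on the index set \<open>{1..k}\<close>, extensional (\<open>undefined\<close>) outside of it.
\<close>

abbreviation mats :: "nat \<Rightarrow> (nat \<Rightarrow> real^'m) set" where
  "mats k \<equiv> {1..k} \<rightarrow>\<^sub>E UNIV"

text \<open>Euclidean distance on \<open>\<real>\<^sup>m \<times> \<real>\<^bsup>m\<times>k\<^esup>\<close> (Frobenius on the matrix part).\<close>

definition joint_dist ::
  "nat \<Rightarrow> (real^'m) \<times> (nat \<Rightarrow> real^'m) \<Rightarrow> (real^'m) \<times> (nat \<Rightarrow> real^'m) \<Rightarrow> real" where
  "joint_dist k p q =
     sqrt ((dist (fst p) (fst q))\<^sup>2 + (\<Sum>j=1..k. (dist (snd p j) (snd q j))\<^sup>2))"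

definition joint_lipschitz ::
  "nat \<Rightarrow> real \<Rightarrow> (real^'m \<Rightarrow> (nat \<Rightarrow> real^'m) \<Rightarrow> real^'m) \<Rightarrow> bool" where
  "joint_lipschitz k C f \<longleftrightarrow>
     (\<forall>x y. \<forall>X\<in>mats k. \<forall>Y\<in>mats k. dist (f x X) (f y Y) \<le> C * joint_dist k (x, X) (y, Y))"

definition grad :: "('a::real_inner \<Rightarrow> real) \<Rightarrow> 'a \<Rightarrow> 'a" where
  "grad \<phi> x = (THE D. GDERIV \<phi> x :> D)"

definition strongly_convex :: "real \<Rightarrow> ('a::real_inner \<Rightarrow> real) \<Rightarrow> bool" where
  "strongly_convex \<mu> \<phi> \<longleftrightarrow> convex_on UNIV (\<lambda>x. \<phi> x - \<mu> / 2 * (norm x)\<^sup>2)"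

definition smooth :: "real \<Rightarrow> ('a::real_inner \<Rightarrow> real) \<Rightarrow> bool" where
  "smooth L \<phi> \<longleftrightarrow> (\<forall>x. \<exists>D. GDERIV \<phi> x :> D) \<and> L-lipschitz_on UNIV (grad \<phi>)"

definition saddle_regular ::
  "real \<Rightarrow> real \<Rightarrow> nat \<Rightarrow> (real^'m \<Rightarrow> (nat \<Rightarrow> real^'m) \<Rightarrow> real) \<Rightarrow> bool" where
  "saddle_regular L \<mu> k \<phi> \<longleftrightarrow>
     (\<forall>X\<in>mats k. strongly_convex \<mu> (\<lambda>x. \<phi> x X) \<and> smooth L (\<lambda>x. \<phi> x X)) \<and>
     (\<exists>C. joint_lipschitz k C (\<lambda>x X. grad (\<lambda>y. \<phi> y X) x))"

datatype ('n::finite, 'd::finite) update =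
    First_Order "real^'n \<Rightarrow> (nat \<Rightarrow> real^'n) \<Rightarrow> real^'n" "real^'d \<Rightarrow> (nat \<Rightarrow> real^'d) \<Rightarrow> real^'d"
  | Saddle "real^'n \<Rightarrow> (nat \<Rightarrow> real^'n) \<Rightarrow> real" "real^'d \<Rightarrow> (nat \<Rightarrow> real^'d) \<Rightarrow> real"

text \<open>Admissibility of the update at iteration \<open>l \<ge> 2\<close>, which sees \<open>l - 1\<close> previous iterates.\<close>

definition admissible_update ::
  "real \<Rightarrow> real \<Rightarrow> nat \<Rightarrow> ('n::finite, 'd::finite) update \<Rightarrow> bool" where
  "admissible_update L \<mu> l upd \<longleftrightarrow>
     (case upd of
        First_Order fu fv \<Rightarrow> joint_lipschitz (l - 1) L fu \<and> joint_lipschitz (l - 1) L fv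
      | Saddle \<phi>u \<phi>v \<Rightarrow> saddle_regular L \<mu> (l - 1) \<phi>u \<and> saddle_regular L \<mu> (l - 1) \<phi>v)"


section \<open>Gaussian vectors\<close>

text \<open>
  Degenerate (almost surely constant) variables count as normal: the covariance matrices in the state
  evolution may be singular, whereas \<^term>\<open>normal_density\<close> requires positive variance.
\<close>

definition normal_rv :: "'a measure \<Rightarrow> ('a \<Rightarrow> real) \<Rightarrow> bool" where
  "normal_rv M X \<longleftrightarrow>
     (\<exists>\<mu> \<sigma>. 0 < \<sigma> \<and> distributed M lborel X (normal_density \<mu> \<sigma>)) \<or>
     (X \<in> borel_measurable M \<and> (\<exists>c. AE \<omega> in M. X \<omega> = c))"

definition jointly_gaussian :: "'a measure \<Rightarrow> nat set \<Rightarrow> (nat \<Rightarrow> 'a \<Rightarrow> real^'m) \<Rightarrow> bool" where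
  "jointly_gaussian M I z \<longleftrightarrow>
     (\<forall>l\<in>I. z l \<in> borel_measurable M) \<and>
     (\<forall>c :: nat \<Rightarrow> real^'m. normal_rv M (\<lambda>\<omega>. \<Sum>l\<in>I. c l \<bullet> z l \<omega>))"

text \<open>\<open>(z\<^sub>l)\<^sub>l\<^sub>\<in>\<^sub>I \<sim> N(0, K \<otimes> I\<^sub>m / m)\<close>.\<close>

definition gaussian_columns ::
  "'a measure \<Rightarrow> nat set \<Rightarrow> (nat \<Rightarrow> nat \<Rightarrow> real) \<Rightarrow> (nat \<Rightarrow> 'a \<Rightarrow> real^'m) \<Rightarrow> bool" where
  "gaussian_columns M I K z \<longleftrightarrow>
     jointly_gaussian M I z \<and>
     (\<forall>l\<in>I. (\<integral>\<omega>. z l \<omega> \<partial>M) = 0) \<and>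
     (\<forall>l\<in>I. \<forall>l'\<in>I. \<forall>i j. (\<integral>\<omega>. z l \<omega> $ i * z l' \<omega> $ j \<partial>M) = K l l' * mat 1 $ i $ j / real CARD('m))"

definition covariance_matrix :: "nat \<Rightarrow> (nat \<Rightarrow> nat \<Rightarrow> real) \<Rightarrow> bool" where
  "covariance_matrix k K \<longleftrightarrow>
     (\<forall>i\<in>{1..k}. \<forall>j\<in>{1..k}. K i j = K j i) \<and>
     (\<forall>x. 0 \<le> (\<Sum>i=1..k. \<Sum>j=1..k. x i * K i j * x j))"

text \<open>\<open>N(0, I\<^sub>m)\<close>: independent standard normal coordinates.\<close>

definition std_gaussian :: "(real^'m) measure" where
  "std_gaussian =
     distr (\<Pi>\<^sub>M i\<in>(UNIV :: 'm set). density lborel std_normal_density) borel (\<lambda>x. \<chi> i. x i)"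

text \<open>The probability space \<open>((\<real>\<^sup>m)\<^sup>k, B, N(0, I\<^sub>m)\<^sup>\<otimes>\<^sup>k)\<close>.\<close>

definition gaussian_space :: "nat \<Rightarrow> (nat \<Rightarrow> real^'m) measure" where
  "gaussian_space k = (\<Pi>\<^sub>M l\<in>{1..k}. std_gaussian)"

lemma grad_eqI:
  assumes "GDERIV \<phi> x :> D"
  shows "grad \<phi> x = D"
  unfolding grad_def
proof (rule the_equality[of "\<lambda>D. GDERIV \<phi> x :> D", OF assms])
  fix E assume "GDERIV \<phi> x :> E"
  then have "(\<lambda>h. h \<bullet> E) = (\<lambda>h. h \<bullet> D)"
    using assms unfolding gderiv_def by (rule has_derivative_unique)
  then show "E = D"
    by (simp add: fun_eq_iff vector_eq_ldot)
qed

lemma prob_space_std_gaussian: "prob_space (std_gaussian :: (real^'m) measure)"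
proof -
  let ?N = "density lborel std_normal_density"
  interpret N: prob_space ?N
    by (rule prob_space_normal_density) simp
  interpret P: product_prob_space "\<lambda>_ :: 'm. ?N" UNIV
    by unfold_locales
  have "(\<lambda>x. \<chi> i. x i) \<in> borel_measurable (\<Pi>\<^sub>M i\<in>(UNIV :: 'm set). ?N)"
  proof (rule borel_measurable_euclidean_space[THEN iffD2], rule ballI)
    fix b :: "real^'m" assume "b \<in> Basis"
    then obtain i where "b = axis i 1"
      by (auto simp: Basis_vec_def)
    then show "(\<lambda>x. (\<chi> i. x i) \<bullet> b) \<in> borel_measurable (\<Pi>\<^sub>M i\<in>(UNIV :: 'm set). ?N)"
      by (simp add: inner_axis)
  qed
  then show ?thesis
    unfolding std_gaussian_def by (rule P.prob_space_distr)
qed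

lemma prob_space_gaussian_space: "prob_space (gaussian_space k :: (nat \<Rightarrow> real^'m) measure)"
  unfolding gaussian_space_def by (intro prob_space_PiM prob_space_std_gaussian)


section \<open>State evolution\<close>

text \<open>The \<open>k\<close>-column matrix with columns \<open>A\<^sub>1(\<omega>), \<dots>, A\<^sub>k(\<omega>)\<close>.\<close>

abbreviation cols :: "nat \<Rightarrow> (nat \<Rightarrow> 'a \<Rightarrow> real^'m) \<Rightarrow> 'a \<Rightarrow> nat \<Rightarrow> real^'m" where
  "cols k A \<omega> \<equiv> (\<lambda>l\<in>{1..k}. A l \<omega>)"

text \<open>Entry \<open>(i, j)\<close> of \<open>E[A\<^sup>T B]\<close>.\<close>

definition gram :: "'a measure \<Rightarrow> (nat \<Rightarrow> 'a \<Rightarrow> real^'m) \<Rightarrow> (nat \<Rightarrow> 'a \<Rightarrow> real^'m) \<Rightarrow> nat \<Rightarrow> nat \<Rightarrow> real" where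
  "gram M A B i j = (\<integral>\<omega>. A i \<omega> \<bullet> B j \<omega> \<partial>M)"

definition square_integrable :: "'a measure \<Rightarrow> ('a \<Rightarrow> real^'m) \<Rightarrow> bool" where
  "square_integrable M X \<longleftrightarrow> X \<in> borel_measurable M \<and> integrable M (\<lambda>\<omega>. (norm (X \<omega>))\<^sup>2)"

definition in_span :: "'a measure \<Rightarrow> nat \<Rightarrow> (nat \<Rightarrow> 'a \<Rightarrow> real^'m) \<Rightarrow> ('a \<Rightarrow> real^'m) \<Rightarrow> bool" where
  "in_span M l A X \<longleftrightarrow> (\<exists>c :: nat \<Rightarrow> real. AE \<omega> in M. X \<omega> = (\<Sum>j=1..l. c j *\<^sub>R A j \<omega>))"

text \<open>
  The state evolution equations up to iteration \<open>k\<close>, for \<open>G\<close>, \<open>V\<close>, \<open>Vh\<close> on a probability space \<open>M\<close>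
  and \<open>H\<close>, \<open>U\<close>, \<open>Uh\<close> on a probability space \<open>N\<close>. Random vectors are elements of \<open>L\<^sup>2\<close>, so
  identities between them hold almost everywhere.
\<close>

definition state_evolution ::
  "real^'n \<Rightarrow> real^'d \<Rightarrow> (nat \<Rightarrow> ('n::finite, 'd::finite) update) \<Rightarrow> nat \<Rightarrow>
   'a measure \<Rightarrow> (nat \<Rightarrow> 'a \<Rightarrow> real^'d) \<Rightarrow> (nat \<Rightarrow> 'a \<Rightarrow> real^'d) \<Rightarrow> (nat \<Rightarrow> 'a \<Rightarrow> real^'d) \<Rightarrow>
   'b measure \<Rightarrow> (nat \<Rightarrow> 'b \<Rightarrow> real^'n) \<Rightarrow> (nat \<Rightarrow> 'b \<Rightarrow> real^'n) \<Rightarrow> (nat \<Rightarrow> 'b \<Rightarrow> real^'n) \<Rightarrow> bool" where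
  "state_evolution u1 v1 upd k M G V Vh N H U Uh \<longleftrightarrow>
    (let \<Lambda> = real CARD('n) / real CARD('d) in
     (\<forall>l\<in>{1..k}. square_integrable M (G l) \<and> square_integrable M (V l) \<and> square_integrable M (Vh l) \<and>
                 square_integrable N (H l) \<and> square_integrable N (U l) \<and> square_integrable N (Uh l)) \<and>
     (AE \<omega> in M. V 1 \<omega> = v1) \<and> (AE \<omega> in N. U 1 \<omega> = u1) \<and>
     (AE \<omega> in N. Uh 1 \<omega> = 0) \<and> (AE \<omega> in M. Vh 1 \<omega> = 0) \<and>
     gaussian_columns M {1} (\<lambda>_ _. (norm u1)\<^sup>2) G \<and>
     gaussian_columns N {1} (\<lambda>_ _. (norm v1)\<^sup>2) H \<and>
     (\<exists>Kg Kh.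
       covariance_matrix k Kg \<and> covariance_matrix k Kh \<and>
       gaussian_columns M {1..k} Kg G \<and> gaussian_columns N {1..k} Kh H \<and>
       (\<forall>l\<in>{1..k}. in_span N l U (Uh l) \<and> in_span M l V (Vh l)) \<and>
       (\<forall>l\<in>{2..k}.
          case upd l of
            First_Order fu fv \<Rightarrow>
              (AE \<omega> in N. U l \<omega> = fu (sqrt \<Lambda> *\<^sub>R H (l - 1) \<omega> - Uh (l - 1) \<omega>) (cols (l - 1) U \<omega>)) \<and>
              (AE \<omega> in M. V l \<omega> = fv (G (l - 1) \<omega> - Vh (l - 1) \<omega>) (cols (l - 1) V \<omega>))
          | Saddle \<phi>u \<phi>v \<Rightarrow>
              (AE \<omega> in N. sqrt \<Lambda> *\<^sub>R H l \<omega> - Uh l \<omega> = grad (\<lambda>x. \<phi>u x (cols (l - 1) U \<omega>)) (U l \<omega>)) \<and>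
              (AE \<omega> in M. G l \<omega> - Vh l \<omega> = grad (\<lambda>x. \<phi>v x (cols (l - 1) V \<omega>)) (V l \<omega>))) \<and>
       (\<forall>i\<in>{1..k}. \<forall>j\<in>{1..k}.
          Kg i j = gram M G G i j \<and> gram M G G i j = gram N U U i j \<and>
          Kh i j = gram N H H i j \<and> gram N H H i j = gram M V V i j \<and>
          gram M G V i j = gram N U Uh i j \<and>
          gram N (\<lambda>l \<omega>. sqrt \<Lambda> *\<^sub>R H l \<omega>) U i j = gram M V Vh i j)))"

text \<open>The Borel space of triples of \<open>m \<times> k\<close> matrices and the joint law of three random matrices.\<close>

abbreviation mat_borel :: "nat \<Rightarrow> (nat \<Rightarrow> real^'m) measure" where
  "mat_borel k \<equiv> (\<Pi>\<^sub>M l\<in>{1..k}. borel)"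

definition law3 ::
  "nat \<Rightarrow> 'a measure \<Rightarrow> (nat \<Rightarrow> 'a \<Rightarrow> real^'m) \<Rightarrow> (nat \<Rightarrow> 'a \<Rightarrow> real^'m) \<Rightarrow> (nat \<Rightarrow> 'a \<Rightarrow> real^'m) \<Rightarrow>
   ((nat \<Rightarrow> real^'m) \<times> (nat \<Rightarrow> real^'m) \<times> (nat \<Rightarrow> real^'m)) measure" where
  "law3 k M A B C =
     distr M (mat_borel k \<Otimes>\<^sub>M mat_borel k \<Otimes>\<^sub>M mat_borel k) (\<lambda>\<omega>. (cols k A \<omega>, cols k B \<omega>, cols k C \<omega>))"

text \<open>
  \<open>P\<close> and \<open>Q\<close> are the laws of \<open>(G, V, Vh)\<close> and \<open>(H, U, Uh)\<close> for some solution of the state evolution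
  equations on the spaces \<open>((\<real>\<^sup>d)\<^sup>k, N(0, I\<^sub>d)\<^sup>\<otimes>\<^sup>k)\<close> and \<open>((\<real>\<^sup>n)\<^sup>k, N(0, I\<^sub>n)\<^sup>\<otimes>\<^sup>k)\<close>.
\<close>

definition state_evolution_laws ::
  "real^'n \<Rightarrow> real^'d \<Rightarrow> (nat \<Rightarrow> ('n::finite, 'd::finite) update) \<Rightarrow> nat \<Rightarrow>
   ((nat \<Rightarrow> real^'d) \<times> (nat \<Rightarrow> real^'d) \<times> (nat \<Rightarrow> real^'d)) measure \<Rightarrow>
   ((nat \<Rightarrow> real^'n) \<times> (nat \<Rightarrow> real^'n) \<times> (nat \<Rightarrow> real^'n)) measure \<Rightarrow> bool" where
  "state_evolution_laws u1 v1 upd k P Q \<longleftrightarrow>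
     (let M = gaussian_space k :: (nat \<Rightarrow> real^'d) measure;
          N = gaussian_space k :: (nat \<Rightarrow> real^'n) measure
      in \<exists>G V Vh H U Uh.
           state_evolution u1 v1 upd k M G V Vh N H U Uh \<and>
           P = law3 k M G V Vh \<and> Q = law3 k N H U Uh)"

end

theory Submission
  imports Defs
begin

text \<open>
  Let \<open>e\<^sub>i\<close> and \<open>f\<^sub>i\<close> be the Gram-Schmidt orthonormalisations of \<open>u\<^sub>1, u\<^sub>2, \<dots>\<close> and \<open>v\<^sub>1, v\<^sub>2, \<dots>\<close> in \<open>L\<^sup>2\<close>, and
  \<open>\<xi>\<^sub>i\<close>, \<open>\<zeta>\<^sub>i\<close> the independent Gaussian coordinates. In the canonical ansatz
  \<open>g\<^sub>l = \<Sum>\<^sub>i \<langle>u\<^sub>l, e\<^sub>i\<rangle> \<xi>\<^sub>i\<close>, \<open>uh\<^sub>l = \<Sum>\<^sub>i \<langle>\<xi>\<^sub>i, v\<^sub>l\<rangle> e\<^sub>i\<close> (and symmetrically for \<open>h\<^sub>l\<close>, \<open>vh\<^sub>l\<close>) all moment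
  conditions hold automatically. A first-order update is then explicit, and a saddle update is a
  strongly monotone saddle equation in \<open>L\<^sup>2\<close> coupled through four scalars: a solution exists by Brouwer's
  theorem, and it is unique by the Cauchy-Schwarz inequality.

  For uniqueness of the laws, innovation inequalities from strong monotonicity force the diagonal memory
  coefficients of any solution to be nonnegative. So \<open>u\<^sub>l\<close> and \<open>v\<^sub>l\<close> are functions of \<open>h\<^sub>1, \<dots>, h\<^sub>l\<close> and
  \<open>g\<^sub>1, \<dots>, g\<^sub>l\<close>, and the solution can be copied, without changing its law, onto the canonical one.
\<close>

section \<open>Square-integrable random vectors\<close>

text \<open>Two obstacles shape the argument. Covariances may be singular. Then the coefficients of
  a memory term are not unique and quotients by an innovation norm make no sense, so memory terms
  are compared as vectors, through their inner products, and Gram-Schmidt is written with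
  \<open>sgn\<close>, which sends a vanishing residual to zero.

  A saddle update is moreover implicit on both sides at once: the law of \<open>h_l\<close> is fixed
  by the Gram matrix of \<open>v_1, ..., v_l\<close>, whose last row is itself unknown, and
  symmetrically for \<open>g_l\<close> and \<open>u_l\<close>. A given solution, which is not even
  assumed to be adapted, thus cannot be compared directly with the canonical one. It is moved onto a
  process with the canonical past and one fresh coordinate of still unknown amplitude; there it
  solves the same system in the same Hilbert space, and uniqueness of that system identifies
  iterates and amplitudes together.

  Signs enter twice. With a nonnegative diagonal memory coefficient the implicit equation is
  strongly monotone and can be inverted pointwise, which yields adaptedness; and the Cauchy-Schwarz
  step needs nonnegative responses to the fresh coordinates.\<close>

lemma sets_std_gaussian [simp, measurable_cong]: "sets (std_gaussian :: (real^'m) measure) = sets borel"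
  by (simp add: std_gaussian_def)

text \<open>Infinitely many coordinates, so that a single Hilbert space serves all \<open>k\<close>.\<close>

definition gauss :: "(nat \<Rightarrow> real^'m) measure" where
  "gauss = (\<Pi>\<^sub>M l\<in>UNIV. std_gaussian)"

text \<open>For countably many second countable factors the product sigma-algebra is the Borel one
  of the product topology, so continuous functions of the whole process are measurable without
  further work.\<close>

lemma sets_gauss [simp, measurable_cong]: "sets (gauss :: (nat \<Rightarrow> real^'m) measure) = sets borel"
proof -
  have "sets (gauss :: (nat \<Rightarrow> real^'m) measure) = sets (\<Pi>\<^sub>M l\<in>(UNIV::nat set). (borel :: (real^'m) measure))"
    unfolding gauss_def by (rule sets_PiM_cong) simp_all
  then show ?thesis
    by (simp add: sets_PiM_equal_borel)
qed

lemma space_gauss [simp]: "space (gauss :: (nat \<Rightarrow> real^'m) measure) = UNIV"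
  using sets_eq_imp_space_eq[OF sets_gauss] by simp

interpretation gauss: prob_space "gauss :: (nat \<Rightarrow> real^'m) measure"
  unfolding gauss_def by (intro prob_space_PiM prob_space_std_gaussian)

section \<open>Square-integrable random vectors modulo almost everywhere equality\<close>

definition L2 :: "((nat \<Rightarrow> real^'m) \<Rightarrow> real^'m) \<Rightarrow> bool" where
  "L2 X \<longleftrightarrow> X \<in> borel_measurable borel \<and> integrable gauss (\<lambda>\<omega>. (norm (X \<omega>))\<^sup>2)"

lemma borel_measurable_gauss_iff: "f \<in> borel_measurable gauss \<longleftrightarrow> f \<in> borel_measurable borel"
  by (simp add: measurable_def)

lemma integrable_inner_L2:
  assumes "L2 X" "L2 Y"
  shows "integrable gauss (\<lambda>\<omega>. X \<omega> \<bullet> Y \<omega>)"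
proof (rule Bochner_Integration.integrable_bound)
  show "integrable gauss (\<lambda>\<omega>. (norm (X \<omega>))\<^sup>2 + (norm (Y \<omega>))\<^sup>2)"
    using assms by (auto simp: L2_def)
  have [measurable]: "X \<in> borel_measurable borel" "Y \<in> borel_measurable borel"
    using assms by (auto simp: L2_def)
  show "(\<lambda>\<omega>. X \<omega> \<bullet> Y \<omega>) \<in> borel_measurable gauss" by measurable
  have "\<bar>x \<bullet> y\<bar> \<le> (norm x)\<^sup>2 + (norm y)\<^sup>2" for x y :: "real^'m"
  proof -
    have "\<bar>x \<bullet> y\<bar> \<le> norm x * norm y" by (rule Cauchy_Schwarz_ineq2)
    moreover have "2 * norm x * norm y \<le> (norm x)\<^sup>2 + (norm y)\<^sup>2" by (rule sum_squares_bound)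
    moreover have "0 \<le> norm x * norm y" by simp
    ultimately show ?thesis by linarith
  qed
  then show "AE \<omega> in gauss. norm (X \<omega> \<bullet> Y \<omega>) \<le> norm ((norm (X \<omega>))\<^sup>2 + (norm (Y \<omega>))\<^sup>2)"
    by auto
qed

lemma L2_bound:
  assumes [measurable]: "X \<in> borel_measurable borel" and "integrable gauss f"
    and "AE \<omega> in gauss. (norm (X \<omega>))\<^sup>2 \<le> f \<omega>"
  shows "L2 X"
  unfolding L2_def
proof
  show "integrable gauss (\<lambda>\<omega>. (norm (X \<omega>))\<^sup>2)"
    using assms(2) by (rule Bochner_Integration.integrable_bound) (use assms(3) in auto)
qed fact

lemma L2_add: assumes "L2 X" "L2 Y" shows "L2 (\<lambda>\<omega>. X \<omega> + Y \<omega>)"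
proof (rule L2_bound)
  have [measurable]: "X \<in> borel_measurable borel" "Y \<in> borel_measurable borel"
    using assms by (auto simp: L2_def)
  show "(\<lambda>\<omega>. X \<omega> + Y \<omega>) \<in> borel_measurable borel" by measurable
  show "integrable gauss (\<lambda>\<omega>. (norm (X \<omega>))\<^sup>2 + 2 * (X \<omega> \<bullet> Y \<omega>) + (norm (Y \<omega>))\<^sup>2)"
    using assms integrable_inner_L2[OF assms] by (auto simp: L2_def)
  show "AE \<omega> in gauss. (norm (X \<omega> + Y \<omega>))\<^sup>2 \<le> (norm (X \<omega>))\<^sup>2 + 2 * (X \<omega> \<bullet> Y \<omega>) + (norm (Y \<omega>))\<^sup>2"
    by (auto simp: power2_norm_eq_inner inner_add inner_commute)
qed

lemma L2_scaleR: "L2 X \<Longrightarrow> L2 (\<lambda>\<omega>. c *\<^sub>R X \<omega>)"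
  by (auto simp: L2_def power_mult_distrib)

lemma L2_const: "L2 (\<lambda>\<omega>. c)"
  by (auto simp: L2_def)

\<comment> \<open>The quotient is partial because only square-integrable functions are to be
  classified; this is why \<open>rep_cl\<close> asks for \<open>L2 X\<close>. Almost everywhere
  identities become equations, so that spans, projections and fixed points can be handled in a
  Hilbert space.\<close>
quotient_type 'm l2 = "(nat \<Rightarrow> real^'m) \<Rightarrow> real^'m" /
  partial: "\<lambda>X Y. L2 X \<and> L2 Y \<and> (AE \<omega> in gauss. X \<omega> = Y \<omega>)"
proof (rule part_equivpI)
  show "\<exists>X. L2 X \<and> L2 X \<and> (AE \<omega> in gauss. X \<omega> = X \<omega>)"
    using L2_const by blast
  show "symp (\<lambda>X Y. L2 X \<and> L2 Y \<and> (AE \<omega> in gauss. X \<omega> = Y \<omega>))"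
    by (auto simp: symp_def eq_commute)
  show "transp (\<lambda>X Y. L2 X \<and> L2 Y \<and> (AE \<omega> in gauss. X \<omega> = Y \<omega>))"
    unfolding transp_def
  proof (intro allI impI; elim conjE, intro conjI)
    fix X Y Z :: "(nat \<Rightarrow> real^'a) \<Rightarrow> real^'a"
    assume "AE \<omega> in gauss. X \<omega> = Y \<omega>" "AE \<omega> in gauss. Y \<omega> = Z \<omega>"
    then show "AE \<omega> in gauss. X \<omega> = Z \<omega>" by eventually_elim simp
  qed
qed

abbreviation rep :: "'m l2 \<Rightarrow> (nat \<Rightarrow> real^'m) \<Rightarrow> real^'m" where "rep \<equiv> rep_l2"
abbreviation cl :: "((nat \<Rightarrow> real^'m) \<Rightarrow> real^'m) \<Rightarrow> 'm l2" where "cl \<equiv> abs_l2"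

lemma L2_rep [simp]: "L2 (rep x)"
  using Quotient3_rep_reflp[OF Quotient3_l2] by blast

lemma rep_measurable [measurable]: "rep x \<in> borel_measurable borel"
  using L2_rep L2_def by blast

lemma rep_cl: "L2 X \<Longrightarrow> AE \<omega> in gauss. rep (cl X) \<omega> = X \<omega>"
  using Quotient3_rep_abs[OF Quotient3_l2, of X] by auto

lemma l2_eqI: "AE \<omega> in gauss. rep x \<omega> = rep y \<omega> \<Longrightarrow> x = y"
  using Quotient3_rel_rep[OF Quotient3_l2, of x y] by auto

instantiation l2 :: (finite) real_vector
begin
definition zero_l2 :: "'a l2" where "zero_l2 = cl (\<lambda>\<omega>. 0)"
definition plus_l2 :: "'a l2 \<Rightarrow> 'a l2 \<Rightarrow> 'a l2" where "plus_l2 x y = cl (\<lambda>\<omega>. rep x \<omega> + rep y \<omega>)"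
definition scaleR_l2 :: "real \<Rightarrow> 'a l2 \<Rightarrow> 'a l2" where "scaleR_l2 c x = cl (\<lambda>\<omega>. c *\<^sub>R rep x \<omega>)"
definition uminus_l2 :: "'a l2 \<Rightarrow> 'a l2" where "uminus_l2 x = (-1) *\<^sub>R x"
definition minus_l2 :: "'a l2 \<Rightarrow> 'a l2 \<Rightarrow> 'a l2" where "minus_l2 x y = x + (-1) *\<^sub>R y"

lemma rep_zero: "AE \<omega> in gauss. rep (0::'a l2) \<omega> = 0"
  unfolding zero_l2_def by (rule rep_cl[OF L2_const])
lemma rep_add: "AE \<omega> in gauss. rep (x + y :: 'a l2) \<omega> = rep x \<omega> + rep y \<omega>"
  unfolding plus_l2_def by (rule rep_cl[OF L2_add]) auto
lemma rep_scaleR: "AE \<omega> in gauss. rep (c *\<^sub>R x :: 'a l2) \<omega> = c *\<^sub>R rep x \<omega>"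
  unfolding scaleR_l2_def by (rule rep_cl[OF L2_scaleR]) auto

instance
proof
  fix a b c :: "'a l2" and s t :: real
  show "a + b + c = a + (b + c)"
    by (rule l2_eqI) (use rep_add[of "a+b" c] rep_add[of a b] rep_add[of a "b+c"] rep_add[of b c] in
      \<open>eventually_elim, simp add: add.assoc\<close>)
  show "a + b = b + a"
    by (rule l2_eqI) (use rep_add[of a b] rep_add[of b a] in \<open>eventually_elim, simp\<close>)
  show "0 + a = a"
    by (rule l2_eqI) (use rep_add[of 0 a] rep_zero in \<open>eventually_elim, simp\<close>)
  show "- a + a = 0" unfolding uminus_l2_def
    by (rule l2_eqI) (use rep_add[of "(-1) *\<^sub>R a" a] rep_zero rep_scaleR[of "-1" a] in \<open>eventually_elim, simp\<close>)
  show "a - b = a + - b" by (simp add: minus_l2_def uminus_l2_def)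
  show "s *\<^sub>R (a + b) = s *\<^sub>R a + s *\<^sub>R b"
    by (rule l2_eqI) (use rep_add[of a b] rep_add[of "s *\<^sub>R a" "s *\<^sub>R b"] rep_scaleR[of s a] rep_scaleR[of s b]
      rep_scaleR[of s "a + b"] in \<open>eventually_elim, simp add: scaleR_add_right\<close>)
  show "(s + t) *\<^sub>R a = s *\<^sub>R a + t *\<^sub>R a"
    by (rule l2_eqI) (use rep_add[of "s *\<^sub>R a" "t *\<^sub>R a"] rep_scaleR[of s a] rep_scaleR[of t a]
      rep_scaleR[of "s + t" a] in \<open>eventually_elim, simp add: scaleR_add_left\<close>)
  show "s *\<^sub>R t *\<^sub>R a = (s * t) *\<^sub>R a"
    by (rule l2_eqI) (use rep_scaleR[of s "t *\<^sub>R a"] rep_scaleR[of t a] rep_scaleR[of "s * t" a] in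
      \<open>eventually_elim, simp\<close>)
  show "1 *\<^sub>R a = a"
    by (rule l2_eqI) (use rep_scaleR[of 1 a] in \<open>eventually_elim, simp\<close>)
qed
end

lemma rep_diff: "AE \<omega> in gauss. rep (x - y :: 'a::finite l2) \<omega> = rep x \<omega> - rep y \<omega>"
  unfolding minus_l2_def using rep_add[of x "(-1) *\<^sub>R y"] rep_scaleR[of "-1" y] by eventually_elim simp

lemma rep_lincomb: "AE \<omega> in gauss. rep (\<Sum>i\<in>I. c i *\<^sub>R x i :: 'a::finite l2) \<omega> = (\<Sum>i\<in>I. c i *\<^sub>R rep (x i) \<omega>)"
proof (induction I rule: infinite_finite_induct)
  case (insert i I)
  from rep_add[of "c i *\<^sub>R x i" "\<Sum>i\<in>I. c i *\<^sub>R x i"] rep_scaleR[of "c i" "x i"] insert.IH show ?case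
    by eventually_elim (use insert.hyps in simp)
qed (use rep_zero in auto)

lemma integrable_rep_inner [simp]: "integrable gauss (\<lambda>\<omega>. rep x \<omega> \<bullet> rep y \<omega>)"
  by (rule integrable_inner_L2) auto

instantiation l2 :: (finite) real_inner
begin
definition inner_l2 :: "'a l2 \<Rightarrow> 'a l2 \<Rightarrow> real" where "inner_l2 x y = (\<integral>\<omega>. rep x \<omega> \<bullet> rep y \<omega> \<partial>gauss)"
definition norm_l2 :: "'a l2 \<Rightarrow> real" where "norm_l2 x = sqrt (inner x x)"
definition sgn_l2 :: "'a l2 \<Rightarrow> 'a l2" where "sgn_l2 x = x /\<^sub>R norm x"
definition dist_l2 :: "'a l2 \<Rightarrow> 'a l2 \<Rightarrow> real" where "dist_l2 x y = norm (x - y)"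
definition uniformity_l2 :: "('a l2 \<times> 'a l2) filter" where
  "uniformity_l2 = (INF e\<in>{0 <..}. principal {(x, y). dist x y < e})"
definition open_l2 :: "'a l2 set \<Rightarrow> bool" where
  "open_l2 U = (\<forall>x\<in>U. \<forall>\<^sub>F (x', y) in uniformity. x' = x \<longrightarrow> y \<in> U)"

instance
proof
  fix x y z :: "'a l2" and r :: real and U :: "'a l2 set"
  show "x \<bullet> y = y \<bullet> x" by (simp add: inner_l2_def inner_commute)
  have "(x + y) \<bullet> z = (\<integral>\<omega>. rep x \<omega> \<bullet> rep z \<omega> + rep y \<omega> \<bullet> rep z \<omega> \<partial>gauss)"
    unfolding inner_l2_def
    by (rule integral_cong_AE, measurable) (use rep_add[of x y] in \<open>eventually_elim, simp add: inner_add_left\<close>)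
  then show "(x + y) \<bullet> z = x \<bullet> z + y \<bullet> z"
    by (simp add: inner_l2_def)
  have "(r *\<^sub>R x) \<bullet> y = (\<integral>\<omega>. r * (rep x \<omega> \<bullet> rep y \<omega>) \<partial>gauss)"
    unfolding inner_l2_def
    by (rule integral_cong_AE, measurable) (use rep_scaleR[of r x] in \<open>eventually_elim, simp\<close>)
  then show "r *\<^sub>R x \<bullet> y = r * (x \<bullet> y)"
    by (simp add: inner_l2_def)
  show "0 \<le> x \<bullet> x" by (simp add: inner_l2_def)
  show "x \<bullet> x = 0 \<longleftrightarrow> x = 0"
  proof
    assume "x \<bullet> x = 0"
    then have "AE \<omega> in gauss. rep x \<omega> \<bullet> rep x \<omega> = 0"
      unfolding inner_l2_def by (subst (asm) integral_nonneg_eq_0_iff_AE) auto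
    then have "AE \<omega> in gauss. rep x \<omega> = rep 0 \<omega>"
      using rep_zero by eventually_elim simp
    then show "x = 0" by (rule l2_eqI)
  next
    assume x: "x = 0"
    have "AE \<omega> in gauss. rep x \<omega> \<bullet> rep x \<omega> = 0"
      using rep_zero unfolding x by eventually_elim simp
    then show "x \<bullet> x = 0"
      unfolding inner_l2_def by (subst integral_nonneg_eq_0_iff_AE) auto
  qed
qed (auto simp: norm_l2_def sgn_l2_def dist_l2_def uniformity_l2_def open_l2_def)
end

lemma norm_sq_l2: "(norm x)\<^sup>2 = (\<integral>\<omega>. (norm (rep x \<omega>))\<^sup>2 \<partial>gauss)"
  by (simp add: power2_norm_eq_inner inner_l2_def)

lemma inner_cl:
  assumes "L2 X" "L2 Y"
  shows "cl X \<bullet> cl Y = (\<integral>\<omega>. X \<omega> \<bullet> Y \<omega> \<partial>gauss)"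
proof -
  have [measurable]: "X \<in> borel_measurable borel" "Y \<in> borel_measurable borel"
    using assms by (auto simp: L2_def)
  show ?thesis
    unfolding inner_l2_def
    by (rule integral_cong_AE, measurable)
      (use rep_cl[OF assms(1)] rep_cl[OF assms(2)] in \<open>eventually_elim, simp\<close>)
qed

lemma integrable_norm_sq_rep [simp]: "integrable gauss (\<lambda>\<omega>. (norm (rep x \<omega>))\<^sup>2)"
  using L2_rep unfolding L2_def by blast

lemma integrable_norm_rep [simp]: "integrable gauss (\<lambda>\<omega>. norm (rep x \<omega>))"
  by (rule gauss.square_integrable_imp_integrable) auto

text \<open>Nonnegativity of the variance of the norm. It controls increments in mean in the
  completeness proof.\<close>

lemma integral_norm_le: "(\<integral>\<omega>. norm (rep x \<omega>) \<partial>gauss) \<le> norm x" for x :: "'a::finite l2"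
proof -
  have "(\<integral>\<omega>. norm (rep x \<omega>) \<partial>gauss)\<^sup>2 \<le> (norm x)\<^sup>2"
    using gauss.variance_positive[of "\<lambda>\<omega>. norm (rep x \<omega>)"]
    by (subst (asm) gauss.variance_eq) (simp_all add: norm_sq_l2)
  then show ?thesis by (rule power2_le_imp_le) simp
qed

text \<open>Riesz-Fischer: a subsequence with geometrically small increments has increments summable
  in mean, hence summable almost everywhere, and Fatou's lemma turns the pointwise limit into a
  limit in mean square.\<close>

instance l2 :: (finite) complete_space
proof
  fix X :: "nat \<Rightarrow> 'a l2" assume X: "Cauchy X"
  have "\<exists>N. \<forall>m\<ge>N. \<forall>n\<ge>N. dist (X m) (X n) < (1/2)^j" for j
    by (rule metric_CauchyD[OF X]) simp
  then obtain N where N: "\<And>j m n. m \<ge> N j \<Longrightarrow> n \<ge> N j \<Longrightarrow> dist (X m) (X n) < (1/2)^j"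
    by metis
  \<comment> \<open>Partial sums make the \<open>j\<close>-th index exceed all thresholds
    \<open>N i\<close> with \<open>i \<le> j\<close>, so that two terms of the subsequence beyond
    \<open>k\<close> are within \<open>(1/2)^k\<close>.\<close>
  define r where "r j = (\<Sum>i\<le>j. N i)" for j
  have rN: "i \<le> j \<Longrightarrow> N i \<le> r j" for i j
    unfolding r_def by (rule member_le_sum) auto
  define x where "x j = X (r j)" for j
  have d: "dist (x i) (x j) \<le> (1/2)^k" if "k \<le> i" "k \<le> j" for i j k
    unfolding x_def using N[of k "r i" "r j"] rN that by (auto intro: less_imp_le)
  define D where "D j \<omega> = norm (rep (x (Suc j) - x j) \<omega>)" for j \<omega>
  have Dm[measurable]: "D j \<in> borel_measurable borel" for j
    unfolding D_def by measurable
  have Di: "integrable gauss (D j)" for j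
    unfolding D_def by simp
  have "(\<integral>\<^sup>+\<omega>. (\<Sum>j. ennreal (D j \<omega>)) \<partial>gauss) = (\<Sum>j. \<integral>\<^sup>+\<omega>. ennreal (D j \<omega>) \<partial>gauss)"
    by (rule nn_integral_suminf) measurable
  also have "\<dots> \<le> (\<Sum>j. ennreal ((1/2)^j))"
  proof (rule suminf_le)
    fix j
    have "(\<integral>\<omega>. norm (rep (x (Suc j) - x j) \<omega>) \<partial>gauss) \<le> (1/2)^j"
      using integral_norm_le[of "x (Suc j) - x j"] d[of j "Suc j" j] by (simp add: dist_norm)
    moreover have "D j = (\<lambda>\<omega>. norm (rep (x (Suc j) - x j) \<omega>))"
      by (simp add: D_def fun_eq_iff)
    ultimately show "(\<integral>\<^sup>+\<omega>. ennreal (D j \<omega>) \<partial>gauss) \<le> ennreal ((1/2)^j)"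
      by (subst nn_integral_eq_integral[OF Di]) (auto simp: D_def intro: ennreal_leI)
  qed auto
  also have "\<dots> = ennreal (\<Sum>j. (1/2)^j)"
    by (rule suminf_ennreal2) (auto simp: summable_geometric)
  also have "\<dots> < \<infinity>" by simp
  finally have "AE \<omega> in gauss. (\<Sum>j. ennreal (D j \<omega>)) \<noteq> \<infinity>"
    by (intro nn_integral_PInf_AE) auto
  moreover have "AE \<omega> in gauss. \<forall>j. rep (x (Suc j) - x j) \<omega> = rep (x (Suc j)) \<omega> - rep (x j) \<omega>"
    unfolding AE_all_countable using rep_diff by blast
  ultimately have conv: "AE \<omega> in gauss. convergent (\<lambda>j. rep (x j) \<omega>)"
  proof eventually_elim
    case (elim \<omega>)
    then have "summable (\<lambda>j. D j \<omega>)"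
      by (intro summable_suminf_not_top) (auto simp: D_def)
    moreover have "D j \<omega> = norm (rep (x (Suc j)) \<omega> - rep (x j) \<omega>)" for j
      unfolding D_def using elim(2) by metis
    ultimately have "summable (\<lambda>j. norm (rep (x (Suc j)) \<omega> - rep (x j) \<omega>))"
      by (simp only:)
    then have "summable (\<lambda>j. rep (x (Suc j)) \<omega> - rep (x j) \<omega>)"
      by (rule summable_norm_cancel)
    then have "convergent (\<lambda>n. \<Sum>j<n. rep (x (Suc j)) \<omega> - rep (x j) \<omega>)"
      by (simp add: summable_iff_convergent)
    then have "convergent (\<lambda>n. rep (x n) \<omega> - rep (x 0) \<omega>)"
      by (simp only: sum_lessThan_telescope[of "\<lambda>j. rep (x j) \<omega>"])
    then have "convergent (\<lambda>n. (rep (x n) \<omega> - rep (x 0) \<omega>) + rep (x 0) \<omega>)"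
      by (intro convergent_add convergent_const)
    then show ?case by simp
  qed
  define L where "L \<omega> = lim (\<lambda>j. rep (x j) \<omega>)" for \<omega>
  have [measurable]: "L \<in> borel_measurable borel"
    unfolding L_def by measurable
  have lim: "AE \<omega> in gauss. (\<lambda>j. rep (x j) \<omega>) \<longlonglongrightarrow> L \<omega>"
    using conv by eventually_elim (simp add: L_def convergent_LIMSEQ_iff)
  \<comment> \<open>Fatou in the running index with \<open>k\<close> fixed: the pointwise limit
    inherits the bound on the distance to \<open>x k\<close>. For \<open>k = 0\<close> this also
    yields square integrability of the limit.\<close>
  have fatou: "(\<integral>\<^sup>+\<omega>. ennreal ((norm (L \<omega> - rep (x k) \<omega>))\<^sup>2) \<partial>gauss) \<le> ennreal (((1/2)^k)\<^sup>2)" for k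
  proof -
    have "(\<integral>\<^sup>+\<omega>. ennreal ((norm (L \<omega> - rep (x k) \<omega>))\<^sup>2) \<partial>gauss)
        = (\<integral>\<^sup>+\<omega>. liminf (\<lambda>j. ennreal ((norm (rep (x j) \<omega> - rep (x k) \<omega>))\<^sup>2)) \<partial>gauss)"
      by (intro nn_integral_cong_AE, use lim in eventually_elim)
        (auto intro!: lim_imp_Liminf[symmetric] tendsto_intros)
    also have "\<dots> \<le> liminf (\<lambda>j. \<integral>\<^sup>+\<omega>. ennreal ((norm (rep (x j) \<omega> - rep (x k) \<omega>))\<^sup>2) \<partial>gauss)"
      by (rule nn_integral_liminf) measurable
    also have "\<dots> \<le> ennreal (((1/2)^k)\<^sup>2)"
    proof (rule Liminf_le)
      show "\<forall>\<^sub>F j in sequentially. (\<integral>\<^sup>+\<omega>. ennreal ((norm (rep (x j) \<omega> - rep (x k) \<omega>))\<^sup>2) \<partial>gauss) \<le> ennreal (((1/2)^k)\<^sup>2)"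
        using eventually_ge_at_top[of k]
      proof eventually_elim
        case (elim j)
        have "(\<integral>\<^sup>+\<omega>. ennreal ((norm (rep (x j) \<omega> - rep (x k) \<omega>))\<^sup>2) \<partial>gauss)
          = (\<integral>\<^sup>+\<omega>. ennreal ((norm (rep (x j - x k) \<omega>))\<^sup>2) \<partial>gauss)"
          by (intro nn_integral_cong_AE, use rep_diff[of "x j" "x k"] in eventually_elim) simp
        also have "\<dots> = ennreal ((norm (x j - x k))\<^sup>2)"
          unfolding norm_sq_l2 using L2_rep[of "x j - x k"] unfolding L2_def by (intro nn_integral_eq_integral) auto
        also have "\<dots> \<le> ennreal (((1/2)^k)\<^sup>2)"
          using d[of k j k] elim by (intro ennreal_leI power_mono) (auto simp: dist_norm)
        finally show ?case .
      qed
    qed simp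
    finally show ?thesis .
  qed
  have L2d: "L2 (\<lambda>\<omega>. L \<omega> - rep (x k) \<omega>)" for k
    unfolding L2_def
  proof
    show "integrable gauss (\<lambda>\<omega>. (norm (L \<omega> - rep (x k) \<omega>))\<^sup>2)"
      using le_less_trans[OF fatou[of k]] by (intro integrableI_nonneg) auto
  qed measurable
  from L2_add[OF this[of 0] L2_rep[of "x 0"]] have L2L: "L2 L" by simp
  have xL: "norm (cl L - x k) \<le> (1/2)^k" for k
  proof -
    have "cl L - x k = cl (\<lambda>\<omega>. L \<omega> - rep (x k) \<omega>)"
      by (rule l2_eqI) (use rep_diff[of "cl L" "x k"] rep_cl[OF L2L] rep_cl[OF L2d[of k]] in \<open>eventually_elim, simp\<close>)
    then have "(norm (cl L - x k))\<^sup>2 = (\<integral>\<omega>. (norm (L \<omega> - rep (x k) \<omega>))\<^sup>2 \<partial>gauss)"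
      by (simp add: power2_norm_eq_inner inner_cl[OF L2d L2d])
    also have "ennreal \<dots> \<le> ennreal (((1/2)^k)\<^sup>2)"
      using fatou[of k] L2d[of k] unfolding L2_def by (subst (asm) nn_integral_eq_integral) auto
    finally show ?thesis
      by (subst (asm) ennreal_le_iff) (auto intro: power2_le_imp_le)
  qed
  have "x \<longlonglongrightarrow> cl L"
  proof (rule metric_LIMSEQ_I)
    fix e :: real assume "0 < e"
    then obtain n where n: "(1/2)^n < e" using real_arch_pow_inv[of e "1/2"] by auto
    show "\<exists>no. \<forall>k\<ge>no. dist (x k) (cl L) < e"
    proof (intro exI allI impI)
      fix k assume "n \<le> k"
      then have "(1/2::real)^k \<le> (1/2)^n" by (intro power_decreasing) auto
      moreover have "dist (x k) (cl L) = norm (cl L - x k)" by (simp add: dist_norm norm_minus_commute)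
      ultimately show "dist (x k) (cl L) < e" using xL[of k] n by linarith
    qed
  qed
  show "convergent X"
  proof (rule convergentI, rule metric_LIMSEQ_I)
    fix e :: real assume "0 < e"
    then obtain n where n: "(1/2)^n < e/2" using real_arch_pow_inv[of "e/2" "1/2"] by auto
    show "\<exists>no. \<forall>k\<ge>no. dist (X k) (cl L) < e"
    proof (intro exI allI impI)
      fix k assume "N n \<le> k"
      then have "dist (X k) (x n) < e/2" using N[of n k "r n"] rN[of n n] n by (auto simp: x_def)
      moreover have "dist (x n) (cl L) = norm (cl L - x n)" by (simp add: dist_norm norm_minus_commute)
      ultimately show "dist (X k) (cl L) < e"
        using xL[of n] n dist_triangle[of "X k" "cl L" "x n"] by linarith
    qed
  qed
qed

section \<open>Strongly monotone maps\<close>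

text \<open>Banach's fixed point theorem for \<open>x - t T x\<close>. The squared contraction
  factor is at most \<open>1 - 2 t \<mu> + t^2 K^2\<close>, and \<open>t = \<mu> / K^2\<close>
  minimises it.\<close>

lemma strongly_monotone_zero:
  fixes T :: "'a::{real_inner,complete_space} \<Rightarrow> 'a"
  assumes "0 < \<mu>" and mono: "\<And>x y. \<mu> * (norm (x - y))\<^sup>2 \<le> (T x - T y) \<bullet> (x - y)"
    and lip: "\<And>x y. norm (T x - T y) \<le> L * norm (x - y)"
  shows "\<exists>x. T x = 0"
proof -
  \<comment> \<open>Enlarging the Lipschitz constant to at least \<open>\<mu>\<close> makes it
    positive and keeps the radicand in \<open>c\<close> nonnegative.\<close>
  define K where "K = max L \<mu>"
  have K: "0 < K" "\<mu> \<le> K" and lipK: "norm (T x - T y) \<le> K * norm (x - y)" for x y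
    using \<open>0 < \<mu>\<close> order_trans[OF lip[of x y] mult_right_mono[of L K "norm (x - y)"]] by (auto simp: K_def)
  define t where "t = \<mu> / K\<^sup>2"
  define c where "c = sqrt (1 - \<mu>\<^sup>2 / K\<^sup>2)"
  have c1: "\<mu>\<^sup>2 / K\<^sup>2 \<le> 1"
    using K \<open>0 < \<mu>\<close> by (simp add: power_mono)
  have c: "0 \<le> c" "c < 1"
    using c1 K \<open>0 < \<mu>\<close> by (auto simp: c_def)
  have "dist (x - t *\<^sub>R T x) (y - t *\<^sub>R T y) \<le> c * dist x y" for x y
  proof (rule power2_le_imp_le)
    have e: "x - t *\<^sub>R T x - (y - t *\<^sub>R T y) = (x - y) - t *\<^sub>R (T x - T y)"
      by (simp add: algebra_simps)
    have "(dist (x - t *\<^sub>R T x) (y - t *\<^sub>R T y))\<^sup>2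
        = (norm (x - y))\<^sup>2 - 2 * t * ((T x - T y) \<bullet> (x - y)) + t\<^sup>2 * (norm (T x - T y))\<^sup>2"
      unfolding dist_norm e power2_norm_eq_inner
      by (simp add: inner_diff_left inner_diff_right inner_commute power2_eq_square algebra_simps)
    also have "\<dots> \<le> (norm (x - y))\<^sup>2 - 2 * t * (\<mu> * (norm (x - y))\<^sup>2) + t\<^sup>2 * (K * norm (x - y))\<^sup>2"
      using mono[of x y] lipK[of x y] K \<open>0 < \<mu>\<close>
      by (intro add_mono diff_mono mult_left_mono power_mono) (auto simp: t_def)
    also have "\<dots> = (1 - \<mu>\<^sup>2 / K\<^sup>2) * (norm (x - y))\<^sup>2"
      using K by (simp add: t_def field_simps power2_eq_square)
    also have "\<dots> = (c * dist x y)\<^sup>2"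
      using c1 by (simp add: c_def dist_norm power_mult_distrib)
    finally show "(dist (x - t *\<^sub>R T x) (y - t *\<^sub>R T y))\<^sup>2 \<le> (c * dist x y)\<^sup>2" .
  qed (use c in auto)
  then have "\<exists>!x. x - t *\<^sub>R T x = x"
    by (intro banach_fix_type[OF c]) auto
  then obtain x where "x - t *\<^sub>R T x = x" by blast
  then have "T x = 0" using K \<open>0 < \<mu>\<close> by (auto simp: t_def)
  then show ?thesis ..
qed

text \<open>On the line through \<open>y\<close> and \<open>x\<close> the function minus its
  quadratic part is convex; the tangent inequalities at the two end points add up to the
  claim.\<close>

lemma strongly_convex_monotone:
  fixes \<phi> :: "'a::real_inner \<Rightarrow> real"
  assumes cvx: "strongly_convex \<mu> \<phi>" and diff: "\<And>x. \<exists>D. GDERIV \<phi> x :> D"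
  shows "\<mu> * (norm (x - y))\<^sup>2 \<le> (grad \<phi> x - grad \<phi> y) \<bullet> (x - y)"
proof -
  define d where "d = x - y"
  define \<psi> where "\<psi> = (\<lambda>x. \<phi> x - \<mu> / 2 * (norm x)\<^sup>2)"
  define h where "h = (\<lambda>t. \<psi> (y + t *\<^sub>R d))"
  have cvx': "convex_on UNIV \<psi>" using cvx by (simp add: strongly_convex_def \<psi>_def)
  have "convex_on UNIV h"
  proof (rule convex_onI)
    fix t a b :: real assume t: "0 < t" "t < 1"
    have "y + ((1 - t) *\<^sub>R a + t *\<^sub>R b) *\<^sub>R d = (1 - t) *\<^sub>R (y + a *\<^sub>R d) + t *\<^sub>R (y + b *\<^sub>R d)"
      by (simp add: algebra_simps)
    then show "h ((1 - t) *\<^sub>R a + t *\<^sub>R b) \<le> (1 - t) * h a + t * h b"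
      unfolding h_def using convex_onD[OF cvx', of t] t by simp
  qed simp
  have der: "(h has_field_derivative (grad \<phi> (y + t *\<^sub>R d) \<bullet> d - \<mu> * ((y + t *\<^sub>R d) \<bullet> d))) (at t)" for t
  proof -
    have g: "(\<phi> has_derivative (\<lambda>h. h \<bullet> grad \<phi> z)) (at z)" for z
      using diff[of z] grad_eqI[of \<phi> z] by (auto simp: gderiv_def)
    have 1: "((\<lambda>t. y + t *\<^sub>R d) has_derivative (\<lambda>s. s *\<^sub>R d)) (at t)"
      by (auto intro!: derivative_eq_intros)
    have 2: "((\<lambda>t. \<phi> (y + t *\<^sub>R d)) has_derivative (\<lambda>s. (s *\<^sub>R d) \<bullet> grad \<phi> (y + t *\<^sub>R d))) (at t)"
      using has_derivative_compose[OF 1 g] .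
    have 3: "((\<lambda>t. (y + t *\<^sub>R d) \<bullet> (y + t *\<^sub>R d)) has_derivative
        (\<lambda>s. (y + t *\<^sub>R d) \<bullet> (s *\<^sub>R d) + (s *\<^sub>R d) \<bullet> (y + t *\<^sub>R d))) (at t)"
      by (rule has_derivative_inner[OF 1 1])
    have "(h has_derivative (\<lambda>s. (s *\<^sub>R d) \<bullet> grad \<phi> (y + t *\<^sub>R d)
        - \<mu> / 2 * ((y + t *\<^sub>R d) \<bullet> (s *\<^sub>R d) + (s *\<^sub>R d) \<bullet> (y + t *\<^sub>R d)))) (at t)"
      unfolding h_def \<psi>_def power2_norm_eq_inner
      by (intro has_derivative_diff 2 has_derivative_mult_right 3)
    then show ?thesis
      unfolding has_field_derivative_def
      by (rule has_derivative_eq_rhs) (simp add: fun_eq_iff inner_commute algebra_simps)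
  qed
  have "h 1 - h 0 \<ge> (grad \<phi> (y + 0 *\<^sub>R d) \<bullet> d - \<mu> * ((y + 0 *\<^sub>R d) \<bullet> d)) * (1 - 0)"
    by (rule convex_on_imp_above_tangent[OF \<open>convex_on UNIV h\<close>]) (use der[of 0] in auto)
  moreover have "h 0 - h 1 \<ge> (grad \<phi> (y + 1 *\<^sub>R d) \<bullet> d - \<mu> * ((y + 1 *\<^sub>R d) \<bullet> d)) * (0 - 1)"
    by (rule convex_on_imp_above_tangent[OF \<open>convex_on UNIV h\<close>]) (use der[of 1] in auto)
  ultimately have "0 \<le> (grad \<phi> x - grad \<phi> y) \<bullet> d - \<mu> * ((x - y) \<bullet> d)"
    by (simp add: d_def inner_diff_left algebra_simps)
  then show ?thesis
    by (simp add: d_def power2_norm_eq_inner)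
qed

section \<open>Jointly Lipschitz fields, monotone fields and their resolvents\<close>

lemma joint_dist_nonneg: "0 \<le> joint_dist k p q"
  by (simp add: joint_dist_def sum_nonneg)

lemma dist_le_joint_dist: "dist x y \<le> joint_dist k (x, X) (y, Y)"
  unfolding joint_dist_def by (rule real_le_rsqrt) (simp add: sum_nonneg)

lemma joint_dist_mono_fst: "joint_dist k (z, X) (z, Y) \<le> joint_dist k (x, X) (y, Y)"
  unfolding joint_dist_def by simp

lemma joint_lipschitz_abs:
  assumes "joint_lipschitz k C f" shows "joint_lipschitz k \<bar>C\<bar> f"
  unfolding joint_lipschitz_def
proof (intro allI ballI)
  fix x y :: "real^'a" and X Y :: "nat \<Rightarrow> real^'a" assume "X \<in> mats k" "Y \<in> mats k"
  then have "dist (f x X) (f y Y) \<le> C * joint_dist k (x, X) (y, Y)"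
    using assms unfolding joint_lipschitz_def by blast
  also have "\<dots> \<le> \<bar>C\<bar> * joint_dist k (x, X) (y, Y)"
    by (intro mult_right_mono joint_dist_nonneg) auto
  finally show "dist (f x X) (f y Y) \<le> \<bar>C\<bar> * joint_dist k (x, X) (y, Y)" .
qed

text \<open>The Lipschitz condition speaks about extensional matrices only, hence the
  \<open>restrict\<close>. Since finitely many columns enter, the composite is continuous for the
  product topology on all sequences of columns.\<close>

lemma joint_lipschitz_continuous:
  fixes f :: "real^'m \<Rightarrow> (nat \<Rightarrow> real^'m) \<Rightarrow> real^'m"
  assumes "joint_lipschitz k C f"
  shows "continuous_on UNIV (\<lambda>p. f (fst p) (restrict (snd p) {1..k}))"
  unfolding continuous_on_eq_continuous_at[OF open_UNIV]
proof
  fix q :: "(real^'m) \<times> (nat \<Rightarrow> real^'m)"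
  have "continuous_on UNIV (\<lambda>p :: (real^'m) \<times> (nat \<Rightarrow> real^'m). snd p j)" for j
    by (rule continuous_on_compose2[OF continuous_on_product_coordinates[of j]]) (auto intro: continuous_intros)
  then have cj: "((\<lambda>p :: (real^'m) \<times> (nat \<Rightarrow> real^'m). snd p j) \<longlongrightarrow> snd q j) (at q)" for j
    unfolding continuous_on_eq_continuous_at[OF open_UNIV] isCont_def by blast
  have "((\<lambda>p. \<bar>C\<bar> * joint_dist k (fst p, restrict (snd p) {1..k}) (fst q, restrict (snd q) {1..k})) \<longlongrightarrow>
      \<bar>C\<bar> * sqrt ((dist (fst q) (fst q))\<^sup>2 + (\<Sum>j=1..k. (dist (snd q j) (snd q j))\<^sup>2))) (at q)"
    unfolding joint_dist_def fst_conv snd_conv restrict_def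
    by (simp only: if_True cong: sum.cong) (intro tendsto_intros cj)
  then have lim: "((\<lambda>p. \<bar>C\<bar> * joint_dist k (fst p, restrict (snd p) {1..k}) (fst q, restrict (snd q) {1..k})) \<longlongrightarrow> 0) (at q)"
    by simp
  have "((\<lambda>p. dist (f (fst p) (restrict (snd p) {1..k})) (f (fst q) (restrict (snd q) {1..k}))) \<longlongrightarrow> 0) (at q)"
    by (rule tendsto_sandwich[OF _ _ tendsto_const lim])
      (use joint_lipschitz_abs[OF assms] in \<open>auto simp: joint_lipschitz_def PiE_iff intro!: always_eventually\<close>)
  then show "isCont (\<lambda>p. f (fst p) (restrict (snd p) {1..k})) q"
    unfolding isCont_def by (subst tendsto_dist_iff)
qed

lemma measurable_if_const:
  "(P \<Longrightarrow> f \<in> measurable M N) \<Longrightarrow> (\<not> P \<Longrightarrow> g \<in> measurable M N) \<Longrightarrow>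
    (\<lambda>x. if P then f x else g x) \<in> measurable M N"
  by (cases P) simp_all

lemma joint_lipschitz_measurable:
  fixes f :: "real^'m \<Rightarrow> (nat \<Rightarrow> real^'m) \<Rightarrow> real^'m"
  assumes "joint_lipschitz k C f" and X: "X \<in> borel_measurable M"
    and A: "\<And>j. j \<in> {1..k} \<Longrightarrow> A j \<in> borel_measurable M"
  shows "(\<lambda>\<omega>. f (X \<omega>) (cols k A \<omega>)) \<in> borel_measurable M"
proof -
  \<comment> \<open>Padding with zero gives a sequence all of whose entries are measurable;
    restricting it afterwards returns the original matrix.\<close>
  have "(\<lambda>\<omega>. (\<lambda>j. if j \<in> {1..k} then A j \<omega> else 0)) \<in> borel_measurable M"
  proof (rule measurable_coordinatewise_then_product)
    fix j show "(\<lambda>\<omega>. if j \<in> {1..k} then A j \<omega> else 0) \<in> borel_measurable M"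
      using A by (intro measurable_if_const) auto
  qed
  with X have "(\<lambda>\<omega>. (X \<omega>, (\<lambda>j. if j \<in> {1..k} then A j \<omega> else 0))) \<in> borel_measurable M"
    by (rule borel_measurable_Pair)
  from measurable_compose[OF this borel_measurable_continuous_onI[OF joint_lipschitz_continuous[OF assms(1)]]]
  have "(\<lambda>\<omega>. f (X \<omega>) (\<lambda>j\<in>{1..k}. if j \<in> {1..k} then A j \<omega> else 0)) \<in> borel_measurable M"
    by simp
  moreover have "(\<lambda>j\<in>{1..k}. if j \<in> {1..k} then A j \<omega> else 0) = cols k A \<omega>" for \<omega>
    by auto
  ultimately show ?thesis by simp
qed

text \<open>All that the argument retains of a saddle function: its gradient as a jointly Lipschitz
  field that is strongly monotone in the first argument.\<close>

definition monotone_field :: "real \<Rightarrow> real \<Rightarrow> nat \<Rightarrow> (real^'m \<Rightarrow> (nat \<Rightarrow> real^'m) \<Rightarrow> real^'m) \<Rightarrow> bool" where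
  "monotone_field \<mu> C k F \<longleftrightarrow> joint_lipschitz k C F \<and>
     (\<forall>X\<in>mats k. \<forall>x y. \<mu> * (norm (x - y))\<^sup>2 \<le> (F x X - F y X) \<bullet> (x - y))"

lemma saddle_regular_monotone_field:
  assumes "saddle_regular L \<mu> k \<phi>"
  obtains C where "0 \<le> C" "monotone_field \<mu> C k (\<lambda>x X. grad (\<lambda>y. \<phi> y X) x)"
proof -
  from assms obtain C where C: "joint_lipschitz k C (\<lambda>x X. grad (\<lambda>y. \<phi> y X) x)"
    by (auto simp: saddle_regular_def)
  have "monotone_field \<mu> \<bar>C\<bar> k (\<lambda>x X. grad (\<lambda>y. \<phi> y X) x)"
    unfolding monotone_field_def
    using joint_lipschitz_abs[OF C] assms
    by (auto intro!: strongly_convex_monotone simp: saddle_regular_def smooth_def)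
  with that[of "\<bar>C\<bar>"] show ?thesis by simp
qed

text \<open>The inverse of \<open>F(-, X) + c I\<close> at \<open>z\<close>. It is used for
  \<open>c \<ge> 0\<close>, where that map is strongly monotone; this is the reason why the sign of
  a memory coefficient matters.\<close>

definition resolvent :: "(real^'m \<Rightarrow> (nat \<Rightarrow> real^'m) \<Rightarrow> real^'m) \<Rightarrow> real \<Rightarrow> real^'m \<Rightarrow> (nat \<Rightarrow> real^'m) \<Rightarrow> real^'m" where
  "resolvent F c z X = (THE x. F x X + c *\<^sub>R x = z)"

text \<open>One estimate serves twice: for equal matrices and right-hand sides it is injectivity, in
  general it is the Lipschitz bound for the resolvent. The term \<open>c * (norm (x - y))^2\<close>
  is nonnegative and dropped, so the constant does not depend on \<open>c\<close>.\<close>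

lemma monotone_field_stable:
  assumes F: "monotone_field \<mu> C k F" "0 < \<mu>" "0 \<le> C" "0 \<le> c" and X: "X \<in> mats k" "Y \<in> mats k"
  shows "\<mu> * dist x y \<le> (1 + C) * joint_dist k (F x X + c *\<^sub>R x, X) (F y Y + c *\<^sub>R y, Y)"
proof (cases "x = y")
  case True
  then show ?thesis using F(3) by (simp add: joint_dist_nonneg)
next
  case False
  let ?j = "joint_dist k (F x X + c *\<^sub>R x, X) (F y Y + c *\<^sub>R y, Y)"
  have "norm (F y X - F y Y) \<le> C * joint_dist k (y, X) (y, Y)"
    using F(1) X by (simp add: monotone_field_def joint_lipschitz_def dist_norm)
  also have "\<dots> \<le> C * ?j"
    by (intro mult_left_mono joint_dist_mono_fst F)
  finally have l: "norm (F y X - F y Y) \<le> C * ?j" .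
  have "\<mu> * (norm (x - y))\<^sup>2 \<le> (F x X - F y X) \<bullet> (x - y)"
    using F(1) X(1) by (simp add: monotone_field_def)
  also have "\<dots> = ((F x X + c *\<^sub>R x) - (F y Y + c *\<^sub>R y)) \<bullet> (x - y) - c * (norm (x - y))\<^sup>2
      - (F y X - F y Y) \<bullet> (x - y)"
    by (simp add: power2_norm_eq_inner inner_diff_left inner_diff_right inner_add_left algebra_simps)
  also have "\<dots> \<le> ?j * norm (x - y) - 0 + (C * ?j) * norm (x - y)"
  proof -
    have "((F x X + c *\<^sub>R x) - (F y Y + c *\<^sub>R y)) \<bullet> (x - y) \<le> ?j * norm (x - y)"
      using dist_le_joint_dist[of "F x X + c *\<^sub>R x" "F y Y + c *\<^sub>R y" k X Y]
      by (intro order_trans[OF norm_cauchy_schwarz] mult_right_mono) (auto simp: dist_norm)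
    moreover have "- ((F y X - F y Y) \<bullet> (x - y)) \<le> (C * ?j) * norm (x - y)"
      by (intro order_trans[OF _ mult_right_mono[OF l]] order_trans[OF _ Cauchy_Schwarz_ineq2]) auto
    moreover have "0 \<le> c * (norm (x - y))\<^sup>2" using F by simp
    ultimately show ?thesis by linarith
  qed
  finally have "(\<mu> * dist x y) * norm (x - y) \<le> ((1 + C) * ?j) * norm (x - y)"
    by (simp add: dist_norm power2_eq_square algebra_simps)
  then show ?thesis using False by (subst (asm) mult_le_cancel_right) auto
qed

lemma resolvent_unique:
  assumes F: "monotone_field \<mu> C k F" "0 < \<mu>" "0 \<le> C" "0 \<le> c" and X: "X \<in> mats k"
    and "F x X + c *\<^sub>R x = z"
  shows "resolvent F c z X = x"
  unfolding resolvent_def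
proof (rule the_equality, fact)
  fix y assume "F y X + c *\<^sub>R y = z"
  then have "\<mu> * dist y x \<le> (1 + C) * joint_dist k (z, X) (z, X)"
    using monotone_field_stable[OF F X X, of y x] assms(6) by simp
  then have "\<mu> * dist y x \<le> 0" by (simp add: joint_dist_def)
  then show "y = x" using F(2) by (simp add: mult_le_0_iff)
qed

lemma resolvent_eq:
  assumes F: "monotone_field \<mu> C k F" "0 < \<mu>" "0 \<le> C" "0 \<le> c" and X: "X \<in> mats k"
  shows "F (resolvent F c z X) X + c *\<^sub>R resolvent F c z X = z"
proof -
  have "\<exists>x. F x X + c *\<^sub>R x - z = 0"
  proof (rule strongly_monotone_zero[OF F(2)])
    fix x y
    have "\<mu> * (norm (x - y))\<^sup>2 \<le> (F x X - F y X) \<bullet> (x - y) + c * (norm (x - y))\<^sup>2"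
      using F X by (intro add_increasing2) (auto simp: monotone_field_def)
    then show "\<mu> * (norm (x - y))\<^sup>2 \<le> (F x X + c *\<^sub>R x - z - (F y X + c *\<^sub>R y - z)) \<bullet> (x - y)"
      by (simp add: power2_norm_eq_inner inner_diff_left inner_diff_right inner_add_left algebra_simps)
    have "norm (F x X - F y X) \<le> C * joint_dist k (x, X) (y, X)"
      using F(1) X by (simp add: monotone_field_def joint_lipschitz_def dist_norm)
    then have "norm (F x X - F y X) \<le> C * norm (x - y)"
      by (simp add: joint_dist_def dist_norm)
    moreover have "F x X + c *\<^sub>R x - z - (F y X + c *\<^sub>R y - z) = (F x X - F y X) + c *\<^sub>R (x - y)"
      by (simp add: algebra_simps)
    moreover have "norm (c *\<^sub>R (x - y)) = c * norm (x - y)" using F(4) by simp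
    ultimately show "norm (F x X + c *\<^sub>R x - z - (F y X + c *\<^sub>R y - z)) \<le> (C + c) * norm (x - y)"
      using norm_triangle_ineq[of "F x X - F y X" "c *\<^sub>R (x - y)"] by (simp only: distrib_right)
  qed
  then obtain x where "F x X + c *\<^sub>R x = z" by auto
  with resolvent_unique[OF F X this] show ?thesis by simp
qed

lemma resolvent_lipschitz:
  assumes F: "monotone_field \<mu> C k F" "0 < \<mu>" "0 \<le> C" "0 \<le> c"
  shows "joint_lipschitz k ((1 + C) / \<mu>) (resolvent F c)"
  unfolding joint_lipschitz_def
proof (intro allI ballI)
  fix z w and X Y :: "nat \<Rightarrow> real^'a" assume X: "X \<in> mats k" "Y \<in> mats k"
  show "dist (resolvent F c z X) (resolvent F c w Y) \<le> (1 + C) / \<mu> * joint_dist k (z, X) (w, Y)"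
    using monotone_field_stable[OF F X, of "resolvent F c z X" "resolvent F c w Y"] F(2)
    by (simp add: resolvent_eq[OF F X(1)] resolvent_eq[OF F X(2)] field_simps)
qed

section \<open>Nemytskii operators and functions of a process\<close>

definition nem :: "nat \<Rightarrow> (real^'m \<Rightarrow> (nat \<Rightarrow> real^'m) \<Rightarrow> real^'m) \<Rightarrow> 'm l2 \<Rightarrow> (nat \<Rightarrow> 'm l2) \<Rightarrow> 'm::finite l2" where
  "nem k f x us = cl (\<lambda>\<omega>. f (rep x \<omega>) (cols k (\<lambda>j. rep (us j)) \<omega>))"

text \<open>A Lipschitz map grows at most linearly, so it preserves square integrability.\<close>

lemma joint_lipschitz_L2:
  assumes f: "joint_lipschitz k C f"
  shows "L2 (\<lambda>\<omega>. f (rep x \<omega>) (cols k (\<lambda>j. rep (us j)) \<omega>))"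
proof (rule L2_bound)
  show "(\<lambda>\<omega>. f (rep x \<omega>) (cols k (\<lambda>j. rep (us j)) \<omega>)) \<in> borel_measurable borel"
    by (rule joint_lipschitz_measurable[OF f]) measurable
  let ?f0 = "f 0 (\<lambda>j\<in>{1..k}. 0)"
  let ?b = "\<lambda>\<omega>. 2 * (norm ?f0)\<^sup>2 + 2 * C\<^sup>2 * ((norm (rep x \<omega>))\<^sup>2 + (\<Sum>j=1..k. (norm (rep (us j) \<omega>))\<^sup>2))"
  show "integrable gauss ?b" by auto
  have "(norm (f (rep x \<omega>) (cols k (\<lambda>j. rep (us j)) \<omega>)))\<^sup>2 \<le> ?b \<omega>" for \<omega>
  proof -
    let ?X = "cols k (\<lambda>j. rep (us j)) \<omega>"
    have "dist (f (rep x \<omega>) ?X) ?f0 \<le> \<bar>C\<bar> * joint_dist k (rep x \<omega>, ?X) (0, \<lambda>j\<in>{1..k}. 0)"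
      using joint_lipschitz_abs[OF f] unfolding joint_lipschitz_def by auto
    then have "norm (f (rep x \<omega>) ?X) \<le> norm ?f0 + \<bar>C\<bar> * joint_dist k (rep x \<omega>, ?X) (0, \<lambda>j\<in>{1..k}. 0)" (is "_ \<le> ?a + ?c")
      unfolding dist_norm using norm_triangle_sub[of "f (rep x \<omega>) ?X" ?f0] by linarith
    then have "(norm (f (rep x \<omega>) ?X))\<^sup>2 \<le> (?a + ?c)\<^sup>2"
      by (intro power_mono) auto
    also have "\<dots> \<le> 2 * ?a\<^sup>2 + 2 * ?c\<^sup>2"
      using sum_squares_bound[of ?a ?c] by (simp add: power2_sum)
    also have "?c\<^sup>2 = C\<^sup>2 * ((norm (rep x \<omega>))\<^sup>2 + (\<Sum>j=1..k. (norm (rep (us j) \<omega>))\<^sup>2))"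
      by (simp add: joint_dist_def power_mult_distrib sum_nonneg)
    finally show ?thesis by (simp only: mult.assoc)
  qed
  then show "AE \<omega> in gauss. (norm (f (rep x \<omega>) (cols k (\<lambda>j. rep (us j)) \<omega>)))\<^sup>2 \<le> ?b \<omega>" by simp
qed

lemma rep_nem:
  "joint_lipschitz k C f \<Longrightarrow> AE \<omega> in gauss. rep (nem k f x us) \<omega> = f (rep x \<omega>) (cols k (\<lambda>j. rep (us j)) \<omega>)"
  unfolding nem_def by (rule rep_cl[OF joint_lipschitz_L2])

lemma nem_cong: "(\<And>j. j \<in> {1..k} \<Longrightarrow> us j = us' j) \<Longrightarrow> nem k f x us = nem k f x us'"
  unfolding nem_def by (simp cong: restrict_cong)

lemma nem_lipschitz:
  assumes f: "joint_lipschitz k C f"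
  shows "norm (nem k f x us - nem k f y us) \<le> \<bar>C\<bar> * norm (x - y)"
proof (rule power2_le_imp_le)
  have "(norm (nem k f x us - nem k f y us))\<^sup>2 \<le> (\<integral>\<omega>. C\<^sup>2 * (norm (rep (x - y) \<omega>))\<^sup>2 \<partial>gauss)"
    unfolding norm_sq_l2
  proof (rule integral_mono_AE)
    show "AE \<omega> in gauss. (norm (rep (nem k f x us - nem k f y us) \<omega>))\<^sup>2 \<le> C\<^sup>2 * (norm (rep (x - y) \<omega>))\<^sup>2"
      using rep_diff[of "nem k f x us" "nem k f y us"] rep_diff[of x y] rep_nem[OF f, of x us] rep_nem[OF f, of y us]
    proof eventually_elim
      case (elim \<omega>)
      let ?X = "cols k (\<lambda>j. rep (us j)) \<omega>"
      have "dist (f (rep x \<omega>) ?X) (f (rep y \<omega>) ?X) \<le> \<bar>C\<bar> * joint_dist k (rep x \<omega>, ?X) (rep y \<omega>, ?X)"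
        using joint_lipschitz_abs[OF f] unfolding joint_lipschitz_def by auto
      then have "norm (f (rep x \<omega>) ?X - f (rep y \<omega>) ?X) \<le> \<bar>C\<bar> * norm (rep x \<omega> - rep y \<omega>)"
        by (simp add: joint_dist_def dist_norm)
      then have "(norm (f (rep x \<omega>) ?X - f (rep y \<omega>) ?X))\<^sup>2 \<le> (\<bar>C\<bar> * norm (rep x \<omega> - rep y \<omega>))\<^sup>2"
        by (intro power_mono) auto
      then show ?case unfolding elim by (simp add: power_mult_distrib)
    qed
  qed auto
  then show "(norm (nem k f x us - nem k f y us))\<^sup>2 \<le> (\<bar>C\<bar> * norm (x - y))\<^sup>2"
    by (simp add: norm_sq_l2 power_mult_distrib)
qed simp

lemma nem_monotone:
  assumes F: "monotone_field \<mu> C k F"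
  shows "\<mu> * (norm (x - y))\<^sup>2 \<le> (nem k F x us - nem k F y us) \<bullet> (x - y)"
  unfolding norm_sq_l2 inner_l2_def integral_mult_right_zero[symmetric]
proof (rule integral_mono_AE)
  have f: "joint_lipschitz k C F" using F by (simp add: monotone_field_def)
  show "AE \<omega> in gauss. \<mu> * (norm (rep (x - y) \<omega>))\<^sup>2 \<le> rep (nem k F x us - nem k F y us) \<omega> \<bullet> rep (x - y) \<omega>"
    using rep_diff[of "nem k F x us" "nem k F y us"] rep_diff[of x y] rep_nem[OF f, of x us] rep_nem[OF f, of y us]
  proof eventually_elim
    case (elim \<omega>)
    then show ?case using F by (simp add: monotone_field_def)
  qed
qed auto

text \<open>Inverts the implicit equation pointwise. An iterate satisfying it becomes a Lipschitz
  function of \<open>z\<close> and of earlier iterates, and its adaptedness can be read off.\<close>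

lemma nem_resolvent:
  assumes F: "monotone_field \<mu> C k F" "0 < \<mu>" "0 \<le> C" "0 \<le> c"
    and eq: "nem k F x us + c *\<^sub>R x = z"
  shows "x = nem k (resolvent F c) z us"
proof (rule l2_eqI)
  have f: "joint_lipschitz k C F" using F by (simp add: monotone_field_def)
  show "AE \<omega> in gauss. rep x \<omega> = rep (nem k (resolvent F c) z us) \<omega>"
    using rep_nem[OF f, of x us] rep_nem[OF resolvent_lipschitz[OF F], of z us]
      rep_add[of "nem k F x us" "c *\<^sub>R x"] rep_scaleR[of c x]
  proof eventually_elim
    case (elim \<omega>)
    have "resolvent F c (rep z \<omega>) (cols k (\<lambda>j. rep (us j)) \<omega>) = rep x \<omega>"
      by (rule resolvent_unique[OF F]) (use elim eq in auto)
    then show ?case using elim by simp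
  qed
qed

section \<open>Functions of the past of a process and their transfer to another process\<close>

definition past :: "(nat \<Rightarrow> 'm l2) \<Rightarrow> nat \<Rightarrow> (nat \<Rightarrow> real^'m) \<Rightarrow> nat \<Rightarrow> real^'m::finite" where
  "past g l \<omega> = (\<lambda>j. if j \<in> {1..l} then rep (g j) \<omega> else 0)"

lemma past_measurable [measurable]: "past g l \<in> borel_measurable borel"
  unfolding past_def
proof (rule measurable_coordinatewise_then_product)
  fix j show "(\<lambda>\<omega>. if j \<in> {1..l} then rep (g j) \<omega> else 0) \<in> borel_measurable borel"
    by (intro measurable_if_const) auto
qed

text \<open>Every identity satisfied by functions of \<open>g\<close> carries over to the coupled functions of a process \<open>h\<close> of the
  same law.\<close>

definition coupled :: "nat \<Rightarrow> (nat \<Rightarrow> 'm l2) \<Rightarrow> (nat \<Rightarrow> 'm l2) \<Rightarrow> 'm l2 \<Rightarrow> 'm::finite l2 \<Rightarrow> bool" where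
  "coupled l g h x y \<longleftrightarrow> (\<exists>F \<in> borel_measurable borel.
     (AE \<omega> in gauss. rep x \<omega> = F (past g l \<omega>)) \<and> (AE \<omega> in gauss. rep y \<omega> = F (past h l \<omega>)))"

lemma coupledI:
  assumes "F \<in> borel_measurable borel" "AE \<omega> in gauss. rep x \<omega> = F (past g l \<omega>)" "AE \<omega> in gauss. rep y \<omega> = F (past h l \<omega>)"
  shows "coupled l g h x y"
  using assms unfolding coupled_def by blast

lemma coupledE:
  assumes "coupled l g h x y"
  obtains F where "F \<in> borel_measurable borel" "AE \<omega> in gauss. rep x \<omega> = F (past g l \<omega>)"
    "AE \<omega> in gauss. rep y \<omega> = F (past h l \<omega>)"
  using assms unfolding coupled_def by blast

lemma component_measurable [measurable]: "(\<lambda>p :: nat \<Rightarrow> real^'m. p j) \<in> borel_measurable borel"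
  by (rule borel_measurable_continuous_onI) (rule continuous_on_product_coordinates)

lemma coupled_base: "j \<in> {1..l} \<Longrightarrow> coupled l g h (g j) (h j)"
  by (rule coupledI[of "\<lambda>p. p j"]) (simp_all add: past_def)

lemma coupled_const: "coupled l g h (cl (\<lambda>_. a)) (cl (\<lambda>_. a))"
  by (rule coupledI[of "\<lambda>_. a"]) (simp_all add: rep_cl[OF L2_const])

lemma coupled_zero: "coupled l g h 0 0"
  using coupled_const[of l g h 0] by (simp add: zero_l2_def)

lemma coupled_add:
  assumes "coupled l g h x y" "coupled l g h x' y'"
  shows "coupled l g h (x + x') (y + y')"
  using assms(1)
proof (rule coupledE)
  fix F assume F [measurable]: "F \<in> borel_measurable borel" and FA: "AE \<omega> in gauss. rep x \<omega> = F (past g l \<omega>)"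
    "AE \<omega> in gauss. rep y \<omega> = F (past h l \<omega>)"
  from assms(2) show ?thesis
  proof (rule coupledE)
    fix G assume G [measurable]: "G \<in> borel_measurable borel" and GA: "AE \<omega> in gauss. rep x' \<omega> = G (past g l \<omega>)"
      "AE \<omega> in gauss. rep y' \<omega> = G (past h l \<omega>)"
    show ?thesis
    proof (rule coupledI[of "\<lambda>p. F p + G p"])
      show "AE \<omega> in gauss. rep (x + x') \<omega> = F (past g l \<omega>) + G (past g l \<omega>)"
        using FA(1) GA(1) rep_add[of x x'] by eventually_elim simp
      show "AE \<omega> in gauss. rep (y + y') \<omega> = F (past h l \<omega>) + G (past h l \<omega>)"
        using FA(2) GA(2) rep_add[of y y'] by eventually_elim simp
    qed measurable
  qed
qed

lemma coupled_scaleR: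
  assumes "coupled l g h x y"
  shows "coupled l g h (c *\<^sub>R x) (c *\<^sub>R y)"
  using assms
proof (rule coupledE)
  fix F assume F [measurable]: "F \<in> borel_measurable borel" and FA: "AE \<omega> in gauss. rep x \<omega> = F (past g l \<omega>)"
    "AE \<omega> in gauss. rep y \<omega> = F (past h l \<omega>)"
  show ?thesis
  proof (rule coupledI[of "\<lambda>p. c *\<^sub>R F p"])
    show "AE \<omega> in gauss. rep (c *\<^sub>R x) \<omega> = c *\<^sub>R F (past g l \<omega>)"
      using FA(1) rep_scaleR[of c x] by eventually_elim simp
    show "AE \<omega> in gauss. rep (c *\<^sub>R y) \<omega> = c *\<^sub>R F (past h l \<omega>)"
      using FA(2) rep_scaleR[of c y] by eventually_elim simp
  qed measurable
qed

lemma coupled_diff: "coupled l g h x y \<Longrightarrow> coupled l g h x' y' \<Longrightarrow> coupled l g h (x - x') (y - y')"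
  using coupled_add[OF _ coupled_scaleR[of l g h x' y' "-1"], of x y] by simp

lemma coupled_lincomb:
  "(\<And>i. i \<in> I \<Longrightarrow> coupled l g h (x i) (y i)) \<Longrightarrow> coupled l g h (\<Sum>i\<in>I. c i *\<^sub>R x i) (\<Sum>i\<in>I. c i *\<^sub>R y i)"
  by (induction I rule: infinite_finite_induct) (auto intro: coupled_zero coupled_add coupled_scaleR)

text \<open>All pasts are padded with zero to sequences in one Borel space, so that the shorter past
  is a measurable function \<open>?t\<close> of the longer one.\<close>

lemma coupled_mono:
  assumes "coupled l g h x y" "l \<le> l'"
  shows "coupled l' g h x y"
  using assms(1)
proof (rule coupledE)
  fix F assume F [measurable]: "F \<in> borel_measurable borel" and FA: "AE \<omega> in gauss. rep x \<omega> = F (past g l \<omega>)"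
    "AE \<omega> in gauss. rep y \<omega> = F (past h l \<omega>)"
  let ?t = "\<lambda>p :: nat \<Rightarrow> real^'a. (\<lambda>j. if j \<in> {1..l} then p j else 0)"
  have [measurable]: "?t \<in> borel_measurable borel"
  proof (rule measurable_coordinatewise_then_product)
    fix j show "(\<lambda>p :: nat \<Rightarrow> real^'a. if j \<in> {1..l} then p j else 0) \<in> borel_measurable borel"
      by (intro measurable_if_const) auto
  qed
  have t: "?t (past g l' \<omega>) = past g l \<omega>" for g \<omega>
    using assms(2) by (auto simp: past_def fun_eq_iff)
  show ?thesis
    by (rule coupledI[of "\<lambda>p. F (?t p)"]) (measurable, simp_all only: t FA)
qed

lemma coupled_nem:
  assumes f: "joint_lipschitz k C f" and x: "coupled l g h x y"
    and us: "\<And>j. j \<in> {1..k} \<Longrightarrow> coupled l g h (us j) (vs j)"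
  shows "coupled l g h (nem k f x us) (nem k f y vs)"
  using x
proof (rule coupledE)
  fix F assume F [measurable]: "F \<in> borel_measurable borel" and FA: "AE \<omega> in gauss. rep x \<omega> = F (past g l \<omega>)"
    "AE \<omega> in gauss. rep y \<omega> = F (past h l \<omega>)"
  have "\<exists>G. \<forall>j\<in>{1..k}. G j \<in> borel_measurable borel \<and> (AE \<omega> in gauss. rep (us j) \<omega> = G j (past g l \<omega>)) \<and>
      (AE \<omega> in gauss. rep (vs j) \<omega> = G j (past h l \<omega>))"
    using us unfolding coupled_def by (intro bchoice) blast
  then obtain G where G: "\<And>j. j \<in> {1..k} \<Longrightarrow> G j \<in> borel_measurable borel"
    and GA: "\<And>j. j \<in> {1..k} \<Longrightarrow> AE \<omega> in gauss. rep (us j) \<omega> = G j (past g l \<omega>)"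
     "\<And>j. j \<in> {1..k} \<Longrightarrow> AE \<omega> in gauss. rep (vs j) \<omega> = G j (past h l \<omega>)"
    by blast
  have GA': "AE \<omega> in gauss. \<forall>j\<in>{1..k}. rep (us j) \<omega> = G j (past g l \<omega>)"
    "AE \<omega> in gauss. \<forall>j\<in>{1..k}. rep (vs j) \<omega> = G j (past h l \<omega>)"
    using GA by (auto intro: AE_finite_allI)
  show ?thesis
  proof (rule coupledI[of "\<lambda>p. f (F p) (cols k G p)"])
    show "(\<lambda>p. f (F p) (cols k G p)) \<in> borel_measurable borel"
      by (rule joint_lipschitz_measurable[OF f F]) (use G in auto)
    show "AE \<omega> in gauss. rep (nem k f x us) \<omega> = f (F (past g l \<omega>)) (cols k G (past g l \<omega>))"
      using rep_nem[OF f, of x us] FA(1) GA'(1) by eventually_elim (simp cong: restrict_cong)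
    show "AE \<omega> in gauss. rep (nem k f y vs) \<omega> = f (F (past h l \<omega>)) (cols k G (past h l \<omega>))"
      using rep_nem[OF f, of y vs] FA(2) GA'(2) by eventually_elim (simp cong: restrict_cong)
  qed
qed

definition same_law :: "nat \<Rightarrow> (nat \<Rightarrow> 'm l2) \<Rightarrow> (nat \<Rightarrow> 'm::finite l2) \<Rightarrow> bool" where
  "same_law l g h \<longleftrightarrow> distr gauss borel (past g l) = distr gauss borel (past h l)"

text \<open>Both inner products are the integral of \<open>F \<bullet> G\<close> against the common
  law of the pasts.\<close>

lemma coupled_inner:
  assumes law: "same_law l g h" and "coupled l g h x y" "coupled l g h x' y'"
  shows "x \<bullet> x' = y \<bullet> y'"
  using assms(2)
proof (rule coupledE)
  fix F assume F [measurable]: "F \<in> borel_measurable borel" and FA: "AE \<omega> in gauss. rep x \<omega> = F (past g l \<omega>)"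
    "AE \<omega> in gauss. rep y \<omega> = F (past h l \<omega>)"
  from assms(3) show ?thesis
  proof (rule coupledE)
    fix G assume G [measurable]: "G \<in> borel_measurable borel" and GA: "AE \<omega> in gauss. rep x' \<omega> = G (past g l \<omega>)"
      "AE \<omega> in gauss. rep y' \<omega> = G (past h l \<omega>)"
    have Fm [measurable]: "(\<lambda>\<omega>. F (past g l \<omega>)) \<in> borel_measurable borel" "(\<lambda>\<omega>. F (past h l \<omega>)) \<in> borel_measurable borel"
      "(\<lambda>\<omega>. G (past g l \<omega>)) \<in> borel_measurable borel" "(\<lambda>\<omega>. G (past h l \<omega>)) \<in> borel_measurable borel"
      by (rule measurable_compose[OF past_measurable]; fact)+
    have FGm: "(\<lambda>\<omega>. F (past g l \<omega>) \<bullet> G (past g l \<omega>)) \<in> borel_measurable gauss"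
      "(\<lambda>\<omega>. F (past h l \<omega>) \<bullet> G (past h l \<omega>)) \<in> borel_measurable gauss"
      unfolding borel_measurable_gauss_iff by (intro borel_measurable_inner Fm)+
    have "x \<bullet> x' = (\<integral>\<omega>. F (past g l \<omega>) \<bullet> G (past g l \<omega>) \<partial>gauss)"
      unfolding inner_l2_def by (rule integral_cong_AE[OF _ FGm(1)], measurable) (use FA(1) GA(1) in \<open>eventually_elim, simp\<close>)
    also have "\<dots> = (\<integral>p. F p \<bullet> G p \<partial>distr gauss borel (past g l))"
      by (rule integral_distr[symmetric]) (simp_all add: borel_measurable_gauss_iff)
    also have "\<dots> = (\<integral>p. F p \<bullet> G p \<partial>distr gauss borel (past h l))"
      using law by (simp add: same_law_def)
    also have "\<dots> = (\<integral>\<omega>. F (past h l \<omega>) \<bullet> G (past h l \<omega>) \<partial>gauss)"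
      by (rule integral_distr) (simp_all add: borel_measurable_gauss_iff)
    also have "\<dots> = y \<bullet> y'"
      unfolding inner_l2_def by (rule integral_cong_AE[OF FGm(2)], measurable) (use FA(2) GA(2) in \<open>eventually_elim, simp\<close>)
    finally show ?thesis .
  qed
qed

text \<open>The difference \<open>y - z\<close> is coupled with \<open>x - x = 0\<close>, so by
  equality of inner products it has norm zero. This is how equations are carried from one process to
  the other.\<close>

lemma coupled_unique:
  assumes "same_law l g h" "coupled l g h x y" "coupled l g h x z"
  shows "y = z"
proof -
  have "coupled l g h (x - x) (y - z)" by (intro coupled_diff assms)
  from coupled_inner[OF assms(1) this this] show ?thesis by simp
qed

text \<open>Square integrability of \<open>F\<close> along the past is a property of its law, so
  \<open>F\<close> evaluated along \<open>h\<close> is again square-integrable.\<close>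

lemma coupled_ex:
  assumes law: "same_law l g h" and x: "coupled l g g x x"
  shows "\<exists>y. coupled l g h x y"
  using x
proof (rule coupledE)
  fix F assume F [measurable]: "F \<in> borel_measurable borel" and FA: "AE \<omega> in gauss. rep x \<omega> = F (past g l \<omega>)"
  have Fm: "(\<lambda>\<omega>. F (past g l \<omega>)) \<in> borel_measurable borel" for g
    by (rule measurable_compose[OF past_measurable F])
  have pm: "past g l \<in> borel_measurable gauss" for g
    by (simp add: borel_measurable_gauss_iff)
  have "integrable gauss (\<lambda>\<omega>. (norm (F (past g l \<omega>)))\<^sup>2)"
    using integrable_norm_sq_rep[of x]
    proof (rule integrable_cong_AE_imp)
    show "(\<lambda>\<omega>. (norm (F (past g l \<omega>)))\<^sup>2) \<in> borel_measurable gauss"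
      unfolding borel_measurable_gauss_iff by (intro borel_measurable_power measurable_compose[OF Fm borel_measurable_norm])
    show "AE \<omega> in gauss. (norm (rep x \<omega>))\<^sup>2 = (norm (F (past g l \<omega>)))\<^sup>2"
      using FA by eventually_elim simp
  qed
  then have "integrable (distr gauss borel (past g l)) (\<lambda>p. (norm (F p))\<^sup>2)"
    by (subst integrable_distr_eq[OF pm]) measurable
  then have "integrable (distr gauss borel (past h l)) (\<lambda>p. (norm (F p))\<^sup>2)"
    using law by (simp add: same_law_def)
  then have "integrable gauss (\<lambda>\<omega>. (norm (F (past h l \<omega>)))\<^sup>2)"
    by (subst (asm) integrable_distr_eq[OF pm]) measurable
  then have "L2 (\<lambda>\<omega>. F (past h l \<omega>))"
    unfolding L2_def using Fm by simp
  then have "coupled l g h x (cl (\<lambda>\<omega>. F (past h l \<omega>)))"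
    by (intro coupledI[OF F FA] rep_cl)
  then show ?thesis ..
qed

lemma coupled_fst: "coupled l g h x y \<Longrightarrow> coupled l g g x x"
  by (auto simp: coupled_def)

text \<open>Coupling a process with itself expresses that \<open>x\<close> is a measurable function
  of the past, so the closure properties of \<open>coupled\<close> carry over.\<close>

definition adapted :: "(nat \<Rightarrow> 'm l2) \<Rightarrow> nat \<Rightarrow> 'm::finite l2 set" where
  "adapted g l = {x. coupled l g g x x}"

lemma subspace_adapted: "subspace (adapted g l)"
  by (auto simp: subspace_def adapted_def intro: coupled_zero coupled_add coupled_scaleR)

section \<open>Laws of Gaussian processes\<close>

text \<open>One-dimensional Levy uniqueness for a weighted law. The weight will carry the
  coordinates already treated in an induction, and the free phase \<open>\<theta>\<close> does the
  work of complex exponentials.\<close>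

lemma distr_eq_of_cos_integrals:
  fixes X :: "'a \<Rightarrow> real" and X' :: "'b \<Rightarrow> real"
  assumes "prob_space M" "prob_space M'"
    and X [measurable]: "X \<in> borel_measurable M" "X' \<in> borel_measurable M'"
    and w [measurable]: "w \<in> borel_measurable M" "w' \<in> borel_measurable M'"
    and w_nonneg: "\<And>\<omega>. 0 \<le> w \<omega>" "\<And>\<omega>. 0 \<le> w' \<omega>"
    and w_bound: "\<And>\<omega>. w \<omega> \<le> K" "\<And>\<omega>. w' \<omega> \<le> K"
    and eq: "\<And>s \<theta>. (\<integral>\<omega>. w \<omega> * cos (s * X \<omega> + \<theta>) \<partial>M) = (\<integral>\<omega>. w' \<omega> * cos (s * X' \<omega> + \<theta>) \<partial>M')"
    and B [measurable]: "B \<in> sets borel"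
  shows "(\<integral>\<omega>. w \<omega> * indicator B (X \<omega>) \<partial>M) = (\<integral>\<omega>. w' \<omega> * indicator B (X' \<omega>) \<partial>M')"
proof -
  interpret M: prob_space M by fact
  interpret M': prob_space M' by fact
  have wi: "integrable M w" "integrable M' w'"
    using w_nonneg w_bound by (auto intro!: M.integrable_const_bound[of _ K] M'.integrable_const_bound[of _ K])
  have bi: "integrable M (\<lambda>\<omega>. w \<omega> * f (X \<omega>))" "integrable M' (\<lambda>\<omega>. w' \<omega> * f (X' \<omega>))"
    if [measurable]: "f \<in> borel_measurable borel" and f: "\<And>x. \<bar>f x\<bar> \<le> 1" for f :: "real \<Rightarrow> real"
  proof -
    have "\<bar>a * f x\<bar> \<le> K" if "0 \<le> a" "a \<le> K" for a x
      using mult_mono[of a K "\<bar>f x\<bar>" 1] f[of x] that by (simp add: abs_mult)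
    then show "integrable M (\<lambda>\<omega>. w \<omega> * f (X \<omega>))" "integrable M' (\<lambda>\<omega>. w' \<omega> * f (X' \<omega>))"
      using w_nonneg w_bound by (auto intro!: M.integrable_const_bound[of _ K] M'.integrable_const_bound[of _ K])
  qed
  define c where "c = (\<integral>\<omega>. w \<omega> \<partial>M)"
  have c': "c = (\<integral>\<omega>. w' \<omega> \<partial>M')"
    using eq[of 0 0] by (simp add: c_def)
  have c0: "0 \<le> c" using w_nonneg by (simp add: c_def)
  show ?thesis
  proof (cases "c = 0")
    case True
    have z: "(\<integral>\<omega>. w \<omega> * indicator B (X \<omega>) \<partial>M) = 0"
    proof (rule integral_eq_zero_AE)
      have "AE \<omega> in M. w \<omega> = 0"
        using True integral_nonneg_eq_0_iff_AE[OF wi(1)] w_nonneg by (simp add: c_def)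
      then show "AE \<omega> in M. w \<omega> * indicator B (X \<omega>) = 0" by eventually_elim simp
    qed
    have z': "(\<integral>\<omega>. w' \<omega> * indicator B (X' \<omega>) \<partial>M') = 0"
    proof (rule integral_eq_zero_AE)
      have "AE \<omega> in M'. w' \<omega> = 0"
        using True integral_nonneg_eq_0_iff_AE[OF wi(2)] w_nonneg by (simp add: c')
      then show "AE \<omega> in M'. w' \<omega> * indicator B (X' \<omega>) = 0" by eventually_elim simp
    qed
    from z z' show ?thesis by simp
  next
    case False
    with c0 have c: "0 < c" by simp
    \<comment> \<open>Under the measure tilted by the normalised weight, \<open>X\<close> has a
      genuine probability law. A weight of total mass zero vanishes almost everywhere and was
      treated before.\<close>
    let ?D = "distr (density M (\<lambda>\<omega>. ennreal (w \<omega> / c))) borel X"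
    let ?D' = "distr (density M' (\<lambda>\<omega>. ennreal (w' \<omega> / c))) borel X'"
    have "(\<integral>\<^sup>+\<omega>. ennreal (w \<omega> / c) \<partial>M) = 1"
      using c wi w_nonneg by (subst nn_integral_eq_integral) (auto simp: c_def)
    then have "prob_space (density M (\<lambda>\<omega>. ennreal (w \<omega> / c)))"
      by (intro prob_spaceI) (auto simp: emeasure_density cong: nn_integral_cong)
    then have rD: "real_distribution ?D"
      by (intro real_distribution.intro prob_space.prob_space_distr) (auto simp: real_distribution_axioms_def)
    have "(\<integral>\<^sup>+\<omega>. ennreal (w' \<omega> / c) \<partial>M') = 1"
      using c wi w_nonneg by (subst nn_integral_eq_integral) (auto simp: c')
    then have "prob_space (density M' (\<lambda>\<omega>. ennreal (w' \<omega> / c)))"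
      by (intro prob_spaceI) (auto simp: emeasure_density cong: nn_integral_cong)
    then have rD': "real_distribution ?D'"
      by (intro real_distribution.intro prob_space.prob_space_distr) (auto simp: real_distribution_axioms_def)
    have int: "(\<integral>x. f x \<partial>?D) = (\<integral>\<omega>. w \<omega> * f (X \<omega>) \<partial>M) / c" "(\<integral>x. f x \<partial>?D') = (\<integral>\<omega>. w' \<omega> * f (X' \<omega>) \<partial>M') / c"
      if [measurable]: "f \<in> borel_measurable borel" for f :: "real \<Rightarrow> real"
      using c w_nonneg by (simp_all add: integral_distr integral_density)
    \<comment> \<open>The phases \<open>0\<close> and \<open>- pi/2\<close> give the real and the
      imaginary part of the characteristic function.\<close>
    have char: "char N t = Complex (\<integral>x. cos (t * x + 0) \<partial>N) (\<integral>x. cos (t * x + (- pi/2)) \<partial>N)" if "real_distribution N" for N t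
    proof -
      interpret N: real_distribution N by fact
      have i: "integrable N (\<lambda>x. iexp (t * x))"
        by (rule N.integrable_iexp) auto
      show ?thesis
        unfolding char_def complex_eq_iff
        using integral_Re[OF i] integral_Im[OF i] by (simp add: cos_diff Re_exp Im_exp)
    qed
    have "char ?D = char ?D'"
      unfolding char[OF rD] char[OF rD'] fun_eq_iff using eq[of _ 0] eq[of _ "- pi/2"] by (simp add: int)
    then have D: "?D = ?D'"
      by (rule Levy_uniqueness[OF rD rD'])
    have "(\<integral>\<omega>. w \<omega> * indicator B (X \<omega>) \<partial>M) / c = (\<integral>\<omega>. w' \<omega> * indicator B (X' \<omega>) \<partial>M') / c"
      by (simp only: int[symmetric, OF borel_measurable_indicator[OF B]] D)
    then show ?thesis using c by simp
  qed
qed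

text \<open>Multivariate Levy uniqueness, one coordinate at a time: a frequency in the cosine is
  exchanged for an indicator by the weighted one-dimensional statement. For \<open>I = J\<close>
  only indicators are left, that is, probabilities of rectangles.\<close>

lemma prod_cos_integrals_eq:
  fixes X :: "'i \<Rightarrow> 'a \<Rightarrow> real" and X' :: "'i \<Rightarrow> 'b \<Rightarrow> real"
  assumes M: "prob_space M" "prob_space M'" and J: "finite J"
    and X: "\<And>j. j \<in> J \<Longrightarrow> X j \<in> borel_measurable M" "\<And>j. j \<in> J \<Longrightarrow> X' j \<in> borel_measurable M'"
    and eq: "\<And>t \<theta>. (\<integral>\<omega>. cos ((\<Sum>j\<in>J. t j * X j \<omega>) + \<theta>) \<partial>M) = (\<integral>\<omega>. cos ((\<Sum>j\<in>J. t j * X' j \<omega>) + \<theta>) \<partial>M')"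
    and I: "I \<subseteq> J" and A: "\<And>j. j \<in> J \<Longrightarrow> A j \<in> sets borel"
  shows "(\<integral>\<omega>. (\<Prod>j\<in>I. indicator (A j) (X j \<omega>)) * cos ((\<Sum>j\<in>J - I. t j * X j \<omega>) + \<theta>) \<partial>M) =
    (\<integral>\<omega>. (\<Prod>j\<in>I. indicator (A j) (X' j \<omega>)) * cos ((\<Sum>j\<in>J - I. t j * X' j \<omega>) + \<theta>) \<partial>M')"
  using finite_subset[OF I J] I
proof (induction I arbitrary: t \<theta> rule: finite_induct)
  case empty
  then show ?case by (simp add: eq)
next
  case (insert i I)
  interpret M: prob_space M by fact
  interpret M': prob_space M' by fact
  have iJ: "i \<in> J" "i \<in> J - I" and IJ: "I \<subseteq> J" using insert by auto
  define R where "R = J - insert i I"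
  have R: "finite R" "i \<notin> R" "J - I = insert i R" "R \<subseteq> J" using insert J by (auto simp: R_def)
  define P where "P \<omega> = (\<Prod>j\<in>I. indicator (A j) (X j \<omega>) :: real)" for \<omega>
  define P' where "P' \<omega> = (\<Prod>j\<in>I. indicator (A j) (X' j \<omega>) :: real)" for \<omega>
  define S where "S \<omega> = (\<Sum>j\<in>R. t j * X j \<omega>) + \<theta>" for \<omega>
  define S' where "S' \<omega> = (\<Sum>j\<in>R. t j * X' j \<omega>) + \<theta>" for \<omega>
  have Pm [measurable]: "P \<in> borel_measurable M" "P' \<in> borel_measurable M'"
    unfolding P_def P'_def using X A IJ
    by (auto intro!: borel_measurable_prod measurable_compose[OF _ borel_measurable_indicator])
  have Sm [measurable]: "S \<in> borel_measurable M" "S' \<in> borel_measurable M'"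
    unfolding S_def S'_def using X R
    by (auto intro!: borel_measurable_sum borel_measurable_add borel_measurable_times)
  have Xm [measurable]: "X i \<in> borel_measurable M" "X' i \<in> borel_measurable M'" using X iJ by auto
  have Ai [measurable]: "A i \<in> sets borel" using A iJ by auto
  have P01: "0 \<le> P \<omega>" "P \<omega> \<le> 1" for \<omega> by (auto simp: P_def intro!: prod_nonneg prod_le_1)
  have P01': "0 \<le> P' \<omega>" "P' \<omega> \<le> 1" for \<omega> by (auto simp: P'_def intro!: prod_nonneg prod_le_1)
  \<comment> \<open>The factor \<open>a\<close> rescales all remaining frequencies and
    \<open>\<theta>'\<close> replaces the phase; the values \<open>a = 0, 1, -1\<close> arise when a
    product of two cosines is expanded.\<close>
  have IH: "(\<integral>\<omega>. P \<omega> * cos (s * X i \<omega> + (a * (S \<omega> - \<theta>) + \<theta>')) \<partial>M) = (\<integral>\<omega>. P' \<omega> * cos (s * X' i \<omega> + (a * (S' \<omega> - \<theta>) + \<theta>')) \<partial>M')" for s a \<theta>'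
  proof -
    have *: "(\<Sum>j\<in>J - I. (if j = i then s else a * t j) * Y j) = s * Y i + a * (\<Sum>j\<in>R. t j * Y j)" for Y :: "'i \<Rightarrow> real"
    proof -
      have "(\<Sum>j\<in>R. (if j = i then s else a * t j) * Y j) = (\<Sum>j\<in>R. a * (t j * Y j))"
        using R(2) by (intro sum.cong) auto
      then show ?thesis using R by (simp add: sum_distrib_left)
    qed
    show ?thesis
      using insert.IH[OF IJ, of "\<lambda>j. if j = i then s else a * t j" \<theta>']
      by (simp add: * P_def P'_def S_def S'_def add.assoc)
  qed
  have int: "integrable M (\<lambda>\<omega>. P \<omega> * f \<omega>)" if [measurable]: "f \<in> borel_measurable M" and "\<And>\<omega>. \<bar>f \<omega>\<bar> \<le> 1" for f
    by (rule M.integrable_const_bound[of _ 1]) (use P01 that in \<open>auto simp: abs_mult intro!: mult_le_one\<close>)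
  have int': "integrable M' (\<lambda>\<omega>. P' \<omega> * f \<omega>)" if [measurable]: "f \<in> borel_measurable M'" and "\<And>\<omega>. \<bar>f \<omega>\<bar> \<le> 1" for f
    by (rule M'.integrable_const_bound[of _ 1]) (use P01' that in \<open>auto simp: abs_mult intro!: mult_le_one\<close>)
  note cosm = measurable_compose[OF _ borel_measurable_continuous_onI[OF continuous_on_cos[OF continuous_on_id]]]
  have 1: "(\<integral>\<omega>. P \<omega> * indicator (A i) (X i \<omega>) \<partial>M) = (\<integral>\<omega>. P' \<omega> * indicator (A i) (X' i \<omega>) \<partial>M')"
    by (rule distr_eq_of_cos_integrals[OF M, where K = 1]) (use P01 P01' IH[of _ 0] in auto)
  \<comment> \<open>\<open>P * cos S\<close> changes sign and cannot serve as a weight.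
    \<open>P * (1 + cos S)\<close> is nonnegative and at most 2, and the contribution of
    \<open>P\<close> alone, known from the preceding step, is subtracted afterwards.\<close>
  have 2: "(\<integral>\<omega>. (P \<omega> * (1 + cos (S \<omega>))) * indicator (A i) (X i \<omega>) \<partial>M) = (\<integral>\<omega>. (P' \<omega> * (1 + cos (S' \<omega>))) * indicator (A i) (X' i \<omega>) \<partial>M')"
  proof (rule distr_eq_of_cos_integrals[OF M, where K = 2])
    fix s \<theta>'
    have e: "p * (1 + cos a) * cos (b + \<theta>') = p * cos (b + (0 * (a - \<theta>) + \<theta>')) + (1/2) * (p * cos (b + (1 * (a - \<theta>) + (\<theta> + \<theta>'))))
       + (1/2) * (p * cos (b + ((-1) * (a - \<theta>) + (\<theta>' - \<theta>))))" for p a b :: real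
    proof -
      have "cos a * cos (b + \<theta>') = (cos (b + \<theta>' + a) + cos (b + \<theta>' - a)) / 2"
        by (simp add: cos_add cos_diff)
      then have "p * (1 + cos a) * cos (b + \<theta>') = p * cos (b + \<theta>') + p * ((cos (b + \<theta>' + a) + cos (b + \<theta>' - a)) / 2)"
        by (metis distrib_left mult.assoc mult.commute mult_1)
      moreover have "b + (0 * (a - \<theta>) + \<theta>') = b + \<theta>'" "b + (1 * (a - \<theta>) + (\<theta> + \<theta>')) = b + \<theta>' + a"
        "b + ((-1) * (a - \<theta>) + (\<theta>' - \<theta>)) = b + \<theta>' - a" by simp_all
      ultimately show ?thesis by (simp only: add_divide_distrib distrib_left)
    qed
    have "(\<integral>\<omega>. (P \<omega> * (1 + cos (S \<omega>))) * cos (s * X i \<omega> + \<theta>') \<partial>M) =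
        (\<integral>\<omega>. P \<omega> * cos (s * X i \<omega> + (0 * (S \<omega> - \<theta>) + \<theta>')) \<partial>M)
        + (1/2) * (\<integral>\<omega>. P \<omega> * cos (s * X i \<omega> + (1 * (S \<omega> - \<theta>) + (\<theta> + \<theta>'))) \<partial>M)
        + (1/2) * (\<integral>\<omega>. P \<omega> * cos (s * X i \<omega> + ((-1) * (S \<omega> - \<theta>) + (\<theta>' - \<theta>))) \<partial>M)"
    proof -
      have i: "integrable M (\<lambda>\<omega>. P \<omega> * cos (s * X i \<omega> + (a * (S \<omega> - \<theta>) + t)))" for a t
        by (rule int) (intro cosm borel_measurable_add borel_measurable_times borel_measurable_diff Xm Sm borel_measurable_const, simp)
      show ?thesis
        unfolding e
        by (simp only: Bochner_Integration.integral_add[OF Bochner_Integration.integrable_add[OF i integrable_mult_right[OF i]] integrable_mult_right[OF i]]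
            Bochner_Integration.integral_add[OF i integrable_mult_right[OF i]] integral_mult_right_zero)
    qed
    moreover have "(\<integral>\<omega>. (P' \<omega> * (1 + cos (S' \<omega>))) * cos (s * X' i \<omega> + \<theta>') \<partial>M') =
        (\<integral>\<omega>. P' \<omega> * cos (s * X' i \<omega> + (0 * (S' \<omega> - \<theta>) + \<theta>')) \<partial>M')
        + (1/2) * (\<integral>\<omega>. P' \<omega> * cos (s * X' i \<omega> + (1 * (S' \<omega> - \<theta>) + (\<theta> + \<theta>'))) \<partial>M')
        + (1/2) * (\<integral>\<omega>. P' \<omega> * cos (s * X' i \<omega> + ((-1) * (S' \<omega> - \<theta>) + (\<theta>' - \<theta>))) \<partial>M')"
    proof -
      have i: "integrable M' (\<lambda>\<omega>. P' \<omega> * cos (s * X' i \<omega> + (a * (S' \<omega> - \<theta>) + t)))" for a t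
        by (rule int') (intro cosm borel_measurable_add borel_measurable_times borel_measurable_diff Xm Sm borel_measurable_const, simp)
      show ?thesis
        unfolding e
        by (simp only: Bochner_Integration.integral_add[OF Bochner_Integration.integrable_add[OF i integrable_mult_right[OF i]] integrable_mult_right[OF i]]
            Bochner_Integration.integral_add[OF i integrable_mult_right[OF i]] integral_mult_right_zero)
    qed
    ultimately show "(\<integral>\<omega>. (P \<omega> * (1 + cos (S \<omega>))) * cos (s * X i \<omega> + \<theta>') \<partial>M) = (\<integral>\<omega>. (P' \<omega> * (1 + cos (S' \<omega>))) * cos (s * X' i \<omega> + \<theta>') \<partial>M')"
      by (simp only: IH)
  next
    show "0 \<le> P \<omega> * (1 + cos (S \<omega>))" "P \<omega> * (1 + cos (S \<omega>)) \<le> 2" for \<omega>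
      using P01[of \<omega>] mult_mono[of "P \<omega>" 1 "1 + cos (S \<omega>)" 2] cos_ge_minus_one[of "S \<omega>"] cos_le_one[of "S \<omega>"]
      by (auto intro!: mult_nonneg_nonneg simp del: cos_ge_minus_one cos_le_one)
    show "0 \<le> P' \<omega> * (1 + cos (S' \<omega>))" "P' \<omega> * (1 + cos (S' \<omega>)) \<le> 2" for \<omega>
      using P01'[of \<omega>] mult_mono[of "P' \<omega>" 1 "1 + cos (S' \<omega>)" 2] cos_ge_minus_one[of "S' \<omega>"] cos_le_one[of "S' \<omega>"]
      by (auto intro!: mult_nonneg_nonneg simp del: cos_ge_minus_one cos_le_one)
  qed (intro Xm Ai Pm Sm cosm borel_measurable_times borel_measurable_add borel_measurable_const)+
  have "(\<integral>\<omega>. (P \<omega> * (1 + cos (S \<omega>))) * indicator (A i) (X i \<omega>) \<partial>M) =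
      (\<integral>\<omega>. P \<omega> * indicator (A i) (X i \<omega>) \<partial>M) + (\<integral>\<omega>. P \<omega> * (indicator (A i) (X i \<omega>) * cos (S \<omega>)) \<partial>M)"
    by (subst Bochner_Integration.integral_add[symmetric])
      (auto intro!: int Bochner_Integration.integral_cong simp: algebra_simps indicator_def)
  moreover have "(\<integral>\<omega>. (P' \<omega> * (1 + cos (S' \<omega>))) * indicator (A i) (X' i \<omega>) \<partial>M') =
      (\<integral>\<omega>. P' \<omega> * indicator (A i) (X' i \<omega>) \<partial>M') + (\<integral>\<omega>. P' \<omega> * (indicator (A i) (X' i \<omega>) * cos (S' \<omega>)) \<partial>M')"
    by (subst Bochner_Integration.integral_add[symmetric])
      (auto intro!: int' Bochner_Integration.integral_cong simp: algebra_simps indicator_def)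
  ultimately have "(\<integral>\<omega>. P \<omega> * (indicator (A i) (X i \<omega>) * cos (S \<omega>)) \<partial>M) = (\<integral>\<omega>. P' \<omega> * (indicator (A i) (X' i \<omega>) * cos (S' \<omega>)) \<partial>M')"
    using 1 2 by simp
  then show ?case
    using insert.hyps by (simp add: P_def P'_def S_def S'_def R_def mult_ac)
qed

section \<open>Saddle equations in Hilbert space\<close>

text \<open>\<open>W\<close> is not assumed closed, so the distance need not be attained. A point
  whose squared distance exceeds the infimum by at most \<open>\<delta>^2\<close> is already
  orthogonal to \<open>W\<close> up to \<open>\<delta>\<close>, because moving it inside
  \<open>W\<close> cannot lower the squared distance by more.\<close>

lemma near_projection:
  fixes u :: "'a::real_inner"
  assumes W: "subspace W" and \<delta>: "0 < \<delta>"
  obtains w where "w \<in> W" "norm (u - w) \<le> infdist u W + \<delta>"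
    "\<And>x. x \<in> W \<Longrightarrow> \<bar>(u - w) \<bullet> x\<bar> \<le> \<delta> * norm x"
proof -
  define d where "d = infdist u W"
  have W0: "W \<noteq> {}" using W subspace_0 by auto
  have d0: "0 \<le> d" by (simp add: d_def infdist_nonneg)
  have "d < sqrt (d\<^sup>2 + \<delta>\<^sup>2)"
    using \<delta> d0 by (intro real_less_rsqrt) auto
  then obtain w where w: "w \<in> W" "dist u w < sqrt (d\<^sup>2 + \<delta>\<^sup>2)"
    using W0 unfolding d_def infdist_notempty[OF W0] by (subst (asm) cINF_less_iff) auto
  have dn: "d \<le> norm (u - y)" if "y \<in> W" for y
    using infdist_le[OF that, of u] by (simp add: d_def dist_norm)
  have nw: "(norm (u - w))\<^sup>2 \<le> d\<^sup>2 + \<delta>\<^sup>2"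
  proof -
    have "(norm (u - w))\<^sup>2 \<le> (sqrt (d\<^sup>2 + \<delta>\<^sup>2))\<^sup>2"
      using w(2) by (intro power_mono) (auto simp: dist_norm)
    then show ?thesis by simp
  qed
  show ?thesis
  proof
    show "w \<in> W" by fact
    have "sqrt (d\<^sup>2 + \<delta>\<^sup>2) \<le> d + \<delta>"
      using \<delta> d0 by (intro real_le_lsqrt) (auto simp: power2_sum)
    then show "norm (u - w) \<le> infdist u W + \<delta>"
      using w(2) by (simp add: d_def dist_norm)
  next
    fix x assume x: "x \<in> W"
    show "\<bar>(u - w) \<bullet> x\<bar> \<le> \<delta> * norm x"
    proof (cases "x = 0")
      case False
      \<comment> \<open>The step that minimises the distance to \<open>u\<close> along the direction
        \<open>x\<close>.\<close>
      define t where "t = ((u - w) \<bullet> x) / (x \<bullet> x)"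
      have "d \<le> norm (u - (w + t *\<^sub>R x))"
        using w x W by (intro dn) (auto intro: subspace_add subspace_scale)
      then have "d\<^sup>2 \<le> (norm ((u - w) - t *\<^sub>R x))\<^sup>2"
        using d0 by (intro power_mono) (auto simp: algebra_simps)
      also have "\<dots> = (norm (u - w))\<^sup>2 - 2 * t * ((u - w) \<bullet> x) + t\<^sup>2 * (x \<bullet> x)"
        unfolding power2_norm_eq_inner
        by (simp add: inner_diff_left inner_diff_right inner_commute power2_eq_square algebra_simps)
      also have "\<dots> = (norm (u - w))\<^sup>2 - ((u - w) \<bullet> x)\<^sup>2 / (x \<bullet> x)"
        using False by (simp add: t_def power2_eq_square field_simps)
      finally have "((u - w) \<bullet> x)\<^sup>2 / (x \<bullet> x) \<le> \<delta>\<^sup>2"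
        using nw by linarith
      moreover have "0 < x \<bullet> x" using False by simp
      ultimately have "((u - w) \<bullet> x)\<^sup>2 \<le> \<delta>\<^sup>2 * (x \<bullet> x)"
        by (simp add: pos_divide_le_eq)
      then have "((u - w) \<bullet> x)\<^sup>2 \<le> (\<delta> * norm x)\<^sup>2"
        by (simp only: power_mult_distrib power2_norm_eq_inner)
      then have "\<bar>(u - w) \<bullet> x\<bar> \<le> \<bar>\<delta> * norm x\<bar>"
        by (simp only: abs_le_square_iff)
      then show ?thesis using \<delta> by simp
    qed simp
  qed
qed

text \<open>Subtract an almost nearest point of \<open>W\<close>, which \<open>y\<close> does not
  see, and apply Cauchy-Schwarz.\<close>

lemma orthogonal_inner_infdist:
  fixes u :: "'a::real_inner"
  assumes W: "subspace W" and y: "\<And>x. x \<in> W \<Longrightarrow> y \<bullet> x = 0"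
  shows "\<bar>y \<bullet> u\<bar> \<le> norm y * infdist u W"
proof (rule field_le_epsilon)
  fix e :: real assume "0 < e"
  define \<delta> where "\<delta> = e / (norm y + 1)"
  have \<delta>: "0 < \<delta>" "norm y * \<delta> \<le> e"
  proof -
    have n: "0 < norm y + 1" by (simp add: add_nonneg_pos)
    then show "0 < \<delta>" using \<open>0 < e\<close> by (simp add: \<delta>_def)
    have "norm y * e \<le> e * (norm y + 1)" using \<open>0 < e\<close> by (simp add: algebra_simps)
    then show "norm y * \<delta> \<le> e" using n by (simp add: \<delta>_def pos_divide_le_eq)
  qed
  from near_projection[OF W \<delta>(1), of u] obtain w where w: "w \<in> W" "norm (u - w) \<le> infdist u W + \<delta>" by metis
  have "\<bar>y \<bullet> u\<bar> = \<bar>y \<bullet> (u - w)\<bar>" using y[OF w(1)] by (simp add: inner_diff_right)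
  also have "\<dots> \<le> norm y * norm (u - w)" by (rule Cauchy_Schwarz_ineq2)
  also have "\<dots> \<le> norm y * (infdist u W + \<delta>)" by (intro mult_left_mono w) auto
  finally show "\<bar>y \<bullet> u\<bar> \<le> norm y * infdist u W + e" using \<delta> by (simp add: distrib_left)
qed

text \<open>Strong monotonicity is tested between \<open>u\<close> and an almost projection
  \<open>p\<close> of \<open>u\<close> to \<open>W\<close>. The increment of \<open>A\<close> is a
  sum of an element of \<open>W\<close>, almost orthogonal to \<open>u - p\<close>, of
  \<open>z\<close>, which sees only \<open>u\<close>, and of \<open>- b (u - p)\<close>, which moves
  to the left. As \<open>b\<close> may be negative, the inequality carries information on its
  sign.\<close>

lemma monotone_innovation:
  fixes u :: "'a::real_inner"
  assumes W: "subspace W" and u: "A u + b *\<^sub>R u = w + z" and w: "w \<in> W"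
    and z: "\<And>x. x \<in> W \<Longrightarrow> z \<bullet> x = 0"
    and mono: "\<And>x y. \<mu> * (norm (x - y))\<^sup>2 \<le> (A x - A y) \<bullet> (x - y)"
    and lip: "\<And>x y. norm (A x - A y) \<le> C * norm (x - y)"
    and AW: "\<And>x. x \<in> W \<Longrightarrow> A x \<in> W"
  shows "(b + \<mu>) * (infdist u W)\<^sup>2 \<le> z \<bullet> u"
proof -
  define D where "D = infdist u W"
  have D0: "0 \<le> D" by (simp add: D_def infdist_nonneg)
  \<comment> \<open>A bound, uniform in \<open>\<delta> \<le> 1\<close>, for the norm of the
    component \<open>w - A p - b p\<close> in \<open>W\<close>; its pairing with
    \<open>u - p\<close> is then at most \<open>\<delta> * K\<close> and disappears in the
    limit.\<close>
  define K where "K = norm (A u) + \<bar>C\<bar> * (D + 1) + norm w + \<bar>b\<bar> * (norm u + D + 1)"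
  have bound: "(b + \<mu>) * D\<^sup>2 \<le> z \<bullet> u + \<delta> * K + \<bar>b + \<mu>\<bar> * (\<delta> * (2 * D + 1))" if \<delta>: "0 < \<delta>" "\<delta> \<le> 1" for \<delta>
  proof -
    from near_projection[OF W \<delta>(1), of u] obtain p where p: "p \<in> W" "norm (u - p) \<le> D + \<delta>"
      and orth: "\<And>x. x \<in> W \<Longrightarrow> \<bar>(u - p) \<bullet> x\<bar> \<le> \<delta> * norm x"
      unfolding D_def by metis
    have Dp: "D \<le> norm (u - p)" using infdist_le[OF p(1), of u] by (simp add: D_def dist_norm)
    have inW: "w - A p - b *\<^sub>R p \<in> W"
      using W w AW p by (auto intro!: subspace_diff subspace_scale)
    have "norm (w - A p - b *\<^sub>R p) \<le> norm w + norm (A p) + \<bar>b\<bar> * norm p"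
      using norm_triangle_ineq4[of "w - A p" "b *\<^sub>R p"] norm_triangle_ineq4[of w "A p"] by simp
    also have "\<dots> \<le> norm w + (norm (A u) + \<bar>C\<bar> * (D + 1)) + \<bar>b\<bar> * (norm u + D + 1)"
    proof -
      have "norm (A p) \<le> norm (A u) + norm (A u - A p)"
        by (metis norm_minus_commute norm_triangle_sub)
      moreover have "norm (A u - A p) \<le> \<bar>C\<bar> * norm (u - p)"
        using order_trans[OF lip[of u p] mult_right_mono[of C "\<bar>C\<bar>" "norm (u - p)"]] by auto
      moreover have "\<bar>C\<bar> * norm (u - p) \<le> \<bar>C\<bar> * (D + 1)"
        using p \<delta> by (intro mult_left_mono) auto
      moreover have "norm p \<le> norm u + norm (u - p)" by (metis norm_minus_commute norm_triangle_sub)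
      then have "\<bar>b\<bar> * norm p \<le> \<bar>b\<bar> * (norm u + D + 1)"
        using p \<delta> by (intro mult_left_mono) auto
      ultimately show ?thesis by linarith
    qed
    finally have "norm (w - A p - b *\<^sub>R p) \<le> K" by (simp add: K_def)
    then have "\<delta> * norm (w - A p - b *\<^sub>R p) \<le> \<delta> * K"
      using \<delta> by (intro mult_left_mono) auto
    with orth[OF inW] have o: "(w - A p - b *\<^sub>R p) \<bullet> (u - p) \<le> \<delta> * K"
      by (simp add: inner_commute)
    have "\<mu> * (norm (u - p))\<^sup>2 \<le> (A u - A p) \<bullet> (u - p)" by (rule mono)
    also have "A u - A p = (w - A p - b *\<^sub>R p) + z - b *\<^sub>R (u - p)"
      using u by (simp add: algebra_simps)
    also have "\<dots> \<bullet> (u - p) = (w - A p - b *\<^sub>R p) \<bullet> (u - p) + z \<bullet> u - b * (norm (u - p))\<^sup>2"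
      using z[OF p(1)] by (simp add: inner_diff_left inner_add_left inner_diff_right power2_norm_eq_inner algebra_simps)
    finally have 1: "(b + \<mu>) * (norm (u - p))\<^sup>2 \<le> z \<bullet> u + \<delta> * K"
      using o by (simp add: distrib_right)
    have "0 \<le> (norm (u - p))\<^sup>2 - D\<^sup>2" using Dp D0 by (simp add: power_mono)
    moreover have "(norm (u - p))\<^sup>2 - D\<^sup>2 \<le> \<delta> * (2 * D + 1)"
    proof -
      have "(norm (u - p))\<^sup>2 \<le> (D + \<delta>)\<^sup>2" using p by (intro power_mono) auto
      moreover have "(D + \<delta>)\<^sup>2 - D\<^sup>2 = \<delta> * (2 * D + \<delta>)" by (simp add: power2_eq_square algebra_simps)
      moreover have "\<delta> * (2 * D + \<delta>) \<le> \<delta> * (2 * D + 1)" using \<delta> by (intro mult_left_mono) auto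
      ultimately show ?thesis by linarith
    qed
    ultimately have "\<bar>(b + \<mu>) * (D\<^sup>2 - (norm (u - p))\<^sup>2)\<bar> \<le> \<bar>b + \<mu>\<bar> * (\<delta> * (2 * D + 1))"
      unfolding abs_mult by (intro mult_left_mono) auto
    with 1 show ?thesis by (simp add: right_diff_distrib)
  qed
  have lim: "((\<lambda>\<delta>. z \<bullet> u + \<delta> * K + \<bar>b + \<mu>\<bar> * (\<delta> * (2 * D + 1))) \<longlongrightarrow> z \<bullet> u + 0 * K + \<bar>b + \<mu>\<bar> * (0 * (2 * D + 1))) (at_right 0)"
    by (intro tendsto_intros)
  have "(b + \<mu>) * D\<^sup>2 \<le> z \<bullet> u + 0 * K + \<bar>b + \<mu>\<bar> * (0 * (2 * D + 1))"
  proof (rule tendsto_lowerbound[OF lim])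
    show "\<forall>\<^sub>F \<delta> in at_right 0. (b + \<mu>) * D\<^sup>2 \<le> z \<bullet> u + \<delta> * K + \<bar>b + \<mu>\<bar> * (\<delta> * (2 * D + 1))"
      unfolding eventually_at_right_field by (intro exI[of _ 1]) (auto intro: bound)
  qed simp
  then show ?thesis by (simp add: D_def)
qed

text \<open>The coupling terms of two solutions contribute a nonpositive amount by Cauchy-Schwarz.\<close>

lemma saddle_unique:
  fixes u u' :: "'a::real_inner" and v v' :: "'b::real_inner"
  assumes \<mu>: "0 < \<mu>"
    and A: "\<And>x y. \<mu> * (norm (x - y))\<^sup>2 \<le> (A x - A y) \<bullet> (x - y)"
    and B: "\<And>x y. \<mu> * (norm (x - y))\<^sup>2 \<le> (B x - B y) \<bullet> (x - y)"
    and S: "linear S" "linear S'" "\<And>x y. S y \<bullet> x = y \<bullet> S' x"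
    and P: "\<And>x y. P x \<bullet> y = P x \<bullet> P y" and Q: "\<And>x y. Q x \<bullet> y = Q x \<bullet> Q y"
    and u: "A u = S v + norm (Q v) *\<^sub>R \<zeta> - (\<xi> \<bullet> v) *\<^sub>R sgn (P u)"
    and v: "B v = norm (P u) *\<^sub>R \<xi> - S' u - (\<zeta> \<bullet> u) *\<^sub>R sgn (Q v)"
    and u': "A u' = S v' + norm (Q v') *\<^sub>R \<zeta> - (\<xi> \<bullet> v') *\<^sub>R sgn (P u')"
    and v': "B v' = norm (P u') *\<^sub>R \<xi> - S' u' - (\<zeta> \<bullet> u') *\<^sub>R sgn (Q v')"
    and pos: "0 \<le> \<zeta> \<bullet> u" "0 \<le> \<xi> \<bullet> v" "0 \<le> \<zeta> \<bullet> u'" "0 \<le> \<xi> \<bullet> v'"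
  shows "u = u' \<and> v = v'"
proof -
  \<comment> \<open>Since \<open>P\<close> behaves as an orthogonal projection, \<open>y\<close> may
    be replaced by \<open>P y\<close>; the sign vector has norm at most one. For
    \<open>y = x\<close> there is equality, which is \<open>se\<close> below.\<close>
  have sg: "sgn (P x) \<bullet> y \<le> norm (P y)" for x y
  proof -
    have "sgn (P x) \<bullet> y = sgn (P x) \<bullet> P y" using P by (simp add: sgn_div_norm)
    also have "\<dots> \<le> norm (sgn (P x)) * norm (P y)" by (rule norm_cauchy_schwarz)
    also have "\<dots> \<le> 1 * norm (P y)" by (intro mult_right_mono) (auto simp: norm_sgn)
    finally show ?thesis by simp
  qed
  have sgQ: "sgn (Q x) \<bullet> y \<le> norm (Q y)" for x y
  proof -
    have "sgn (Q x) \<bullet> y = sgn (Q x) \<bullet> Q y" using Q by (simp add: sgn_div_norm)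
    also have "\<dots> \<le> norm (sgn (Q x)) * norm (Q y)" by (rule norm_cauchy_schwarz)
    also have "\<dots> \<le> 1 * norm (Q y)" by (intro mult_right_mono) (auto simp: norm_sgn)
    finally show ?thesis by simp
  qed
  have se: "sgn (P x) \<bullet> x = norm (P x)" for x
  proof -
    have "sgn (P x) \<bullet> x = sgn (P x) \<bullet> P x" using P by (simp add: sgn_div_norm)
    then show ?thesis by (cases "P x = 0") (auto simp: sgn_div_norm field_simps power2_norm_eq_inner[symmetric] power2_eq_square)
  qed
  have seQ: "sgn (Q x) \<bullet> x = norm (Q x)" for x
  proof -
    have "sgn (Q x) \<bullet> x = sgn (Q x) \<bullet> Q x" using Q by (simp add: sgn_div_norm)
    then show ?thesis by (cases "Q x = 0") (auto simp: sgn_div_norm field_simps power2_norm_eq_inner[symmetric] power2_eq_square)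
  qed
  \<comment> \<open>The adjoint pair \<open>S\<close>, \<open>S'\<close> cancels, and so do products
    belonging to one solution such as \<open>norm (Q v) * (\<zeta> \<bullet> u)\<close>. What is
    left is, four times, a nonnegative response times a Cauchy-Schwarz deficit.\<close>
  have e: "(A u - A u') \<bullet> (u - u') + (B v - B v') \<bullet> (v - v') =
      (\<zeta> \<bullet> u) * (sgn (Q v) \<bullet> v' - norm (Q v')) + (\<zeta> \<bullet> u') * (sgn (Q v') \<bullet> v - norm (Q v))
    + (\<xi> \<bullet> v) * (sgn (P u) \<bullet> u' - norm (P u')) + (\<xi> \<bullet> v') * (sgn (P u') \<bullet> u - norm (P u))"
    unfolding u v u' v'
    by (simp add: inner_diff_left inner_diff_right inner_add_left S(3) se seQ inner_commute[of _ "S' _"] algebra_simps)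
  have "\<mu> * (norm (u - u'))\<^sup>2 + \<mu> * (norm (v - v'))\<^sup>2 \<le> (A u - A u') \<bullet> (u - u') + (B v - B v') \<bullet> (v - v')"
    by (intro add_mono A B)
  also have "\<dots> \<le> 0"
    unfolding e using pos sg sgQ by (intro add_nonpos_nonpos mult_nonneg_nonpos) auto
  finally have "(norm (u - u'))\<^sup>2 + (norm (v - v'))\<^sup>2 \<le> 0"
    using \<mu> by (simp add: distrib_left[symmetric] mult_le_0_iff)
  then show ?thesis
    by (simp add: sum_power2_le_zero_iff)
qed

text \<open>Here \<open>a\<close> is the amplitude of the fresh coordinate, \<open>z\<close> the
  response to it and \<open>D\<close> the size of the innovation. From
  \<open>\<mu> D^2 \<le> a z\<close> and \<open>|z| \<le> n D\<close> follows
  \<open>D \<le> a n / \<mu>\<close>. The bound on \<open>z\<close> is linear in \<open>a\<close>,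
  which bounds the memory coefficient \<open>z / a\<close> in advance.\<close>

lemma innovation_response:
  fixes a b \<mu> D z n :: real
  assumes "0 < \<mu>" "0 \<le> a" "0 \<le> b" "0 \<le> D" "0 \<le> n" and mono: "(b + \<mu>) * D\<^sup>2 \<le> a * z" and z: "\<bar>z\<bar> \<le> n * D"
  shows "0 \<le> z" "z \<le> a * (n\<^sup>2 / \<mu>)"
proof -
  have "\<mu> * D\<^sup>2 \<le> (b + \<mu>) * D\<^sup>2" using assms by (intro mult_right_mono) auto
  with mono have m: "\<mu> * D\<^sup>2 \<le> a * z" by linarith
  have m0: "0 \<le> \<mu> * D\<^sup>2" using assms by simp
  have "0 \<le> z \<and> z \<le> a * (n\<^sup>2 / \<mu>)"
  proof (cases "D = 0")
    case True
    then show ?thesis using z assms by simp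
  next
    case False
    with \<open>0 \<le> D\<close> have D: "0 < D" by simp
    then have "0 < a * z" using m \<open>0 < \<mu>\<close> by (smt (verit) mult_pos_pos zero_less_power)
    then have "0 < z" using \<open>0 \<le> a\<close> by (simp add: zero_less_mult_iff)
    have "(\<mu> * D) * D \<le> (a * n) * D"
      using m mult_left_mono[OF abs_le_D1[OF z] \<open>0 \<le> a\<close>] by (simp add: power2_eq_square algebra_simps)
    then have "\<mu> * D \<le> a * n" using D by simp
    then have "n * (\<mu> * D) \<le> n * (a * n)" by (rule mult_left_mono) fact
    then have "n * D \<le> a * (n\<^sup>2 / \<mu>)"
      using \<open>0 < \<mu>\<close> by (simp add: field_simps power2_eq_square)
    then show ?thesis using z \<open>0 < z\<close> by linarith
  qed
  then show "0 \<le> z" "z \<le> a * (n\<^sup>2 / \<mu>)" by auto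
qed

text \<open>At the lower barrier \<open>b = 0\<close> and \<open>z = 0\<close>. At the upper barrier
  \<open>(Z + 1) * a \<le> z \<le> a * Z\<close> forces \<open>a = 0\<close>, hence
  \<open>z = 0\<close>; the extra 1 in the barrier serves this conclusion. In between the claim is
  the fixed point equation.\<close>

lemma clamp_fixed_point:
  fixes a b z Z :: real
  assumes "b = max 0 (min (Z + 1) (b + z - b * a))" "0 \<le> z" "z \<le> a * Z" "0 \<le> a" "0 \<le> Z"
  shows "b * a = z"
proof -
  consider "b + z - b * a \<le> 0" "b = 0" | "Z + 1 \<le> b + z - b * a" "b = Z + 1" | "b = b + z - b * a"
    using assms(1,5) by linarith
  then show ?thesis
  proof cases
    case 2
    then have "(Z + 1) * a \<le> z" by simp
    with assms have "a = 0" by (simp add: algebra_simps)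
    with assms show ?thesis by simp
  qed (use assms in auto)
qed

lemma norm_scaleR_sgn: "norm x *\<^sub>R sgn x = (x :: 'a::real_normed_vector)"
  by (cases "x = 0") (simp_all add: sgn_div_norm)

text \<open>
  With the four scalars \<open>a = \<parallel>Q v\<parallel>\<close>, \<open>a' = \<parallel>P u\<parallel>\<close>, \<open>b = \<langle>\<xi>, v\<rangle> / a'\<close>, \<open>c = \<langle>\<zeta>, u\<rangle> / a\<close> frozen, the system is
  strongly monotone because the linear coupling \<open>(S, S')\<close> is skew; Brouwer's theorem then matches the
  scalars. Clamping \<open>b + \<langle>\<xi>, v\<rangle> - b a'\<close> instead of dividing keeps the scalar map continuous at \<open>a' = 0\<close>.
\<close>

lemma saddle_exists:
  fixes A :: "'a::{real_inner,complete_space} \<Rightarrow> 'a" and B :: "'b::{real_inner,complete_space} \<Rightarrow> 'b"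
  assumes \<mu>: "0 < \<mu>"
    and A: "\<And>x y. \<mu> * (norm (x - y))\<^sup>2 \<le> (A x - A y) \<bullet> (x - y)" "\<And>x y. norm (A x - A y) \<le> C * norm (x - y)"
    and B: "\<And>x y. \<mu> * (norm (x - y))\<^sup>2 \<le> (B x - B y) \<bullet> (x - y)" "\<And>x y. norm (B x - B y) \<le> C' * norm (x - y)"
    and S: "bounded_linear S" "bounded_linear S'" "\<And>x y. S y \<bullet> x = y \<bullet> S' x"
    and P: "bounded_linear P" "\<And>x y. P x \<bullet> y = P x \<bullet> P y"
    and Q: "bounded_linear Q" "\<And>x y. Q x \<bullet> y = Q x \<bullet> Q y"
    and W: "subspace W" "\<And>x. x \<in> W \<Longrightarrow> A x \<in> W" "\<And>y. S y \<in> W" "\<And>x. x - P x \<in> W" "\<And>x. x \<in> W \<Longrightarrow> \<zeta> \<bullet> x = 0"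
    and W': "subspace W'" "\<And>x. x \<in> W' \<Longrightarrow> B x \<in> W'" "\<And>y. S' y \<in> W'" "\<And>x. x - Q x \<in> W'" "\<And>x. x \<in> W' \<Longrightarrow> \<xi> \<bullet> x = 0"
  obtains u v b c where "A u = S v + norm (Q v) *\<^sub>R \<zeta> - (\<xi> \<bullet> v) *\<^sub>R sgn (P u)"
    and "B v = norm (P u) *\<^sub>R \<xi> - S' u - (\<zeta> \<bullet> u) *\<^sub>R sgn (Q v)"
    and "0 \<le> \<zeta> \<bullet> u" "0 \<le> \<xi> \<bullet> v"
    and "0 \<le> b" "0 \<le> c" "(\<xi> \<bullet> v) *\<^sub>R sgn (P u) = b *\<^sub>R P u" "(\<zeta> \<bullet> u) *\<^sub>R sgn (Q v) = c *\<^sub>R Q v"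
proof -
  interpret S: bounded_linear S by fact
  interpret S': bounded_linear S' by fact
  interpret P: bounded_linear P by fact
  interpret Q: bounded_linear Q by fact
  define T where "T p x = (A (fst x) + fst (snd (snd p)) *\<^sub>R P (fst x) - S (snd x) - fst p *\<^sub>R \<zeta>,
      B (snd x) + snd (snd (snd p)) *\<^sub>R Q (snd x) + S' (fst x) - fst (snd p) *\<^sub>R \<xi>)"
    for p :: "real \<times> real \<times> real \<times> real" and x :: "'a \<times> 'b"
  \<comment> \<open>\<open>R\<close> exceeds by one the a priori bound on the norm of the solution
    proved at the end; \<open>Zx\<close> and \<open>Zz\<close> are the constants of
    \<open>innovation_response\<close> for the two memory coefficients.\<close>
  define R where "R = (norm (A 0) + norm (B 0)) / \<mu> + 1"
  define Zx where "Zx = (norm \<xi>)\<^sup>2 / \<mu>"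
  define Zz where "Zz = (norm \<zeta>)\<^sup>2 / \<mu>"
  define K where "K = {0..R} \<times> {0..R} \<times> {0..Zx + 1} \<times> {0..Zz + 1}"
  have R1: "1 \<le> R" and Z0: "0 \<le> Zx" "0 \<le> Zz" using \<mu> by (auto simp: R_def Zx_def Zz_def)
  have Tmono: "\<mu> * (norm (x - y))\<^sup>2 \<le> (T p x - T p y) \<bullet> (x - y)" if p: "p \<in> K" for p x y
  proof -
    obtain a a' b c where pe: "p = (a, a', b, c)" by (cases p)
    have bc: "0 \<le> b" "0 \<le> c" using p by (auto simp: pe K_def)
    define d e where "d = fst x - fst y" and "e = snd x - snd y"
    have "(T p x - T p y) \<bullet> (x - y) = (A (fst x) - A (fst y)) \<bullet> d + b * (P d \<bullet> d) - S e \<bullet> d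
        + ((B (snd x) - B (snd y)) \<bullet> e + c * (Q e \<bullet> e) + S' d \<bullet> e)"
      by (simp add: T_def pe inner_prod_def d_def e_def P.diff Q.diff S.diff S'.diff
          inner_diff_left inner_diff_right inner_add_left algebra_simps)
    also have "S e \<bullet> d = S' d \<bullet> e" unfolding S(3) by (rule inner_commute)
    finally have "(T p x - T p y) \<bullet> (x - y) = (A (fst x) - A (fst y)) \<bullet> d + b * (P d \<bullet> P d)
        + ((B (snd x) - B (snd y)) \<bullet> e + c * (Q e \<bullet> Q e))"
      using P(2)[of d d] Q(2)[of e e] by simp
    moreover have "\<mu> * (norm d)\<^sup>2 \<le> (A (fst x) - A (fst y)) \<bullet> d" "\<mu> * (norm e)\<^sup>2 \<le> (B (snd x) - B (snd y)) \<bullet> e"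
      unfolding d_def e_def by (rule A B)+
    moreover have "0 \<le> b * (P d \<bullet> P d)" "0 \<le> c * (Q e \<bullet> Q e)" using bc by auto
    moreover have "(norm (x - y))\<^sup>2 = (norm d)\<^sup>2 + (norm e)\<^sup>2"
      by (simp add: norm_prod_def d_def e_def)
    ultimately show ?thesis by (simp add: distrib_left)
  qed
  obtain kS kS' kP kQ where k: "\<And>x. norm (S x) \<le> norm x * kS" "\<And>x. norm (S' x) \<le> norm x * kS'"
    "\<And>x. norm (P x) \<le> norm x * kP" "\<And>x. norm (Q x) \<le> norm x * kQ" and k0: "0 \<le> kS" "0 \<le> kS'" "0 \<le> kP" "0 \<le> kQ"
    using S.nonneg_bounded S'.nonneg_bounded P.nonneg_bounded Q.nonneg_bounded by metis
  have "\<exists>x. T p x = 0" if p: "p \<in> K" for p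
  proof (rule strongly_monotone_zero[OF \<mu> Tmono[OF p]])
    fix x y :: "'a \<times> 'b"
    obtain a a' b c where pe: "p = (a, a', b, c)" by (cases p)
    have bc: "0 \<le> b" "0 \<le> c" using p by (auto simp: pe K_def)
    define d e where "d = fst x - fst y" and "e = snd x - snd y"
    have de: "norm d \<le> norm (x - y)" "norm e \<le> norm (x - y)"
      using norm_fst_le[of "fst (x - y)" "snd (x - y)"] norm_snd_le[of "snd (x - y)" "fst (x - y)"]
      unfolding prod.collapse by (simp_all add: d_def e_def)
    have "T p x - T p y = ((A (fst x) - A (fst y)) + b *\<^sub>R P d - S e, (B (snd x) - B (snd y)) + c *\<^sub>R Q e + S' d)"
      by (simp add: T_def pe d_def e_def P.diff Q.diff S.diff S'.diff algebra_simps)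
    then have "norm (T p x - T p y) \<le> norm ((A (fst x) - A (fst y)) + b *\<^sub>R P d - S e) + norm ((B (snd x) - B (snd y)) + c *\<^sub>R Q e + S' d)"
      by (simp add: norm_Pair_le)
    also have "\<dots> \<le> (norm (A (fst x) - A (fst y)) + b * norm (P d) + norm (S e)) + (norm (B (snd x) - B (snd y)) + c * norm (Q e) + norm (S' d))"
      using norm_triangle_ineq4[of "A (fst x) - A (fst y) + b *\<^sub>R P d" "S e"] norm_triangle_ineq[of "A (fst x) - A (fst y)" "b *\<^sub>R P d"]
        norm_triangle_ineq[of "B (snd x) - B (snd y) + c *\<^sub>R Q e" "S' d"] norm_triangle_ineq[of "B (snd x) - B (snd y)" "c *\<^sub>R Q e"] bc
      by simp
    also have "\<dots> \<le> (\<bar>C\<bar> * norm (x - y) + b * (norm (x - y) * kP) + norm (x - y) * kS) + (\<bar>C'\<bar> * norm (x - y) + c * (norm (x - y) * kQ) + norm (x - y) * kS')"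
    proof (intro add_mono mult_left_mono)
      show "norm (A (fst x) - A (fst y)) \<le> \<bar>C\<bar> * norm (x - y)"
        unfolding d_def[symmetric] using A(2)[of "fst x" "fst y", folded d_def] mult_mono[OF abs_ge_self[of C] de(1)] by simp
      show "norm (B (snd x) - B (snd y)) \<le> \<bar>C'\<bar> * norm (x - y)"
        unfolding e_def[symmetric] using B(2)[of "snd x" "snd y", folded e_def] mult_mono[OF abs_ge_self[of C'] de(2)] by simp
      show "norm (P d) \<le> norm (x - y) * kP" "norm (S e) \<le> norm (x - y) * kS"
        "norm (Q e) \<le> norm (x - y) * kQ" "norm (S' d) \<le> norm (x - y) * kS'"
        using k(3)[of d] k(1)[of e] k(4)[of e] k(2)[of d] mult_right_mono[OF de(1) k0(3)] mult_right_mono[OF de(2) k0(1)]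
          mult_right_mono[OF de(2) k0(4)] mult_right_mono[OF de(1) k0(2)] by auto
    qed (use bc in auto)
    also have "\<dots> = (\<bar>C\<bar> + b * kP + kS + \<bar>C'\<bar> + c * kQ + kS') * norm (x - y)"
      by (simp add: algebra_simps)
    finally show "norm (T p x - T p y) \<le> (\<bar>C\<bar> + fst (snd (snd p)) * kP + kS + \<bar>C'\<bar> + snd (snd (snd p)) * kQ + kS') * norm (x - y)"
      by (simp add: pe)
  qed
  then obtain sol where sol: "\<And>p. p \<in> K \<Longrightarrow> T p (sol p) = 0" by metis
  have cont: "continuous_on K sol"
    unfolding continuous_on_def
  proof
    fix q assume q: "q \<in> K"
    have "((\<lambda>p. norm (T p (sol q)) / \<mu>) \<longlongrightarrow> norm (T q (sol q)) / \<mu>) (at q within K)"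
      unfolding T_def by (intro tendsto_intros) (use \<mu> in auto)
    then have lim: "((\<lambda>p. norm (T p (sol q)) / \<mu>) \<longlongrightarrow> 0) (at q within K)"
      using sol[OF q] by simp
    have "dist (sol p) (sol q) \<le> norm (T p (sol q)) / \<mu>" if p: "p \<in> K" for p
    proof -
      have "\<mu> * (norm (sol p - sol q))\<^sup>2 \<le> (- T p (sol q)) \<bullet> (sol p - sol q)"
        using Tmono[OF p, of "sol p" "sol q"] sol[OF p] by simp
      also have "\<dots> \<le> norm (T p (sol q)) * norm (sol p - sol q)"
        using norm_cauchy_schwarz[of "- T p (sol q)" "sol p - sol q"] by simp
      finally have "(\<mu> * norm (sol p - sol q)) * norm (sol p - sol q) \<le> norm (T p (sol q)) * norm (sol p - sol q)"
        by (simp add: power2_eq_square algebra_simps)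
      then have "\<mu> * norm (sol p - sol q) \<le> norm (T p (sol q))"
        by (cases "sol p = sol q") auto
      then show ?thesis using \<mu> by (simp add: dist_norm field_simps)
    qed
    then show "(sol \<longlongrightarrow> sol q) (at q within K)"
      unfolding tendsto_dist_iff[of sol]
      by (intro tendsto_sandwich[OF _ _ tendsto_const lim]) (auto simp: eventually_at_filter intro!: always_eventually)
  qed
  \<comment> \<open>Truncation and clamping make \<open>F\<close> a self-map of the box
    \<open>K\<close>; that its fixed point nevertheless solves the original system is shown
    afterwards.\<close>
  define F where "F p = (min R (norm (Q (snd (sol p)))), min R (norm (P (fst (sol p)))),
      max 0 (min (Zx + 1) (fst (snd (snd p)) + \<xi> \<bullet> snd (sol p) - fst (snd (snd p)) * fst (snd p))),
      max 0 (min (Zz + 1) (snd (snd (snd p)) + \<zeta> \<bullet> fst (sol p) - snd (snd (snd p)) * fst p)))" for p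
  have "continuous_on K F"
    unfolding F_def
    by (intro continuous_intros cont P.continuous_on Q.continuous_on)
  moreover have "compact K" "convex K" "K \<noteq> {}"
    unfolding K_def using R1 Z0 by (auto intro!: compact_Times convex_Times)
  moreover have "F \<in> K \<rightarrow> K"
    using R1 Z0 by (auto simp: F_def K_def)
  ultimately obtain p where p: "p \<in> K" "F p = p" using brouwer by metis
  obtain a a' b c where pe: "p = (a, a', b, c)" by (cases p)
  define u v where "u = fst (sol p)" and "v = snd (sol p)"
  have pos: "0 \<le> a" "0 \<le> a'" "0 \<le> b" "0 \<le> c" using p(1) by (auto simp: pe K_def)
  have fix1: "a = min R (norm (Q v))" "a' = min R (norm (P u))"
    and fix2: "b = max 0 (min (Zx + 1) (b + \<xi> \<bullet> v - b * a'))" "c = max 0 (min (Zz + 1) (c + \<zeta> \<bullet> u - c * a))"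
    using p(2) by (auto simp: F_def pe u_def v_def)
  have eU: "A u + b *\<^sub>R P u = S v + a *\<^sub>R \<zeta>" and eV: "B v + c *\<^sub>R Q v = a' *\<^sub>R \<xi> - S' u"
    using sol[OF p(1)] by (auto simp: T_def pe u_def v_def zero_prod_def algebra_simps)
  have "(b + \<mu>) * (infdist u W)\<^sup>2 \<le> (a *\<^sub>R \<zeta>) \<bullet> u"
  proof (rule monotone_innovation[OF W(1) _ _ _ A W(2)])
    \<comment> \<open>The term \<open>b (P u)\<close> is completed to \<open>b u\<close>; the
      correction \<open>b (u - P u)\<close> lies in \<open>W\<close>, and so the innovation
      inequality applies.\<close>
    show "A u + b *\<^sub>R u = (S v + b *\<^sub>R (u - P u)) + a *\<^sub>R \<zeta>" using eU by (simp add: algebra_simps)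
    show "S v + b *\<^sub>R (u - P u) \<in> W" by (intro subspace_add[OF W(1)] subspace_scale[OF W(1)] W(3,4))
  qed (use W(5) in auto)
  then have mu: "(b + \<mu>) * (infdist u W)\<^sup>2 \<le> a * (\<zeta> \<bullet> u)" by simp
  have "(c + \<mu>) * (infdist v W')\<^sup>2 \<le> (a' *\<^sub>R \<xi>) \<bullet> v"
  proof (rule monotone_innovation[OF W'(1) _ _ _ B W'(2)])
    show "B v + c *\<^sub>R v = (c *\<^sub>R (v - Q v) - S' u) + a' *\<^sub>R \<xi>" using eV by (simp add: algebra_simps)
    show "c *\<^sub>R (v - Q v) - S' u \<in> W'" by (intro subspace_diff[OF W'(1)] subspace_scale[OF W'(1)] W'(3,4))
  qed (use W'(5) in auto)
  then have mv: "(c + \<mu>) * (infdist v W')\<^sup>2 \<le> a' * (\<xi> \<bullet> v)" by simp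
  have zu: "0 \<le> \<zeta> \<bullet> u" "\<zeta> \<bullet> u \<le> a * Zz"
    unfolding Zz_def using innovation_response[OF \<mu> pos(1,3) infdist_nonneg norm_ge_zero mu orthogonal_inner_infdist[OF W(1,5)]] by auto
  have xv: "0 \<le> \<xi> \<bullet> v" "\<xi> \<bullet> v \<le> a' * Zx"
    unfolding Zx_def using innovation_response[OF \<mu> pos(2,4) infdist_nonneg norm_ge_zero mv orthogonal_inner_infdist[OF W'(1,5)]] by auto
  have ba: "b * a' = \<xi> \<bullet> v" and ca: "c * a = \<zeta> \<bullet> u"
    using clamp_fixed_point[OF fix2(1) xv pos(2) Z0(1)] clamp_fixed_point[OF fix2(2) zu pos(1) Z0(2)] by auto
  \<comment> \<open>Energy estimate, valid although the amplitudes may still be truncated: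
    truncation only decreases \<open>a\<close> and \<open>a'\<close>. It yields a norm of at most
    \<open>R - 1\<close> for the solution, so the truncation is in fact inactive.\<close>
  have "A u \<bullet> u + B v \<bullet> v \<le> 0"
  proof -
    have "A u \<bullet> u = S v \<bullet> u + a * (\<zeta> \<bullet> u) - b * (P u \<bullet> u)"
      using arg_cong[OF eU, of "\<lambda>x. x \<bullet> u"] by (simp add: inner_add_left)
    moreover have "B v \<bullet> v = a' * (\<xi> \<bullet> v) - S' u \<bullet> v - c * (Q v \<bullet> v)"
      using arg_cong[OF eV, of "\<lambda>x. x \<bullet> v"] by (simp add: inner_add_left inner_diff_left)
    moreover have "S v \<bullet> u = S' u \<bullet> v" unfolding S(3) by (rule inner_commute)
    moreover have "P u \<bullet> u = (norm (P u))\<^sup>2" "Q v \<bullet> v = (norm (Q v))\<^sup>2"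
      using P(2)[of u u] Q(2)[of v v] by (simp_all add: power2_norm_eq_inner)
    ultimately have "A u \<bullet> u + B v \<bullet> v = c * (a\<^sup>2 - (norm (Q v))\<^sup>2) + b * (a'\<^sup>2 - (norm (P u))\<^sup>2)"
      by (simp add: ba[symmetric] ca[symmetric] power2_eq_square algebra_simps)
    also have "\<dots> \<le> 0"
      using pos fix1 by (intro add_nonpos_nonpos mult_nonneg_nonpos) (auto simp: power_mono)
    finally show ?thesis .
  qed
  moreover have "\<mu> * (norm u)\<^sup>2 \<le> A u \<bullet> u - A 0 \<bullet> u" "\<mu> * (norm v)\<^sup>2 \<le> B v \<bullet> v - B 0 \<bullet> v"
    using A(1)[of u 0] B(1)[of v 0] by (auto simp: inner_diff_left)
  moreover have "- (A 0 \<bullet> u) \<le> norm (A 0) * norm u" "- (B 0 \<bullet> v) \<le> norm (B 0) * norm v"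
    using norm_cauchy_schwarz[of "- A 0" u] norm_cauchy_schwarz[of "- B 0" v] by auto
  ultimately have e1: "\<mu> * ((norm u)\<^sup>2 + (norm v)\<^sup>2) \<le> norm (A 0) * norm u + norm (B 0) * norm v"
    by (simp add: distrib_left)
  define N where "N = norm (u, v)"
  have N: "norm u \<le> N" "norm v \<le> N" "N\<^sup>2 = (norm u)\<^sup>2 + (norm v)\<^sup>2"
    by (auto simp: N_def norm_fst_le norm_snd_le norm_Pair)
  have "(\<mu> * N) * N \<le> (norm (A 0) + norm (B 0)) * N"
    using e1 mult_left_mono[OF N(1), of "norm (A 0)"] mult_left_mono[OF N(2), of "norm (B 0)"] N(3)
    by (simp add: power2_eq_square distrib_right mult.assoc)
  then have "\<mu> * N \<le> norm (A 0) + norm (B 0)"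
    using N_def by (cases "N = 0") auto
  then have "N \<le> R - 1" using \<mu> by (simp add: R_def field_simps)
  moreover have contract: "norm (P u) \<le> norm u" "norm (Q v) \<le> norm v"
  proof -
    have "norm (P u) * norm (P u) \<le> norm (P u) * norm u"
      using P(2)[of u u] norm_cauchy_schwarz[of "P u" u] by (simp add: power2_norm_eq_inner[symmetric] power2_eq_square)
    then show "norm (P u) \<le> norm u" by (cases "P u = 0") auto
    have "norm (Q v) * norm (Q v) \<le> norm (Q v) * norm v"
      using Q(2)[of v v] norm_cauchy_schwarz[of "Q v" v] by (simp add: power2_norm_eq_inner[symmetric] power2_eq_square)
    then show "norm (Q v) \<le> norm v" by (cases "Q v = 0") auto
  qed
  ultimately have aa: "a = norm (Q v)" "a' = norm (P u)"
    using fix1 N by auto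
  \<comment> \<open>Correct also for \<open>P u = 0\<close>: then
    \<open>\<xi> \<bullet> v = b * a'\<close> vanishes, and no division takes place.\<close>
  have sg: "(\<xi> \<bullet> v) *\<^sub>R sgn (P u) = b *\<^sub>R P u" "(\<zeta> \<bullet> u) *\<^sub>R sgn (Q v) = c *\<^sub>R Q v"
    by (simp_all only: ba[symmetric] ca[symmetric] aa scaleR_scaleR[symmetric] norm_scaleR_sgn)
  show ?thesis
  proof (rule that[of u v b c])
    show "A u = S v + norm (Q v) *\<^sub>R \<zeta> - (\<xi> \<bullet> v) *\<^sub>R sgn (P u)"
      unfolding sg aa[symmetric] using eU by (simp add: algebra_simps)
    show "B v = norm (P u) *\<^sub>R \<xi> - S' u - (\<zeta> \<bullet> u) *\<^sub>R sgn (Q v)"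
      unfolding sg aa[symmetric] using eV by (simp add: algebra_simps)
  qed (fact zu(1) xv(1) pos(3,4) sg)+
qed

section \<open>Gaussian processes\<close>

text \<open>The variance of the sum of the \<open>c j \<bullet> g j\<close> when the covariance is
  the Gram matrix of \<open>g\<close> times the identity over the dimension.\<close>

definition quad_form :: "nat \<Rightarrow> (nat \<Rightarrow> 'm l2) \<Rightarrow> (nat \<Rightarrow> real^'m) \<Rightarrow> real" where
  "quad_form l g c = (\<Sum>i\<in>{1..l}. \<Sum>j\<in>{1..l}. (g i \<bullet> g j) * (c i \<bullet> c j)) / real CARD('m::finite)"

text \<open>The characteristic function of \<open>N(0, K \<otimes> I\<^sub>m / m)\<close>, with \<open>K\<close> the Gram matrix of \<open>g\<close>, in real form.\<close>

definition gaussian :: "nat \<Rightarrow> (nat \<Rightarrow> 'm::finite l2) \<Rightarrow> bool" where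
  "gaussian l g \<longleftrightarrow> (\<forall>c \<theta>. (\<integral>\<omega>. cos ((\<Sum>j\<in>{1..l}. c j \<bullet> rep (g j) \<omega>) + \<theta>) \<partial>gauss) = cos \<theta> * exp (- quad_form l g c / 2))"

text \<open>Rectangles generate the product sigma-algebra, and their probabilities agree once every
  cosine has been exchanged for an indicator.\<close>

lemma distr_PiM_eqI:
  fixes X :: "'i \<Rightarrow> 'a \<Rightarrow> real" and X' :: "'i \<Rightarrow> 'b \<Rightarrow> real"
  assumes M: "prob_space M" "prob_space M'" and J: "finite J"
    and X: "\<And>j. j \<in> J \<Longrightarrow> X j \<in> borel_measurable M" "\<And>j. j \<in> J \<Longrightarrow> X' j \<in> borel_measurable M'"
    and eq: "\<And>t \<theta>. (\<integral>\<omega>. cos ((\<Sum>j\<in>J. t j * X j \<omega>) + \<theta>) \<partial>M) = (\<integral>\<omega>. cos ((\<Sum>j\<in>J. t j * X' j \<omega>) + \<theta>) \<partial>M')"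
  shows "distr M (\<Pi>\<^sub>M j\<in>J. borel) (\<lambda>\<omega>. \<lambda>j\<in>J. X j \<omega>) = distr M' (\<Pi>\<^sub>M j\<in>J. borel) (\<lambda>\<omega>. \<lambda>j\<in>J. X' j \<omega>)"
    (is "?P = ?Q")
proof (rule measure_eqI_PiM_finite[OF J])
  interpret M: prob_space M by fact
  interpret M': prob_space M' by fact
  have m: "(\<lambda>\<omega>. \<lambda>j\<in>J. X j \<omega>) \<in> measurable M (\<Pi>\<^sub>M j\<in>J. borel)" "(\<lambda>\<omega>. \<lambda>j\<in>J. X' j \<omega>) \<in> measurable M' (\<Pi>\<^sub>M j\<in>J. borel)"
    by (intro measurable_restrict X; assumption)+
  interpret P: prob_space ?P by (rule M.prob_space_distr[OF m(1)])
  interpret Q: prob_space ?Q by (rule M'.prob_space_distr[OF m(2)])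
  fix A :: "'i \<Rightarrow> real set" assume A: "\<And>j. j \<in> J \<Longrightarrow> A j \<in> sets borel"
  have E: "Pi\<^sub>E J A \<in> sets (\<Pi>\<^sub>M j\<in>J. borel)" using A J by (intro sets_PiM_I_finite) auto
  have ind: "indicator (Pi\<^sub>E J A) (\<lambda>j\<in>J. f j) = (\<Prod>j\<in>J. indicator (A j) (f j) :: real)" for f
    using J by (auto simp: indicator_def PiE_iff prod_zero_iff extensional_def split: if_splits)
  have "measure ?P (Pi\<^sub>E J A) = (\<integral>x. indicator (Pi\<^sub>E J A) x \<partial>?P)" using E by simp
  also have "\<dots> = (\<integral>\<omega>. (\<Prod>j\<in>J. indicator (A j) (X j \<omega>)) \<partial>M)"
    using E by (subst integral_distr[OF m(1)]) (simp_all add: ind)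
  also have "\<dots> = (\<integral>\<omega>. (\<Prod>j\<in>J. indicator (A j) (X' j \<omega>)) \<partial>M')"
    using prod_cos_integrals_eq[OF M J X eq order_refl A, where t = "\<lambda>_. 0" and \<theta> = 0] by simp
  also have "\<dots> = (\<integral>x. indicator (Pi\<^sub>E J A) x \<partial>?Q)"
    using E by (subst integral_distr[OF m(2)]) (simp_all add: ind)
  also have "\<dots> = measure ?Q (Pi\<^sub>E J A)" using E by simp
  finally show "emeasure ?P (Pi\<^sub>E J A) = emeasure ?Q (Pi\<^sub>E J A)"
    by (simp add: P.emeasure_eq_measure Q.emeasure_eq_measure)
next
  interpret M: prob_space M by fact
  have m: "(\<lambda>\<omega>. \<lambda>j\<in>J. X j \<omega>) \<in> measurable M (\<Pi>\<^sub>M j\<in>J. borel)"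
    by (intro measurable_restrict X; assumption)
  interpret P: prob_space ?P by (rule M.prob_space_distr[OF m])
  show "range (\<lambda>_::nat. \<Pi>\<^sub>E j\<in>J. UNIV) \<subseteq> prod_algebra J (\<lambda>_. borel)"
    using J by (auto intro: prod_algebraI_finite)
  show "(\<Union>i::nat. \<Pi>\<^sub>E j\<in>J. UNIV) = space (\<Pi>\<^sub>M j\<in>J. borel)" by (simp add: space_PiM)
  show "emeasure ?P (\<Pi>\<^sub>E j\<in>J. UNIV) \<noteq> \<infinity>" by simp
qed auto

text \<open>The cosine integrals depend on the process through its Gram matrix alone, also when that
  matrix is singular. All scalar components are treated as one finite family of real
  variables.\<close>

lemma gaussian_same_law:
  fixes g h :: "nat \<Rightarrow> 'm::finite l2"
  assumes g: "gaussian l g" and h: "gaussian l h"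
    and gram: "\<And>i j. i \<in> {1..l} \<Longrightarrow> j \<in> {1..l} \<Longrightarrow> g i \<bullet> g j = h i \<bullet> h j"
  shows "same_law l g h"
proof -
  let ?J = "{1..l} \<times> (UNIV :: 'm set)"
  let ?X = "\<lambda>g p \<omega>. rep (g (fst p) :: 'm l2) \<omega> $ snd p"
  have Xm: "?X g p \<in> borel_measurable gauss" for g p
    unfolding cart_eq_inner_axis borel_measurable_gauss_iff
    by (intro borel_measurable_inner rep_measurable borel_measurable_const)
  \<comment> \<open>Reassembles the scalar components into the padded past.\<close>
  define T where "T = (\<lambda>x :: nat \<times> 'm \<Rightarrow> real. (\<lambda>j. if j \<in> {1..l} then (\<chi> i. x (j, i)) else 0 :: real^'m))"
  have Tm: "T \<in> (\<Pi>\<^sub>M p\<in>?J. borel) \<rightarrow>\<^sub>M borel"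
    unfolding T_def
  proof (rule measurable_coordinatewise_then_product, rule measurable_if_const)
    fix j assume j: "j \<in> {1..l}"
    show "(\<lambda>x. \<chi> i. x (j, i)) \<in> borel_measurable (\<Pi>\<^sub>M p\<in>?J. borel :: real measure)"
    proof (rule borel_measurable_euclidean_space[THEN iffD2], rule ballI)
      fix b :: "real^'m" assume "b \<in> Basis"
      then obtain i where "b = axis i 1" by (auto simp: Basis_vec_def)
      then show "(\<lambda>x. (\<chi> i. x (j, i)) \<bullet> b) \<in> borel_measurable (\<Pi>\<^sub>M p\<in>?J. borel :: real measure)"
        using j by (simp add: inner_axis)
    qed
  qed simp
  have Xr: "(\<lambda>\<omega>. \<lambda>p\<in>?J. ?X g p \<omega>) \<in> gauss \<rightarrow>\<^sub>M (\<Pi>\<^sub>M p\<in>?J. borel)" for g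
    by (intro measurable_restrict Xm)
  have Tp: "past g l = (\<lambda>\<omega>. T (\<lambda>p\<in>?J. ?X g p \<omega>))" for g
    by (auto simp: past_def T_def fun_eq_iff vec_eq_iff)
  have sumJ: "(\<Sum>p\<in>?J. t p * ?X g p \<omega>) = (\<Sum>j\<in>{1..l}. (\<chi> i. t (j, i)) \<bullet> rep (g j) \<omega>)" for t g \<omega>
    by (simp add: inner_vec_def sum.cartesian_product split_beta)
  have "distr gauss (\<Pi>\<^sub>M p\<in>?J. borel) (\<lambda>\<omega>. \<lambda>p\<in>?J. ?X g p \<omega>) = distr gauss (\<Pi>\<^sub>M p\<in>?J. borel) (\<lambda>\<omega>. \<lambda>p\<in>?J. ?X h p \<omega>)"
  proof (rule distr_PiM_eqI[OF gauss.prob_space_axioms gauss.prob_space_axioms _ Xm Xm])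
    fix t \<theta>
    have "quad_form l g c = quad_form l h c" for c
      unfolding quad_form_def using gram by (auto intro!: sum.cong arg_cong2[where f = "(/)"])
    then show "(\<integral>\<omega>. cos ((\<Sum>p\<in>?J. t p * ?X g p \<omega>) + \<theta>) \<partial>gauss) = (\<integral>\<omega>. cos ((\<Sum>p\<in>?J. t p * ?X h p \<omega>) + \<theta>) \<partial>gauss)"
      unfolding sumJ using g h by (simp add: gaussian_def)
  qed simp
  then have "distr (distr gauss (\<Pi>\<^sub>M p\<in>?J. borel) (\<lambda>\<omega>. \<lambda>p\<in>?J. ?X g p \<omega>)) borel T
      = distr (distr gauss (\<Pi>\<^sub>M p\<in>?J. borel) (\<lambda>\<omega>. \<lambda>p\<in>?J. ?X h p \<omega>)) borel T" by simp
  then show ?thesis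
    unfolding same_law_def Tp distr_distr[OF Tm Xr] comp_def .
qed

lemma quad_form_scaleR: "quad_form l g (\<lambda>j. t *\<^sub>R c j) = t\<^sup>2 * quad_form l g c"
  by (simp add: quad_form_def sum_distrib_left power2_eq_square mult_ac)

text \<open>Component by component the form is the squared norm of a linear combination of the
  \<open>g j\<close>. This gives nonnegativity and shows that the form depends only on those
  combinations, not on the family that expresses them.\<close>

lemma quad_form_eq_norm:
  fixes g :: "nat \<Rightarrow> 'm::finite l2"
  shows "quad_form l g d = (\<Sum>i\<in>UNIV. (norm (\<Sum>j\<in>{1..l}. (d j $ i) *\<^sub>R g j))\<^sup>2) / real CARD('m)"
proof -
  have "quad_form l g d * real CARD('m) = (\<Sum>j\<in>{1..l}. \<Sum>k\<in>{1..l}. \<Sum>i\<in>UNIV. (g j \<bullet> g k) * (d j $ i * d k $ i))"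
    by (simp add: quad_form_def inner_vec_def sum_distrib_left)
  also have "\<dots> = (\<Sum>i\<in>UNIV. \<Sum>j\<in>{1..l}. \<Sum>k\<in>{1..l}. (g j \<bullet> g k) * (d j $ i * d k $ i))"
    by (simp add: sum.swap[where B = "UNIV :: 'm set"])
  also have "\<dots> = (\<Sum>i\<in>UNIV. (norm (\<Sum>j\<in>{1..l}. (d j $ i) *\<^sub>R g j))\<^sup>2)"
    by (simp add: power2_norm_eq_inner inner_sum_left inner_sum_right sum_distrib_left inner_commute mult_ac)
  finally show ?thesis by (simp add: field_simps)
qed

lemma quad_form_nonneg: "0 \<le> quad_form l g c"
  unfolding quad_form_eq_norm by (intro divide_nonneg_nonneg sum_nonneg) auto

lemma gaussian_lincomb:
  fixes g h :: "nat \<Rightarrow> 'm::finite l2"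
  assumes g: "gaussian l g" and h: "\<And>j. j \<in> {1..l'} \<Longrightarrow> h j = (\<Sum>i\<in>{1..l}. a j i *\<^sub>R g i)"
  shows "gaussian l' h"
  unfolding gaussian_def
proof (intro allI)
  fix c :: "nat \<Rightarrow> real^'m" and \<theta>
  \<comment> \<open>The coefficient matrix acts on the test vectors by its transpose.\<close>
  define d where "d i = (\<Sum>j\<in>{1..l'}. a j i *\<^sub>R c j)" for i
  have "AE \<omega> in gauss. \<forall>j\<in>{1..l'}. rep (h j) \<omega> = (\<Sum>i\<in>{1..l}. a j i *\<^sub>R rep (g i) \<omega>)"
  proof (rule AE_finite_allI)
    fix j assume "j \<in> {1..l'}"
    with rep_lincomb[where c = "a j" and x = g and I = "{1..l}"] h
    show "AE \<omega> in gauss. rep (h j) \<omega> = (\<Sum>i\<in>{1..l}. a j i *\<^sub>R rep (g i) \<omega>)" by simp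
  qed simp
  then have "(\<integral>\<omega>. cos ((\<Sum>j\<in>{1..l'}. c j \<bullet> rep (h j) \<omega>) + \<theta>) \<partial>gauss) = (\<integral>\<omega>. cos ((\<Sum>i\<in>{1..l}. d i \<bullet> rep (g i) \<omega>) + \<theta>) \<partial>gauss)"
  proof (intro integral_cong_AE, goal_cases)
    case 3
    from 3 show ?case
    proof eventually_elim
      case (elim \<omega>)
      have "(\<Sum>j\<in>{1..l'}. c j \<bullet> rep (h j) \<omega>) = (\<Sum>j\<in>{1..l'}. \<Sum>i\<in>{1..l}. a j i * (c j \<bullet> rep (g i) \<omega>))"
        using elim by (simp add: inner_sum_right)
      also have "\<dots> = (\<Sum>i\<in>{1..l}. d i \<bullet> rep (g i) \<omega>)"
        unfolding d_def by (subst sum.swap) (simp add: inner_sum_left)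
      finally show ?case by simp
    qed
  qed (measurable, measurable)
  also have "\<dots> = cos \<theta> * exp (- quad_form l g d / 2)"
    using g by (simp add: gaussian_def)
  also have "quad_form l g d = quad_form l' h c"
  proof -
    have "(\<Sum>j\<in>{1..l}. (d j $ i) *\<^sub>R g j) = (\<Sum>j\<in>{1..l'}. (c j $ i) *\<^sub>R h j)" for i
    proof -
      have "(\<Sum>j\<in>{1..l'}. (c j $ i) *\<^sub>R h j) = (\<Sum>j\<in>{1..l'}. \<Sum>k\<in>{1..l}. (c j $ i * a j k) *\<^sub>R g k)"
        by (simp add: h scaleR_sum_right)
      also have "\<dots> = (\<Sum>k\<in>{1..l}. (d k $ i) *\<^sub>R g k)"
        by (subst sum.swap) (simp add: d_def scaleR_sum_left mult.commute)
      finally show ?thesis by simp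
    qed
    then show ?thesis unfolding quad_form_eq_norm by simp
  qed
  finally show "(\<integral>\<omega>. cos ((\<Sum>j\<in>{1..l'}. c j \<bullet> rep (h j) \<omega>) + \<theta>) \<partial>gauss) = cos \<theta> * exp (- quad_form l' h c / 2)" .
qed

lemma gaussian_mono: "gaussian l g \<Longrightarrow> l' \<le> l \<Longrightarrow> gaussian l' g"
  by (rule gaussian_lincomb[where a = "\<lambda>j i. of_bool (i = j)"]) (auto simp: of_bool_def if_distrib[of "\<lambda>x. x *\<^sub>R _"] cong: if_cong)

text \<open>The innovation of a Gaussian process is independent of the past: reflecting it preserves the law.\<close>

lemma innovation_orthogonal:
  fixes g :: "nat \<Rightarrow> 'm::finite l2"
  assumes g: "gaussian (Suc l) g" and y: "y = g (Suc l) - (\<Sum>j\<in>{1..l}. t j *\<^sub>R g j)"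
    and orth: "\<And>j. j \<in> {1..l} \<Longrightarrow> y \<bullet> g j = 0" and x: "x \<in> adapted g l"
  shows "y \<bullet> x = 0"
proof -
  define m where "m = (\<Sum>j\<in>{1..l}. t j *\<^sub>R g j)"
  \<comment> \<open>The reflected process: the last entry \<open>m + y\<close> is replaced by
    \<open>m - y\<close>. As \<open>y\<close> is orthogonal to the past, the Gram matrix is
    unchanged.\<close>
  define h where "h = g(Suc l := m - y)"
  have gS: "g (Suc l) = m + y" using y by (simp add: m_def)
  have my: "m - y = (\<Sum>i\<in>{1..Suc l}. (if i = Suc l then - 1 else 2 * t i) *\<^sub>R g i)"
  proof -
    have "(\<Sum>i\<in>{1..l}. (if i = Suc l then - 1 else 2 * t i) *\<^sub>R g i) = (\<Sum>i\<in>{1..l}. 2 *\<^sub>R (t i *\<^sub>R g i))"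
      by (intro sum.cong) auto
    also have "\<dots> = m + m" by (simp only: m_def scaleR_2 sum.distrib)
    finally show ?thesis by (simp add: gS)
  qed
  have "gaussian (Suc l) h"
  proof (rule gaussian_lincomb[OF g])
    fix j assume "j \<in> {1..Suc l}"
    then show "h j = (\<Sum>i\<in>{1..Suc l}. (if j = Suc l then if i = Suc l then - 1 else 2 * t i else of_bool (i = j)) *\<^sub>R g i)"
      using my by (auto simp: h_def of_bool_def if_distrib[of "\<lambda>x. x *\<^sub>R _"] cong: if_cong)
  qed
  have ym: "y \<bullet> m = 0" unfolding m_def using orth by (simp add: inner_sum_right)
  have law: "same_law (Suc l) g h"
  proof (rule gaussian_same_law[OF g \<open>gaussian (Suc l) h\<close>])
    fix i j assume "i \<in> {1..Suc l}" "j \<in> {1..Suc l}"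
    then show "g i \<bullet> g j = h i \<bullet> h j"
      using orth ym by (cases "i = Suc l"; cases "j = Suc l")
        (auto simp: h_def gS inner_add_left inner_add_right inner_diff_left inner_diff_right inner_commute)
  qed
  from x have "coupled l g h x x"
    unfolding adapted_def coupled_def mem_Collect_eq
    by (auto simp: past_def h_def cong: if_cong)
  then have cx: "coupled (Suc l) g h x x" by (rule coupled_mono) simp
  have "coupled (Suc l) g h (g (Suc l) - (\<Sum>j\<in>{1..l}. t j *\<^sub>R g j)) (h (Suc l) - (\<Sum>j\<in>{1..l}. t j *\<^sub>R h j))"
    by (intro coupled_diff coupled_lincomb coupled_base) auto
  moreover have "(\<Sum>j\<in>{1..l}. t j *\<^sub>R h j) = m" by (simp add: h_def m_def)
  \<comment> \<open>The reflection sends \<open>y\<close> to \<open>- y\<close> and fixes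
    \<open>x\<close>, so equality of inner products reads
    \<open>y \<bullet> x = - (y \<bullet> x)\<close>.\<close>
  ultimately have "coupled (Suc l) g h y (- y)" by (simp add: y m_def[symmetric] h_def)
  from coupled_inner[OF law this cx] show ?thesis by simp
qed

section \<open>Cosine integrals and moments of one-dimensional normal variables\<close>

lemma integral_cos_std_normal:
  "(\<integral>x. cos (a * x + \<theta>) \<partial>std_normal_distribution) = cos \<theta> * exp (- a\<^sup>2 / 2)"
proof -
  interpret N: real_distribution std_normal_distribution
    by (rule real_dist_normal_dist)
  have i: "integrable std_normal_distribution (\<lambda>x. iexp (a * x))"
    by (rule N.integrable_iexp) auto
  have "(CLINT x|std_normal_distribution. iexp (a * x)) = complex_of_real (exp (- a\<^sup>2 / 2))"
    using fun_cong[OF char_std_normal_distribution, of a] by (simp add: char_def)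
  then have "(\<integral>x. cos (a * x) \<partial>std_normal_distribution) = exp (- a\<^sup>2 / 2)" "(\<integral>x. sin (a * x) \<partial>std_normal_distribution) = 0"
    using integral_Re[OF i] integral_Im[OF i] by (simp_all add: Re_exp Im_exp)
  moreover have "integrable std_normal_distribution (\<lambda>x. cos (a * x))" "integrable std_normal_distribution (\<lambda>x. sin (a * x))"
    by (auto intro!: N.integrable_const_bound[of _ 1])
  ultimately show ?thesis
    by (simp add: cos_add)
qed

text \<open>The comparison with a rescaled standard normal variable, rather than with a density,
  includes the degenerate variance \<open>s = 0\<close>.\<close>

lemma distr_eq_normal:
  assumes M: "prob_space M" and [measurable]: "Y \<in> borel_measurable M" and s: "0 \<le> s"
    and Y: "\<And>t \<theta>. (\<integral>\<omega>. cos (t * Y \<omega> + \<theta>) \<partial>M) = cos \<theta> * exp (- t\<^sup>2 * s / 2)"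
  shows "distr M borel Y = distr std_normal_distribution borel (\<lambda>x. sqrt s * x)" (is "?P = ?Q")
proof (rule measure_eqI)
  interpret M: prob_space M by fact
  interpret N: real_distribution std_normal_distribution
    by (rule real_dist_normal_dist)
  have Pm: "Y \<in> M \<rightarrow>\<^sub>M borel" "(\<lambda>x. sqrt s * x) \<in> std_normal_distribution \<rightarrow>\<^sub>M borel" by measurable
  interpret P: prob_space ?P by (rule M.prob_space_distr) measurable
  interpret Q: prob_space ?Q by (rule N.prob_space_distr) measurable
  fix B assume "B \<in> sets (distr M borel Y)"
  then have [measurable]: "B \<in> sets borel" by simp
  have "(\<integral>\<omega>. 1 * indicator B (Y \<omega>) \<partial>M) = (\<integral>x. 1 * indicator B (sqrt s * x) \<partial>std_normal_distribution :: real)"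
  proof (rule distr_eq_of_cos_integrals[OF M N.prob_space_axioms, where K = 1])
    fix t \<theta>
    show "(\<integral>\<omega>. 1 * cos (t * Y \<omega> + \<theta>) \<partial>M) = (\<integral>x. 1 * cos (t * (sqrt s * x) + \<theta>) \<partial>std_normal_distribution)"
      using s by (simp add: Y mult.assoc[symmetric] integral_cos_std_normal power_mult_distrib)
  qed auto
  moreover have "measure ?P B = (\<integral>\<omega>. indicator B (Y \<omega>) \<partial>M)"
    using integral_distr[OF Pm(1), of "indicator B :: real \<Rightarrow> real"] by simp
  moreover have "measure ?Q B = (\<integral>x. indicator B (sqrt s * x) \<partial>std_normal_distribution)"
    using integral_distr[OF Pm(2), of "indicator B :: real \<Rightarrow> real"] by simp
  ultimately show "emeasure ?P B = emeasure ?Q B"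
    by (simp add: P.emeasure_eq_measure Q.emeasure_eq_measure)
qed simp

lemma normal_moments:
  assumes M: "prob_space M" and [measurable]: "Y \<in> borel_measurable M" and s: "0 \<le> s"
    and Y: "\<And>t \<theta>. (\<integral>\<omega>. cos (t * Y \<omega> + \<theta>) \<partial>M) = cos \<theta> * exp (- t\<^sup>2 * s / 2)"
  shows "normal_rv M Y" "integrable M (\<lambda>\<omega>. (Y \<omega>)\<^sup>2)" "(\<integral>\<omega>. Y \<omega> \<partial>M) = 0" "(\<integral>\<omega>. (Y \<omega>)\<^sup>2 \<partial>M) = s"
proof -
  interpret M: prob_space M by fact
  have Pm: "Y \<in> M \<rightarrow>\<^sub>M borel" "(\<lambda>x. sqrt s * x) \<in> std_normal_distribution \<rightarrow>\<^sub>M borel" by measurable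
  have D: "distr M borel Y = distr std_normal_distribution borel (\<lambda>x. sqrt s * x)"
    by (rule distr_eq_normal[OF M _ s Y]) measurable
  have "integrable std_normal_distribution (\<lambda>x. (sqrt s * x)\<^sup>2)"
    using integrable_std_normal_distribution_moment[of 2] by (simp add: power_mult_distrib)
  then have "integrable (distr std_normal_distribution borel (\<lambda>x. sqrt s * x)) (\<lambda>x. x\<^sup>2)"
    by (subst integrable_distr_eq[OF Pm(2)]) auto
  then show "integrable M (\<lambda>\<omega>. (Y \<omega>)\<^sup>2)"
    unfolding D[symmetric] by (subst (asm) integrable_distr_eq[OF Pm(1)]) auto
  have "(\<integral>\<omega>. Y \<omega> \<partial>M) = (\<integral>x. x \<partial>distr M borel Y)" by (subst integral_distr[OF Pm(1)]) auto
  also have "\<dots> = sqrt s * (\<integral>x. x \<partial>std_normal_distribution)" unfolding D by (subst integral_distr[OF Pm(2)]) auto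
  also have "\<dots> = 0" using integral_std_normal_distribution_moment_odd[of 1] by simp
  finally show "(\<integral>\<omega>. Y \<omega> \<partial>M) = 0" .
  have "(\<integral>\<omega>. (Y \<omega>)\<^sup>2 \<partial>M) = (\<integral>x. x\<^sup>2 \<partial>distr M borel Y)" by (subst integral_distr[OF Pm(1)]) auto
  also have "\<dots> = s * (\<integral>x. x\<^sup>2 \<partial>std_normal_distribution)" unfolding D
    using s by (subst integral_distr[OF Pm(2)]) (auto simp: power_mult_distrib)
  also have "\<dots> = s" using std_normal_distribution_even_moments(1)[of 1] by (simp add: fact_numeral)
  finally show "(\<integral>\<omega>. (Y \<omega>)\<^sup>2 \<partial>M) = s" .
  show "normal_rv M Y"
  proof (cases "s = 0")
    case True
    have "AE x in distr M borel Y. x = 0"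
      unfolding D using True by (subst AE_distr_iff) auto
    then have "AE \<omega> in M. Y \<omega> = 0" by (subst (asm) AE_distr_iff) auto
    then show ?thesis unfolding normal_rv_def by auto
  next
    case False
    then have s0: "0 < sqrt s" using s by simp
    have "distr M borel (\<lambda>\<omega>. (Y \<omega> - 0) / sqrt s) = distr (distr M borel Y) borel (\<lambda>x. x / sqrt s)"
      by (subst distr_distr) (auto simp: comp_def)
    also have "\<dots> = distr std_normal_distribution borel (\<lambda>x. x)"
      unfolding D using s0 by (subst distr_distr) (auto simp: comp_def)
    also have "\<dots> = density lborel std_normal_density"
      by (rule distr_id2) simp
    finally have "distr M lborel (\<lambda>\<omega>. (Y \<omega> - 0) / sqrt s) = density lborel std_normal_density"
      by (simp cong: distr_cong)
    then have "distributed M lborel (\<lambda>\<omega>. (Y \<omega> - 0) / sqrt s) std_normal_density"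
      unfolding distributed_def by auto
    then have "distributed M lborel Y (normal_density 0 (sqrt s))"
      using M.normal_standard_normal_convert[OF s0, of Y 0] by simp
    then show ?thesis unfolding normal_rv_def using s0 by blast
  qed
qed

lemma normal_rv_cos:
  assumes M: "prob_space M" and Y: "normal_rv M Y" and m: "(\<integral>\<omega>. Y \<omega> \<partial>M) = 0" "(\<integral>\<omega>. (Y \<omega>)\<^sup>2 \<partial>M) = s"
  shows "(\<integral>\<omega>. cos (Y \<omega> + \<theta>) \<partial>M) = cos \<theta> * exp (- s / 2)"
proof -
  interpret M: prob_space M by fact
  from Y consider (normal) \<mu> \<sigma> where "0 < \<sigma>" "distributed M lborel Y (normal_density \<mu> \<sigma>)"
    | (const) c where "Y \<in> borel_measurable M" "AE \<omega> in M. Y \<omega> = c"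
    unfolding normal_rv_def by blast
  then show ?thesis
  proof cases
    case normal
    have "\<mu> = 0" using M.normal_distributed_expectation[OF normal] m by simp
    moreover have "s = \<sigma>\<^sup>2" using M.normal_distributed_variance[OF normal] m by simp
    ultimately have d: "distributed M lborel (\<lambda>\<omega>. (Y \<omega> - 0) / \<sigma>) std_normal_density" and s: "s = \<sigma>\<^sup>2"
      using normal M.normal_standard_normal_convert[OF normal(1), of Y 0] by auto
    have Ym: "(\<lambda>\<omega>. (Y \<omega> - 0) / \<sigma>) \<in> M \<rightarrow>\<^sub>M lborel" using d by (auto simp: distributed_def)
    have "(\<integral>\<omega>. cos (Y \<omega> + \<theta>) \<partial>M) = (\<integral>\<omega>. cos (\<sigma> * ((Y \<omega> - 0) / \<sigma>) + \<theta>) \<partial>M)"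
      using normal(1) by simp
    also have "\<dots> = (\<integral>x. cos (\<sigma> * x + \<theta>) \<partial>distr M lborel (\<lambda>\<omega>. (Y \<omega> - 0) / \<sigma>))"
      by (rule integral_distr[OF Ym, symmetric]) measurable
    also have "distr M lborel (\<lambda>\<omega>. (Y \<omega> - 0) / \<sigma>) = density lborel std_normal_density"
      using d by (auto simp: distributed_def)
    finally show ?thesis by (simp add: integral_cos_std_normal s)
  next
    case const
    have "(\<integral>\<omega>. Y \<omega> \<partial>M) = c"
      using integral_cong_AE[of Y M "\<lambda>_. c"] const M.prob_space by simp
    with m const have Y0: "AE \<omega> in M. Y \<omega> = 0" by simp
    have "(\<integral>\<omega>. (Y \<omega>)\<^sup>2 \<partial>M) = 0"
    proof (intro integral_eq_zero_AE)
      show "AE \<omega> in M. (Y \<omega>)\<^sup>2 = 0" using Y0 by eventually_elim simp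
    qed
    with m have "s = 0" by simp
    moreover have "(\<integral>\<omega>. cos (Y \<omega> + \<theta>) \<partial>M) = (\<integral>\<omega>. cos \<theta> \<partial>M)"
    proof (rule integral_cong_AE)
      note const(1)[measurable]
      show "(\<lambda>\<omega>. cos (Y \<omega> + \<theta>)) \<in> borel_measurable M" by measurable
      show "AE \<omega> in M. cos (Y \<omega> + \<theta>) = cos \<theta>" using Y0 by eventually_elim simp
    qed simp
    ultimately show ?thesis using M.prob_space by simp
  qed
qed

section \<open>The coordinate process on the infinite Gaussian product space\<close>

lemma char_std_gaussian:
  "(CLINT x|std_gaussian. iexp (c \<bullet> x)) = exp (- (norm c)\<^sup>2 / 2)" for c :: "real^'m"
proof -
  let ?N = "density lborel std_normal_density"
  interpret N: real_distribution ?N by (rule real_dist_normal_dist)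
  interpret P: product_prob_space "\<lambda>_ :: 'm. ?N" UNIV by unfold_locales
  have m: "(\<lambda>x. \<chi> i. x i) \<in> borel_measurable (\<Pi>\<^sub>M i\<in>(UNIV :: 'm set). ?N)"
  proof (rule borel_measurable_euclidean_space[THEN iffD2], rule ballI)
    fix b :: "real^'m" assume "b \<in> Basis"
    then obtain i where "b = axis i 1" by (auto simp: Basis_vec_def)
    then show "(\<lambda>x. (\<chi> i. x i) \<bullet> b) \<in> borel_measurable (\<Pi>\<^sub>M i\<in>(UNIV :: 'm set). ?N)"
      by (simp add: inner_axis)
  qed
  have "(CLINT x|std_gaussian. iexp (c \<bullet> x)) = (CLINT x|(\<Pi>\<^sub>M i\<in>(UNIV :: 'm set). ?N). iexp (c \<bullet> (\<chi> i. x i)))"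
    unfolding std_gaussian_def by (rule integral_distr[OF m]) measurable
  also have "\<dots> = (CLINT x|(\<Pi>\<^sub>M i\<in>(UNIV :: 'm set). ?N). (\<Prod>i\<in>UNIV. iexp (c $ i * x i)))"
    by (intro Bochner_Integration.integral_cong refl) (simp add: inner_vec_def sum_distrib_left exp_sum)
  also have "\<dots> = (\<Prod>i\<in>UNIV. (CLINT x|?N. iexp (c $ i * x)))"
    by (rule P.product_integral_prod) (auto intro!: N.integrable_iexp)
  also have "\<dots> = (\<Prod>i\<in>UNIV. complex_of_real (exp (- (c $ i)\<^sup>2 / 2)))"
    using fun_cong[OF char_std_normal_distribution] by (simp add: char_def)
  also have "\<dots> = complex_of_real (exp (\<Sum>i\<in>UNIV. - (c $ i)\<^sup>2 / 2))"
    by (simp add: exp_sum)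
  also have "(\<Sum>i\<in>UNIV. - (c $ i)\<^sup>2 / 2) = - (norm c)\<^sup>2 / 2"
    by (simp add: norm_vec_def L2_set_def sum_nonneg sum_negf sum_divide_distrib[symmetric])
  finally show ?thesis by simp
qed

text \<open>The finite product is a marginal of the infinite one. Random vectors on
  \<open>gaussian_space k\<close> are pulled back along this restriction, and all \<open>k\<close>
  share one Hilbert space.\<close>

lemma gaussian_space_eq_distr:
  "gaussian_space k = distr gauss (gaussian_space k) (\<lambda>\<omega>. restrict \<omega> {1..k})"
proof -
  interpret S: prob_space "std_gaussian :: (real^'a) measure" by (rule prob_space_std_gaussian)
  interpret P: product_prob_space "\<lambda>_ :: nat. std_gaussian :: (real^'a) measure" UNIV by unfold_locales
  show ?thesis
    unfolding gaussian_space_def gauss_def using P.distr_PiM_restrict_finite[of "{1..k}"] by simp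
qed

lemma restrict_measurable [measurable]: "(\<lambda>\<omega>. restrict \<omega> {1..k}) \<in> gauss \<rightarrow>\<^sub>M gaussian_space k"
  unfolding gaussian_space_def gauss_def by measurable

lemma char_gauss:
  "(CLINT \<omega>|gauss. iexp (\<Sum>j\<in>{1..l}. c j \<bullet> \<omega> j)) = exp (- (\<Sum>j\<in>{1..l}. (norm (c j))\<^sup>2) / 2)"
  for c :: "nat \<Rightarrow> real^'m"
proof -
  interpret S: prob_space "std_gaussian :: (real^'m) measure" by (rule prob_space_std_gaussian)
  interpret P: product_prob_space "\<lambda>_ :: nat. std_gaussian :: (real^'m) measure" "{1..l}" by unfold_locales
  have m: "(\<lambda>x. iexp (a \<bullet> x)) \<in> borel_measurable borel" for a :: "real^'m"
    by measurable
  have "(CLINT \<omega>|gauss. iexp (\<Sum>j\<in>{1..l}. c j \<bullet> \<omega> j)) = (CLINT \<omega>|gauss. (\<Prod>j\<in>{1..l}. iexp (c j \<bullet> restrict \<omega> {1..l} j)))"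
    by (intro Bochner_Integration.integral_cong refl) (simp add: sum_distrib_left exp_sum)
  also have "\<dots> = (CLINT \<omega>|gaussian_space l. (\<Prod>j\<in>{1..l}. iexp (c j \<bullet> \<omega> j)))"
  proof -
    have "(CLINT \<omega>|gaussian_space l. (\<Prod>j\<in>{1..l}. iexp (c j \<bullet> \<omega> j))) =
        (CLINT \<omega>|distr gauss (gaussian_space l) (\<lambda>\<omega>. restrict \<omega> {1..l}). (\<Prod>j\<in>{1..l}. iexp (c j \<bullet> \<omega> j)))"
      by (simp only: gaussian_space_eq_distr[symmetric])
    also have "\<dots> = (CLINT \<omega>|gauss. (\<Prod>j\<in>{1..l}. iexp (c j \<bullet> restrict \<omega> {1..l} j)))"
    proof (rule integral_distr[OF restrict_measurable])
      have cm: "(\<lambda>\<omega>. \<omega> j) \<in> borel_measurable (gaussian_space l :: (nat \<Rightarrow> real^'m) measure)" if "j \<in> {1..l}" for j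
        using measurable_component_singleton[OF that, of "\<lambda>_. std_gaussian :: (real^'m) measure"]
        unfolding gaussian_space_def measurable_cong_sets[OF refl sets_std_gaussian] .
      show "(\<lambda>\<omega>. \<Prod>j\<in>{1..l}. iexp (c j \<bullet> \<omega> j)) \<in> borel_measurable (gaussian_space l)"
        by (intro borel_measurable_prod measurable_compose[OF cm m])
    qed
    finally show ?thesis by (rule sym)
  qed
  also have "\<dots> = (\<Prod>j\<in>{1..l}. (CLINT x|std_gaussian. iexp (c j \<bullet> x)))"
    unfolding gaussian_space_def
  proof (rule P.product_integral_prod)
    fix j show "integrable std_gaussian (\<lambda>x. iexp (c j \<bullet> x))"
      by (rule S.integrable_const_bound[of _ 1]) (simp_all add: m measurable_cong_sets[OF sets_std_gaussian refl])
  qed simp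
  also have "\<dots> = exp (\<Sum>j\<in>{1..l}. - (norm (c j))\<^sup>2 / 2)"
    unfolding char_std_gaussian by (simp add: exp_sum of_real_exp[symmetric])
  also have "(\<Sum>j\<in>{1..l}. - (norm (c j))\<^sup>2 / 2) = - (\<Sum>j\<in>{1..l}. (norm (c j))\<^sup>2) / 2"
    by (simp add: sum_negf sum_divide_distrib[symmetric])
  finally show ?thesis by simp
qed

lemma cos_gauss:
  "(\<integral>\<omega>. cos ((\<Sum>j\<in>{1..l}. c j \<bullet> \<omega> j) + \<theta>) \<partial>gauss) = cos \<theta> * exp (- (\<Sum>j\<in>{1..l}. (norm (c j))\<^sup>2) / 2)"
  for c :: "nat \<Rightarrow> real^'m"
proof -
  have Ym [measurable]: "(\<lambda>\<omega>. \<Sum>j\<in>{1..l}. c j \<bullet> \<omega> j) \<in> borel_measurable (gauss :: (nat \<Rightarrow> real^'m) measure)"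
    unfolding borel_measurable_gauss_iff by measurable
  have i: "integrable gauss (\<lambda>\<omega>. iexp (\<Sum>j\<in>{1..l}. c j \<bullet> \<omega> j))"
    by (rule gauss.integrable_const_bound[of _ 1]) (auto simp: borel_measurable_gauss_iff)
  have "(\<integral>\<omega>. cos (\<Sum>j\<in>{1..l}. c j \<bullet> \<omega> j) \<partial>gauss) = exp (- (\<Sum>j\<in>{1..l}. (norm (c j))\<^sup>2) / 2)"
    "(\<integral>\<omega>. sin (\<Sum>j\<in>{1..l}. c j \<bullet> \<omega> j) \<partial>gauss) = 0"
    using integral_Re[OF i] integral_Im[OF i] unfolding char_gauss by (simp_all add: Re_exp Im_exp)
  moreover have "integrable gauss (\<lambda>\<omega>. cos (\<Sum>j\<in>{1..l}. c j \<bullet> \<omega> j))" "integrable gauss (\<lambda>\<omega>. sin (\<Sum>j\<in>{1..l}. c j \<bullet> \<omega> j))"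
    by (rule gauss.integrable_const_bound[of _ 1]; (measurable | simp))+
  ultimately show ?thesis by (simp add: cos_add)
qed

lemma coordinate_moments:
  fixes c d :: "real^'m"
  shows "1 \<le> j \<Longrightarrow> integrable gauss (\<lambda>\<omega>. (norm (\<omega> j :: real^'m))\<^sup>2)"
    and "1 \<le> i \<Longrightarrow> 1 \<le> j \<Longrightarrow> (\<integral>\<omega>. (c \<bullet> \<omega> i) * (d \<bullet> \<omega> j) \<partial>gauss) = (if i = j then c \<bullet> d else 0)"
proof -
  \<comment> \<open>Scaling \<open>c\<close> by \<open>t\<close> produces the one-parameter family
    of cosine integrals from which the second moment is recovered.\<close>
  have key: "integrable gauss (\<lambda>\<omega>. (\<Sum>j\<in>{1..l}. c j \<bullet> \<omega> j)\<^sup>2) \<and> (\<integral>\<omega>. (\<Sum>j\<in>{1..l}. c j \<bullet> \<omega> j)\<^sup>2 \<partial>gauss) = (\<Sum>j\<in>{1..l}. (norm (c j))\<^sup>2)"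
    for l and c :: "nat \<Rightarrow> real^'m"
  proof -
    have "(\<integral>\<omega>. cos (t * (\<Sum>j\<in>{1..l}. c j \<bullet> \<omega> j) + \<theta>) \<partial>gauss) = cos \<theta> * exp (- t\<^sup>2 * (\<Sum>j\<in>{1..l}. (norm (c j))\<^sup>2) / 2)" for t \<theta>
      using cos_gauss[of "\<lambda>j. t *\<^sub>R c j" l \<theta>] by (simp add: sum_distrib_left power_mult_distrib sum_negf)
    note * = normal_moments[OF gauss.prob_space_axioms _ sum_nonneg this]
    show ?thesis by (intro conjI *) (auto simp: borel_measurable_gauss_iff)
  qed
  have single: "(\<Sum>k\<in>{1..l}. (if k = j then c else 0) \<bullet> \<omega> k) = c \<bullet> \<omega> j" if "1 \<le> j" "j \<le> l" for j l and c :: "real^'m" and \<omega> :: "nat \<Rightarrow> real^'m"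
    using that by (simp add: if_distrib[of "\<lambda>x. x \<bullet> _"] cong: if_cong)
  have sq: "integrable gauss (\<lambda>\<omega>. (c \<bullet> \<omega> j)\<^sup>2)" if "1 \<le> j" for j and c :: "real^'m"
    using key[where l = j and c = "\<lambda>k. if k = j then c else 0"] that by (simp only: single order_refl)
  show "integrable gauss (\<lambda>\<omega>. (norm (\<omega> j :: real^'m))\<^sup>2)" if "1 \<le> j"
  proof -
    have "(norm x)\<^sup>2 = (\<Sum>i\<in>UNIV. (axis i 1 \<bullet> x)\<^sup>2)" for x :: "real^'m"
      by (simp add: inner_axis' norm_vec_def L2_set_def sum_nonneg)
    then show ?thesis using sq[OF that] by simp
  qed
  assume ij: "1 \<le> i" "1 \<le> j"
  define l where "l = max i j"
  \<comment> \<open>Test vectors for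
    \<open>c \<bullet> \<omega> i + s * (d \<bullet> \<omega> j)\<close>; the signs
    \<open>s = 1\<close> and \<open>s = -1\<close> give the mixed moment by polarisation, with
    \<open>i = j\<close> included.\<close>
  define e where "e s k = (if k = i then c else 0) + s *\<^sub>R (if k = j then d else 0)" for s :: real and k
  have e: "(\<Sum>k\<in>{1..l}. e s k \<bullet> \<omega> k) = c \<bullet> \<omega> i + s * (d \<bullet> \<omega> j)" for s and \<omega> :: "nat \<Rightarrow> real^'m"
    using ij single[of i l c \<omega>] single[of j l d \<omega>]
    by (simp add: e_def l_def inner_add_left sum.distrib sum_distrib_left[symmetric])
  have e2: "(\<Sum>k\<in>{1..l}. (norm (e 1 k))\<^sup>2) - (\<Sum>k\<in>{1..l}. (norm (e (-1) k))\<^sup>2) = 4 * (if i = j then c \<bullet> d else 0)"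
  proof -
    have "(norm (e 1 k))\<^sup>2 - (norm (e (-1) k))\<^sup>2 = (if k = i then (if i = j then 4 * (c \<bullet> d) else 0) else 0)" for k
      by (simp add: e_def power2_norm_eq_inner inner_add_left inner_add_right inner_diff_left inner_diff_right inner_commute)
    then show ?thesis using ij by (simp add: sum_subtractf[symmetric] l_def)
  qed
  have "4 * (\<integral>\<omega>. (c \<bullet> \<omega> i) * (d \<bullet> \<omega> j) \<partial>gauss) = (\<integral>\<omega>. (c \<bullet> \<omega> i + 1 * (d \<bullet> \<omega> j))\<^sup>2 - (c \<bullet> \<omega> i + (-1) * (d \<bullet> \<omega> j))\<^sup>2 \<partial>gauss)"
    unfolding integral_mult_right_zero[symmetric]
    by (intro Bochner_Integration.integral_cong refl) (simp add: power2_eq_square algebra_simps)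
  also have "\<dots> = (\<Sum>k\<in>{1..l}. (norm (e 1 k))\<^sup>2) - (\<Sum>k\<in>{1..l}. (norm (e (-1) k))\<^sup>2)"
    using key[where l = l and c = "e 1"] key[where l = l and c = "e (-1)"] unfolding e
    by (subst Bochner_Integration.integral_diff) auto
  finally show "(\<integral>\<omega>. (c \<bullet> \<omega> i) * (d \<bullet> \<omega> j) \<partial>gauss) = (if i = j then c \<bullet> d else 0)"
    unfolding e2 by simp
qed

text \<open>The normalisation makes the coordinates orthonormal, since a standard Gaussian vector
  has expected squared norm equal to its dimension.\<close>

definition coord :: "nat \<Rightarrow> 'm::finite l2" where
  "coord j = cl (\<lambda>\<omega>. (1 / sqrt (real CARD('m))) *\<^sub>R \<omega> j)"

lemma rep_coord:
  assumes "1 \<le> j"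
  shows "AE \<omega> in gauss. rep (coord j :: 'm::finite l2) \<omega> = (1 / sqrt (real CARD('m))) *\<^sub>R \<omega> j"
proof -
  have "L2 (\<lambda>\<omega>. \<omega> j :: real^'m)" using coordinate_moments(1)[OF assms] by (simp add: L2_def)
  then show ?thesis unfolding coord_def by (intro rep_cl L2_scaleR)
qed

lemma inner_coord:
  assumes "1 \<le> i" "1 \<le> j"
  shows "coord i \<bullet> (coord j :: 'm::finite l2) = of_bool (i = j)"
proof -
  let ?m = "real CARD('m)"
  have ax: "(\<Sum>a\<in>UNIV. (axis a 1 \<bullet> x) * (axis a 1 \<bullet> y)) = x \<bullet> y" for x y :: "real^'m"
    by (simp add: inner_axis') (simp add: inner_vec_def)
  have "coord i \<bullet> (coord j :: 'm l2) = (\<integral>\<omega>. (\<Sum>a\<in>UNIV. (axis a 1 \<bullet> \<omega> i) * (axis a 1 \<bullet> (\<omega> j :: real^'m))) / ?m \<partial>gauss)"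
    unfolding inner_l2_def
  proof (rule integral_cong_AE)
    show "AE \<omega> in gauss. rep (coord i) \<omega> \<bullet> rep (coord j :: 'm l2) \<omega> = (\<Sum>a\<in>UNIV. (axis a 1 \<bullet> \<omega> i) * (axis a 1 \<bullet> \<omega> j)) / ?m"
      using rep_coord[OF assms(1), where 'm = 'm] rep_coord[OF assms(2), where 'm = 'm]
      by eventually_elim (simp add: ax)
  qed (auto simp: borel_measurable_gauss_iff)
  also have "\<dots> = (\<Sum>a\<in>UNIV. (\<integral>\<omega>. (axis a 1 \<bullet> \<omega> i) * (axis a 1 \<bullet> (\<omega> j :: real^'m)) \<partial>gauss)) / ?m"
  proof -
    have "integrable gauss (\<lambda>\<omega>. (axis a 1 \<bullet> \<omega> i) * (axis a 1 \<bullet> (\<omega> j :: real^'m)))" for a :: 'm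
    proof (rule Bochner_Integration.integrable_bound)
      show "integrable gauss (\<lambda>\<omega>. (norm (\<omega> i :: real^'m))\<^sup>2 + (norm (\<omega> j :: real^'m))\<^sup>2)"
        by (intro Bochner_Integration.integrable_add coordinate_moments(1) assms)
      have "\<bar>x $ a * y $ a\<bar> \<le> (norm x)\<^sup>2 + (norm y)\<^sup>2" for x y :: "real^'m"
      proof -
        have "\<bar>x $ a * y $ a\<bar> \<le> norm x * norm y"
          unfolding abs_mult by (intro mult_mono component_le_norm_cart) auto
        moreover have "2 * norm x * norm y \<le> (norm x)\<^sup>2 + (norm y)\<^sup>2" by (rule sum_squares_bound)
        moreover have "0 \<le> norm x * norm y" by simp
        ultimately show ?thesis by linarith
      qed
      then show "AE \<omega> in gauss. norm ((axis a 1 \<bullet> \<omega> i) * (axis a 1 \<bullet> (\<omega> j :: real^'m))) \<le> norm ((norm (\<omega> i))\<^sup>2 + (norm (\<omega> j))\<^sup>2)"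
        by (auto simp: inner_axis')
    qed (auto simp: borel_measurable_gauss_iff)
    then show ?thesis by simp
  qed
  also have "\<dots> = of_bool (i = j)"
    by (simp add: coordinate_moments(2)[OF assms] inner_axis)
  finally show ?thesis .
qed

lemma gaussian_coord: "gaussian l (coord :: nat \<Rightarrow> 'm::finite l2)"
  unfolding gaussian_def
proof (intro allI)
  fix c :: "nat \<Rightarrow> real^'m" and \<theta>
  let ?s = "1 / sqrt (real CARD('m))"
  have "AE \<omega> in gauss. \<forall>j\<in>{1..l}. rep (coord j :: 'm l2) \<omega> = ?s *\<^sub>R \<omega> j"
    by (rule AE_finite_allI) (auto intro: rep_coord)
  then have "(\<integral>\<omega>. cos ((\<Sum>j\<in>{1..l}. c j \<bullet> rep (coord j) \<omega>) + \<theta>) \<partial>gauss) = (\<integral>\<omega>. cos ((\<Sum>j\<in>{1..l}. (?s *\<^sub>R c j) \<bullet> \<omega> j) + \<theta>) \<partial>gauss)"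
    by (intro integral_cong_AE) (auto simp: borel_measurable_gauss_iff elim!: eventually_mono)
  also have "\<dots> = cos \<theta> * exp (- (\<Sum>j\<in>{1..l}. (norm (?s *\<^sub>R c j))\<^sup>2) / 2)"
    by (rule cos_gauss)
  also have "(\<Sum>j\<in>{1..l}. (norm (?s *\<^sub>R c j))\<^sup>2) = quad_form l coord c"
  proof -
    have "(\<Sum>i\<in>{1..l}. \<Sum>j\<in>{1..l}. (coord i \<bullet> (coord j :: 'm l2)) * (c i \<bullet> c j)) = (\<Sum>i\<in>{1..l}. \<Sum>j\<in>{1..l}. (if i = j then c i \<bullet> c j else 0))"
      by (intro sum.cong refl) (auto simp: inner_coord)
    then show ?thesis
      by (simp add: quad_form_def power_divide power2_norm_eq_inner sum_divide_distrib)
  qed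
  finally show "(\<integral>\<omega>. cos ((\<Sum>j\<in>{1..l}. c j \<bullet> rep (coord j) \<omega>) + \<theta>) \<partial>gauss) = cos \<theta> * exp (- quad_form l coord c / 2)" .
qed

section \<open>The state evolution equations in the Hilbert space of random vectors\<close>

text \<open>On square-integrable random vectors this is an isometric embedding into the common
  Hilbert space.\<close>

definition emb :: "nat \<Rightarrow> ((nat \<Rightarrow> real^'m) \<Rightarrow> real^'m) \<Rightarrow> 'm::finite l2" where
  "emb k X = cl (\<lambda>\<omega>. X (restrict \<omega> {1..k}))"

interpretation gaussian_space: prob_space "gaussian_space k"
  by (rule prob_space_gaussian_space)

lemma AE_gaussian_space_iff:
  fixes f g :: "(nat \<Rightarrow> real^'m) \<Rightarrow> real^'m"
  assumes [measurable]: "f \<in> borel_measurable (gaussian_space k)" "g \<in> borel_measurable (gaussian_space k)"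
  shows "(AE \<omega> in gaussian_space k. f \<omega> = g \<omega>) \<longleftrightarrow> (AE \<omega> in gauss. f (restrict \<omega> {1..k}) = g (restrict \<omega> {1..k}))"
proof -
  have "(AE \<omega> in gaussian_space k. f \<omega> = g \<omega>) \<longleftrightarrow>
      (AE \<omega> in distr gauss (gaussian_space k) (\<lambda>\<omega>. restrict \<omega> {1..k}). f \<omega> = g \<omega>)"
    by (simp only: gaussian_space_eq_distr[symmetric])
  also have "\<dots> \<longleftrightarrow> (AE \<omega> in gauss. f (restrict \<omega> {1..k}) = g (restrict \<omega> {1..k}))"
    by (rule AE_distr_iff[OF restrict_measurable]) measurable
  finally show ?thesis .
qed

lemma integral_gaussian_space:
  fixes f :: "(nat \<Rightarrow> real^'m) \<Rightarrow> real"
  assumes "f \<in> borel_measurable (gaussian_space k)"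
  shows "(\<integral>\<omega>. f \<omega> \<partial>gaussian_space k) = (\<integral>\<omega>. f (restrict \<omega> {1..k}) \<partial>gauss)"
    and "integrable (gaussian_space k) f \<longleftrightarrow> integrable gauss (\<lambda>\<omega>. f (restrict \<omega> {1..k}))"
proof -
  show "(\<integral>\<omega>. f \<omega> \<partial>gaussian_space k) = (\<integral>\<omega>. f (restrict \<omega> {1..k}) \<partial>gauss)"
    using integral_distr[OF restrict_measurable assms] by (simp only: gaussian_space_eq_distr[symmetric])
  show "integrable (gaussian_space k) f \<longleftrightarrow> integrable gauss (\<lambda>\<omega>. f (restrict \<omega> {1..k}))"
    using integrable_distr_eq[OF restrict_measurable assms] by (simp only: gaussian_space_eq_distr[symmetric])
qed

lemma square_integrable_L2:
  fixes X :: "(nat \<Rightarrow> real^'m) \<Rightarrow> real^'m"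
  assumes "square_integrable (gaussian_space k) X"
  shows "L2 (\<lambda>\<omega>. X (restrict \<omega> {1..k}))"
proof -
  have X: "X \<in> borel_measurable (gaussian_space k)" and i: "integrable (gaussian_space k) (\<lambda>\<omega>. (norm (X \<omega>))\<^sup>2)"
    using assms by (auto simp: square_integrable_def)
  have "(\<lambda>\<omega>. (norm (X \<omega>))\<^sup>2) \<in> borel_measurable (gaussian_space k)" using X by measurable
  from integral_gaussian_space(2)[OF this] i measurable_compose[OF restrict_measurable X]
  show ?thesis unfolding L2_def by (simp add: borel_measurable_gauss_iff)
qed

lemma rep_emb:
  "square_integrable (gaussian_space k) X \<Longrightarrow> AE \<omega> in gauss. rep (emb k X) \<omega> = X (restrict \<omega> {1..k})"
  unfolding emb_def by (intro rep_cl square_integrable_L2)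

lemma AE_emb_eq_iff:
  fixes X :: "(nat \<Rightarrow> real^'m::finite) \<Rightarrow> real^'m" and x y :: "'m l2"
  assumes "f \<in> borel_measurable (gaussian_space k)" "g \<in> borel_measurable (gaussian_space k)"
    and f: "AE \<omega> in gauss. rep x \<omega> = f (restrict \<omega> {1..k})"
    and g: "AE \<omega> in gauss. rep y \<omega> = g (restrict \<omega> {1..k})"
  shows "(AE \<omega> in gaussian_space k. f \<omega> = g \<omega>) \<longleftrightarrow> x = y"
proof -
  have "(AE \<omega> in gauss. f (restrict \<omega> {1..k}) = g (restrict \<omega> {1..k})) \<longleftrightarrow> x = y"
  proof
    assume "AE \<omega> in gauss. f (restrict \<omega> {1..k}) = g (restrict \<omega> {1..k})"
    with f g have "AE \<omega> in gauss. rep x \<omega> = rep y \<omega>" by eventually_elim simp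
    then show "x = y" by (rule l2_eqI)
  next
    assume "x = y"
    with f g show "AE \<omega> in gauss. f (restrict \<omega> {1..k}) = g (restrict \<omega> {1..k})"
      by (auto elim: eventually_elim2)
  qed
  with AE_gaussian_space_iff[OF assms(1,2)] show ?thesis by simp
qed

lemma inner_emb:
  assumes "square_integrable (gaussian_space k) X" "square_integrable (gaussian_space k) Y"
  shows "emb k X \<bullet> emb k Y = (\<integral>\<omega>. X \<omega> \<bullet> Y \<omega> \<partial>gaussian_space k)"
proof -
  have "(\<lambda>\<omega>. X \<omega> \<bullet> Y \<omega>) \<in> borel_measurable (gaussian_space k)"
    using assms by (auto simp: square_integrable_def intro: borel_measurable_inner)
  from integral_gaussian_space(1)[OF this] show ?thesis
    unfolding emb_def inner_cl[OF assms[THEN square_integrable_L2]] by simp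
qed

text \<open>A function of the first \<open>k\<close> coordinates factors through their restriction
  and so comes from a random vector on \<open>gaussian_space k\<close>. The canonical solution
  returns to the prescribed probability space in this way.\<close>

lemma emb_surj:
  fixes x :: "'m::finite l2"
  assumes "x \<in> adapted coord k"
  obtains X where "square_integrable (gaussian_space k) X" "emb k X = x"
proof -
  from assms obtain F where F [measurable]: "F \<in> borel_measurable borel" and FA: "AE \<omega> in gauss. rep x \<omega> = F (past coord k \<omega>)"
    by (auto simp: adapted_def coupled_def)
  let ?s = "1 / sqrt (real CARD('m))"
  let ?p = "\<lambda>\<omega>. (\<lambda>j. if j \<in> {1..k} then ?s *\<^sub>R \<omega> j else 0) :: nat \<Rightarrow> real^'m"
  have cm: "(\<lambda>\<omega>. \<omega> j) \<in> borel_measurable (gaussian_space k :: (nat \<Rightarrow> real^'m) measure)" if "j \<in> {1..k}" for j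
    using measurable_component_singleton[OF that, of "\<lambda>_. std_gaussian :: (real^'m) measure"]
    unfolding gaussian_space_def measurable_cong_sets[OF refl sets_std_gaussian] .
  have pm: "?p \<in> borel_measurable (gaussian_space k)"
  proof (rule measurable_coordinatewise_then_product, rule measurable_if_const)
    fix j assume "j \<in> {1..k}"
    from cm[OF this] show "(\<lambda>\<omega>. ?s *\<^sub>R \<omega> j) \<in> borel_measurable (gaussian_space k :: (nat \<Rightarrow> real^'m) measure)"
      by measurable
  qed simp
  define X where "X = (\<lambda>\<omega>. F (?p \<omega>))"
  have Xm: "X \<in> borel_measurable (gaussian_space k)"
    unfolding X_def by (rule measurable_compose[OF pm F])
  have "AE \<omega> in gauss. \<forall>j\<in>{1..k}. rep (coord j :: 'm l2) \<omega> = ?s *\<^sub>R \<omega> j"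
    by (rule AE_finite_allI) (auto intro: rep_coord)
  then have "AE \<omega> in gauss. past coord k \<omega> = ?p (restrict \<omega> {1..k})"
    by eventually_elim (auto simp: past_def fun_eq_iff)
  with FA have e: "AE \<omega> in gauss. rep x \<omega> = X (restrict \<omega> {1..k})"
    unfolding X_def by eventually_elim simp
  have "integrable gauss (\<lambda>\<omega>. (norm (X (restrict \<omega> {1..k})))\<^sup>2)"
  proof (rule integrable_cong_AE_imp[OF integrable_norm_sq_rep[of x]])
    show "(\<lambda>\<omega>. (norm (X (restrict \<omega> {1..k})))\<^sup>2) \<in> borel_measurable gauss"
      using measurable_compose[OF restrict_measurable Xm] by measurable
    show "AE \<omega> in gauss. (norm (rep x \<omega>))\<^sup>2 = (norm (X (restrict \<omega> {1..k})))\<^sup>2"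
      using e by eventually_elim simp
  qed
  moreover have "(\<lambda>\<omega>. (norm (X \<omega>))\<^sup>2) \<in> borel_measurable (gaussian_space k)" using Xm by measurable
  ultimately have X: "square_integrable (gaussian_space k) X"
    using Xm unfolding square_integrable_def by (simp add: integral_gaussian_space(2))
  have "emb k X = x"
    by (rule l2_eqI) (use rep_emb[OF X] e in \<open>eventually_elim, simp\<close>)
  with X that show ?thesis by blast
qed

lemma rep_emb_all:
  fixes A :: "nat \<Rightarrow> (nat \<Rightarrow> real^'m::finite) \<Rightarrow> real^'m"
  assumes "\<And>j. j \<in> {1..l} \<Longrightarrow> square_integrable (gaussian_space k) (A j)"
  shows "AE \<omega> in gauss. \<forall>j\<in>{1..l}. rep (emb k (A j)) \<omega> = A j (restrict \<omega> {1..k})"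
proof (rule AE_finite_allI)
  fix j assume "j \<in> {1..l}"
  then show "AE \<omega> in gauss. rep (emb k (A j)) \<omega> = A j (restrict \<omega> {1..k})"
    by (intro rep_emb assms)
qed simp

lemma in_span_emb_iff:
  fixes A :: "nat \<Rightarrow> (nat \<Rightarrow> real^'m::finite) \<Rightarrow> real^'m"
  assumes A: "\<And>j. j \<in> {1..l} \<Longrightarrow> square_integrable (gaussian_space k) (A j)" and X: "square_integrable (gaussian_space k) X"
  shows "in_span (gaussian_space k) l A X \<longleftrightarrow> (\<exists>c. emb k X = (\<Sum>j=1..l. c j *\<^sub>R emb k (A j)))"
  unfolding in_span_def
proof (intro ex_cong1 AE_emb_eq_iff rep_emb X)
  fix c :: "nat \<Rightarrow> real"
  show "X \<in> borel_measurable (gaussian_space k)" using X by (simp add: square_integrable_def)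
  show "(\<lambda>\<omega>. \<Sum>j=1..l. c j *\<^sub>R A j \<omega>) \<in> borel_measurable (gaussian_space k)"
    using A by (intro borel_measurable_sum borel_measurable_scaleR) (auto simp: square_integrable_def)
  show "AE \<omega> in gauss. rep (\<Sum>j=1..l. c j *\<^sub>R emb k (A j)) \<omega> = (\<Sum>j=1..l. c j *\<^sub>R A j (restrict \<omega> {1..k}))"
  proof -
    have "AE \<omega> in gauss. \<forall>j\<in>{1..l}. rep (emb k (A j)) \<omega> = A j (restrict \<omega> {1..k})"
      by (rule rep_emb_all) (rule A)
    with rep_lincomb[of c "\<lambda>j. emb k (A j)" "{1..l}"] show ?thesis
      by eventually_elim simp
  qed
qed

lemma rep_nem_emb:
  assumes f: "joint_lipschitz l C f" and A: "\<And>j. j \<in> {1..l} \<Longrightarrow> square_integrable (gaussian_space k) (A j)"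
    and X: "AE \<omega> in gauss. rep x \<omega> = X (restrict \<omega> {1..k})"
  shows "AE \<omega> in gauss. rep (nem l f x (\<lambda>j. emb k (A j))) \<omega> = f (X (restrict \<omega> {1..k})) (cols l A (restrict \<omega> {1..k}))"
proof -
  have "AE \<omega> in gauss. \<forall>j\<in>{1..l}. rep (emb k (A j)) \<omega> = A j (restrict \<omega> {1..k})"
    by (rule rep_emb_all) (rule A)
  with rep_nem[OF f, of x "\<lambda>j. emb k (A j)"] X show ?thesis
    by eventually_elim (simp cong: restrict_cong)
qed

lemma nem_emb_iff:
  fixes A :: "nat \<Rightarrow> (nat \<Rightarrow> real^'m::finite) \<Rightarrow> real^'m"
  assumes f: "joint_lipschitz l C f" and A: "\<And>j. j \<in> {1..l} \<Longrightarrow> square_integrable (gaussian_space k) (A j)"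
    and X: "X \<in> borel_measurable (gaussian_space k)" "AE \<omega> in gauss. rep x \<omega> = X (restrict \<omega> {1..k})"
    and Y: "Y \<in> borel_measurable (gaussian_space k)" "AE \<omega> in gauss. rep y \<omega> = Y (restrict \<omega> {1..k})"
  shows "(AE \<omega> in gaussian_space k. Y \<omega> = f (X \<omega>) (cols l A \<omega>)) \<longleftrightarrow> y = nem l f x (\<lambda>j. emb k (A j))"
proof (rule AE_emb_eq_iff[OF Y(1) _ Y(2)])
  show "(\<lambda>\<omega>. f (X \<omega>) (cols l A \<omega>)) \<in> borel_measurable (gaussian_space k)"
    by (rule joint_lipschitz_measurable[OF f X(1)]) (use A in \<open>auto simp: square_integrable_def\<close>)
qed (rule rep_nem_emb[OF f A X(2)])

lemma cos_integral_emb: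
  fixes G :: "nat \<Rightarrow> (nat \<Rightarrow> real^'m::finite) \<Rightarrow> real^'m"
  assumes G: "\<And>j. j \<in> {1..l} \<Longrightarrow> square_integrable (gaussian_space k) (G j)"
  shows "(\<integral>\<omega>. cos ((\<Sum>j\<in>{1..l}. c j \<bullet> G j \<omega>) + \<theta>) \<partial>gaussian_space k)
     = (\<integral>\<omega>. cos ((\<Sum>j\<in>{1..l}. c j \<bullet> rep (emb k (G j)) \<omega>) + \<theta>) \<partial>gauss)"
proof -
  note cosm = measurable_compose[OF _ borel_measurable_continuous_onI[OF continuous_on_cos[OF continuous_on_id]]]
  have m: "(\<lambda>\<omega>. cos ((\<Sum>j\<in>{1..l}. c j \<bullet> G j \<omega>) + \<theta>)) \<in> borel_measurable (gaussian_space k)"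
    using G by (intro cosm borel_measurable_add borel_measurable_sum borel_measurable_inner) (auto simp: square_integrable_def)
  have "AE \<omega> in gauss. \<forall>j\<in>{1..l}. rep (emb k (G j)) \<omega> = G j (restrict \<omega> {1..k})"
    by (rule rep_emb_all) (rule G)
  then have e: "AE \<omega> in gauss. cos ((\<Sum>j\<in>{1..l}. c j \<bullet> G j (restrict \<omega> {1..k})) + \<theta>)
      = cos ((\<Sum>j\<in>{1..l}. c j \<bullet> rep (emb k (G j)) \<omega>) + \<theta>)"
    by eventually_elim simp
  show ?thesis
    unfolding integral_gaussian_space(1)[OF m]
    by (rule integral_cong_AE[OF measurable_compose[OF restrict_measurable m] _ e]) measurable
qed

lemma square_integrable_imp:
  fixes X Y :: "(nat \<Rightarrow> real^'m) \<Rightarrow> real^'m"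
  assumes X: "square_integrable (gaussian_space k) X" and Y: "square_integrable (gaussian_space k) Y"
  shows "integrable (gaussian_space k) X" "integrable (gaussian_space k) (\<lambda>\<omega>. (a \<bullet> X \<omega>) * (b \<bullet> Y \<omega>))"
proof -
  have m [measurable]: "X \<in> borel_measurable (gaussian_space k)" "Y \<in> borel_measurable (gaussian_space k)"
    using assms by (auto simp: square_integrable_def)
  have i: "integrable (gaussian_space k) (\<lambda>\<omega>. (norm (X \<omega>))\<^sup>2)" "integrable (gaussian_space k) (\<lambda>\<omega>. (norm (Y \<omega>))\<^sup>2)"
    using assms by (auto simp: square_integrable_def)
  have "integrable (gaussian_space k) (\<lambda>\<omega>. norm (X \<omega>))"
    by (rule gaussian_space.square_integrable_imp_integrable) (use i in auto)
  then show "integrable (gaussian_space k) X" by (simp add: integrable_norm_iff)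
  show "integrable (gaussian_space k) (\<lambda>\<omega>. (a \<bullet> X \<omega>) * (b \<bullet> Y \<omega>))"
  proof (rule Bochner_Integration.integrable_bound)
    show "integrable (gaussian_space k) (\<lambda>\<omega>. norm a * norm b * ((norm (X \<omega>))\<^sup>2 + (norm (Y \<omega>))\<^sup>2))"
      using i by auto
    have "\<bar>(a \<bullet> x) * (b \<bullet> y)\<bar> \<le> norm a * norm b * ((norm x)\<^sup>2 + (norm y)\<^sup>2)" for x y :: "real^'m"
    proof -
      have "\<bar>(a \<bullet> x) * (b \<bullet> y)\<bar> \<le> (norm a * norm x) * (norm b * norm y)"
        unfolding abs_mult by (intro mult_mono Cauchy_Schwarz_ineq2) auto
      also have "\<dots> = norm a * norm b * (norm x * norm y)" by simp
      also have "norm x * norm y \<le> (norm x)\<^sup>2 + (norm y)\<^sup>2"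
      proof -
        have "2 * norm x * norm y \<le> (norm x)\<^sup>2 + (norm y)\<^sup>2" by (rule sum_squares_bound)
        moreover have "0 \<le> norm x * norm y" by simp
        ultimately show ?thesis by linarith
      qed
      finally show ?thesis by (simp add: mult_left_mono)
    qed
    then show "AE \<omega> in gaussian_space k. norm ((a \<bullet> X \<omega>) * (b \<bullet> Y \<omega>)) \<le> norm (norm a * norm b * ((norm (X \<omega>))\<^sup>2 + (norm (Y \<omega>))\<^sup>2))"
      by (auto intro!: AE_I2)
  qed measurable
qed

lemma quad_form_polarization:
  "quad_form l g (\<lambda>k. c k + d k) - quad_form l g (\<lambda>k. c k - d k) =
     4 * (\<Sum>i\<in>{1..l}. \<Sum>j\<in>{1..l}. (g i \<bullet> g j) * (c i \<bullet> d j)) / real CARD('m)"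
  for g :: "nat \<Rightarrow> 'm::finite l2"
proof -
  have "(\<Sum>i\<in>{1..l}. \<Sum>j\<in>{1..l}. (g i \<bullet> g j) * ((c i + d i) \<bullet> (c j + d j))) - (\<Sum>i\<in>{1..l}. \<Sum>j\<in>{1..l}. (g i \<bullet> g j) * ((c i - d i) \<bullet> (c j - d j)))
      = 2 * (\<Sum>i\<in>{1..l}. \<Sum>j\<in>{1..l}. (g i \<bullet> g j) * (c i \<bullet> d j)) + 2 * (\<Sum>i\<in>{1..l}. \<Sum>j\<in>{1..l}. (g i \<bullet> g j) * (d i \<bullet> c j))"
    unfolding sum_distrib_left sum_subtractf[symmetric] sum.distrib[symmetric]
    by (intro sum.cong refl) (simp add: inner_add_left inner_add_right inner_diff_left inner_diff_right algebra_simps)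
  moreover have "(\<Sum>i\<in>{1..l}. \<Sum>j\<in>{1..l}. (g i \<bullet> g j) * (d i \<bullet> c j)) = (\<Sum>i\<in>{1..l}. \<Sum>j\<in>{1..l}. (g i \<bullet> g j) * (c i \<bullet> d j))"
    by (subst sum.swap) (simp add: inner_commute)
  ultimately show ?thesis
    unfolding quad_form_def by (simp add: diff_divide_distrib[symmetric])
qed

text \<open>The Cramer-Wold device in both directions. Normality together with the moments fixes the
  cosine integral of every linear functional; conversely those integrals identify the law of each
  functional, and covariances follow by polarisation. The trace over the components cancels the
  factor \<open>1 / CARD('m)\<close>, so \<open>K\<close> is the Gram matrix.\<close>

lemma gaussian_columns_iff:
  fixes G :: "nat \<Rightarrow> (nat \<Rightarrow> real^'m::finite) \<Rightarrow> real^'m"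
  assumes G: "\<And>j. j \<in> {1..l} \<Longrightarrow> square_integrable (gaussian_space k) (G j)"
    and K: "\<And>i j. i \<in> {1..l} \<Longrightarrow> j \<in> {1..l} \<Longrightarrow> K i j = emb k (G i) \<bullet> emb k (G j)"
  shows "gaussian_columns (gaussian_space k) {1..l} K G \<longleftrightarrow> gaussian l (\<lambda>j. emb k (G j))"
proof -
  let ?g = "\<lambda>j. emb k (G j)" and ?M = "gaussian_space k :: (nat \<Rightarrow> real^'m) measure"
  define Y where "Y c \<omega> = (\<Sum>j\<in>{1..l}. c j \<bullet> G j \<omega>)" for c \<omega>
  have Gm: "G j \<in> borel_measurable ?M" if "j \<in> {1..l}" for j using G[OF that] by (simp add: square_integrable_def)
  have Ym: "Y c \<in> borel_measurable ?M" for c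
    unfolding Y_def using Gm by (intro borel_measurable_sum borel_measurable_inner) auto
  show ?thesis
  proof
    assume gc: "gaussian_columns ?M {1..l} K G"
    show "gaussian l ?g"
      unfolding gaussian_def
    proof (intro allI)
      fix c :: "nat \<Rightarrow> real^'m" and \<theta>
      have n: "normal_rv ?M (Y c)" using gc by (simp add: gaussian_columns_def jointly_gaussian_def Y_def[abs_def])
      have "(\<integral>\<omega>. Y c \<omega> \<partial>?M) = (\<Sum>j\<in>{1..l}. c j \<bullet> (\<integral>\<omega>. G j \<omega> \<partial>?M))"
        unfolding Y_def using square_integrable_imp(1)[OF G G] by (subst Bochner_Integration.integral_sum) auto
      then have m1: "(\<integral>\<omega>. Y c \<omega> \<partial>?M) = 0"
        using gc by (simp add: gaussian_columns_def)
      have cov: "(\<integral>\<omega>. (c i \<bullet> G i \<omega>) * (c j \<bullet> G j \<omega>) \<partial>?M) = K i j * (c i \<bullet> c j) / real CARD('m)" if ij: "i \<in> {1..l}" "j \<in> {1..l}" for i j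
      proof -
        have "(\<integral>\<omega>. (c i \<bullet> G i \<omega>) * (c j \<bullet> G j \<omega>) \<partial>?M) = (\<integral>\<omega>. (\<Sum>a\<in>UNIV. \<Sum>b\<in>UNIV. (c i $ a * c j $ b) * (G i \<omega> $ a * G j \<omega> $ b)) \<partial>?M)"
          by (simp add: inner_vec_def sum_product mult_ac)
        also have "\<dots> = (\<Sum>a\<in>UNIV. \<Sum>b\<in>UNIV. (c i $ a * c j $ b) * (\<integral>\<omega>. (G i \<omega> $ a * G j \<omega> $ b) \<partial>?M))"
        proof -
          have "integrable ?M (\<lambda>\<omega>. G i \<omega> $ a * G j \<omega> $ b)" for a b
            using square_integrable_imp(2)[OF G[OF ij(1)] G[OF ij(2)], of "axis a 1" "axis b 1"] by (simp add: inner_axis')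
          then show ?thesis by simp
        qed
        also have "\<dots> = (\<Sum>a\<in>UNIV. \<Sum>b\<in>UNIV. (c i $ a * c j $ b) * (K i j * (if a = b then 1 else 0) / real CARD('m)))"
          using gc ij by (simp add: gaussian_columns_def mat_def)
        also have "\<dots> = (\<Sum>a\<in>UNIV. \<Sum>b\<in>UNIV. if a = b then K i j * (c i $ a * c j $ a) / real CARD('m) else 0)"
          by (intro sum.cong refl) auto
        also have "\<dots> = K i j * (c i \<bullet> c j) / real CARD('m)"
          by (simp add: inner_vec_def sum_distrib_left sum_divide_distrib)
        finally show ?thesis .
      qed
      have "(\<integral>\<omega>. (Y c \<omega>)\<^sup>2 \<partial>?M) = (\<integral>\<omega>. (\<Sum>i\<in>{1..l}. \<Sum>j\<in>{1..l}. (c i \<bullet> G i \<omega>) * (c j \<bullet> G j \<omega>)) \<partial>?M)"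
        by (simp add: Y_def power2_eq_square sum_product)
      also have "\<dots> = (\<Sum>i\<in>{1..l}. \<Sum>j\<in>{1..l}. K i j * (c i \<bullet> c j) / real CARD('m))"
      proof -
        have ii: "integrable ?M (\<lambda>\<omega>. (c i \<bullet> G i \<omega>) * (c j \<bullet> G j \<omega>))" if "i \<in> {1..l}" "j \<in> {1..l}" for i j
          by (rule square_integrable_imp(2)[OF G[OF that(1)] G[OF that(2)]])
        have "(\<integral>\<omega>. (\<Sum>i\<in>{1..l}. \<Sum>j\<in>{1..l}. (c i \<bullet> G i \<omega>) * (c j \<bullet> G j \<omega>)) \<partial>?M) =
            (\<Sum>i\<in>{1..l}. \<Sum>j\<in>{1..l}. (\<integral>\<omega>. (c i \<bullet> G i \<omega>) * (c j \<bullet> G j \<omega>) \<partial>?M))"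
          by (subst Bochner_Integration.integral_sum) (auto intro!: sum.cong Bochner_Integration.integrable_sum Bochner_Integration.integral_sum ii)
        also have "\<dots> = (\<Sum>i\<in>{1..l}. \<Sum>j\<in>{1..l}. K i j * (c i \<bullet> c j) / real CARD('m))"
          by (intro sum.cong refl cov)
        finally show ?thesis .
      qed
      also have "\<dots> = quad_form l ?g c"
        by (simp add: quad_form_def sum_divide_distrib K)
      finally have m2: "(\<integral>\<omega>. (Y c \<omega>)\<^sup>2 \<partial>?M) = quad_form l ?g c" .
      have "(\<integral>\<omega>. cos ((\<Sum>j\<in>{1..l}. c j \<bullet> G j \<omega>) + \<theta>) \<partial>?M) = (\<integral>\<omega>. cos ((\<Sum>j\<in>{1..l}. c j \<bullet> rep (?g j) \<omega>) + \<theta>) \<partial>gauss)"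
        by (rule cos_integral_emb) (rule G)
      with normal_rv_cos[OF gaussian_space.prob_space_axioms n m1 m2, of \<theta>]
      show "(\<integral>\<omega>. cos ((\<Sum>j\<in>{1..l}. c j \<bullet> rep (?g j) \<omega>) + \<theta>) \<partial>gauss) = cos \<theta> * exp (- quad_form l ?g c / 2)"
        by (simp add: Y_def)
    qed
  next
    assume g: "gaussian l ?g"
    have e: "(\<integral>\<omega>. cos (t * Y c \<omega> + \<theta>) \<partial>?M) = cos \<theta> * exp (- t\<^sup>2 * quad_form l ?g c / 2)" for t \<theta> c
    proof -
      have "(\<integral>\<omega>. cos (t * Y c \<omega> + \<theta>) \<partial>?M) = (\<integral>\<omega>. cos ((\<Sum>j\<in>{1..l}. (t *\<^sub>R c j) \<bullet> G j \<omega>) + \<theta>) \<partial>?M)"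
        by (simp add: Y_def sum_distrib_left)
      also have "\<dots> = (\<integral>\<omega>. cos ((\<Sum>j\<in>{1..l}. (t *\<^sub>R c j) \<bullet> rep (?g j) \<omega>) + \<theta>) \<partial>gauss)"
        by (rule cos_integral_emb) (rule G)
      also have "\<dots> = cos \<theta> * exp (- quad_form l ?g (\<lambda>j. t *\<^sub>R c j) / 2)"
        by (rule g[unfolded gaussian_def, rule_format])
      finally show ?thesis by (simp add: quad_form_scaleR)
    qed
    note nm = normal_moments[OF gaussian_space.prob_space_axioms Ym quad_form_nonneg e]
    have Y1: "Y (\<lambda>k. if k = j then a else 0) \<omega> = a \<bullet> G j \<omega>" if "j \<in> {1..l}" for j a \<omega>
      using that by (simp add: Y_def if_distrib[of "\<lambda>x. x \<bullet> _"] cong: if_cong)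
    have mean: "(\<integral>\<omega>. G j \<omega> \<partial>?M) = 0" if j: "j \<in> {1..l}" for j
    proof (rule vector_eq_rdot[THEN iffD1], rule allI)
      fix a
      have "(\<integral>\<omega>. G j \<omega> \<partial>?M) \<bullet> a = (\<integral>\<omega>. a \<bullet> G j \<omega> \<partial>?M)"
        using square_integrable_imp(1)[OF G[OF j] G[OF j]] by (simp add: inner_commute)
      also have "\<dots> = 0" using nm(3)[of "\<lambda>k. if k = j then a else 0"] by (simp add: Y1[OF j])
      finally show "(\<integral>\<omega>. G j \<omega> \<partial>?M) \<bullet> a = 0 \<bullet> a" by simp
    qed
    have cov: "(\<integral>\<omega>. (a \<bullet> G i \<omega>) * (b \<bullet> G j \<omega>) \<partial>?M) = K i j * (a \<bullet> b) / real CARD('m)" if ij: "i \<in> {1..l}" "j \<in> {1..l}" for i j a b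
    proof -
      \<comment> \<open>Test families concentrated at \<open>i\<close> and at \<open>j\<close>,
        which make \<open>Y\<close> equal to the sum and to the difference of the two
        functionals.\<close>
      let ?c = "\<lambda>k. if k = i then a else 0" and ?d = "\<lambda>k. if k = j then b else 0"
      have Yp: "Y (\<lambda>k. ?c k + ?d k) \<omega> = a \<bullet> G i \<omega> + b \<bullet> G j \<omega>" "Y (\<lambda>k. ?c k - ?d k) \<omega> = a \<bullet> G i \<omega> - b \<bullet> G j \<omega>" for \<omega>
        using Y1[OF ij(1), of a \<omega>] Y1[OF ij(2), of b \<omega>]
        by (simp_all add: Y_def inner_add_left inner_diff_left sum.distrib sum_subtractf)
      have "4 * (\<integral>\<omega>. (a \<bullet> G i \<omega>) * (b \<bullet> G j \<omega>) \<partial>?M) = (\<integral>\<omega>. (Y (\<lambda>k. ?c k + ?d k) \<omega>)\<^sup>2 - (Y (\<lambda>k. ?c k - ?d k) \<omega>)\<^sup>2 \<partial>?M)"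
        unfolding Yp integral_mult_right_zero[symmetric]
        by (intro Bochner_Integration.integral_cong refl) (simp add: power2_eq_square algebra_simps)
      also have "\<dots> = quad_form l ?g (\<lambda>k. ?c k + ?d k) - quad_form l ?g (\<lambda>k. ?c k - ?d k)"
        using nm(2,4) by (subst Bochner_Integration.integral_diff) auto
      also have "\<dots> = 4 * (\<Sum>p\<in>{1..l}. \<Sum>q\<in>{1..l}. (?g p \<bullet> ?g q) * (?c p \<bullet> ?d q)) / real CARD('m)"
        by (rule quad_form_polarization)
      also have "(\<Sum>p\<in>{1..l}. \<Sum>q\<in>{1..l}. (?g p \<bullet> ?g q) * (?c p \<bullet> ?d q)) = K i j * (a \<bullet> b)"
      proof -
        have "(\<Sum>p\<in>{1..l}. \<Sum>q\<in>{1..l}. (?g p \<bullet> ?g q) * (?c p \<bullet> ?d q)) =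
            (\<Sum>p\<in>{1..l}. \<Sum>q\<in>{1..l}. if q = j then (if p = i then (?g p \<bullet> ?g q) * (a \<bullet> b) else 0) else 0)"
          by (intro sum.cong refl) simp
        also have "\<dots> = (?g i \<bullet> ?g j) * (a \<bullet> b)"
          using ij by (simp only: sum.delta finite_atLeastAtMost if_True)
        finally show ?thesis using ij by (simp add: K)
      qed
      finally show ?thesis by simp
    qed
    show "gaussian_columns ?M {1..l} K G"
      unfolding gaussian_columns_def jointly_gaussian_def
    proof (intro conjI ballI allI)
      fix c show "normal_rv ?M (\<lambda>\<omega>. \<Sum>j\<in>{1..l}. c j \<bullet> G j \<omega>)"
        using nm(1)[of c] by (simp add: Y_def[abs_def])
    next
      fix i j a b assume "i \<in> {1..l}" "j \<in> {1..l}"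
      from cov[OF this, of "axis a 1" "axis b 1"]
      show "(\<integral>\<omega>. G i \<omega> $ a * G j \<omega> $ b \<partial>?M) = K i j * mat 1 $ a $ b / real CARD('m)"
        unfolding inner_axis' by (simp add: mat_def axis_def eq_commute)
    qed (use Gm mean in auto)
  qed
qed

text \<open>The covariance matrices are replaced by the Gram matrices with which (SE-e) identifies
  them; the base-case laws are recovered from \<open>gaussian\<close> and from the squared norms of
  the first columns.\<close>

definition state_evolution_l2 ::
  "real^'n \<Rightarrow> real^'d \<Rightarrow> (nat \<Rightarrow> ('n::finite, 'd::finite) update) \<Rightarrow> nat \<Rightarrow>
   (nat \<Rightarrow> 'd l2) \<Rightarrow> (nat \<Rightarrow> 'd l2) \<Rightarrow> (nat \<Rightarrow> 'd l2) \<Rightarrow> (nat \<Rightarrow> 'n l2) \<Rightarrow> (nat \<Rightarrow> 'n l2) \<Rightarrow> (nat \<Rightarrow> 'n l2) \<Rightarrow> bool" where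
  "state_evolution_l2 u1 v1 upd k g v vh h u uh \<longleftrightarrow>
    (let s = sqrt (real CARD('n) / real CARD('d)) in
     v 1 = cl (\<lambda>_. v1) \<and> u 1 = cl (\<lambda>_. u1) \<and> uh 1 = 0 \<and> vh 1 = 0 \<and>
     gaussian k g \<and> gaussian k h \<and>
     (\<forall>l\<in>{1..k}. (\<exists>c. uh l = (\<Sum>j=1..l. c j *\<^sub>R u j)) \<and> (\<exists>c. vh l = (\<Sum>j=1..l. c j *\<^sub>R v j))) \<and>
     (\<forall>l\<in>{2..k}.
        case upd l of
          First_Order fu fv \<Rightarrow>
            u l = nem (l - 1) fu (s *\<^sub>R h (l - 1) - uh (l - 1)) u \<and>
            v l = nem (l - 1) fv (g (l - 1) - vh (l - 1)) v
        | Saddle \<phi>u \<phi>v \<Rightarrow>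
            s *\<^sub>R h l - uh l = nem (l - 1) (\<lambda>x X. grad (\<lambda>y. \<phi>u y X) x) (u l) u \<and>
            g l - vh l = nem (l - 1) (\<lambda>x X. grad (\<lambda>y. \<phi>v y X) x) (v l) v) \<and>
     (\<forall>i\<in>{1..k}. \<forall>j\<in>{1..k}.
        g i \<bullet> g j = u i \<bullet> u j \<and> h i \<bullet> h j = v i \<bullet> v j \<and>
        g i \<bullet> v j = u i \<bullet> uh j \<and> s * (h i \<bullet> u j) = v i \<bullet> vh j))"

definition all_square_integrable :: "nat \<Rightarrow> (nat \<Rightarrow> (nat \<Rightarrow> real^'m) \<Rightarrow> real^'m) \<Rightarrow> bool" where
  "all_square_integrable k A \<longleftrightarrow> (\<forall>j\<in>{1..k}. square_integrable (gaussian_space k) (A j))"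

lemma admissible_lipschitz:
  "admissible_update L \<mu> l (First_Order fu fv) \<Longrightarrow> joint_lipschitz (l - 1) L fu \<and> joint_lipschitz (l - 1) L fv"
  "admissible_update L \<mu> l (Saddle \<phi>u \<phi>v) \<Longrightarrow> (\<exists>C. joint_lipschitz (l - 1) C (\<lambda>x X. grad (\<lambda>y. \<phi>u y X) x)) \<and>
     (\<exists>C. joint_lipschitz (l - 1) C (\<lambda>x X. grad (\<lambda>y. \<phi>v y X) x))"
  by (auto simp: admissible_update_def saddle_regular_def)

lemma gram_emb:
  "all_square_integrable k A \<Longrightarrow> all_square_integrable k B \<Longrightarrow> i \<in> {1..k} \<Longrightarrow> j \<in> {1..k} \<Longrightarrow>
    gram (gaussian_space k) A B i j = emb k (A i) \<bullet> emb k (B j)"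
  by (simp add: gram_def all_square_integrable_def inner_emb)

lemma covariance_matrix_gram: "covariance_matrix k (\<lambda>i j. a i \<bullet> a j)" for a :: "nat \<Rightarrow> 'a::real_inner"
  unfolding covariance_matrix_def
proof (intro conjI allI ballI)
  fix x
  have "(\<Sum>i=1..k. \<Sum>j=1..k. x i * (a i \<bullet> a j) * x j) = (norm (\<Sum>i=1..k. x i *\<^sub>R a i))\<^sup>2"
    by (simp add: power2_norm_eq_inner inner_sum_left inner_sum_right sum_distrib_left inner_commute mult_ac)
  then show "0 \<le> (\<Sum>i=1..k. \<Sum>j=1..k. x i * (a i \<bullet> a j) * x j)" by simp
qed (simp add: inner_commute)

lemma emb_const_iff:
  assumes "square_integrable (gaussian_space k) X"
  shows "(AE \<omega> in gaussian_space k. X \<omega> = a) \<longleftrightarrow> emb k X = cl (\<lambda>_. a)"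
proof (rule AE_emb_eq_iff[OF _ _ rep_emb[OF assms] rep_cl[OF L2_const]])
  show "X \<in> borel_measurable (gaussian_space k)" using assms by (simp add: square_integrable_def)
qed simp

lemma rep_emb_comb:
  assumes "square_integrable (gaussian_space k) X" "square_integrable (gaussian_space k) Y"
  shows "AE \<omega> in gauss. rep (s *\<^sub>R emb k X - emb k Y) \<omega> = s *\<^sub>R X (restrict \<omega> {1..k}) - Y (restrict \<omega> {1..k})"
  using rep_diff[of "s *\<^sub>R emb k X" "emb k Y"] rep_scaleR[of s "emb k X"] rep_emb[OF assms(1)] rep_emb[OF assms(2)]
  by eventually_elim simp

text \<open>The first form is the explicit first-order update, the second the implicit saddle
  update. The factor \<open>s\<close> is the square root of \<open>\<Lambda>\<close> on one side of
  the system and 1 on the other.\<close>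

lemma update_emb_iff:
  fixes X Y Z :: "(nat \<Rightarrow> real^'m::finite) \<Rightarrow> real^'m"
  assumes A: "all_square_integrable k A" and l: "l \<le> k"
    and X: "square_integrable (gaussian_space k) X" and Y: "square_integrable (gaussian_space k) Y"
    and Z: "square_integrable (gaussian_space k) Z"
  shows "joint_lipschitz l C f \<Longrightarrow> (AE \<omega> in gaussian_space k. Z \<omega> = f (s *\<^sub>R X \<omega> - Y \<omega>) (cols l A \<omega>)) \<longleftrightarrow>
      emb k Z = nem l f (s *\<^sub>R emb k X - emb k Y) (\<lambda>j. emb k (A j))"
    and "joint_lipschitz l C f \<Longrightarrow> (AE \<omega> in gaussian_space k. s *\<^sub>R X \<omega> - Y \<omega> = f (Z \<omega>) (cols l A \<omega>)) \<longleftrightarrow>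
      s *\<^sub>R emb k X - emb k Y = nem l f (emb k Z) (\<lambda>j. emb k (A j))"
proof -
  have m: "(\<lambda>\<omega>. s *\<^sub>R X \<omega> - Y \<omega>) \<in> borel_measurable (gaussian_space k)" "Z \<in> borel_measurable (gaussian_space k)"
    using X Y Z by (auto simp: square_integrable_def intro: borel_measurable_diff borel_measurable_scaleR)
  have A': "square_integrable (gaussian_space k) (A j)" if "j \<in> {1..l}" for j
    using A l that by (simp add: all_square_integrable_def)
  show "(AE \<omega> in gaussian_space k. Z \<omega> = f (s *\<^sub>R X \<omega> - Y \<omega>) (cols l A \<omega>)) \<longleftrightarrow>
      emb k Z = nem l f (s *\<^sub>R emb k X - emb k Y) (\<lambda>j. emb k (A j))" if f: "joint_lipschitz l C f"
    by (rule nem_emb_iff[OF f A' m(1) rep_emb_comb[OF X Y] m(2) rep_emb[OF Z]])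
  show "(AE \<omega> in gaussian_space k. s *\<^sub>R X \<omega> - Y \<omega> = f (Z \<omega>) (cols l A \<omega>)) \<longleftrightarrow>
      s *\<^sub>R emb k X - emb k Y = nem l f (emb k Z) (\<lambda>j. emb k (A j))" if f: "joint_lipschitz l C f"
    by (rule nem_emb_iff[OF f A' m(2) rep_emb[OF Z] m(1) rep_emb_comb[OF X Y]])
qed

text \<open>The bridge used in both halves of the theorem: a given solution is moved into the
  Hilbert space for uniqueness, and the canonical solution is moved back for existence.\<close>

lemma state_evolution_iff:
  fixes u1 :: "real^'n::finite" and v1 :: "real^'d::finite" and upd :: "nat \<Rightarrow> ('n, 'd) update"
  assumes adm: "\<And>l. l \<ge> 2 \<Longrightarrow> admissible_update L \<mu> l (upd l)" and k: "k \<ge> 1"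
    and sq: "all_square_integrable k G" "all_square_integrable k V" "all_square_integrable k Vh"
      "all_square_integrable k H" "all_square_integrable k U" "all_square_integrable k Uh"
  shows "state_evolution u1 v1 upd k (gaussian_space k) G V Vh (gaussian_space k) H U Uh \<longleftrightarrow>
    state_evolution_l2 u1 v1 upd k (\<lambda>l. emb k (G l)) (\<lambda>l. emb k (V l)) (\<lambda>l. emb k (Vh l))
      (\<lambda>l. emb k (H l)) (\<lambda>l. emb k (U l)) (\<lambda>l. emb k (Uh l))"
proof -
  define s where "s = sqrt (real CARD('n) / real CARD('d))"
  let ?M = "gaussian_space k :: (nat \<Rightarrow> real^'d) measure" and ?N = "gaussian_space k :: (nat \<Rightarrow> real^'n) measure"
  note sqD = sq[unfolded all_square_integrable_def, rule_format]
  have one: "1 \<in> {1..k}" using k by simp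
  have base: "(AE \<omega> in ?M. V 1 \<omega> = v1) \<longleftrightarrow> emb k (V 1) = cl (\<lambda>_. v1)" "(AE \<omega> in ?N. U 1 \<omega> = u1) \<longleftrightarrow> emb k (U 1) = cl (\<lambda>_. u1)"
    "(AE \<omega> in ?N. Uh 1 \<omega> = 0) \<longleftrightarrow> emb k (Uh 1) = 0" "(AE \<omega> in ?M. Vh 1 \<omega> = 0) \<longleftrightarrow> emb k (Vh 1) = 0"
    unfolding zero_l2_def by (rule emb_const_iff, rule sqD, rule one)+
  have span: "in_span ?N l U (Uh l) \<longleftrightarrow> (\<exists>c. emb k (Uh l) = (\<Sum>j=1..l. c j *\<^sub>R emb k (U j)))"
    "in_span ?M l V (Vh l) \<longleftrightarrow> (\<exists>c. emb k (Vh l) = (\<Sum>j=1..l. c j *\<^sub>R emb k (V j)))" if "l \<in> {1..k}" for l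
    by (rule in_span_emb_iff; use that in \<open>auto intro: sqD\<close>)+
  have grams: "gram ?M G G i j = emb k (G i) \<bullet> emb k (G j)" "gram ?N U U i j = emb k (U i) \<bullet> emb k (U j)"
    "gram ?N H H i j = emb k (H i) \<bullet> emb k (H j)" "gram ?M V V i j = emb k (V i) \<bullet> emb k (V j)"
    "gram ?M G V i j = emb k (G i) \<bullet> emb k (V j)" "gram ?N U Uh i j = emb k (U i) \<bullet> emb k (Uh j)"
    "gram ?M V Vh i j = emb k (V i) \<bullet> emb k (Vh j)"
    "gram ?N (\<lambda>l \<omega>. s *\<^sub>R H l \<omega>) U i j = s * (emb k (H i) \<bullet> emb k (U j))" if "i \<in> {1..k}" "j \<in> {1..k}" for i j
    using that sq by (simp_all add: gram_emb) (simp add: gram_def inner_emb sqD)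
  have upds: "(case upd l of
            First_Order fu fv \<Rightarrow>
              (AE \<omega> in ?N. U l \<omega> = fu (s *\<^sub>R H (l - 1) \<omega> - Uh (l - 1) \<omega>) (cols (l - 1) U \<omega>)) \<and>
              (AE \<omega> in ?M. V l \<omega> = fv (G (l - 1) \<omega> - Vh (l - 1) \<omega>) (cols (l - 1) V \<omega>))
          | Saddle \<phi>u \<phi>v \<Rightarrow>
              (AE \<omega> in ?N. s *\<^sub>R H l \<omega> - Uh l \<omega> = grad (\<lambda>x. \<phi>u x (cols (l - 1) U \<omega>)) (U l \<omega>)) \<and>
              (AE \<omega> in ?M. G l \<omega> - Vh l \<omega> = grad (\<lambda>x. \<phi>v x (cols (l - 1) V \<omega>)) (V l \<omega>))) \<longleftrightarrow>
     (case upd l of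
          First_Order fu fv \<Rightarrow>
            emb k (U l) = nem (l - 1) fu (s *\<^sub>R emb k (H (l - 1)) - emb k (Uh (l - 1))) (\<lambda>l. emb k (U l)) \<and>
            emb k (V l) = nem (l - 1) fv (emb k (G (l - 1)) - emb k (Vh (l - 1))) (\<lambda>l. emb k (V l))
        | Saddle \<phi>u \<phi>v \<Rightarrow>
            s *\<^sub>R emb k (H l) - emb k (Uh l) = nem (l - 1) (\<lambda>x X. grad (\<lambda>y. \<phi>u y X) x) (emb k (U l)) (\<lambda>l. emb k (U l)) \<and>
            emb k (G l) - emb k (Vh l) = nem (l - 1) (\<lambda>x X. grad (\<lambda>y. \<phi>v y X) x) (emb k (V l)) (\<lambda>l. emb k (V l)))"
    if l: "l \<in> {2..k}" for l
  proof -
    have l': "l - 1 \<in> {1..k}" "l \<in> {1..k}" "l - 1 \<le> k" using l by auto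
    show ?thesis
    proof (cases "upd l")
      case (First_Order fu fv)
      then have "admissible_update L \<mu> l (First_Order fu fv)"
        using adm[of l] l by simp
      then have f: "joint_lipschitz (l - 1) L fu" "joint_lipschitz (l - 1) L fv"
        using admissible_lipschitz(1) by blast+
      show ?thesis
        using update_emb_iff(1)[OF sq(5) l'(3) sqD(4)[OF l'(1)] sqD(6)[OF l'(1)] sqD(5)[OF l'(2)] f(1), of s]
          update_emb_iff(1)[OF sq(2) l'(3) sqD(1)[OF l'(1)] sqD(3)[OF l'(1)] sqD(2)[OF l'(2)] f(2), of 1]
        by (simp add: First_Order)
    next
      case (Saddle \<phi>u \<phi>v)
      then have "admissible_update L \<mu> l (Saddle \<phi>u \<phi>v)"
        using adm[of l] l by simp
      then obtain C C' where f: "joint_lipschitz (l - 1) C (\<lambda>x X. grad (\<lambda>y. \<phi>u y X) x)" "joint_lipschitz (l - 1) C' (\<lambda>x X. grad (\<lambda>y. \<phi>v y X) x)"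
        using admissible_lipschitz(2) by blast
      show ?thesis
        using update_emb_iff(2)[OF sq(5) l'(3) sqD(4)[OF l'(2)] sqD(6)[OF l'(2)] sqD(5)[OF l'(2)] f(1), of s]
          update_emb_iff(2)[OF sq(2) l'(3) sqD(1)[OF l'(2)] sqD(3)[OF l'(2)] sqD(2)[OF l'(2)] f(2), of 1]
        by (simp add: Saddle)
    qed
  qed
  have sqs: "(\<forall>l\<in>{1..k}. square_integrable ?M (G l) \<and> square_integrable ?M (V l) \<and> square_integrable ?M (Vh l) \<and>
                 square_integrable ?N (H l) \<and> square_integrable ?N (U l) \<and> square_integrable ?N (Uh l))"
    using sqD by blast
  have gG: "gaussian_columns ?M {1..l} K G \<longleftrightarrow> gaussian l (\<lambda>j. emb k (G j))"
    if "l \<le> k" "\<And>i j. i \<in> {1..l} \<Longrightarrow> j \<in> {1..l} \<Longrightarrow> K i j = emb k (G i) \<bullet> emb k (G j)" for l K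
    by (rule gaussian_columns_iff) (use that sqD in auto)
  have gH: "gaussian_columns ?N {1..l} K H \<longleftrightarrow> gaussian l (\<lambda>j. emb k (H j))"
    if "l \<le> k" "\<And>i j. i \<in> {1..l} \<Longrightarrow> j \<in> {1..l} \<Longrightarrow> K i j = emb k (H i) \<bullet> emb k (H j)" for l K
    by (rule gaussian_columns_iff) (use that sqD in auto)
  show ?thesis
  proof
    assume "state_evolution u1 v1 upd k ?M G V Vh ?N H U Uh"
    note S = this[unfolded state_evolution_def Let_def s_def[symmetric] base]
    then obtain Kg Kh where K: "gaussian_columns ?M {1..k} Kg G" "gaussian_columns ?N {1..k} Kh H"
      and sp: "\<forall>l\<in>{1..k}. in_span ?N l U (Uh l) \<and> in_span ?M l V (Vh l)"
      and up: "\<forall>l\<in>{2..k}. (case upd l of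
            First_Order fu fv \<Rightarrow>
              (AE \<omega> in ?N. U l \<omega> = fu (s *\<^sub>R H (l - 1) \<omega> - Uh (l - 1) \<omega>) (cols (l - 1) U \<omega>)) \<and>
              (AE \<omega> in ?M. V l \<omega> = fv (G (l - 1) \<omega> - Vh (l - 1) \<omega>) (cols (l - 1) V \<omega>))
          | Saddle \<phi>u \<phi>v \<Rightarrow>
              (AE \<omega> in ?N. s *\<^sub>R H l \<omega> - Uh l \<omega> = grad (\<lambda>x. \<phi>u x (cols (l - 1) U \<omega>)) (U l \<omega>)) \<and>
              (AE \<omega> in ?M. G l \<omega> - Vh l \<omega> = grad (\<lambda>x. \<phi>v x (cols (l - 1) V \<omega>)) (V l \<omega>)))"
      and gr: "\<forall>i\<in>{1..k}. \<forall>j\<in>{1..k}.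
          Kg i j = gram ?M G G i j \<and> gram ?M G G i j = gram ?N U U i j \<and>
          Kh i j = gram ?N H H i j \<and> gram ?N H H i j = gram ?M V V i j \<and>
          gram ?M G V i j = gram ?N U Uh i j \<and>
          gram ?N (\<lambda>l \<omega>. s *\<^sub>R H l \<omega>) U i j = gram ?M V Vh i j"
      by blast
    have "gaussian k (\<lambda>j. emb k (G j))" "gaussian k (\<lambda>j. emb k (H j))"
      using K gG[OF order_refl, of Kg] gH[OF order_refl, of Kh] gr grams by auto
    then show "state_evolution_l2 u1 v1 upd k (\<lambda>l. emb k (G l)) (\<lambda>l. emb k (V l)) (\<lambda>l. emb k (Vh l))
      (\<lambda>l. emb k (H l)) (\<lambda>l. emb k (U l)) (\<lambda>l. emb k (Uh l))"
      unfolding state_evolution_l2_def Let_def s_def[symmetric]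
      using S sp up gr by (simp only: grams span upds simp_thms cong: ball_cong) blast
  next
    assume "state_evolution_l2 u1 v1 upd k (\<lambda>l. emb k (G l)) (\<lambda>l. emb k (V l)) (\<lambda>l. emb k (Vh l))
      (\<lambda>l. emb k (H l)) (\<lambda>l. emb k (U l)) (\<lambda>l. emb k (Uh l))"
    note S = this[unfolded state_evolution_l2_def Let_def s_def[symmetric]]
    then have g: "gaussian k (\<lambda>j. emb k (G j))" "gaussian k (\<lambda>j. emb k (H j))" by blast+
    have nc: "cl (\<lambda>_. a) \<bullet> cl (\<lambda>_. a) = (norm a)\<^sup>2" for a :: "real^'m::finite"
      by (simp add: inner_cl L2_const power2_norm_eq_inner gauss.prob_space[simplified])
    \<comment> \<open>The deterministic initial vectors have squared length equal to the Gram
      entries at index 1, which supplies the variances of the base case.\<close>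
    have n1: "(norm u1)\<^sup>2 = emb k (G 1) \<bullet> emb k (G 1)" "(norm v1)\<^sup>2 = emb k (H 1) \<bullet> emb k (H 1)"
      using S one by (simp_all add: nc)
    have b1: "gaussian_columns ?M {1} (\<lambda>_ _. (norm u1)\<^sup>2) G"
      using gG[of 1 "\<lambda>_ _. (norm u1)\<^sup>2"] gaussian_mono[OF g(1)] k n1 by simp
    have b2: "gaussian_columns ?N {1} (\<lambda>_ _. (norm v1)\<^sup>2) H"
      using gH[of 1 "\<lambda>_ _. (norm v1)\<^sup>2"] gaussian_mono[OF g(2)] k n1 by simp
    have K: "gaussian_columns ?M {1..k} (\<lambda>i j. emb k (G i) \<bullet> emb k (G j)) G" "gaussian_columns ?N {1..k} (\<lambda>i j. emb k (H i) \<bullet> emb k (H j)) H"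
      using gG[OF order_refl] gH[OF order_refl] g by auto
    show "state_evolution u1 v1 upd k ?M G V Vh ?N H U Uh"
      unfolding state_evolution_def Let_def s_def[symmetric] base
    proof (intro conjI exI)
      show "covariance_matrix k (\<lambda>i j. emb k (G i) \<bullet> emb k (G j))" "covariance_matrix k (\<lambda>i j. emb k (H i) \<bullet> emb k (H j))"
        by (rule covariance_matrix_gram)+
      show "\<forall>l\<in>{1..k}. in_span ?N l U (Uh l) \<and> in_span ?M l V (Vh l)"
        using S by (simp only: span cong: ball_cong) blast
    qed (use S b1 b2 K sqs in \<open>simp_all only: upds grams cong: ball_cong\<close>, (blast | simp)+)
  qed
qed

definition law3_l2 :: "nat \<Rightarrow> (nat \<Rightarrow> 'm l2) \<Rightarrow> (nat \<Rightarrow> 'm l2) \<Rightarrow> (nat \<Rightarrow> 'm::finite l2) \<Rightarrow>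
   ((nat \<Rightarrow> real^'m) \<times> (nat \<Rightarrow> real^'m) \<times> (nat \<Rightarrow> real^'m)) measure" where
  "law3_l2 k a b c = law3 k gauss (\<lambda>j. rep (a j)) (\<lambda>j. rep (b j)) (\<lambda>j. rep (c j))"

lemma cols_measurable:
  "(\<And>j. j \<in> {1..k} \<Longrightarrow> A j \<in> borel_measurable M) \<Longrightarrow> cols k A \<in> M \<rightarrow>\<^sub>M mat_borel k"
  by (rule measurable_restrict)

lemma law3_emb:
  fixes A B C :: "nat \<Rightarrow> (nat \<Rightarrow> real^'m::finite) \<Rightarrow> real^'m"
  assumes "all_square_integrable k A" "all_square_integrable k B" "all_square_integrable k C"
  shows "law3 k (gaussian_space k) A B C = law3_l2 k (\<lambda>j. emb k (A j)) (\<lambda>j. emb k (B j)) (\<lambda>j. emb k (C j))"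
proof -
  let ?P = "mat_borel k \<Otimes>\<^sub>M mat_borel k \<Otimes>\<^sub>M mat_borel k :: ((nat \<Rightarrow> real^'m) \<times> (nat \<Rightarrow> real^'m) \<times> (nat \<Rightarrow> real^'m)) measure"
  let ?f = "\<lambda>\<omega>. (cols k A \<omega>, cols k B \<omega>, cols k C \<omega>)"
  have sqm: "X j \<in> borel_measurable (gaussian_space k)" if "all_square_integrable k X" "j \<in> {1..k}" for j and X :: "nat \<Rightarrow> (nat \<Rightarrow> real^'m) \<Rightarrow> real^'m"
    using that by (simp add: all_square_integrable_def square_integrable_def)
  have f: "?f \<in> gaussian_space k \<rightarrow>\<^sub>M ?P"
    using assms sqm by (intro measurable_Pair cols_measurable) auto
  have "law3 k (gaussian_space k) A B C = distr (distr gauss (gaussian_space k) (\<lambda>\<omega>. restrict \<omega> {1..k})) ?P ?f"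
    unfolding law3_def by (simp only: gaussian_space_eq_distr[symmetric])
  also have "\<dots> = distr gauss ?P (?f \<circ> (\<lambda>\<omega>. restrict \<omega> {1..k}))"
    by (rule distr_distr[OF f restrict_measurable])
  also have "\<dots> = law3_l2 k (\<lambda>j. emb k (A j)) (\<lambda>j. emb k (B j)) (\<lambda>j. emb k (C j))"
    unfolding law3_l2_def law3_def
  proof (rule distr_cong_AE[OF refl refl])
    have e: "AE \<omega> in gauss. \<forall>j\<in>{1..k}. rep (emb k (X j)) \<omega> = X j (restrict \<omega> {1..k})" if "all_square_integrable k X" for X :: "nat \<Rightarrow> (nat \<Rightarrow> real^'m) \<Rightarrow> real^'m"
      by (rule rep_emb_all) (use that in \<open>simp add: all_square_integrable_def\<close>)
    show "AE \<omega> in gauss. (?f \<circ> (\<lambda>\<omega>. restrict \<omega> {1..k})) \<omega> =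
        (cols k (\<lambda>j. rep (emb k (A j))) \<omega>, cols k (\<lambda>j. rep (emb k (B j))) \<omega>, cols k (\<lambda>j. rep (emb k (C j))) \<omega>)"
      using e[OF assms(1)] e[OF assms(2)] e[OF assms(3)] by eventually_elim (simp cong: restrict_cong)
    show "?f \<circ> (\<lambda>\<omega>. restrict \<omega> {1..k}) \<in> gauss \<rightarrow>\<^sub>M ?P"
      by (rule measurable_comp[OF restrict_measurable f])
    show "(\<lambda>\<omega>. (cols k (\<lambda>j. rep (emb k (A j))) \<omega>, cols k (\<lambda>j. rep (emb k (B j))) \<omega>, cols k (\<lambda>j. rep (emb k (C j))) \<omega>)) \<in> gauss \<rightarrow>\<^sub>M ?P"
      by (intro measurable_Pair cols_measurable) (simp_all add: borel_measurable_gauss_iff)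
  qed
  finally show ?thesis .
qed

text \<open>The triple is one fixed Borel function \<open>?T\<close> of the past of the driving
  process, so its law is the image of the common law under \<open>?T\<close>.\<close>

lemma law3_l2_eqI:
  fixes g g' :: "nat \<Rightarrow> 'm::finite l2"
  assumes law: "same_law k g g'"
    and v: "\<And>j. j \<in> {1..k} \<Longrightarrow> coupled k g g' (v j) (v' j)" and w: "\<And>j. j \<in> {1..k} \<Longrightarrow> coupled k g g' (w j) (w' j)"
  shows "law3_l2 k g v w = law3_l2 k g' v' w'"
proof -
  let ?P = "mat_borel k \<Otimes>\<^sub>M mat_borel k \<Otimes>\<^sub>M mat_borel k :: ((nat \<Rightarrow> real^'m) \<times> (nat \<Rightarrow> real^'m) \<times> (nat \<Rightarrow> real^'m)) measure"
  have "\<exists>F. \<forall>j\<in>{1..k}. F j \<in> borel_measurable borel \<and> (AE \<omega> in gauss. rep (v j) \<omega> = F j (past g k \<omega>)) \<and> (AE \<omega> in gauss. rep (v' j) \<omega> = F j (past g' k \<omega>))"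
    using v unfolding coupled_def by (intro bchoice) blast
  then obtain F where F: "\<And>j. j \<in> {1..k} \<Longrightarrow> F j \<in> borel_measurable borel"
    "\<And>j. j \<in> {1..k} \<Longrightarrow> AE \<omega> in gauss. rep (v j) \<omega> = F j (past g k \<omega>)" "\<And>j. j \<in> {1..k} \<Longrightarrow> AE \<omega> in gauss. rep (v' j) \<omega> = F j (past g' k \<omega>)"
    by blast
  have "\<exists>F. \<forall>j\<in>{1..k}. F j \<in> borel_measurable borel \<and> (AE \<omega> in gauss. rep (w j) \<omega> = F j (past g k \<omega>)) \<and> (AE \<omega> in gauss. rep (w' j) \<omega> = F j (past g' k \<omega>))"
    using w unfolding coupled_def by (intro bchoice) blast
  then obtain E where E: "\<And>j. j \<in> {1..k} \<Longrightarrow> E j \<in> borel_measurable borel"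
    "\<And>j. j \<in> {1..k} \<Longrightarrow> AE \<omega> in gauss. rep (w j) \<omega> = E j (past g k \<omega>)" "\<And>j. j \<in> {1..k} \<Longrightarrow> AE \<omega> in gauss. rep (w' j) \<omega> = E j (past g' k \<omega>)"
    by blast
  let ?T = "\<lambda>p. (cols k (\<lambda>j p. p j) p, cols k F p, cols k E p)"
  have T: "?T \<in> borel \<rightarrow>\<^sub>M ?P"
    by (intro measurable_Pair cols_measurable) (auto intro: F E component_measurable)
  have eq: "law3_l2 k g v w = distr (distr gauss borel (past g k)) ?P ?T"
    if "\<And>j. j \<in> {1..k} \<Longrightarrow> AE \<omega> in gauss. rep (v j) \<omega> = F j (past g k \<omega>)" "\<And>j. j \<in> {1..k} \<Longrightarrow> AE \<omega> in gauss. rep (w j) \<omega> = E j (past g k \<omega>)"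
    for g v w :: "nat \<Rightarrow> 'm l2"
  proof -
    have pm: "past g k \<in> borel_measurable gauss" by (simp add: borel_measurable_gauss_iff)
    have "AE \<omega> in gauss. \<forall>j\<in>{1..k}. rep (v j) \<omega> = F j (past g k \<omega>)" "AE \<omega> in gauss. \<forall>j\<in>{1..k}. rep (w j) \<omega> = E j (past g k \<omega>)"
      using that by (auto intro: AE_finite_allI)
    then have "AE \<omega> in gauss. (cols k (\<lambda>j. rep (g j)) \<omega>, cols k (\<lambda>j. rep (v j)) \<omega>, cols k (\<lambda>j. rep (w j)) \<omega>) = (?T \<circ> past g k) \<omega>"
      by eventually_elim (simp add: past_def cong: restrict_cong)
    then have "law3_l2 k g v w = distr gauss ?P (?T \<circ> past g k)"
      unfolding law3_l2_def law3_def
      by (rule distr_cong_AE[OF refl refl])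
        (intro measurable_Pair cols_measurable measurable_comp[OF pm T]; simp add: borel_measurable_gauss_iff)+
    then show ?thesis unfolding distr_distr[OF T pm] .
  qed
  have "law3_l2 k g v w = distr (distr gauss borel (past g k)) ?P ?T"
    by (rule eq) (erule F(2), erule E(2))
  also have "\<dots> = distr (distr gauss borel (past g' k)) ?P ?T"
    using law by (simp add: same_law_def)
  also have "\<dots> = law3_l2 k g' v' w'"
    by (rule eq[symmetric]) (erule F(3), erule E(3))
  finally show ?thesis .
qed

section \<open>Canonical solutions\<close>

fun gs :: "(nat \<Rightarrow> 'a::real_inner) \<Rightarrow> nat \<Rightarrow> 'a" where
  "gs u l = sgn (u l - (\<Sum>i\<in>{1..<l}. (u l \<bullet> gs u i) *\<^sub>R gs u i))"

declare gs.simps [simp del]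

text \<open>Orthogonal projection to the complement of the span of \<open>u 1, ..., u l\<close>; it
  serves as the \<open>P\<close> and \<open>Q\<close> of the saddle equations.\<close>

definition residual :: "(nat \<Rightarrow> 'a::real_inner) \<Rightarrow> nat \<Rightarrow> 'a \<Rightarrow> 'a" where
  "residual u l x = x - (\<Sum>i\<in>{1..l}. (x \<bullet> gs u i) *\<^sub>R gs u i)"

lemma gs_Suc: "gs u (Suc l) = sgn (residual u l (u (Suc l)))"
  by (subst gs.simps) (simp add: residual_def atLeastLessThanSuc_atLeastAtMost)

lemma gs_cong: "(\<And>i. i \<in> {1..l} \<Longrightarrow> u i = w i) \<Longrightarrow> 1 \<le> l \<Longrightarrow> gs u l = gs w l"
proof (induction l rule: less_induct)
  case (less l)
  have "gs u i = gs w i" if "i \<in> {1..<l}" for i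
    using less that by auto
  moreover have "u l = w l" using less by auto
  ultimately show ?case by (subst (1 2) gs.simps) simp
qed

lemma inner_sgn_self: "sgn x \<bullet> sgn x = of_bool (x \<noteq> (0::'a::real_inner))"
  by (auto simp: power2_norm_eq_inner[symmetric] norm_sgn)

text \<open>A vector dependent on its predecessors leaves residual zero, and
  \<open>sgn 0 = 0\<close>; the family is orthonormal up to zero entries, which drop out of all
  expansions.\<close>

lemma gs_self: "gs u i \<bullet> gs u i = of_bool (gs u i \<noteq> 0)"
  by (subst (1 2 3) gs.simps) (simp add: inner_sgn_self sgn_zero_iff)

lemma gs_orthogonal:
  assumes "1 \<le> i" "1 \<le> j" "i \<noteq> j" shows "gs u i \<bullet> gs u j = 0"
proof -
  have "\<forall>i. 1 \<le> i \<and> i < l \<longrightarrow> gs u i \<bullet> gs u l = 0" for l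
  proof (induction l rule: less_induct)
    case (less l)
    note IH = less.IH
    show ?case
    proof (intro allI impI)
      fix i assume i: "1 \<le> i \<and> i < l"
      have o: "gs u p \<bullet> gs u i = (if p = i then gs u i \<bullet> gs u i else 0)" if "p \<in> {1..<l}" for p
      proof (cases p i rule: linorder_cases)
        case less
        then show ?thesis using IH[of i] i that by simp
      next
        case greater
        then have "gs u i \<bullet> gs u p = 0" using IH[of p] i that by simp
        then show ?thesis using greater by (simp only: inner_commute[of "gs u p"]) simp
      qed simp
      have "(\<Sum>p\<in>{1..<l}. (u l \<bullet> gs u p) * (gs u p \<bullet> gs u i)) = (\<Sum>p\<in>{1..<l}. if p = i then (u l \<bullet> gs u i) * (gs u i \<bullet> gs u i) else 0)"
        by (intro sum.cong refl, subst o) auto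
      also have "\<dots> = (u l \<bullet> gs u i) * (gs u i \<bullet> gs u i)" using i by simp
      also have "\<dots> = u l \<bullet> gs u i" by (cases "gs u i = 0") (auto simp: gs_self)
      finally have "(u l - (\<Sum>p\<in>{1..<l}. (u l \<bullet> gs u p) *\<^sub>R gs u p)) \<bullet> gs u i = 0"
        by (simp add: inner_diff_left inner_sum_left)
      then have "sgn (u l - (\<Sum>p\<in>{1..<l}. (u l \<bullet> gs u p) *\<^sub>R gs u p)) \<bullet> gs u i = 0"
        by (simp add: sgn_div_norm)
      then show "gs u i \<bullet> gs u l = 0" by (subst (2) gs.simps) (simp add: inner_commute)
    qed
  qed
  note orth = this
  show ?thesis
  proof (cases "i < j")
    case True
    then show ?thesis using orth[of j] assms by blast
  next
    case False
    then have "gs u j \<bullet> gs u i = 0" using orth[of i] assms by auto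
    then show ?thesis by (simp only: inner_commute[of "gs u i"])
  qed
qed

lemma residual_orthogonal:
  assumes "i \<in> {1..l}" shows "residual u l x \<bullet> gs u i = 0"
proof -
  have "(\<Sum>p\<in>{1..l}. (x \<bullet> gs u p) * (gs u p \<bullet> gs u i)) = (\<Sum>p\<in>{1..l}. if p = i then (x \<bullet> gs u i) * (gs u i \<bullet> gs u i) else 0)"
    using assms by (intro sum.cong refl) (auto simp: gs_orthogonal)
  also have "\<dots> = (x \<bullet> gs u i) * (gs u i \<bullet> gs u i)" using assms by simp
  also have "\<dots> = x \<bullet> gs u i" by (cases "gs u i = 0") (auto simp: gs_self)
  finally show ?thesis by (simp add: residual_def inner_diff_left inner_sum_left)
qed

lemma residual_inner: "residual u l x \<bullet> y = residual u l x \<bullet> residual u l y"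
proof -
  have "residual u l x \<bullet> (\<Sum>i\<in>{1..l}. (y \<bullet> gs u i) *\<^sub>R gs u i) = 0"
    by (simp add: inner_sum_right residual_orthogonal)
  then show ?thesis by (subst (3) residual_def) (simp add: inner_diff_right)
qed

lemma sgn_inner_self: "sgn x \<bullet> x = norm (x :: 'a::real_inner)"
  by (cases "x = 0") (simp_all add: sgn_div_norm dot_square_norm power2_eq_square)

lemma inner_sgn_residual: "x \<bullet> sgn (residual u l x) = norm (residual u l x)"
proof -
  have "x \<bullet> sgn (residual u l x) = sgn (residual u l x) \<bullet> residual u l x"
    using residual_inner[of u l x x] by (simp add: sgn_div_norm inner_commute)
  then show ?thesis by (simp add: sgn_inner_self)
qed

lemma gs_expansion_self: "1 \<le> l \<Longrightarrow> u l = (\<Sum>i\<in>{1..l}. (u l \<bullet> gs u i) *\<^sub>R gs u i)"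
proof (cases l)
  case (Suc n)
  have "(u (Suc n) \<bullet> gs u (Suc n)) *\<^sub>R gs u (Suc n) = residual u n (u (Suc n))"
    unfolding gs_Suc inner_sgn_residual by (rule norm_scaleR_sgn)
  then show ?thesis by (simp add: Suc residual_def)
qed simp

lemma gs_future: "1 \<le> l \<Longrightarrow> l < i \<Longrightarrow> u l \<bullet> gs u i = 0"
  by (subst gs_expansion_self[of l u]) (auto simp: inner_sum_left gs_orthogonal)

text \<open>The coefficients form a triangular array, a Cholesky factor of the Gram matrix, so all
  columns can share one upper limit of summation.\<close>

lemma gs_sum_extend:
  fixes w :: "nat \<Rightarrow> 'b::real_vector"
  assumes "1 \<le> l" "l \<le> k"
  shows "(\<Sum>i\<in>{1..l}. (u l \<bullet> gs u i) *\<^sub>R w i) = (\<Sum>i\<in>{1..k}. (u l \<bullet> gs u i) *\<^sub>R w i)"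
  using assms by (intro sum.mono_neutral_left) (auto simp: gs_future)

lemma gs_expansion: "1 \<le> l \<Longrightarrow> l \<le> k \<Longrightarrow> u l = (\<Sum>i\<in>{1..k}. (u l \<bullet> gs u i) *\<^sub>R gs u i)"
  using gs_expansion_self[of l u] gs_sum_extend[of l k u "gs u"] by simp

lemma residual_inner_family: "j \<in> {1..l} \<Longrightarrow> residual u l x \<bullet> u j = 0"
  by (subst gs_expansion[of j l u]) (auto simp: inner_sum_right residual_orthogonal)

lemma span_image_iff: "x \<in> span (u ` {1..l}) \<longleftrightarrow> (\<exists>c. x = (\<Sum>j=1..l. c j *\<^sub>R u j))" for u :: "nat \<Rightarrow> 'a::real_vector"
proof
  assume "x \<in> span (u ` {1..l})"
  then show "\<exists>c. x = (\<Sum>j=1..l. c j *\<^sub>R u j)"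
  proof (induction rule: span_induct_alt)
    case base show ?case by (intro exI[of _ "\<lambda>_. 0"]) simp
  next
    case (step a y z)
    then obtain j c where "j \<in> {1..l}" "y = u j" "z = (\<Sum>j=1..l. c j *\<^sub>R u j)" by auto
    then have "a *\<^sub>R y + z = (\<Sum>i=1..l. (c i + (if i = j then a else 0)) *\<^sub>R u i)"
      by (simp add: scaleR_add_left sum.distrib if_distrib[of "\<lambda>x. x *\<^sub>R _"] cong: if_cong)
    then show ?case by (intro exI)
  qed
next
  assume "\<exists>c. x = (\<Sum>j=1..l. c j *\<^sub>R u j)"
  then show "x \<in> span (u ` {1..l})"
    by (elim exE, simp only:, intro span_sum span_scale span_base imageI)
qed

lemma gs_span: "1 \<le> i \<Longrightarrow> gs u i \<in> span (u ` {1..i})"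
proof (induction i rule: less_induct)
  case (less i)
  have "gs u p \<in> span (u ` {1..i})" if "p \<in> {1..<i}" for p
    using less(1)[of p] that span_mono[of "u ` {1..p}" "u ` {1..i}"] by fastforce
  moreover have "u i \<in> span (u ` {1..i})" using less by (intro span_base) auto
  ultimately show ?case
    by (subst gs.simps) (auto simp: sgn_div_norm intro!: span_scale span_diff span_sum)
qed

lemma residual_decomp:
  obtains p where "x = (\<Sum>j=1..l. p j *\<^sub>R u j) + residual u l x"
proof -
  have "(\<Sum>i\<in>{1..l}. (x \<bullet> gs u i) *\<^sub>R gs u i) \<in> span (u ` {1..l})"
  proof (intro span_sum span_scale)
    fix i assume "i \<in> {1..l}"
    then show "gs u i \<in> span (u ` {1..l})"
      using gs_span[of i u] span_mono[of "u ` {1..i}" "u ` {1..l}"] by fastforce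
  qed
  then obtain p where "(\<Sum>i\<in>{1..l}. (x \<bullet> gs u i) *\<^sub>R gs u i) = (\<Sum>j=1..l. p j *\<^sub>R u j)"
    unfolding span_image_iff by blast
  then have "x = (\<Sum>j=1..l. p j *\<^sub>R u j) + residual u l x" by (simp add: residual_def)
  then show ?thesis by (rule that)
qed

lemma bounded_linear_residual: "bounded_linear (residual u l)"
  unfolding residual_def[abs_def]
  by (intro bounded_linear_sub bounded_linear_sum bounded_linear_ident
      bounded_linear_compose[OF bounded_linear_scaleR_left bounded_linear_inner_left])

text \<open>\<open>transport u l x\<close> replaces the orthonormalised \<open>u\<close> by the independent Gaussian coordinates.\<close>

definition transport :: "(nat \<Rightarrow> 'a l2) \<Rightarrow> nat \<Rightarrow> 'a::finite l2 \<Rightarrow> 'b::finite l2" where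
  "transport u l x = (\<Sum>i\<in>{1..l}. (x \<bullet> gs u i) *\<^sub>R coord i)"

text \<open>The adjoint of \<open>transport\<close>. With memory terms of this shape the
  cross-moment equations of (SE-e) become the adjointness relation.\<close>

definition cotransport :: "(nat \<Rightarrow> 'a l2) \<Rightarrow> nat \<Rightarrow> 'b::finite l2 \<Rightarrow> 'a::finite l2" where
  "cotransport u l y = (\<Sum>i\<in>{1..l}. (coord i \<bullet> y) *\<^sub>R gs u i)"

lemma bounded_linear_transport: "bounded_linear (transport u l)"
  unfolding transport_def[abs_def]
  by (intro bounded_linear_sum bounded_linear_compose[OF bounded_linear_scaleR_left bounded_linear_inner_left])

lemma bounded_linear_cotransport: "bounded_linear (cotransport u l)"
  unfolding cotransport_def[abs_def]
  by (intro bounded_linear_sum bounded_linear_compose[OF bounded_linear_scaleR_left bounded_linear_inner_right])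

lemma transport_adjoint: "transport u l x \<bullet> y = x \<bullet> cotransport u l y"
  by (simp add: transport_def cotransport_def inner_sum_left inner_sum_right mult.commute)

lemma transport_inner: "transport u l x \<bullet> (transport u l y :: 'b::finite l2) = (\<Sum>i\<in>{1..l}. (x \<bullet> gs u i) * (y \<bullet> gs u i))"
proof -
  have "transport u l x \<bullet> (transport u l y :: 'b l2) = (\<Sum>i\<in>{1..l}. \<Sum>j\<in>{1..l}. (if i = j then (x \<bullet> gs u i) * (y \<bullet> gs u i) else 0))"
    unfolding transport_def inner_sum_left inner_sum_right by (intro sum.cong refl) (auto simp: inner_coord)
  then show ?thesis by simp
qed

lemma transport_cong: "(\<And>i. i \<in> {1..l} \<Longrightarrow> u i = w i) \<Longrightarrow> transport u l x = transport w l x"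
  unfolding transport_def by (intro sum.cong refl arg_cong2[where f = scaleR] arg_cong2[where f = inner] gs_cong) auto

lemma cotransport_cong: "(\<And>i. i \<in> {1..l} \<Longrightarrow> u i = w i) \<Longrightarrow> cotransport u l x = cotransport w l x"
  unfolding cotransport_def by (intro sum.cong refl arg_cong2[where f = scaleR] gs_cong) auto

text \<open>Separates the part linear in the new iterate from the nonlinear amplitude of the fresh
  coordinate; \<open>cotransport_Suc\<close> does the same for the memory term.\<close>

lemma transport_Suc: "transport u (Suc l) (u (Suc l)) = transport u l (u (Suc l)) + norm (residual u l (u (Suc l))) *\<^sub>R coord (Suc l)"
  by (simp add: transport_def gs_Suc inner_sgn_residual)

lemma cotransport_Suc: "cotransport u (Suc l) y = cotransport u l y + (coord (Suc l) \<bullet> y) *\<^sub>R sgn (residual u l (u (Suc l)))"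
  by (simp add: cotransport_def gs_Suc)

section \<open>Adapted families and the canonical ansatz\<close>

lemma adapted_mono: "l \<le> l' \<Longrightarrow> adapted g l \<subseteq> adapted g l'"
  by (auto simp: adapted_def intro: coupled_mono)

text \<open>A coordinate is its own innovation, so it is orthogonal to every square-integrable
  function of the earlier ones.\<close>

lemma coord_orthogonal:
  assumes "x \<in> adapted coord l" "l < i" shows "coord i \<bullet> x = 0"
proof -
  obtain n where n: "i = Suc n" using assms by (cases i) auto
  show ?thesis
    unfolding n
    by (rule innovation_orthogonal[OF gaussian_coord, where t = "\<lambda>_. 0" and l = n])
      (use assms n adapted_mono[of l n coord] in \<open>auto simp: inner_coord\<close>)
qed

lemma coord_adapted: "1 \<le> i \<Longrightarrow> i \<le> l \<Longrightarrow> coord i \<in> adapted coord l"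
  by (auto simp: adapted_def intro: coupled_base)

lemma adapted_lincomb: "(\<And>i. i \<in> I \<Longrightarrow> x i \<in> adapted g l) \<Longrightarrow> (\<Sum>i\<in>I. c i *\<^sub>R x i) \<in> adapted g l"
  by (auto simp: adapted_def intro: coupled_lincomb)

lemma transport_adapted: "transport u l x \<in> adapted coord l"
  unfolding transport_def by (intro adapted_lincomb coord_adapted) auto

lemma gs_adapted:
  assumes "\<And>i. i \<in> {1..l} \<Longrightarrow> u i \<in> adapted g l" "i \<in> {1..l}"
  shows "gs u i \<in> adapted g l"
proof -
  obtain c where "gs u i = (\<Sum>j=1..i. c j *\<^sub>R u j)"
    using gs_span[of i u] assms(2) unfolding span_image_iff by auto
  then show ?thesis using assms by (auto intro!: adapted_lincomb)
qed

lemma cotransport_adapted: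
  "(\<And>i. i \<in> {1..l} \<Longrightarrow> u i \<in> adapted g l) \<Longrightarrow> cotransport u l y \<in> adapted g l"
  unfolding cotransport_def by (intro adapted_lincomb gs_adapted) auto

text \<open>A canonical solution consists of the iterates alone; noise and memory are expressed
  through \<open>transport\<close> and \<open>cotransport\<close>. The sign conditions are recorded
  because uniqueness of the saddle equations relies on them.\<close>

definition canonical ::
  "real^'n \<Rightarrow> real^'d \<Rightarrow> (nat \<Rightarrow> ('n::finite, 'd::finite) update) \<Rightarrow> nat \<Rightarrow> (nat \<Rightarrow> 'n l2) \<Rightarrow> (nat \<Rightarrow> 'd l2) \<Rightarrow> bool" where
  "canonical u1 v1 upd k u v \<longleftrightarrow>
    (let s = sqrt (real CARD('n) / real CARD('d)) in
     u 1 = cl (\<lambda>_. u1) \<and> v 1 = cl (\<lambda>_. v1) \<and>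
     (\<forall>l\<in>{1..k}. u l \<in> adapted coord l \<and> v l \<in> adapted coord l \<and> 0 \<le> coord l \<bullet> u l \<and> 0 \<le> coord l \<bullet> v l) \<and>
     (\<forall>l\<in>{1..<k}.
        case upd (Suc l) of
          First_Order fu fv \<Rightarrow>
            u (Suc l) = nem l fu (s *\<^sub>R transport v l (v l) - cotransport u l (v l)) u \<and>
            v (Suc l) = nem l fv (transport u l (u l) - s *\<^sub>R cotransport v l (u l)) v
        | Saddle \<phi>u \<phi>v \<Rightarrow>
            s *\<^sub>R transport v (Suc l) (v (Suc l)) - cotransport u (Suc l) (v (Suc l)) = nem l (\<lambda>x X. grad (\<lambda>y. \<phi>u y X) x) (u (Suc l)) u \<and>
            transport u (Suc l) (u (Suc l)) - s *\<^sub>R cotransport v (Suc l) (u (Suc l)) = nem l (\<lambda>x X. grad (\<lambda>y. \<phi>v y X) x) (v (Suc l)) v))"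

lemma canonical_cong:
  assumes "\<And>i. i \<in> {1..k} \<Longrightarrow> u i = u' i" "\<And>i. i \<in> {1..k} \<Longrightarrow> v i = v' i" "1 \<le> k"
  shows "canonical u1 v1 upd k u v \<longleftrightarrow> canonical u1 v1 upd k u' v'"
proof -
  have c: "transport v l x = transport v' l x" "cotransport u l y = cotransport u' l y"
    "transport u l x' = transport u' l x'" "cotransport v l y' = cotransport v' l y'"
    "nem l f z u = nem l f z u'" "nem l f' z' v = nem l f' z' v'" if "l \<le> k" for l x x' y y' f z f' z'
    using assms that by (auto intro!: transport_cong cotransport_cong nem_cong)
  have "u l = u' l" "v l = v' l" "u (Suc l) = u' (Suc l)" "v (Suc l) = v' (Suc l)" if "l \<in> {1..<k}" for l
    using assms that by auto
  moreover have "u 1 = u' 1" "v 1 = v' 1" using assms by auto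
  moreover have "u l = u' l" "v l = v' l" if "l \<in> {1..k}" for l
    using assms that by auto
  ultimately show ?thesis
    unfolding canonical_def Let_def
    by (intro conj_cong ball_cong refl) (auto simp: c split: update.splits)
qed

lemma transport_self_extend: "1 \<le> l \<Longrightarrow> l \<le> k \<Longrightarrow> transport u l (u l) = transport u k (u l)"
  unfolding transport_def by (rule gs_sum_extend)

text \<open>An iterate adapted to \<open>l\<close> coordinates does not respond to later ones, so
  the memory matrix is triangular and all its sums may run to a common limit.\<close>

lemma cotransport_extend:
  assumes "y \<in> adapted coord l" "l \<le> k"
  shows "cotransport u l y = cotransport u k y"
  unfolding cotransport_def using assms(2)
  by (intro sum.mono_neutral_left) (auto simp: coord_orthogonal[OF assms(1)])

lemma const_adapted: "cl (\<lambda>_. a) \<in> adapted g l"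
  by (simp add: adapted_def coupled_const)

lemma adapted_nem:
  "joint_lipschitz k C f \<Longrightarrow> x \<in> adapted g l \<Longrightarrow> (\<And>j. j \<in> {1..k} \<Longrightarrow> us j \<in> adapted g l) \<Longrightarrow>
    nem k f x us \<in> adapted g l"
  unfolding adapted_def mem_Collect_eq by (rule coupled_nem)

lemma gs_inner_expansion:
  assumes "1 \<le> i" "i \<le> k" shows "(\<Sum>p\<in>{1..k}. (u i \<bullet> gs u p) * (x \<bullet> gs u p)) = u i \<bullet> x"
proof -
  have "u i \<bullet> x = (\<Sum>p\<in>{1..k}. (u i \<bullet> gs u p) *\<^sub>R gs u p) \<bullet> x"
    using gs_expansion[OF assms, of u] by simp
  also have "\<dots> = (\<Sum>p\<in>{1..k}. (u i \<bullet> gs u p) * (x \<bullet> gs u p))"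
    unfolding inner_sum_left inner_scaleR_left by (intro sum.cong refl) (simp add: inner_commute)
  finally show ?thesis by (rule sym)
qed

lemma gaussian_transport:
  fixes u :: "nat \<Rightarrow> 'a::finite l2"
  shows "gaussian k (\<lambda>l. transport u l (u l) :: 'b::finite l2)"
proof (rule gaussian_lincomb[OF gaussian_coord])
  fix j assume "j \<in> {1..k}"
  then show "transport u j (u j) = (\<Sum>i\<in>{1..k}. (u j \<bullet> gs u i) *\<^sub>R (coord i :: 'b l2))"
    by (simp add: transport_self_extend[of j k]) (simp add: transport_def)
qed

lemma transport_self_inner:
  assumes "i \<in> {1..k}" "j \<in> {1..k}"
  shows "transport u i (u i) \<bullet> (transport u j (u j) :: 'b::finite l2) = u i \<bullet> u j"
proof -
  have ij: "1 \<le> i" "i \<le> k" "1 \<le> j" "j \<le> k" using assms by auto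
  show ?thesis
    unfolding transport_self_extend[OF ij(1,2)] transport_self_extend[OF ij(3,4)] transport_inner
    by (rule gs_inner_expansion[OF ij(1,2)])
qed

lemma cotransport_span:
  assumes "l \<le> k"
  shows "\<exists>c. a *\<^sub>R cotransport u l y = (\<Sum>j=1..l. c j *\<^sub>R u j)"
proof -
  have "cotransport u l y \<in> span (u ` {1..l})"
    unfolding cotransport_def
  proof (intro span_sum span_scale)
    fix i assume "i \<in> {1..l}"
    then show "gs u i \<in> span (u ` {1..l})"
      using gs_span[of i u] span_mono[of "u ` {1..i}" "u ` {1..l}"] by fastforce
  qed
  from span_scale[OF this] show ?thesis unfolding span_image_iff .
qed

text \<open>A deterministic vector is adapted to the empty past and hence orthogonal to the first
  coordinate; the memory starts at zero, as (SE-a) demands.\<close>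

lemma cotransport_first:
  assumes "y = cl (\<lambda>_. a)" shows "cotransport u 1 y = 0"
  using coord_orthogonal[OF const_adapted[of a coord 0], of 1] by (simp add: cotransport_def assms)

lemma canonical_state_evolution:
  fixes u :: "nat \<Rightarrow> 'n::finite l2" and v :: "nat \<Rightarrow> 'd::finite l2"
  assumes can: "canonical u1 v1 upd k u v" and k: "1 \<le> k"
  defines "s \<equiv> sqrt (real CARD('n) / real CARD('d))"
  shows "state_evolution_l2 u1 v1 upd k (\<lambda>l. transport u l (u l)) v (\<lambda>l. s *\<^sub>R cotransport v l (u l))
     (\<lambda>l. transport v l (v l)) u (\<lambda>l. cotransport u l (v l))"
proof -
  note C = can[unfolded canonical_def Let_def s_def[symmetric]]
  have ad: "u l \<in> adapted coord l" "v l \<in> adapted coord l" if "l \<in> {1..k}" for l using C that by blast+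
  have 1: "u 1 = cl (\<lambda>_. u1)" "v 1 = cl (\<lambda>_. v1)" using C by blast+
  have up: "case upd l of
          First_Order fu fv \<Rightarrow>
            u l = nem (l - 1) fu (s *\<^sub>R transport v (l - 1) (v (l - 1)) - cotransport u (l - 1) (v (l - 1))) u \<and>
            v l = nem (l - 1) fv (transport u (l - 1) (u (l - 1)) - s *\<^sub>R cotransport v (l - 1) (u (l - 1))) v
        | Saddle \<phi>u \<phi>v \<Rightarrow>
            s *\<^sub>R transport v l (v l) - cotransport u l (v l) = nem (l - 1) (\<lambda>x X. grad (\<lambda>y. \<phi>u y X) x) (u l) u \<and>
            transport u l (u l) - s *\<^sub>R cotransport v l (u l) = nem (l - 1) (\<lambda>x X. grad (\<lambda>y. \<phi>v y X) x) (v l) v"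
    if l: "l \<in> {2..k}" for l
  proof -
    obtain n where n: "l = Suc n" "n \<in> {1..<k}" using l by (cases l) auto
    then show ?thesis unfolding n(1) diff_Suc_1 using C n(2) by blast
  qed
  have sp: "\<exists>c. cotransport u l (v l) = (\<Sum>j=1..l. c j *\<^sub>R u j)" "\<exists>c. s *\<^sub>R cotransport v l (u l) = (\<Sum>j=1..l. c j *\<^sub>R v j)" for l
    using cotransport_span[OF order_refl, of 1 u l "v l"] cotransport_span[OF order_refl, of s v l "u l"] by auto
  \<comment> \<open>With all sums extended to the common limit \<open>k\<close>, the cross-moment
    equations are adjointness of \<open>transport\<close> and \<open>cotransport\<close>.\<close>
  have adj: "transport u i (u i) \<bullet> v j = u i \<bullet> cotransport u j (v j)" "s * (transport v i (v i) \<bullet> u j) = v i \<bullet> s *\<^sub>R cotransport v j (u j)"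
    if "i \<in> {1..k}" "j \<in> {1..k}" for i j
    using that by (simp_all add: transport_self_extend[of _ k] cotransport_extend[OF ad(1), of j k] cotransport_extend[OF ad(2), of j k] transport_adjoint)
  have f: "cotransport u 1 (v 1) = 0" "s *\<^sub>R cotransport v 1 (u 1) = 0"
    by (simp_all only: cotransport_first[OF 1(1)] cotransport_first[OF 1(2)] scaleR_zero_right)
  show ?thesis
    unfolding state_evolution_l2_def Let_def s_def[symmetric]
    by (intro conjI ballI 1 f gaussian_transport sp up transport_self_inner adj)
qed

text \<open>The unknowns enter through the Hilbert space saddle equations with
  \<open>\<zeta> = s \<cdot> coord (l + 1)\<close> and \<open>\<xi> = coord (l + 1)\<close>, which are orthogonal to everything already constructed.\<close>

lemma saddle_step_exists:
  fixes u :: "nat \<Rightarrow> 'a::finite l2" and v :: "nat \<Rightarrow> 'b::finite l2"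
  assumes \<mu>: "0 < \<mu>" and Fu: "monotone_field \<mu> C l Fu" "0 \<le> C" and Fv: "monotone_field \<mu> C' l Fv" "0 \<le> C'"
    and ad: "\<And>i. i \<in> {1..l} \<Longrightarrow> u i \<in> adapted coord l" "\<And>i. i \<in> {1..l} \<Longrightarrow> v i \<in> adapted coord l"
    and s: "0 < s"
  obtains x y where "nem l Fu x u = s *\<^sub>R (transport v l y + norm (residual v l y) *\<^sub>R coord (Suc l))
        - (cotransport u l y + (coord (Suc l) \<bullet> y) *\<^sub>R sgn (residual u l x))"
    and "nem l Fv y v = (transport u l x + norm (residual u l x) *\<^sub>R coord (Suc l))
        - s *\<^sub>R (cotransport v l x + (coord (Suc l) \<bullet> x) *\<^sub>R sgn (residual v l y))"
    and "x \<in> adapted coord (Suc l)" "y \<in> adapted coord (Suc l)" "0 \<le> coord (Suc l) \<bullet> x" "0 \<le> coord (Suc l) \<bullet> y"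
proof -
  have lip: "joint_lipschitz l C Fu" "joint_lipschitz l C' Fv" using Fu Fv by (auto simp: monotone_field_def)
  \<comment> \<open>\<open>S\<close> and \<open>S'\<close> are adjoint to each other; they enter the
    two equations with opposite signs, and this makes the coupling skew.\<close>
  define S where "S y = s *\<^sub>R transport v l y - cotransport u l y" for y
  define S' where "S' x = s *\<^sub>R cotransport v l x - transport u l x" for x
  have SW: "S y \<in> adapted coord l" "S' x \<in> adapted coord l" for x y
    unfolding S_def S'_def
    by (intro subspace_diff[OF subspace_adapted] subspace_scale[OF subspace_adapted] transport_adapted cotransport_adapted ad; assumption)+
  have rW: "x - residual u l x \<in> adapted coord l" "y - residual v l y \<in> adapted coord l" for x y
    unfolding residual_def diff_diff_eq2 add_diff_cancel_left'
    by (intro adapted_lincomb gs_adapted ad; assumption)+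
  have nW: "nem l Fu x u \<in> adapted coord l" if "x \<in> adapted coord l" for x
    by (rule adapted_nem[OF lip(1) that ad(1)])
  have nW': "nem l Fv x v \<in> adapted coord l" if "x \<in> adapted coord l" for x
    by (rule adapted_nem[OF lip(2) that ad(2)])
  obtain x y b c where e: "nem l Fu x u = S y + norm (residual v l y) *\<^sub>R (s *\<^sub>R coord (Suc l)) - (coord (Suc l) \<bullet> y) *\<^sub>R sgn (residual u l x)"
    "nem l Fv y v = norm (residual u l x) *\<^sub>R coord (Suc l) - S' x - ((s *\<^sub>R coord (Suc l)) \<bullet> x) *\<^sub>R sgn (residual v l y)"
    and pos: "0 \<le> (s *\<^sub>R coord (Suc l)) \<bullet> x" "0 \<le> coord (Suc l) \<bullet> y" and bc: "0 \<le> b" "0 \<le> c"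
    and sg: "(coord (Suc l) \<bullet> y) *\<^sub>R sgn (residual u l x) = b *\<^sub>R residual u l x" "((s *\<^sub>R coord (Suc l)) \<bullet> x) *\<^sub>R sgn (residual v l y) = c *\<^sub>R residual v l y"
  proof (rule saddle_exists[OF \<mu>, where A = "\<lambda>x. nem l Fu x u" and B = "\<lambda>y. nem l Fv y v" and S = S and S' = S'
      and P = "residual u l" and Q = "residual v l" and \<zeta> = "s *\<^sub>R coord (Suc l)" and \<xi> = "coord (Suc l)"
      and W = "adapted coord l" and W' = "adapted coord l" and C = "\<bar>C\<bar>" and C' = "\<bar>C'\<bar>"])
    show "bounded_linear S" "bounded_linear S'"
      unfolding S_def[abs_def] S'_def[abs_def]
      by (intro bounded_linear_sub bounded_linear_const_scaleR bounded_linear_transport bounded_linear_cotransport)+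
    show "S y \<bullet> x = y \<bullet> S' x" for x y
      unfolding S_def S'_def
      by (simp add: inner_diff_left inner_diff_right transport_adjoint)
        (simp add: transport_adjoint[symmetric] inner_commute)
  qed (fact | rule nem_monotone[OF Fu(1)] nem_monotone[OF Fv(1)] nem_lipschitz[OF lip(1)] nem_lipschitz[OF lip(2)]
      bounded_linear_residual residual_inner subspace_adapted nW nW' SW rW | simp add: coord_orthogonal)+
  have cs: "coord (Suc l) \<in> adapted coord (Suc l)" by (rule coord_adapted) auto
  have up: "z \<in> adapted coord (Suc l)" if "z \<in> adapted coord l" for z :: "'c::finite l2"
    using that adapted_mono[of l "Suc l" coord] by auto
  have adx: "x \<in> adapted coord (Suc l)"
  proof -
    \<comment> \<open>Adding \<open>b x\<close> to both sides leaves
      \<open>b (x - residual u l x)\<close> on the right, a function of the past. So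
      \<open>z\<close> is adapted, and \<open>x\<close> is a resolvent evaluated at
      \<open>z\<close>.\<close>
    define z where "z = S y + norm (residual v l y) *\<^sub>R (s *\<^sub>R coord (Suc l)) + b *\<^sub>R (x - residual u l x)"
    have "nem l Fu x u + b *\<^sub>R x = z"
      unfolding e(1) sg z_def by (simp add: algebra_simps)
    from nem_resolvent[OF Fu(1) \<mu> Fu(2) bc(1) this] have x: "x = nem l (resolvent Fu b) z u" .
    have "z \<in> adapted coord (Suc l)"
      unfolding z_def by (intro subspace_add[OF subspace_adapted] subspace_scale[OF subspace_adapted] up SW rW cs)
    then have "nem l (resolvent Fu b) z u \<in> adapted coord (Suc l)"
      by (rule adapted_nem[OF resolvent_lipschitz[OF Fu(1) \<mu> Fu(2) bc(1)]]) (intro up ad(1))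
    then show ?thesis using x by simp
  qed
  have ady: "y \<in> adapted coord (Suc l)"
  proof -
    define z where "z = norm (residual u l x) *\<^sub>R coord (Suc l) - S' x + c *\<^sub>R (y - residual v l y)"
    have "nem l Fv y v + c *\<^sub>R y = z"
      unfolding e(2) sg z_def by (simp add: algebra_simps)
    from nem_resolvent[OF Fv(1) \<mu> Fv(2) bc(2) this] have y: "y = nem l (resolvent Fv c) z v" .
    have "z \<in> adapted coord (Suc l)"
      unfolding z_def by (intro subspace_add[OF subspace_adapted] subspace_diff[OF subspace_adapted] subspace_scale[OF subspace_adapted] up SW rW cs)
    then have "nem l (resolvent Fv c) z v \<in> adapted coord (Suc l)"
      by (rule adapted_nem[OF resolvent_lipschitz[OF Fv(1) \<mu> Fv(2) bc(2)]]) (intro up ad(2))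
    then show ?thesis using y by simp
  qed
  show ?thesis
  proof (rule that[OF _ _ adx ady])
    show "nem l Fu x u = s *\<^sub>R (transport v l y + norm (residual v l y) *\<^sub>R coord (Suc l))
        - (cotransport u l y + (coord (Suc l) \<bullet> y) *\<^sub>R sgn (residual u l x))"
      unfolding e(1) S_def by (simp add: algebra_simps)
    show "nem l Fv y v = (transport u l x + norm (residual u l x) *\<^sub>R coord (Suc l))
        - s *\<^sub>R (cotransport v l x + (coord (Suc l) \<bullet> x) *\<^sub>R sgn (residual v l y))"
      unfolding e(2) S'_def by (simp add: algebra_simps)
  qed (use pos s in \<open>auto simp: zero_le_mult_iff\<close>)
qed

lemma canonical_exists:
  fixes u1 :: "real^'n::finite" and v1 :: "real^'d::finite" and upd :: "nat \<Rightarrow> ('n, 'd) update"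
  assumes \<mu>: "\<mu> > 0" and adm: "\<And>l. l \<ge> 2 \<Longrightarrow> admissible_update L \<mu> l (upd l)" and "1 \<le> k"
  shows "\<exists>u v. canonical u1 v1 upd k u v"
  using \<open>1 \<le> k\<close>
proof (induction k rule: dec_induct)
  case base
  \<comment> \<open>Deterministic initial vectors have zero response to the first coordinate, so the
    sign conditions hold at the start.\<close>
  have c0: "coord (Suc 0) \<bullet> cl (\<lambda>_. a) = 0" for a :: "real^'m::finite"
    by (rule coord_orthogonal[OF const_adapted[of a coord 0]]) simp
  have "canonical u1 v1 upd 1 (\<lambda>_. cl (\<lambda>_. u1)) (\<lambda>_. cl (\<lambda>_. v1))"
    by (simp add: canonical_def const_adapted Let_def c0)
  then show ?case by blast
next
  case (step l)
  then obtain u v where can: "canonical u1 v1 upd l u v" by blast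
  define s where "s = sqrt (real CARD('n) / real CARD('d))"
  have s: "0 < s" by (simp add: s_def)
  note C = can[unfolded canonical_def Let_def s_def[symmetric]]
  have adl: "u i \<in> adapted coord i" "v i \<in> adapted coord i" if "i \<in> {1..l}" for i using C that by blast+
  have ad: "u i \<in> adapted coord l" "v i \<in> adapted coord l" if "i \<in> {1..l}" for i
    using adl[OF that] adapted_mono[of i l coord] that by auto
  have adm': "admissible_update L \<mu> (Suc l) (upd (Suc l))" using adm[of "Suc l"] step by simp
  let ?u = "\<lambda>x. u(Suc l := x)" and ?v = "\<lambda>y. v(Suc l := y)"
  have ext: "canonical u1 v1 upd l (?u x) (?v y)" for x y
    using can canonical_cong[of l u "?u x" v "?v y" u1 v1 upd] step by auto
  \<comment> \<open>Earlier equations do not involve the new index, so only the conditions at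
    \<open>Suc l\<close> remain.\<close>
  have reduce: "canonical u1 v1 upd (Suc l) (?u x) (?v y)"
    if "x \<in> adapted coord (Suc l)" "y \<in> adapted coord (Suc l)" "0 \<le> coord (Suc l) \<bullet> x" "0 \<le> coord (Suc l) \<bullet> y"
      "case upd (Suc l) of
          First_Order fu fv \<Rightarrow>
            ?u x (Suc l) = nem l fu (s *\<^sub>R transport (?v y) l (?v y l) - cotransport (?u x) l (?v y l)) (?u x) \<and>
            ?v y (Suc l) = nem l fv (transport (?u x) l (?u x l) - s *\<^sub>R cotransport (?v y) l (?u x l)) (?v y)
        | Saddle \<phi>u \<phi>v \<Rightarrow>
            s *\<^sub>R transport (?v y) (Suc l) (?v y (Suc l)) - cotransport (?u x) (Suc l) (?v y (Suc l)) = nem l (\<lambda>x X. grad (\<lambda>y. \<phi>u y X) x) (?u x (Suc l)) (?u x) \<and>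
            transport (?u x) (Suc l) (?u x (Suc l)) - s *\<^sub>R cotransport (?v y) (Suc l) (?u x (Suc l)) = nem l (\<lambda>x X. grad (\<lambda>y. \<phi>v y X) x) (?v y (Suc l)) (?v y)"
    for x y
  proof -
    note E = ext[of x y, unfolded canonical_def Let_def s_def[symmetric]]
    have i1: "j \<in> {1..Suc l} \<longleftrightarrow> j \<in> {1..l} \<or> j = Suc l" and i2: "j \<in> {1..<Suc l} \<longleftrightarrow> j \<in> {1..<l} \<or> j = l" for j
      using step by auto
    show ?thesis
      unfolding canonical_def Let_def s_def[symmetric]
    proof (intro conjI)
      show "?u x 1 = cl (\<lambda>_. u1)" "?v y 1 = cl (\<lambda>_. v1)" using E by blast+
      show "\<forall>j\<in>{1..Suc l}. ?u x j \<in> adapted coord j \<and> ?v y j \<in> adapted coord j \<and> 0 \<le> coord j \<bullet> ?u x j \<and> 0 \<le> coord j \<bullet> ?v y j"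
      proof
        fix j assume "j \<in> {1..Suc l}"
        then consider "j \<in> {1..l}" | "j = Suc l" using i1 by blast
        then show "?u x j \<in> adapted coord j \<and> ?v y j \<in> adapted coord j \<and> 0 \<le> coord j \<bullet> ?u x j \<and> 0 \<le> coord j \<bullet> ?v y j"
          using E that(1-4) by cases (blast, simp)
      qed
    qed (unfold Ball_def i2, use E that(5) in blast)
  qed
  have tr: "transport (?u x) l w = transport u l w" "cotransport (?u x) l w' = cotransport u l w'" "nem l f z (?u x) = nem l f z u" for x w w' f z
    by (rule transport_cong cotransport_cong nem_cong; auto)+
  have tr': "transport (?v x) l w = transport v l w" "cotransport (?v x) l w' = cotransport v l w'" "nem l f z (?v x) = nem l f z v" for x w w' f z
    by (rule transport_cong cotransport_cong nem_cong; auto)+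
  have res: "residual (?u x) l w = residual u l w" for x w
    unfolding residual_def by (intro arg_cong2[where f = minus] refl sum.cong arg_cong2[where f = scaleR] arg_cong2[where f = inner] gs_cong) auto
  have res': "residual (?v x) l w = residual v l w" for x w
    unfolding residual_def by (intro arg_cong2[where f = minus] refl sum.cong arg_cong2[where f = scaleR] arg_cong2[where f = inner] gs_cong) auto
  show ?case
  proof (cases "upd (Suc l)")
    case (First_Order fu fv)
    then have f: "joint_lipschitz l L fu" "joint_lipschitz l L fv"
      using adm' by (auto simp: admissible_update_def)
    define x where "x = nem l fu (s *\<^sub>R transport v l (v l) - cotransport u l (v l)) u"
    define y where "y = nem l fv (transport u l (u l) - s *\<^sub>R cotransport v l (u l)) v"
    have "s *\<^sub>R transport v l (v l) - cotransport u l (v l) \<in> adapted coord l" "transport u l (u l) - s *\<^sub>R cotransport v l (u l) \<in> adapted coord l"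
      by (intro subspace_diff[OF subspace_adapted] subspace_scale[OF subspace_adapted] transport_adapted cotransport_adapted ad; assumption)+
    then have xy: "x \<in> adapted coord l" "y \<in> adapted coord l"
      unfolding x_def y_def using adapted_nem[OF f(1)] adapted_nem[OF f(2)] ad by blast+
    then have "x \<in> adapted coord (Suc l)" "y \<in> adapted coord (Suc l)"
      using adapted_mono[of l "Suc l" coord] by auto
    then have "canonical u1 v1 upd (Suc l) (?u x) (?v y)"
      \<comment> \<open>First-order iterates use only the first \<open>l\<close> coordinates; their
        responses to the next one vanish and satisfy the sign conditions trivially.\<close>
      using coord_orthogonal[OF xy(1), of "Suc l"] coord_orthogonal[OF xy(2), of "Suc l"] step
      by (intro reduce) (simp_all add: First_Order tr tr' x_def y_def)
    then show ?thesis by blast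
  next
    case (Saddle \<phi>u \<phi>v)
    then have sr: "saddle_regular L \<mu> l \<phi>u" "saddle_regular L \<mu> l \<phi>v"
      using adm' by (auto simp: admissible_update_def)
    obtain C where F1: "0 \<le> C" "monotone_field \<mu> C l (\<lambda>x X. grad (\<lambda>y. \<phi>u y X) x)"
      by (rule saddle_regular_monotone_field[OF sr(1)])
    obtain C' where F2: "0 \<le> C'" "monotone_field \<mu> C' l (\<lambda>x X. grad (\<lambda>y. \<phi>v y X) x)"
      by (rule saddle_regular_monotone_field[OF sr(2)])
    note F = F1(2,1) F2(2,1)
    obtain x y where xy: "nem l (\<lambda>x X. grad (\<lambda>y. \<phi>u y X) x) x u = s *\<^sub>R (transport v l y + norm (residual v l y) *\<^sub>R coord (Suc l))
        - (cotransport u l y + (coord (Suc l) \<bullet> y) *\<^sub>R sgn (residual u l x))"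
     "nem l (\<lambda>x X. grad (\<lambda>y. \<phi>v y X) x) y v = (transport u l x + norm (residual u l x) *\<^sub>R coord (Suc l))
        - s *\<^sub>R (cotransport v l x + (coord (Suc l) \<bullet> x) *\<^sub>R sgn (residual v l y))"
     "x \<in> adapted coord (Suc l)" "y \<in> adapted coord (Suc l)" "0 \<le> coord (Suc l) \<bullet> x" "0 \<le> coord (Suc l) \<bullet> y"
      by (rule saddle_step_exists[OF \<mu> F ad s])
    have T: "transport (?u x) (Suc l) x = transport u l x + norm (residual u l x) *\<^sub>R coord (Suc l)"
      "transport (?v y) (Suc l) y = transport v l y + norm (residual v l y) *\<^sub>R coord (Suc l)"
      using transport_Suc[of "?u x" l] transport_Suc[of "?v y" l] by (simp_all add: tr tr' res res')
    have "canonical u1 v1 upd (Suc l) (?u x) (?v y)"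
      by (rule reduce[OF xy(3-6)])
        (simp add: Saddle T cotransport_Suc[of "?u x"] cotransport_Suc[of "?v y"] tr tr' res res' xy(1,2))
    then show ?thesis by blast
  qed
qed

section \<open>Uniqueness\<close>

lemma gram_isometry:
  assumes "\<And>i j. i \<in> I \<Longrightarrow> j \<in> I \<Longrightarrow> a i \<bullet> a j = b i \<bullet> b j"
  shows "(\<Sum>i\<in>I. x i *\<^sub>R a i) \<bullet> (\<Sum>i\<in>I. y i *\<^sub>R a i) = (\<Sum>i\<in>I. x i *\<^sub>R b i) \<bullet> (\<Sum>i\<in>I. y i *\<^sub>R b i)"
  using assms by (simp add: inner_sum_left inner_sum_right)

text \<open>The cross moments say that the innovation of the noise has inner product
  \<open>c (Suc l) * (norm v')^2\<close> with the new iterate, up to the scale \<open>s\<close>. The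
  innovation inequality thus ties the own coefficient \<open>b (Suc l)\<close> to the coefficient
  \<open>c (Suc l)\<close> of the other side.\<close>

lemma innovation_sign:
  fixes h u :: "nat \<Rightarrow> 'a::finite l2" and v :: "nat \<Rightarrow> 'b::finite l2"
  assumes h: "gaussian (Suc l) h" and gram: "\<And>i j. i \<in> {1..Suc l} \<Longrightarrow> j \<in> {1..Suc l} \<Longrightarrow> h i \<bullet> h j = v i \<bullet> v j"
    and v: "v (Suc l) = (\<Sum>j=1..l. q j *\<^sub>R v j) + v'" "\<And>j. j \<in> {1..l} \<Longrightarrow> v' \<bullet> v j = 0"
    and cross: "\<And>i. i \<in> {1..Suc l} \<Longrightarrow> s * (h i \<bullet> u (Suc l)) = v i \<bullet> (\<Sum>j=1..Suc l. c j *\<^sub>R v j)"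
    and eq: "s *\<^sub>R h (Suc l) - (\<Sum>j=1..Suc l. b j *\<^sub>R u j) = A (u (Suc l))"
    and uW: "\<And>j. j \<in> {1..l} \<Longrightarrow> u j \<in> adapted h l"
    and mono: "\<And>x y. \<mu> * (norm (x - y))\<^sup>2 \<le> (A x - A y) \<bullet> (x - y)"
    and lip: "\<And>x y. norm (A x - A y) \<le> C * norm (x - y)"
    and AW: "\<And>x. x \<in> adapted h l \<Longrightarrow> A x \<in> adapted h l"
  shows "(b (Suc l) + \<mu>) * (infdist (u (Suc l)) (adapted h l))\<^sup>2 \<le> c (Suc l) * (norm v')\<^sup>2"
proof -
  define h' where "h' = h (Suc l) - (\<Sum>j=1..l. q j *\<^sub>R h j)"
  \<comment> \<open>The regression coefficients \<open>q\<close> of \<open>v (Suc l)\<close> also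
    serve for \<open>h (Suc l)\<close>, because the two families have the same Gram matrix.\<close>
  have hj: "h' \<bullet> h j = 0" if j: "j \<in> {1..l}" for j
  proof -
    have "h' \<bullet> h j = v (Suc l) \<bullet> v j - (\<Sum>i=1..l. q i * (v i \<bullet> v j))"
      using j by (simp add: h'_def inner_diff_left inner_sum_left gram)
    also have "\<dots> = v' \<bullet> v j" by (simp add: v(1) inner_add_left inner_sum_left)
    finally show ?thesis using v(2)[OF j] by simp
  qed
  have hW: "h' \<bullet> x = 0" if "x \<in> adapted h l" for x
    by (rule innovation_orthogonal[OF h h'_def hj that])
  have v'm: "v' \<bullet> v (Suc l) = (norm v')\<^sup>2"
    unfolding v(1) using v(2) by (simp add: inner_add_right inner_sum_right power2_norm_eq_inner)
  have "s * (h' \<bullet> u (Suc l)) = s * (h (Suc l) \<bullet> u (Suc l)) - (\<Sum>j=1..l. q j * (s * (h j \<bullet> u (Suc l))))"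
    by (simp add: h'_def inner_diff_left inner_sum_left sum_distrib_left right_diff_distrib mult_ac)
  also have "\<dots> = v (Suc l) \<bullet> (\<Sum>j=1..Suc l. c j *\<^sub>R v j) - (\<Sum>j=1..l. q j * (v j \<bullet> (\<Sum>j=1..Suc l. c j *\<^sub>R v j)))"
    by (intro arg_cong2[where f = minus] sum.cong refl arg_cong2[where f = times] cross) auto
  also have "\<dots> = (v (Suc l) - (\<Sum>j=1..l. q j *\<^sub>R v j)) \<bullet> (\<Sum>j=1..Suc l. c j *\<^sub>R v j)"
    by (simp only: inner_diff_left inner_sum_left inner_scaleR_left)
  also have "\<dots> = v' \<bullet> (\<Sum>j=1..Suc l. c j *\<^sub>R v j)" by (simp add: v(1))
  also have "\<dots> = c (Suc l) * (norm v')\<^sup>2"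
    using v(2) v'm by (simp add: inner_add_right inner_sum_right)
  finally have z: "(s *\<^sub>R h') \<bullet> u (Suc l) = c (Suc l) * (norm v')\<^sup>2" by simp
  have "(b (Suc l) + \<mu>) * (infdist (u (Suc l)) (adapted h l))\<^sup>2 \<le> (s *\<^sub>R h') \<bullet> u (Suc l)"
  proof (rule monotone_innovation[OF subspace_adapted _ _ _ mono lip AW])
    show "A (u (Suc l)) + b (Suc l) *\<^sub>R u (Suc l) = (s *\<^sub>R (\<Sum>j=1..l. q j *\<^sub>R h j) - (\<Sum>j=1..l. b j *\<^sub>R u j)) + s *\<^sub>R h'"
      unfolding eq[symmetric] h'_def by (simp add: scaleR_diff_right)
    show "s *\<^sub>R (\<Sum>j=1..l. q j *\<^sub>R h j) - (\<Sum>j=1..l. b j *\<^sub>R u j) \<in> adapted h l"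
      by (intro subspace_diff[OF subspace_adapted] subspace_scale[OF subspace_adapted] adapted_lincomb uW)
        (auto simp: adapted_def intro: coupled_base)
  qed (simp_all add: hW)
  then show ?thesis unfolding z .
qed

text \<open>Suppose \<open>b < 0\<close>. If \<open>c \<ge> 0\<close>, the second inequality gives
  \<open>0 \<le> b * \<alpha>\<close>. If \<open>c < 0\<close>, replacing \<open>\<alpha>\<close>,
  \<open>\<beta>\<close> by the smaller \<open>D^2\<close>, \<open>E^2\<close> and adding gives
  \<open>\<mu> (D^2 + E^2) \<le> 0\<close>, so \<open>E = 0\<close> and again
  \<open>0 \<le> b * \<alpha>\<close>. Here \<open>\<alpha>\<close> and \<open>\<beta>\<close> stand
  for squared innovation norms of the iterates.\<close>

lemma coupled_signs:
  fixes b c \<alpha> \<beta> \<mu> D E :: real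
  assumes \<mu>: "0 < \<mu>" and 1: "(b + \<mu>) * D\<^sup>2 \<le> c * \<beta>" and 2: "(c + \<mu>) * E\<^sup>2 \<le> b * \<alpha>"
    and D: "D\<^sup>2 \<le> \<alpha>" and E: "E\<^sup>2 \<le> \<beta>" and b: "b < 0"
  shows "\<alpha> = 0"
proof -
  have \<alpha>: "0 \<le> \<alpha>" using D zero_le_power2[of D] by linarith
  have "0 \<le> b * \<alpha>"
  proof (cases "0 \<le> c")
    case True
    then have "0 \<le> (c + \<mu>) * E\<^sup>2" using \<mu> by simp
    with 2 show ?thesis by linarith
  next
    case False
    have "b * \<alpha> \<le> b * D\<^sup>2" using D b by (simp add: mult_left_mono_neg)
    moreover have "c * \<beta> \<le> c * E\<^sup>2" using E False by (simp add: mult_left_mono_neg)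
    ultimately have "\<mu> * D\<^sup>2 + \<mu> * E\<^sup>2 \<le> 0" using 1 2 by (simp add: distrib_right)
    then have "\<mu> * E\<^sup>2 \<le> 0" using \<mu> by (smt (verit) mult_nonneg_nonneg zero_le_power2)
    then have "E\<^sup>2 = 0" using \<mu> by (simp add: mult_le_0_iff)
    with 2 show ?thesis by simp
  qed
  with \<alpha> b show ?thesis by (simp add: zero_le_mult_iff)
qed

text \<open>A negative last coefficient occurs only if the last vector depends on the earlier ones,
  and then it can be redistributed among them without changing the sum.\<close>

lemma nonneg_coefficient:
  fixes u :: "nat \<Rightarrow> 'a::real_vector"
  assumes u: "u (Suc l) = (\<Sum>j=1..l. p j *\<^sub>R u j) + u'" and b: "b (Suc l) < 0 \<Longrightarrow> u' = 0"
  obtains b' \<beta> where "0 \<le> \<beta>" "(\<Sum>j=1..Suc l. b j *\<^sub>R u j) = (\<Sum>j=1..l. b' j *\<^sub>R u j) + \<beta> *\<^sub>R u (Suc l)"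
proof (cases "0 \<le> b (Suc l)")
  case True
  then show ?thesis by (intro that[of "b (Suc l)" b]) auto
next
  case False
  have "(\<Sum>j=1..Suc l. b j *\<^sub>R u j) = (\<Sum>j=1..l. (b j + b (Suc l) * p j) *\<^sub>R u j) + 0 *\<^sub>R u (Suc l)"
    using u b False by (simp add: scaleR_add_left sum.distrib scaleR_sum_right)
  then show ?thesis by (intro that[of 0 "\<lambda>j. b j + b (Suc l) * p j"]) simp_all
qed

lemma orthogonal_gs:
  assumes "\<And>j. j \<in> {1..l} \<Longrightarrow> z \<bullet> u j = 0" "i \<in> {1..l}" shows "z \<bullet> gs u i = 0"
proof -
  obtain c where "gs u i = (\<Sum>j=1..i. c j *\<^sub>R u j)"
    using gs_span[of i u] assms(2) unfolding span_image_iff by auto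
  then show ?thesis using assms by (simp add: inner_sum_right)
qed

text \<open>Has the law of \<open>g\<close> if the \<open>u i\<close> have the right Gram matrix, but extends the canonical past by a fresh coordinate.\<close>

definition copy :: "nat \<Rightarrow> (nat \<Rightarrow> 'a::finite l2) \<Rightarrow> (nat \<Rightarrow> real) \<Rightarrow> real \<Rightarrow> nat \<Rightarrow> 'b::finite l2" where
  "copy l u p a = (\<lambda>i. transport u i (u i))
     (Suc l := (\<Sum>j=1..l. p j *\<^sub>R transport u j (u j)) + a *\<^sub>R coord (Suc l))"

lemma copy_past: "past (copy l u p a) l = past (\<lambda>i. transport u i (u i)) l"
  by (auto simp: past_def copy_def fun_eq_iff)

lemma coupled_copy:
  assumes "coupled l g (\<lambda>i. transport u i (u i)) x y" shows "coupled (Suc l) g (copy l u p a) x y"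
proof (rule coupled_mono[of l])
  show "coupled l g (copy l u p a) x y" using assms unfolding coupled_def copy_past .
qed simp

text \<open>\<open>p\<close> and \<open>norm w'\<close> are the regression coefficients and the
  innovation norm of the last column. Together with the Gram matrix of the past they determine the
  whole Gram matrix, and hence the Gaussian law.\<close>

lemma copy_same_law:
  fixes u w :: "nat \<Rightarrow> 'a::finite l2" and g :: "nat \<Rightarrow> 'b::finite l2"
  assumes g: "gaussian (Suc l) g" and gram: "\<And>i j. i \<in> {1..Suc l} \<Longrightarrow> j \<in> {1..Suc l} \<Longrightarrow> g i \<bullet> g j = w i \<bullet> w j"
    and uw: "\<And>i j. i \<in> {1..l} \<Longrightarrow> j \<in> {1..l} \<Longrightarrow> w i \<bullet> w j = u i \<bullet> u j"
    and w: "w (Suc l) = (\<Sum>j=1..l. p j *\<^sub>R w j) + w'" "\<And>j. j \<in> {1..l} \<Longrightarrow> w' \<bullet> w j = 0"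
  shows "same_law (Suc l) g (copy l u p (norm w'))"
proof (rule gaussian_same_law[OF g])
  let ?G = "\<lambda>i. transport u i (u i) :: 'b l2"
  let ?m = "\<Sum>j=1..l. p j *\<^sub>R ?G j"
  have cG: "coord (Suc l) \<bullet> ?G j = 0" if "j \<in> {1..l}" for j
    using coord_orthogonal[OF transport_adapted[of u j "u j"], of "Suc l"] that by simp
  have cm: "coord (Suc l) \<bullet> ?m = 0" using cG by (simp add: inner_sum_right)
  have GG: "?G i \<bullet> ?G j = w i \<bullet> w j" if "i \<in> {1..l}" "j \<in> {1..l}" for i j
    using transport_self_inner[OF that, of u, where 'b = 'b] uw[OF that] by simp
  show "gaussian (Suc l) (copy l u p (norm w') :: nat \<Rightarrow> 'b l2)"
  proof (rule gaussian_lincomb[OF gaussian_coord])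
    fix j assume j: "j \<in> {1..Suc l}"
    show "copy l u p (norm w') j = (\<Sum>i\<in>{1..Suc l}. (if j = Suc l then if i = Suc l then norm w' else \<Sum>j=1..l. p j * (u j \<bullet> gs u i)
        else u j \<bullet> gs u i) *\<^sub>R (coord i :: 'b l2))"
    proof (cases "j = Suc l")
      case True
      have "?m = (\<Sum>j=1..l. p j *\<^sub>R (\<Sum>i=1..l. (u j \<bullet> gs u i) *\<^sub>R coord i))"
        by (intro sum.cong refl arg_cong2[where f = scaleR]) (simp add: transport_self_extend[of _ l], simp add: transport_def)
      also have "\<dots> = (\<Sum>i=1..l. (\<Sum>j=1..l. p j * (u j \<bullet> gs u i)) *\<^sub>R coord i)"
        unfolding scaleR_sum_right scaleR_scaleR scaleR_sum_left by (rule sum.swap)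
      finally show ?thesis using True by (simp add: copy_def)
    next
      case False
      then show ?thesis using j by (simp add: copy_def transport_self_extend[of _ "Suc l"]) (simp add: transport_def)
    qed
  qed
  have wm: "w' \<bullet> (\<Sum>j=1..l. p j *\<^sub>R w j) = 0" using w(2) by (simp add: inner_sum_right)
  have mG: "?m \<bullet> ?G j = w (Suc l) \<bullet> w j" if "j \<in> {1..l}" for j
    using that w by (simp add: inner_sum_left GG inner_add_left)
  have mm: "?m \<bullet> ?m = (\<Sum>j=1..l. p j *\<^sub>R w j) \<bullet> (\<Sum>j=1..l. p j *\<^sub>R w j)"
    by (rule gram_isometry) (rule GG)
  have last: "copy l u p (norm w') (Suc l) \<bullet> (copy l u p (norm w') (Suc l) :: 'b l2) = w (Suc l) \<bullet> w (Suc l)"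
  proof -
    have sq: "(a + b) \<bullet> (a + b) = a \<bullet> a + 2 * (b \<bullet> a) + b \<bullet> b" for a b :: "'c::real_inner"
      by (simp add: inner_add_left inner_add_right inner_commute)
    have "copy l u p (norm w') (Suc l) = ?m + norm w' *\<^sub>R (coord (Suc l) :: 'b l2)" by (simp add: copy_def)
    moreover have "(norm w' *\<^sub>R coord (Suc l)) \<bullet> (norm w' *\<^sub>R (coord (Suc l) :: 'b l2)) = w' \<bullet> w'"
      by (simp only: inner_scaleR_left inner_scaleR_right inner_coord[of "Suc l" "Suc l"] Suc_le_mono le0 One_nat_def)
        (simp add: dot_square_norm power2_eq_square)
    moreover have "(norm w' *\<^sub>R coord (Suc l)) \<bullet> ?m = 0" using cm by simp
    ultimately show ?thesis
      using mm wm unfolding w(1) by (simp only: sq)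
  qed
  have mixed: "copy l u p (norm w') (Suc l) \<bullet> (copy l u p (norm w') j :: 'b l2) = w (Suc l) \<bullet> w j" if "j \<in> {1..l}" for j
    using that mG[OF that] cG[OF that] by (simp add: copy_def inner_add_left)
  fix i j assume ij: "i \<in> {1..Suc l}" "j \<in> {1..Suc l}"
  consider "i \<in> {1..l}" "j \<in> {1..l}" | "i = Suc l" "j = Suc l" | "i = Suc l" "j \<in> {1..l}" | "i \<in> {1..l}" "j = Suc l"
    using ij by fastforce
  then have "copy l u p (norm w') i \<bullet> (copy l u p (norm w') j :: 'b l2) = w i \<bullet> w j"
  proof cases
    case 1 then show ?thesis using GG by (simp add: copy_def)
  next
    case 2 then show ?thesis using last by simp
  next
    case 3 then show ?thesis using mixed by simp
  next
    case 4
    then have "copy l u p (norm w') i \<bullet> (copy l u p (norm w') j :: 'b l2) = copy l u p (norm w') (Suc l) \<bullet> (copy l u p (norm w') i :: 'b l2)"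
      by (simp only: inner_commute)
    also have "\<dots> = w i \<bullet> w j" using mixed[OF 4(1)] 4 by (simp only: inner_commute)
    finally show ?thesis .
  qed
  then show "g i \<bullet> g j = copy l u p (norm w') i \<bullet> (copy l u p (norm w') j :: 'b l2)"
    using gram[OF ij] by simp
qed

text \<open>\<open>x\<close> has the same inner products with the \<open>u j\<close> as
  \<open>w (Suc l)\<close> with the \<open>w j\<close>, so both have the same regression
  coefficients and residual norm. The copied noise thus takes the canonical form in terms of
  \<open>x\<close> itself, whatever \<open>x\<close> is.\<close>

lemma copy_last:
  fixes u w :: "nat \<Rightarrow> 'a::finite l2"
  assumes uw: "\<And>i j. i \<in> {1..l} \<Longrightarrow> j \<in> {1..l} \<Longrightarrow> w i \<bullet> w j = u i \<bullet> u j"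
    and w: "w (Suc l) = (\<Sum>j=1..l. p j *\<^sub>R w j) + w'" "\<And>j. j \<in> {1..l} \<Longrightarrow> w' \<bullet> w j = 0"
    and x: "\<And>j. j \<in> {1..l} \<Longrightarrow> x \<bullet> u j = w (Suc l) \<bullet> w j" "x \<bullet> x = w (Suc l) \<bullet> w (Suc l)"
  shows "copy l u p (norm w') (Suc l) = transport u l x + norm (residual u l x) *\<^sub>R (coord (Suc l) :: 'b::finite l2)"
proof -
  define m where "m = (\<Sum>j=1..l. p j *\<^sub>R u j)"
  have orth: "(x - m) \<bullet> u j = 0" if "j \<in> {1..l}" for j
    using that w by (simp add: m_def inner_diff_left inner_sum_left x(1) uw[symmetric] inner_add_left)
  have xe: "x \<bullet> gs u i = m \<bullet> gs u i" if "i \<in> {1..l}" for i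
    using orthogonal_gs[of l "x - m" u i] orth that by (simp add: inner_diff_left)
  have t: "transport u l x = (\<Sum>j=1..l. p j *\<^sub>R transport u j (u j) :: 'b l2)"
  proof -
    have "transport u l x = (transport u l m :: 'b l2)"
      unfolding transport_def by (intro sum.cong refl) (simp add: xe)
    also have "\<dots> = (\<Sum>j=1..l. p j *\<^sub>R transport u l (u j))"
      unfolding m_def
      by (simp add: linear_sum[OF bounded_linear.linear[OF bounded_linear_transport]] linear_scale[OF bounded_linear.linear[OF bounded_linear_transport]])
    also have "\<dots> = (\<Sum>j=1..l. p j *\<^sub>R transport u j (u j))"
      by (intro sum.cong refl arg_cong2[where f = scaleR] transport_self_extend[symmetric]) auto
    finally show ?thesis .
  qed
  have r: "residual u l x = x - m"
  proof -
    have "residual u l x = x - (\<Sum>i=1..l. (m \<bullet> gs u i) *\<^sub>R gs u i)"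
      unfolding residual_def by (intro arg_cong2[where f = minus] refl sum.cong arg_cong2[where f = scaleR] xe)
    also have "(\<Sum>i=1..l. (m \<bullet> gs u i) *\<^sub>R gs u i) = (\<Sum>j=1..l. p j *\<^sub>R (\<Sum>i=1..l. (u j \<bullet> gs u i) *\<^sub>R gs u i))"
      unfolding m_def inner_sum_left inner_scaleR_left scaleR_sum_left scaleR_sum_right scaleR_scaleR by (rule sum.swap)
    also have "\<dots> = m"
      unfolding m_def by (intro sum.cong refl arg_cong2[where f = scaleR] gs_expansion[symmetric]) auto
    finally show ?thesis .
  qed
  have "(norm (x - m))\<^sup>2 = (norm w')\<^sup>2"
  proof -
    have mm: "m \<bullet> m = (\<Sum>j=1..l. p j *\<^sub>R w j) \<bullet> (\<Sum>j=1..l. p j *\<^sub>R w j)"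
      unfolding m_def by (rule gram_isometry) (rule uw[symmetric])
    have xm: "x \<bullet> m = w (Suc l) \<bullet> (\<Sum>j=1..l. p j *\<^sub>R w j)"
      by (simp add: m_def inner_sum_right x(1))
    have "(norm w')\<^sup>2 = (w (Suc l) - (\<Sum>j=1..l. p j *\<^sub>R w j)) \<bullet> (w (Suc l) - (\<Sum>j=1..l. p j *\<^sub>R w j))"
      by (simp add: w(1) power2_norm_eq_inner)
    then show ?thesis
      unfolding power2_norm_eq_inner using mm xm x(2)
      by (simp add: inner_diff_left inner_diff_right inner_commute)
  qed
  then have "norm (residual u l x) = norm w'" by (simp add: r)
  then show ?thesis by (simp add: copy_def t)
qed

text \<open>A vector in the span of the \<open>v j\<close> and \<open>y\<close> is determined by its
  inner products with them, even if its coefficients are not. The canonical memory term lies in that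
  span and has the same inner products.\<close>

lemma cotransport_determined:
  fixes v :: "nat \<Rightarrow> 'a::finite l2" and x :: "'b::finite l2"
  assumes 1: "\<And>j. j \<in> {1..l} \<Longrightarrow> w \<bullet> v j = s * (transport v j (v j) \<bullet> x)"
    and 2: "w \<bullet> y = s * ((transport v l y + norm (residual v l y) *\<^sub>R coord (Suc l)) \<bullet> x)"
    and w: "w = (\<Sum>j=1..l. c j *\<^sub>R v j) + \<gamma> *\<^sub>R y"
  shows "w = s *\<^sub>R (cotransport v l x + (coord (Suc l) \<bullet> x) *\<^sub>R sgn (residual v l y))"
proof -
  let ?t = "s *\<^sub>R (cotransport v l x + (coord (Suc l) \<bullet> x) *\<^sub>R sgn (residual v l y))"
  \<comment> \<open>\<open>d\<close> is orthogonal to the spanning vectors, hence to both terms of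
    the difference, hence to itself.\<close>
  define d where "d = w - ?t"
  have dv: "d \<bullet> v j = 0" if j: "j \<in> {1..l}" for j
  proof -
    have "sgn (residual v l y) \<bullet> v j = 0"
      using residual_inner_family[OF j, of v y] by (simp add: sgn_div_norm)
    moreover have "cotransport v l x \<bullet> v j = transport v j (v j) \<bullet> x"
    proof -
      have "transport v j (v j) = (transport v l (v j) :: 'b l2)" using j by (intro transport_self_extend) auto
      then show ?thesis by (metis transport_adjoint inner_commute)
    qed
    ultimately show ?thesis
      using 1[OF j] by (simp add: d_def inner_diff_left inner_add_left)
  qed
  have dy: "d \<bullet> y = 0"
  proof -
    have "sgn (residual v l y) \<bullet> y = norm (residual v l y)"
      using inner_sgn_residual[of y v l] by (simp add: inner_commute)
    moreover have "cotransport v l x \<bullet> y = transport v l y \<bullet> x"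
      by (metis transport_adjoint inner_commute)
    ultimately show ?thesis
      using 2 by (simp add: d_def inner_diff_left inner_add_left algebra_simps)
  qed
  have dg: "d \<bullet> gs v i = 0" if "i \<in> {1..l}" for i using orthogonal_gs[OF dv that] .
  have "d \<bullet> cotransport v l x = 0" using dg by (simp add: cotransport_def inner_sum_right)
  moreover have "d \<bullet> sgn (residual v l y) = 0"
  proof -
    have "d \<bullet> residual v l y = 0" using dy dg by (simp add: residual_def inner_diff_right inner_sum_right)
    then show ?thesis by (simp add: sgn_div_norm)
  qed
  ultimately have "d \<bullet> ?t = 0" by (simp add: inner_add_right)
  moreover have "d \<bullet> w = 0" using dv dy by (simp add: w inner_add_right inner_sum_right)
  ultimately have "d \<bullet> d = 0" by (subst (2) d_def) (simp add: inner_diff_right)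
  then show ?thesis by (simp add: d_def)
qed

text \<open>Nonnegativity of the memory coefficients rules out nonadapted solutions: with \<open>\<beta> \<ge> 0\<close> the iterate is a
  Lipschitz function of the past.\<close>

lemma coefficients_nonneg:
  fixes h u :: "nat \<Rightarrow> 'a::finite l2" and g v :: "nat \<Rightarrow> 'b::finite l2"
  assumes \<mu>: "0 < \<mu>" and h: "gaussian (Suc l) h" and g: "gaussian (Suc l) g"
    and gram: "\<And>i j. i \<in> {1..Suc l} \<Longrightarrow> j \<in> {1..Suc l} \<Longrightarrow> h i \<bullet> h j = v i \<bullet> v j"
      "\<And>i j. i \<in> {1..Suc l} \<Longrightarrow> j \<in> {1..Suc l} \<Longrightarrow> g i \<bullet> g j = u i \<bullet> u j"
    and v: "v (Suc l) = (\<Sum>j=1..l. q j *\<^sub>R v j) + v'" "\<And>j. j \<in> {1..l} \<Longrightarrow> v' \<bullet> v j = 0"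
    and u: "u (Suc l) = (\<Sum>j=1..l. p j *\<^sub>R u j) + u'" "\<And>j. j \<in> {1..l} \<Longrightarrow> u' \<bullet> u j = 0"
    and cross: "\<And>i. i \<in> {1..Suc l} \<Longrightarrow> s * (h i \<bullet> u (Suc l)) = v i \<bullet> (\<Sum>j=1..Suc l. c j *\<^sub>R v j)"
      "\<And>i. i \<in> {1..Suc l} \<Longrightarrow> \<sigma> * (g i \<bullet> v (Suc l)) = u i \<bullet> (\<Sum>j=1..Suc l. b j *\<^sub>R u j)"
    and eq: "s *\<^sub>R h (Suc l) - (\<Sum>j=1..Suc l. b j *\<^sub>R u j) = nem l Fu (u (Suc l)) u"
      "\<sigma> *\<^sub>R g (Suc l) - (\<Sum>j=1..Suc l. c j *\<^sub>R v j) = nem l Fv (v (Suc l)) v"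
    and uW: "\<And>j. j \<in> {1..l} \<Longrightarrow> u j \<in> adapted h l" and vW: "\<And>j. j \<in> {1..l} \<Longrightarrow> v j \<in> adapted g l"
    and Fu: "monotone_field \<mu> C l Fu" "0 \<le> C" and Fv: "monotone_field \<mu> C' l Fv" "0 \<le> C'"
  obtains b' \<beta> where "0 \<le> \<beta>" "(\<Sum>j=1..Suc l. b j *\<^sub>R u j) = (\<Sum>j=1..l. b' j *\<^sub>R u j) + \<beta> *\<^sub>R u (Suc l)"
    "u (Suc l) \<in> adapted h (Suc l)"
proof -
  have lip: "joint_lipschitz l C Fu" "joint_lipschitz l C' Fv" using Fu Fv by (auto simp: monotone_field_def)
  \<comment> \<open>Each side's inequality contains the other side's coefficient, so the two signs
    can be settled only jointly.\<close>
  have 1: "(b (Suc l) + \<mu>) * (infdist (u (Suc l)) (adapted h l))\<^sup>2 \<le> c (Suc l) * (norm v')\<^sup>2"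
    by (rule innovation_sign[OF h gram(1) v cross(1) eq(1) uW nem_monotone[OF Fu(1)] nem_lipschitz[OF lip(1)] adapted_nem[OF lip(1) _ uW]])
  have 2: "(c (Suc l) + \<mu>) * (infdist (v (Suc l)) (adapted g l))\<^sup>2 \<le> b (Suc l) * (norm u')\<^sup>2"
    by (rule innovation_sign[OF g gram(2) u cross(2) eq(2) vW nem_monotone[OF Fv(1)] nem_lipschitz[OF lip(2)] adapted_nem[OF lip(2) _ vW]])
  have "infdist (u (Suc l)) (adapted h l) \<le> norm u'"
    using infdist_le[OF adapted_lincomb[where x = u and c = p and I = "{1..l}", OF uW], of "u (Suc l)"]
    by (simp add: dist_norm u(1))
  then have D: "(infdist (u (Suc l)) (adapted h l))\<^sup>2 \<le> (norm u')\<^sup>2" by (intro power_mono infdist_nonneg)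
  have "infdist (v (Suc l)) (adapted g l) \<le> norm v'"
    using infdist_le[OF adapted_lincomb[where x = v and c = q and I = "{1..l}", OF vW], of "v (Suc l)"]
    by (simp add: dist_norm v(1))
  then have E: "(infdist (v (Suc l)) (adapted g l))\<^sup>2 \<le> (norm v')\<^sup>2" by (intro power_mono infdist_nonneg)
  have "u' = 0" if "b (Suc l) < 0" using coupled_signs[OF \<mu> 1 2 D E that] by simp
  then obtain b' \<beta> where b': "0 \<le> \<beta>" "(\<Sum>j=1..Suc l. b j *\<^sub>R u j) = (\<Sum>j=1..l. b' j *\<^sub>R u j) + \<beta> *\<^sub>R u (Suc l)"
    by (rule nonneg_coefficient[where u = u and p = p and b = b and l = l and u' = u', OF u(1)])
  \<comment> \<open>What remains after \<open>\<beta> *\<^sub>R u (Suc l)\<close> has moved to the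
    left: noise up to \<open>Suc l\<close> and earlier iterates.\<close>
  define z where "z = s *\<^sub>R h (Suc l) - (\<Sum>j=1..l. b' j *\<^sub>R u j)"
  have uW': "u j \<in> adapted h (Suc l)" if "j \<in> {1..l}" for j
    using uW[OF that] adapted_mono[of l "Suc l" h] by auto
  have "nem l Fu (u (Suc l)) u + \<beta> *\<^sub>R u (Suc l) = z"
    unfolding eq(1)[symmetric] b'(2) z_def by (simp add: algebra_simps)
  from nem_resolvent[OF Fu(1) \<mu> Fu(2) b'(1) this] have e: "u (Suc l) = nem l (resolvent Fu \<beta>) z u" .
  have "z \<in> adapted h (Suc l)"
    unfolding z_def
    by (intro subspace_diff[OF subspace_adapted] subspace_scale[OF subspace_adapted] adapted_lincomb uW')
      (auto simp: adapted_def intro: coupled_base)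
  then have "nem l (resolvent Fu \<beta>) z u \<in> adapted h (Suc l)"
    by (rule adapted_nem[OF resolvent_lipschitz[OF Fu(1) \<mu> Fu(2) b'(1)] _ uW'])
  with e have "u (Suc l) \<in> adapted h (Suc l)" by simp
  with b' show ?thesis by (rule that)
qed

text \<open>Both sides are coupled with the same function of \<open>g\<close>, so they
  coincide.\<close>

lemma transfer_equation:
  fixes g h :: "nat \<Rightarrow> 'a::finite l2"
  assumes law: "same_law (Suc l) g h" and F: "joint_lipschitz l C F"
    and past: "\<And>j. j \<in> {1..l} \<Longrightarrow> coupled (Suc l) g h (v j) (w j)" and y: "coupled (Suc l) g h (v (Suc l)) y"
    and eq: "s *\<^sub>R g (Suc l) - ((\<Sum>j=1..l. c j *\<^sub>R v j) + \<gamma> *\<^sub>R v (Suc l)) = nem l F (v (Suc l)) v"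
  shows "s *\<^sub>R h (Suc l) - ((\<Sum>j=1..l. c j *\<^sub>R w j) + \<gamma> *\<^sub>R y) = nem l F y w"
proof (rule coupled_unique[OF law])
  show "coupled (Suc l) g h (nem l F (v (Suc l)) v) (s *\<^sub>R h (Suc l) - ((\<Sum>j=1..l. c j *\<^sub>R w j) + \<gamma> *\<^sub>R y))"
    unfolding eq[symmetric]
    by (intro coupled_diff coupled_add coupled_scaleR coupled_lincomb past y coupled_base) auto
  show "coupled (Suc l) g h (nem l F (v (Suc l)) v) (nem l F y w)"
    by (intro coupled_nem[OF F] y past)
qed

text \<open>The driving noise is a past term plus a nonnegative multiple of a fresh coordinate, and
  with a nonnegative coefficient \<open>\<beta>\<close> the innovation inequality forces the
  response to that coordinate to be nonnegative.\<close>

lemma response_nonneg: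
  fixes u :: "nat \<Rightarrow> 'a::finite l2"
  assumes \<mu>: "0 < \<mu>" and Fu: "monotone_field \<mu> C l Fu" and ad: "\<And>j. j \<in> {1..l} \<Longrightarrow> u j \<in> adapted coord l"
    and eq: "s *\<^sub>R (t + a *\<^sub>R coord (Suc l)) - ((\<Sum>j=1..l. b j *\<^sub>R u j) + \<beta> *\<^sub>R x) = nem l Fu x u"
    and t: "t \<in> adapted coord l" and nn: "0 \<le> a" "0 \<le> \<beta>" "0 < s"
  shows "0 \<le> coord (Suc l) \<bullet> x"
proof -
  have lip: "joint_lipschitz l C Fu" using Fu by (simp add: monotone_field_def)
  have o: "coord (Suc l) \<bullet> w = 0" if "w \<in> adapted coord l" for w :: "'a l2"
    using coord_orthogonal[OF that] by simp
  have m: "(\<beta> + \<mu>) * (infdist x (adapted coord l))\<^sup>2 \<le> ((s * a) *\<^sub>R coord (Suc l)) \<bullet> x"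
  proof (rule monotone_innovation[OF subspace_adapted _ _ _ nem_monotone[OF Fu] nem_lipschitz[OF lip] adapted_nem[OF lip _ ad]])
    show "nem l Fu x u + \<beta> *\<^sub>R x = (s *\<^sub>R t - (\<Sum>j=1..l. b j *\<^sub>R u j)) + (s * a) *\<^sub>R coord (Suc l)"
      unfolding eq[symmetric] by (simp add: scaleR_add_right)
    show "s *\<^sub>R t - (\<Sum>j=1..l. b j *\<^sub>R u j) \<in> adapted coord l"
      by (intro subspace_diff[OF subspace_adapted] subspace_scale[OF subspace_adapted] adapted_lincomb ad t)
  qed (simp_all add: o)
  have "0 \<le> s * a" using nn by simp
  from innovation_response(1)[OF \<mu> this nn(2) infdist_nonneg norm_ge_zero _ orthogonal_inner_infdist[OF subspace_adapted o]] m
  show ?thesis by simp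
qed

text \<open>Copied onto the canonical coordinates, the given solution solves the same saddle equations as the
  canonical one.\<close>

lemma saddle_step_unique:
  fixes u u0 h :: "nat \<Rightarrow> 'a::finite l2" and v v0 g :: "nat \<Rightarrow> 'b::finite l2"
  assumes \<mu>: "0 < \<mu>" and s: "0 < s"
    and h: "gaussian (Suc l) h" and g: "gaussian (Suc l) g"
    and gram: "\<And>i j. i \<in> {1..Suc l} \<Longrightarrow> j \<in> {1..Suc l} \<Longrightarrow> h i \<bullet> h j = v i \<bullet> v j"
      "\<And>i j. i \<in> {1..Suc l} \<Longrightarrow> j \<in> {1..Suc l} \<Longrightarrow> g i \<bullet> g j = u i \<bullet> u j"
    and cross: "\<And>i. i \<in> {1..Suc l} \<Longrightarrow> s * (h i \<bullet> u (Suc l)) = v i \<bullet> (\<Sum>j=1..Suc l. c j *\<^sub>R v j)"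
      "\<And>i. i \<in> {1..Suc l} \<Longrightarrow> g i \<bullet> v (Suc l) = u i \<bullet> (\<Sum>j=1..Suc l. b j *\<^sub>R u j)"
    and eq: "s *\<^sub>R h (Suc l) - (\<Sum>j=1..Suc l. b j *\<^sub>R u j) = nem l Fu (u (Suc l)) u"
      "g (Suc l) - (\<Sum>j=1..Suc l. c j *\<^sub>R v j) = nem l Fv (v (Suc l)) v"
    and Fu: "monotone_field \<mu> C l Fu" "0 \<le> C" and Fv: "monotone_field \<mu> C' l Fv" "0 \<le> C'"
    and past: "\<And>j. j \<in> {1..l} \<Longrightarrow> coupled l h (\<lambda>i. transport v0 i (v0 i)) (u j) (u0 j)"
      "\<And>j. j \<in> {1..l} \<Longrightarrow> coupled l g (\<lambda>i. transport u0 i (u0 i)) (v j) (v0 j)"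
    and gram0: "\<And>i j. i \<in> {1..l} \<Longrightarrow> j \<in> {1..l} \<Longrightarrow> u i \<bullet> u j = u0 i \<bullet> u0 j"
      "\<And>i j. i \<in> {1..l} \<Longrightarrow> j \<in> {1..l} \<Longrightarrow> v i \<bullet> v j = v0 i \<bullet> v0 j"
    and ad: "\<And>j. j \<in> {1..l} \<Longrightarrow> u0 j \<in> adapted coord l" "\<And>j. j \<in> {1..l} \<Longrightarrow> v0 j \<in> adapted coord l"
    and eq0: "s *\<^sub>R transport v0 (Suc l) (v0 (Suc l)) - cotransport u0 (Suc l) (v0 (Suc l)) = nem l Fu (u0 (Suc l)) u0"
      "transport u0 (Suc l) (u0 (Suc l)) - s *\<^sub>R cotransport v0 (Suc l) (u0 (Suc l)) = nem l Fv (v0 (Suc l)) v0"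
    and pos0: "0 \<le> coord (Suc l) \<bullet> u0 (Suc l)" "0 \<le> coord (Suc l) \<bullet> v0 (Suc l)"
  shows "coupled (Suc l) h (\<lambda>i. transport v0 i (v0 i)) (u (Suc l)) (u0 (Suc l)) \<and>
    coupled (Suc l) g (\<lambda>i. transport u0 i (u0 i)) (v (Suc l)) (v0 (Suc l)) \<and>
    (\<forall>j\<in>{1..Suc l}. u (Suc l) \<bullet> u j = u0 (Suc l) \<bullet> u0 j \<and> v (Suc l) \<bullet> v j = v0 (Suc l) \<bullet> v0 j)"
proof -
  have lip: "joint_lipschitz l C Fu" "joint_lipschitz l C' Fv" using Fu Fv by (auto simp: monotone_field_def)
  obtain p where p: "u (Suc l) = (\<Sum>j=1..l. p j *\<^sub>R u j) + residual u l (u (Suc l))" by (rule residual_decomp)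
  obtain q where q: "v (Suc l) = (\<Sum>j=1..l. q j *\<^sub>R v j) + residual v l (v (Suc l))" by (rule residual_decomp)
  define u' v' where "u' = residual u l (u (Suc l))" and "v' = residual v l (v (Suc l))"
  note pu = p[folded u'_def] and qv = q[folded v'_def]
  have uo: "u' \<bullet> u j = 0" and vo: "v' \<bullet> v j = 0" if "j \<in> {1..l}" for j
    using that by (simp_all add: u'_def v'_def residual_inner_family)
  have W: "u j \<in> adapted h l" "v j \<in> adapted g l" if "j \<in> {1..l}" for j
    using past[OF that] by (auto simp: adapted_def intro: coupled_fst)
  \<comment> \<open>The side without \<open>\<Lambda>\<close> is written with the factor 1, so that
    the coefficient lemma applies with the two sides in either order.\<close>
  have cross': "1 * (g i \<bullet> v (Suc l)) = u i \<bullet> (\<Sum>j=1..Suc l. b j *\<^sub>R u j)" if "i \<in> {1..Suc l}" for i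
    using cross(2)[OF that] by simp
  have eq': "1 *\<^sub>R g (Suc l) - (\<Sum>j=1..Suc l. c j *\<^sub>R v j) = nem l Fv (v (Suc l)) v"
    using eq(2) by simp
  obtain b' \<beta> where b: "0 \<le> \<beta>" "(\<Sum>j=1..Suc l. b j *\<^sub>R u j) = (\<Sum>j=1..l. b' j *\<^sub>R u j) + \<beta> *\<^sub>R u (Suc l)"
    and adu: "u (Suc l) \<in> adapted h (Suc l)"
    by (rule coefficients_nonneg[OF \<mu> h g gram qv vo pu uo cross(1) cross' eq(1) eq' W Fu Fv])
  obtain c' \<gamma> where c: "0 \<le> \<gamma>" "(\<Sum>j=1..Suc l. c j *\<^sub>R v j) = (\<Sum>j=1..l. c' j *\<^sub>R v j) + \<gamma> *\<^sub>R v (Suc l)"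
    and adv: "v (Suc l) \<in> adapted g (Suc l)"
    by (rule coefficients_nonneg[OF \<mu> g h gram(2,1) pu uo qv vo cross' cross(1) eq' eq(1) W(2,1) Fv Fu])
  \<comment> \<open>The amplitudes are the innovation norms of the given solution, not those of the
    canonical one, whose agreement with them is not yet known.\<close>
  define H where "H = (copy l v0 q (norm v') :: nat \<Rightarrow> 'a l2)"
  define G where "G = (copy l u0 p (norm u') :: nat \<Rightarrow> 'b l2)"
  have lawH: "same_law (Suc l) h H" unfolding H_def by (rule copy_same_law[OF h gram(1) gram0(2) qv vo])
  have lawG: "same_law (Suc l) g G" unfolding G_def by (rule copy_same_law[OF g gram(2) gram0(1) pu uo])
  have pH: "coupled (Suc l) h H (u j) (u0 j)" and pG: "coupled (Suc l) g G (v j) (v0 j)" if "j \<in> {1..l}" for j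
    unfolding H_def G_def by (rule coupled_copy, rule past, rule that)+
  obtain x where x: "coupled (Suc l) h H (u (Suc l)) x" using coupled_ex[OF lawH] adu by (auto simp: adapted_def)
  obtain y where y: "coupled (Suc l) g G (v (Suc l)) y" using coupled_ex[OF lawG] adv by (auto simp: adapted_def)
  have xx: "x \<bullet> u0 j = u (Suc l) \<bullet> u j" and yy: "y \<bullet> v0 j = v (Suc l) \<bullet> v j" if "j \<in> {1..l}" for j
    using coupled_inner[OF lawH x pH[OF that]] coupled_inner[OF lawG y pG[OF that]] by auto
  have xx': "x \<bullet> x = u (Suc l) \<bullet> u (Suc l)" and yy': "y \<bullet> y = v (Suc l) \<bullet> v (Suc l)"
    using coupled_inner[OF lawH x x] coupled_inner[OF lawG y y] by auto
  \<comment> \<open>The amplitude of the copy is now the residual norm of \<open>y\<close> itself,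
    as in the saddle system.\<close>
  have Hl: "H (Suc l) = transport v0 l y + norm (residual v0 l y) *\<^sub>R coord (Suc l)"
    unfolding H_def by (rule copy_last[OF gram0(2) qv vo yy yy'])
  have Gl: "G (Suc l) = transport u0 l x + norm (residual u0 l x) *\<^sub>R coord (Suc l)"
    unfolding G_def by (rule copy_last[OF gram0(1) pu uo xx xx'])
  have Hp: "H j = transport v0 j (v0 j)" and Gp: "G j = transport u0 j (u0 j)" if "j \<in> {1..l}" for j
    using that by (simp_all add: H_def G_def copy_def)
  have ex: "s *\<^sub>R H (Suc l) - ((\<Sum>j=1..l. b' j *\<^sub>R u0 j) + \<beta> *\<^sub>R x) = nem l Fu x u0"
    by (rule transfer_equation[where v = u and w = u0 and l = l and c = b', OF lawH lip(1) pH x]) (use eq(1) b(2) in simp_all)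
  have ey: "1 *\<^sub>R G (Suc l) - ((\<Sum>j=1..l. c' j *\<^sub>R v0 j) + \<gamma> *\<^sub>R y) = nem l Fv y v0"
    by (rule transfer_equation[where v = v and w = v0 and l = l and c = c', OF lawG lip(2) pG y]) (use eq(2) c(2) in simp_all)
  have posx: "0 \<le> coord (Suc l) \<bullet> x"
    by (rule response_nonneg[OF \<mu> Fu(1) ad(1) ex[unfolded Hl] transport_adapted _ b(1) s]) auto
  have posy: "0 \<le> coord (Suc l) \<bullet> y"
    by (rule response_nonneg[OF \<mu> Fv(1) ad(2) ey[unfolded Gl] transport_adapted _ c(1)]) auto
  have cb: "coupled (Suc l) h H (\<Sum>j=1..Suc l. b j *\<^sub>R u j) ((\<Sum>j=1..l. b' j *\<^sub>R u0 j) + \<beta> *\<^sub>R x)"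
    unfolding b(2) by (intro coupled_add coupled_scaleR coupled_lincomb pH x)
  have cc: "coupled (Suc l) g G (\<Sum>j=1..Suc l. c j *\<^sub>R v j) ((\<Sum>j=1..l. c' j *\<^sub>R v0 j) + \<gamma> *\<^sub>R y)"
    unfolding c(2) by (intro coupled_add coupled_scaleR coupled_lincomb pG y)
  have hx: "h i \<bullet> u (Suc l) = H i \<bullet> x" and gy: "g i \<bullet> v (Suc l) = G i \<bullet> y" if "i \<in> {1..Suc l}" for i
    using coupled_inner[OF lawH coupled_base[OF that] x] coupled_inner[OF lawG coupled_base[OF that] y] by auto
  \<comment> \<open>The transferred memory term need not have canonical coefficients, but its inner
    products agree with the canonical expression, and this identifies the vector.\<close>
  have mem_x: "(\<Sum>j=1..l. c' j *\<^sub>R v0 j) + \<gamma> *\<^sub>R y = s *\<^sub>R (cotransport v0 l x + (coord (Suc l) \<bullet> x) *\<^sub>R sgn (residual v0 l y))"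
  proof (rule cotransport_determined[OF _ _ refl])
    fix j assume j: "j \<in> {1..l}"
    have "((\<Sum>j=1..l. c' j *\<^sub>R v0 j) + \<gamma> *\<^sub>R y) \<bullet> v0 j = v j \<bullet> (\<Sum>j=1..Suc l. c j *\<^sub>R v j)"
      using coupled_inner[OF lawG cc pG[OF j]] by (simp only: inner_commute)
    also have "\<dots> = s * (H j \<bullet> x)" using cross(1)[of j] hx[of j] j by simp
    finally show "((\<Sum>j=1..l. c' j *\<^sub>R v0 j) + \<gamma> *\<^sub>R y) \<bullet> v0 j = s * (transport v0 j (v0 j) \<bullet> x)"
      by (simp only: Hp[OF j])
  next
    have "((\<Sum>j=1..l. c' j *\<^sub>R v0 j) + \<gamma> *\<^sub>R y) \<bullet> y = v (Suc l) \<bullet> (\<Sum>j=1..Suc l. c j *\<^sub>R v j)"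
      using coupled_inner[OF lawG cc y] by (simp only: inner_commute)
    also have "\<dots> = s * (H (Suc l) \<bullet> x)" using cross(1)[of "Suc l"] hx[of "Suc l"] by simp
    finally show "((\<Sum>j=1..l. c' j *\<^sub>R v0 j) + \<gamma> *\<^sub>R y) \<bullet> y = s * ((transport v0 l y + norm (residual v0 l y) *\<^sub>R coord (Suc l)) \<bullet> x)"
      by (simp only: Hl)
  qed
  have mem_y: "(\<Sum>j=1..l. b' j *\<^sub>R u0 j) + \<beta> *\<^sub>R x = 1 *\<^sub>R (cotransport u0 l y + (coord (Suc l) \<bullet> y) *\<^sub>R sgn (residual u0 l x))"
  proof (rule cotransport_determined[OF _ _ refl])
    fix j assume j: "j \<in> {1..l}"
    have "((\<Sum>j=1..l. b' j *\<^sub>R u0 j) + \<beta> *\<^sub>R x) \<bullet> u0 j = u j \<bullet> (\<Sum>j=1..Suc l. b j *\<^sub>R u j)"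
      using coupled_inner[OF lawH cb pH[OF j]] by (simp only: inner_commute)
    also have "\<dots> = 1 * (G j \<bullet> y)" using cross(2)[of j] gy[of j] j by simp
    finally show "((\<Sum>j=1..l. b' j *\<^sub>R u0 j) + \<beta> *\<^sub>R x) \<bullet> u0 j = 1 * (transport u0 j (u0 j) \<bullet> y)"
      by (simp only: Gp[OF j])
  next
    have "((\<Sum>j=1..l. b' j *\<^sub>R u0 j) + \<beta> *\<^sub>R x) \<bullet> x = u (Suc l) \<bullet> (\<Sum>j=1..Suc l. b j *\<^sub>R u j)"
      using coupled_inner[OF lawH cb x] by (simp only: inner_commute)
    also have "\<dots> = 1 * (G (Suc l) \<bullet> y)" using cross(2)[of "Suc l"] gy[of "Suc l"] by simp
    finally show "((\<Sum>j=1..l. b' j *\<^sub>R u0 j) + \<beta> *\<^sub>R x) \<bullet> x = 1 * ((transport u0 l x + norm (residual u0 l x) *\<^sub>R coord (Suc l)) \<bullet> y)"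
      by (simp only: Gl)
  qed
  define S where "S y = s *\<^sub>R transport v0 l y - cotransport u0 l y" for y
  define S' where "S' x = s *\<^sub>R cotransport v0 l x - transport u0 l x" for x
  \<comment> \<open>Both pairs solve the same system with nonnegative responses, over the same past
    \<open>u0\<close>, \<open>v0\<close>.\<close>
  have xy: "x = u0 (Suc l) \<and> y = v0 (Suc l)"
  proof (rule saddle_unique[OF \<mu>, where A = "\<lambda>x. nem l Fu x u0" and B = "\<lambda>y. nem l Fv y v0" and S = S and S' = S'
      and P = "residual u0 l" and Q = "residual v0 l" and \<zeta> = "s *\<^sub>R coord (Suc l)" and \<xi> = "coord (Suc l)"])
    show "linear S" "linear S'"
      unfolding S_def[abs_def] S'_def[abs_def]
      by (intro bounded_linear.linear bounded_linear_sub bounded_linear_const_scaleR bounded_linear_transport bounded_linear_cotransport)+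
    show "S y \<bullet> x = y \<bullet> S' x" for x y
      unfolding S_def S'_def
      by (simp add: inner_diff_left inner_diff_right transport_adjoint)
        (simp add: transport_adjoint[symmetric] inner_commute)
    show "nem l Fu x u0 = S y + norm (residual v0 l y) *\<^sub>R (s *\<^sub>R coord (Suc l)) - (coord (Suc l) \<bullet> y) *\<^sub>R sgn (residual u0 l x)"
      unfolding ex[symmetric] mem_y Hl S_def by (simp add: algebra_simps)
    show "nem l Fv y v0 = norm (residual u0 l x) *\<^sub>R coord (Suc l) - S' x - ((s *\<^sub>R coord (Suc l)) \<bullet> x) *\<^sub>R sgn (residual v0 l y)"
      unfolding ey[symmetric] mem_x Gl S'_def by (simp add: algebra_simps)
    show "nem l Fu (u0 (Suc l)) u0 = S (v0 (Suc l)) + norm (residual v0 l (v0 (Suc l))) *\<^sub>R (s *\<^sub>R coord (Suc l)) - (coord (Suc l) \<bullet> v0 (Suc l)) *\<^sub>R sgn (residual u0 l (u0 (Suc l)))"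
      unfolding eq0(1)[symmetric] transport_Suc cotransport_Suc S_def by (simp add: algebra_simps)
    show "nem l Fv (v0 (Suc l)) v0 = norm (residual u0 l (u0 (Suc l))) *\<^sub>R coord (Suc l) - S' (u0 (Suc l)) - ((s *\<^sub>R coord (Suc l)) \<bullet> u0 (Suc l)) *\<^sub>R sgn (residual v0 l (v0 (Suc l)))"
      unfolding eq0(2)[symmetric] transport_Suc cotransport_Suc S'_def by (simp add: algebra_simps)
  qed (rule nem_monotone[OF Fu(1)] nem_monotone[OF Fv(1)] residual_inner | use posx posy pos0 s in simp)+
  \<comment> \<open>With \<open>x\<close> and \<open>y\<close> identified, the copies agree with the
    canonical noise up to \<open>Suc l\<close>, and couplings to the copies become couplings to
    it.\<close>
  have GH: "past G (Suc l) = past (\<lambda>i. transport u0 i (u0 i)) (Suc l)" "past H (Suc l) = past (\<lambda>i. transport v0 i (v0 i)) (Suc l)"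
    using Gp Hp Gl Hl xy by (auto simp: past_def fun_eq_iff transport_Suc le_Suc_eq)
  have "coupled (Suc l) h (\<lambda>i. transport v0 i (v0 i)) (u (Suc l)) (u0 (Suc l))" "coupled (Suc l) g (\<lambda>i. transport u0 i (u0 i)) (v (Suc l)) (v0 (Suc l))"
    using x y xy unfolding coupled_def GH by auto
  moreover have "u (Suc l) \<bullet> u j = u0 (Suc l) \<bullet> u0 j" "v (Suc l) \<bullet> v j = v0 (Suc l) \<bullet> v0 j" if "j \<in> {1..Suc l}" for j
    using xx[of j] yy[of j] xx' yy' xy that by (auto simp: le_Suc_eq)
  ultimately show ?thesis by blast
qed

text \<open>The cross moments fix the inner products of \<open>z\<close> with the
  \<open>v i\<close>, and these are the canonical ones. As \<open>z\<close> lies in their span,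
  \<open>z\<close> equals the combination with the canonical coefficients \<open>c0\<close>, even if
  \<open>c\<close> was a different choice.\<close>

lemma memory_coupled:
  fixes v w0 :: "nat \<Rightarrow> 'a::finite l2" and h H u0' :: "nat \<Rightarrow> 'b::finite l2"
  assumes cp: "\<And>j. j \<in> {1..m} \<Longrightarrow> coupled m g G (v j) (w0 j)"
    and gram: "\<And>i j. i \<in> {1..m} \<Longrightarrow> j \<in> {1..m} \<Longrightarrow> v i \<bullet> v j = w0 i \<bullet> w0 j"
    and hu: "\<And>i. i \<in> {1..m} \<Longrightarrow> h i \<bullet> x = H i \<bullet> y"
    and cross: "\<And>i. i \<in> {1..m} \<Longrightarrow> s * (h i \<bullet> x) = v i \<bullet> z" "\<And>i. i \<in> {1..m} \<Longrightarrow> s * (H i \<bullet> y) = w0 i \<bullet> z0"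
    and span: "z = (\<Sum>j=1..m. c j *\<^sub>R v j)" "z0 = (\<Sum>j=1..m. c0 j *\<^sub>R w0 j)"
  shows "coupled m g G z z0"
proof -
  define d where "d = z - (\<Sum>j=1..m. c0 j *\<^sub>R v j)"
  have o: "d \<bullet> v i = 0" if i: "i \<in> {1..m}" for i
  proof -
    have "v i \<bullet> z = w0 i \<bullet> z0" using cross[OF i] hu[OF i] by simp
    also have "\<dots> = (\<Sum>j=1..m. c0 j * (w0 i \<bullet> w0 j))" by (simp add: span(2) inner_sum_right)
    also have "\<dots> = v i \<bullet> (\<Sum>j=1..m. c0 j *\<^sub>R v j)"
      using i by (simp add: inner_sum_right gram)
    finally show ?thesis by (simp add: d_def inner_diff_right inner_commute[of _ "v i"])
  qed
  have e: "d = (\<Sum>j=1..m. (c j - c0 j) *\<^sub>R v j)"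
    by (simp add: d_def span(1) scaleR_diff_left sum_subtractf)
  have "d \<bullet> d = d \<bullet> (\<Sum>j=1..m. (c j - c0 j) *\<^sub>R v j)" by (rule arg_cong[OF e])
  also have "\<dots> = 0" using o by (simp add: inner_sum_right)
  finally have "d = 0" by simp
  then have "z = (\<Sum>j=1..m. c0 j *\<^sub>R v j)" by (simp add: d_def)
  then show ?thesis unfolding span(2) by (simp only:) (intro coupled_lincomb cp)
qed

text \<open>Induction over the columns. Equality of Gram matrices is carried along since it gives
  equality of the laws of the noise up to the same index, and this in turn transfers inner
  products.\<close>

lemma state_evolution_coupled:
  fixes u1 :: "real^'n::finite" and v1 :: "real^'d::finite" and upd :: "nat \<Rightarrow> ('n, 'd) update"
  assumes \<mu>: "\<mu> > 0" and adm: "\<And>l. l \<ge> 2 \<Longrightarrow> admissible_update L \<mu> l (upd l)"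
    and S: "state_evolution_l2 u1 v1 upd k g v vh h u uh" and can: "canonical u1 v1 upd k u0 v0"
    and l: "1 \<le> l" "l \<le> k"
  defines "s \<equiv> sqrt (real CARD('n) / real CARD('d))"
  defines "G \<equiv> \<lambda>l. transport u0 l (u0 l) :: 'd l2" and "H \<equiv> \<lambda>l. transport v0 l (v0 l) :: 'n l2"
  defines "Vh \<equiv> \<lambda>l. s *\<^sub>R cotransport v0 l (u0 l)" and "Uh \<equiv> \<lambda>l. cotransport u0 l (v0 l)"
  shows "(\<forall>i\<in>{1..l}. coupled l g G (v i) (v0 i) \<and> coupled l h H (u i) (u0 i) \<and>
      coupled l g G (vh i) (Vh i) \<and> coupled l h H (uh i) (Uh i)) \<and>
    (\<forall>i\<in>{1..l}. \<forall>j\<in>{1..l}. u i \<bullet> u j = u0 i \<bullet> u0 j \<and> v i \<bullet> v j = v0 i \<bullet> v0 j) \<and>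
    same_law l g G \<and> same_law l h H"
proof -
  have k: "1 \<le> k" using l by simp
  have s: "0 < s" by (simp add: s_def)
  have S0: "state_evolution_l2 u1 v1 upd k G v0 Vh H u0 Uh"
    unfolding G_def H_def Vh_def Uh_def s_def by (rule canonical_state_evolution[OF can k])
  note E = S[unfolded state_evolution_l2_def Let_def s_def[symmetric]]
  note E0 = S0[unfolded state_evolution_l2_def Let_def s_def[symmetric]]
  note C = can[unfolded canonical_def Let_def s_def[symmetric]]
  have gs: "gaussian k g" "gaussian k h" "gaussian k G" "gaussian k H" using E E0 by blast+
  have gram: "g i \<bullet> g j = u i \<bullet> u j" "h i \<bullet> h j = v i \<bullet> v j" "g i \<bullet> v j = u i \<bullet> uh j" "s * (h i \<bullet> u j) = v i \<bullet> vh j"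
    "G i \<bullet> G j = u0 i \<bullet> u0 j" "H i \<bullet> H j = v0 i \<bullet> v0 j" "G i \<bullet> v0 j = u0 i \<bullet> Uh j" "s * (H i \<bullet> u0 j) = v0 i \<bullet> Vh j"
    if "i \<in> {1..k}" "j \<in> {1..k}" for i j
    using E E0 that by blast+
  \<comment> \<open>The law of the noise up to \<open>m\<close> is available only after the Gram
    matrices of the iterates up to \<open>m\<close> are known to agree, so at each step it comes
    after the new iterates.\<close>
  have laws: "same_law m g G" "same_law m h H"
    if m: "m \<le> k" and eq: "\<And>i j. i \<in> {1..m} \<Longrightarrow> j \<in> {1..m} \<Longrightarrow> u i \<bullet> u j = u0 i \<bullet> u0 j \<and> v i \<bullet> v j = v0 i \<bullet> v0 j" for m
  proof -
    have i: "i \<in> {1..m} \<Longrightarrow> i \<in> {1..k}" for i using m by simp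
    show "same_law m g G"
      by (rule gaussian_same_law[OF gaussian_mono[OF gs(1) m] gaussian_mono[OF gs(3) m]]) (simp only: gram i eq)
    show "same_law m h H"
      by (rule gaussian_same_law[OF gaussian_mono[OF gs(2) m] gaussian_mono[OF gs(4) m]]) (simp only: gram i eq)
  qed
  show ?thesis
    using l
  proof (induction l rule: dec_induct)
    case base
    have 1: "u 1 = u0 1" "v 1 = v0 1" "u0 1 = cl (\<lambda>_. u1)" "v0 1 = cl (\<lambda>_. v1)" "uh 1 = 0" "vh 1 = 0" "Uh 1 = 0" "Vh 1 = 0"
      using E E0 by simp_all
    have "same_law 1 g G" "same_law 1 h H" using laws[of 1] k 1 by auto
    then show ?case using 1 by (simp add: coupled_const coupled_zero)
  next
    case (step l)
    let ?m = "Suc l"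
    have IH: "\<And>i. i \<in> {1..l} \<Longrightarrow> coupled l g G (v i) (v0 i)" "\<And>i. i \<in> {1..l} \<Longrightarrow> coupled l h H (u i) (u0 i)"
      "\<And>i. i \<in> {1..l} \<Longrightarrow> coupled l g G (vh i) (Vh i)" "\<And>i. i \<in> {1..l} \<Longrightarrow> coupled l h H (uh i) (Uh i)"
      and IHg: "\<And>i j. i \<in> {1..l} \<Longrightarrow> j \<in> {1..l} \<Longrightarrow> u i \<bullet> u j = u0 i \<bullet> u0 j" "\<And>i j. i \<in> {1..l} \<Longrightarrow> j \<in> {1..l} \<Longrightarrow> v i \<bullet> v j = v0 i \<bullet> v0 j"
      and lawl: "same_law l g G" "same_law l h H"
      using step by auto
    have mk: "?m \<in> {2..k}" "?m \<in> {1..k}" "?m \<le> k" "l \<in> {1..<k}" "l \<in> {1..l}" using step by auto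
    have sub: "i \<in> {1..?m} \<Longrightarrow> i \<in> {1..k}" for i using mk by auto
    have adm': "admissible_update L \<mu> ?m (upd ?m)" using adm[of ?m] step by simp
    obtain b where b: "uh ?m = (\<Sum>j=1..?m. b j *\<^sub>R u j)" using E mk(2) by blast
    obtain c where c: "vh ?m = (\<Sum>j=1..?m. c j *\<^sub>R v j)" using E mk(2) by blast
    obtain b0 where b0: "Uh ?m = (\<Sum>j=1..?m. b0 j *\<^sub>R u0 j)" using E0 mk(2) by blast
    obtain c0 where c0: "Vh ?m = (\<Sum>j=1..?m. c0 j *\<^sub>R v0 j)" using E0 mk(2) by blast
    have ad: "u0 j \<in> adapted coord l" "v0 j \<in> adapted coord l" if "j \<in> {1..l}" for j
      using C that mk adapted_mono[of j l coord] by auto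
    have up: "case upd ?m of
          First_Order fu fv \<Rightarrow>
            u ?m = nem (?m - 1) fu (s *\<^sub>R h (?m - 1) - uh (?m - 1)) u \<and>
            v ?m = nem (?m - 1) fv (g (?m - 1) - vh (?m - 1)) v
        | Saddle \<phi>u \<phi>v \<Rightarrow>
            s *\<^sub>R h ?m - uh ?m = nem (?m - 1) (\<lambda>x X. grad (\<lambda>y. \<phi>u y X) x) (u ?m) u \<and>
            g ?m - vh ?m = nem (?m - 1) (\<lambda>x X. grad (\<lambda>y. \<phi>v y X) x) (v ?m) v"
      using E mk(1) by blast
    have up0: "case upd ?m of
          First_Order fu fv \<Rightarrow>
            u0 ?m = nem (?m - 1) fu (s *\<^sub>R H (?m - 1) - Uh (?m - 1)) u0 \<and>
            v0 ?m = nem (?m - 1) fv (G (?m - 1) - Vh (?m - 1)) v0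
        | Saddle \<phi>u \<phi>v \<Rightarrow>
            s *\<^sub>R H ?m - Uh ?m = nem (?m - 1) (\<lambda>x X. grad (\<lambda>y. \<phi>u y X) x) (u0 ?m) u0 \<and>
            G ?m - Vh ?m = nem (?m - 1) (\<lambda>x X. grad (\<lambda>y. \<phi>v y X) x) (v0 ?m) v0"
      using E0 mk(1) by blast
    have pos: "0 \<le> coord ?m \<bullet> u0 ?m" "0 \<le> coord ?m \<bullet> v0 ?m" using C mk(2) by blast+
    have new: "coupled ?m h H (u ?m) (u0 ?m) \<and> coupled ?m g G (v ?m) (v0 ?m) \<and>
        (\<forall>j\<in>{1..?m}. u ?m \<bullet> u j = u0 ?m \<bullet> u0 j \<and> v ?m \<bullet> v j = v0 ?m \<bullet> v0 j)"
    proof (cases "upd ?m")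
      case (First_Order fu fv)
      then have f: "joint_lipschitz l L fu" "joint_lipschitz l L fv"
        using adm' by (auto simp: admissible_update_def)
      have e: "u ?m = nem l fu (s *\<^sub>R h l - uh l) u" "v ?m = nem l fv (g l - vh l) v"
        "u0 ?m = nem l fu (s *\<^sub>R H l - Uh l) u0" "v0 ?m = nem l fv (G l - Vh l) v0"
        using up up0 by (simp_all add: First_Order)
      \<comment> \<open>A first-order iterate uses the noise up to \<open>l\<close> only, so the law
        from the induction hypothesis already yields its Gram entries.\<close>
      have cu: "coupled l h H (u ?m) (u0 ?m)"
        unfolding e by (intro coupled_nem[OF f(1)] coupled_diff coupled_scaleR coupled_base IH mk(5))
      have cv: "coupled l g G (v ?m) (v0 ?m)"
        unfolding e by (intro coupled_nem[OF f(2)] coupled_diff coupled_base IH mk(5))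
      have "u ?m \<bullet> u j = u0 ?m \<bullet> u0 j \<and> v ?m \<bullet> v j = v0 ?m \<bullet> v0 j" if "j \<in> {1..?m}" for j
      proof (cases "j = ?m")
        case True
        then show ?thesis using coupled_inner[OF lawl(2) cu cu] coupled_inner[OF lawl(1) cv cv] by simp
      next
        case False
        then have "j \<in> {1..l}" using that by auto
        then show ?thesis using coupled_inner[OF lawl(2) cu IH(2)] coupled_inner[OF lawl(1) cv IH(1)] by simp
      qed
      then show ?thesis using coupled_mono[OF cu, of ?m] coupled_mono[OF cv, of ?m] by simp
    next
      case (Saddle \<phi>u \<phi>v)
      then have sr: "saddle_regular L \<mu> l \<phi>u" "saddle_regular L \<mu> l \<phi>v"
        using adm' by (auto simp: admissible_update_def)
      obtain C1 where F1: "0 \<le> C1" "monotone_field \<mu> C1 l (\<lambda>x X. grad (\<lambda>y. \<phi>u y X) x)"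
        by (rule saddle_regular_monotone_field[OF sr(1)])
      obtain C2 where F2: "0 \<le> C2" "monotone_field \<mu> C2 l (\<lambda>x X. grad (\<lambda>y. \<phi>v y X) x)"
        by (rule saddle_regular_monotone_field[OF sr(2)])
      have e: "s *\<^sub>R h ?m - uh ?m = nem l (\<lambda>x X. grad (\<lambda>y. \<phi>u y X) x) (u ?m) u" "g ?m - vh ?m = nem l (\<lambda>x X. grad (\<lambda>y. \<phi>v y X) x) (v ?m) v"
        "s *\<^sub>R H ?m - Uh ?m = nem l (\<lambda>x X. grad (\<lambda>y. \<phi>u y X) x) (u0 ?m) u0" "G ?m - Vh ?m = nem l (\<lambda>x X. grad (\<lambda>y. \<phi>v y X) x) (v0 ?m) v0"
        using up up0 by (simp_all add: Saddle)
      show ?thesis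
        unfolding G_def H_def
      proof (rule saddle_step_unique[where b = b and c = c, OF \<mu> s _ _ _ _ _ _ _ _ F1(2,1) F2(2,1)])
        show "gaussian ?m h" "gaussian ?m g" by (rule gaussian_mono[OF _ mk(3)], rule gs)+
        show "h i \<bullet> h j = v i \<bullet> v j" "g i \<bullet> g j = u i \<bullet> u j" if "i \<in> {1..?m}" "j \<in> {1..?m}" for i j
          by (rule gram sub that)+
        show "s * (h i \<bullet> u ?m) = v i \<bullet> (\<Sum>j=1..?m. c j *\<^sub>R v j)" "g i \<bullet> v ?m = u i \<bullet> (\<Sum>j=1..?m. b j *\<^sub>R u j)" if "i \<in> {1..?m}" for i
          unfolding b[symmetric] c[symmetric] by (rule gram sub that mk(2))+
        show "0 \<le> coord ?m \<bullet> u0 ?m" "0 \<le> coord ?m \<bullet> v0 ?m" by (rule pos)+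
        show "s *\<^sub>R h ?m - (\<Sum>j=1..?m. b j *\<^sub>R u j) = nem l (\<lambda>x X. grad (\<lambda>y. \<phi>u y X) x) (u ?m) u"
          unfolding b[symmetric] by (rule e(1))
        show "g ?m - (\<Sum>j=1..?m. c j *\<^sub>R v j) = nem l (\<lambda>x X. grad (\<lambda>y. \<phi>v y X) x) (v ?m) v"
          unfolding c[symmetric] by (rule e(2))
        show "s *\<^sub>R transport v0 ?m (v0 ?m) - cotransport u0 ?m (v0 ?m) = nem l (\<lambda>x X. grad (\<lambda>y. \<phi>u y X) x) (u0 ?m) u0"
          by (rule e(3)[unfolded H_def Uh_def])
        show "transport u0 ?m (u0 ?m) - s *\<^sub>R cotransport v0 ?m (u0 ?m) = nem l (\<lambda>x X. grad (\<lambda>y. \<phi>v y X) x) (v0 ?m) v0"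
          by (rule e(4)[unfolded G_def Vh_def])
      qed (erule IH(1,2)[unfolded G_def H_def] IHg ad, assumption?)+
    qed
    have split: "P i" if "i \<in> {1..?m}" "\<And>i. i \<in> {1..l} \<Longrightarrow> P i" "P ?m" for P i
      using that by (cases "i = ?m") auto
    have gm: "u i \<bullet> u j = u0 i \<bullet> u0 j" "v i \<bullet> v j = v0 i \<bullet> v0 j" if ij: "i \<in> {1..?m}" "j \<in> {1..?m}" for i j
    proof -
      have "(u i \<bullet> u j = u0 i \<bullet> u0 j) \<and> (v i \<bullet> v j = v0 i \<bullet> v0 j)"
      proof (cases "i = ?m")
        case True then show ?thesis using new ij by blast
      next
        case i: False
        show ?thesis
        proof (cases "j = ?m")
          case True
          then have "u j \<bullet> u i = u0 j \<bullet> u0 i" "v j \<bullet> v i = v0 j \<bullet> v0 i" using new ij by blast+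
          then show ?thesis by (simp only: inner_commute)
        next
          case False
          then show ?thesis using IHg i ij by auto
        qed
      qed
      then show "u i \<bullet> u j = u0 i \<bullet> u0 j" "v i \<bullet> v j = v0 i \<bullet> v0 j" by auto
    qed
    have law: "same_law ?m g G" "same_law ?m h H" using laws[of ?m] gm mk by blast+
    have cv: "coupled ?m g G (v i) (v0 i)" if "i \<in> {1..?m}" for i
      by (rule split[OF that]) (use new coupled_mono[OF IH(1), of _ ?m] in auto)
    have cu: "coupled ?m h H (u i) (u0 i)" if "i \<in> {1..?m}" for i
      by (rule split[OF that]) (use new coupled_mono[OF IH(2), of _ ?m] in auto)
    have m: "?m \<in> {1..?m}" by simp
    have hu: "h i \<bullet> u ?m = H i \<bullet> u0 ?m" "g i \<bullet> v ?m = G i \<bullet> v0 ?m" if "i \<in> {1..?m}" for i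
      using coupled_inner[OF law(2) coupled_base[OF that] cu[OF m]] coupled_inner[OF law(1) coupled_base[OF that] cv[OF m]] by auto
    \<comment> \<open>The memory terms come last, since they depend on couplings and Gram identities
      at the new level.\<close>
    have vhm: "coupled ?m g G (vh ?m) (Vh ?m)"
    proof (rule memory_coupled[where s = s, OF _ _ _ _ _ c c0])
      fix i j assume i: "i \<in> {1..?m}" and j: "j \<in> {1..?m}"
      show "v i \<bullet> v j = v0 i \<bullet> v0 j" using gm(2)[OF i j] .
    next
      fix i assume i: "i \<in> {1..?m}"
      show "coupled ?m g G (v i) (v0 i)" by (rule cv[OF i])
      show "h i \<bullet> u ?m = H i \<bullet> u0 ?m" by (rule hu(1)[OF i])
      show "s * (h i \<bullet> u ?m) = v i \<bullet> vh ?m" "s * (H i \<bullet> u0 ?m) = v0 i \<bullet> Vh ?m"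
        by (rule gram[OF sub[OF i] mk(2)])+
    qed
    have uhm: "coupled ?m h H (uh ?m) (Uh ?m)"
    proof (rule memory_coupled[where s = 1, OF _ _ _ _ _ b b0])
      fix i j assume i: "i \<in> {1..?m}" and j: "j \<in> {1..?m}"
      show "u i \<bullet> u j = u0 i \<bullet> u0 j" using gm(1)[OF i j] .
    next
      fix i assume i: "i \<in> {1..?m}"
      show "coupled ?m h H (u i) (u0 i)" by (rule cu[OF i])
      show "g i \<bullet> v ?m = G i \<bullet> v0 ?m" by (rule hu(2)[OF i])
      show "1 * (g i \<bullet> v ?m) = u i \<bullet> uh ?m" "1 * (G i \<bullet> v0 ?m) = u0 i \<bullet> Uh ?m"
        unfolding mult_1 by (rule gram[OF sub[OF i] mk(2)])+
    qed
    have cvh: "coupled ?m g G (vh i) (Vh i)" if "i \<in> {1..?m}" for i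
      by (rule split[OF that]) (use vhm coupled_mono[OF IH(3), of _ ?m] in auto)
    have cuh: "coupled ?m h H (uh i) (Uh i)" if "i \<in> {1..?m}" for i
      by (rule split[OF that]) (use uhm coupled_mono[OF IH(4), of _ ?m] in auto)
    show ?case using cv cu cvh cuh gm law by blast
  qed
qed

text \<open>Lifting to random vectors fixes the columns only for indices between 1 and
  \<open>k\<close>.\<close>

lemma state_evolution_l2_cong:
  assumes S: "state_evolution_l2 u1 v1 upd k g v vh h u uh" and k: "1 \<le> k"
    and eq: "\<And>i. i \<in> {1..k} \<Longrightarrow> g' i = g i" "\<And>i. i \<in> {1..k} \<Longrightarrow> v' i = v i" "\<And>i. i \<in> {1..k} \<Longrightarrow> vh' i = vh i"
      "\<And>i. i \<in> {1..k} \<Longrightarrow> h' i = h i" "\<And>i. i \<in> {1..k} \<Longrightarrow> u' i = u i" "\<And>i. i \<in> {1..k} \<Longrightarrow> uh' i = uh i"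
  shows "state_evolution_l2 u1 v1 upd k g' v' vh' h' u' uh'"
proof -
  have one: "1 \<in> {1..k}" using k by simp
  have id: "gaussian k a'" if "gaussian k a" "\<And>i. i \<in> {1..k} \<Longrightarrow> a' i = a i" for a a' :: "nat \<Rightarrow> 'c::finite l2"
    by (rule gaussian_lincomb[OF that(1), where a = "\<lambda>j i. of_bool (i = j)"])
      (use that(2) in \<open>auto simp: of_bool_def if_distrib[of "\<lambda>x. x *\<^sub>R _"] cong: if_cong\<close>)
  have "gaussian k g" "gaussian k h" using S unfolding state_evolution_l2_def Let_def by blast+
  then have "gaussian k g'" "gaussian k h'" using id eq(1,4) by blast+
  moreover have "(\<Sum>j=1..l. c j *\<^sub>R u' j) = (\<Sum>j=1..l. c j *\<^sub>R u j)" "(\<Sum>j=1..l. c j *\<^sub>R v' j) = (\<Sum>j=1..l. c j *\<^sub>R v j)"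
    if "l \<in> {1..k}" for l c
    using eq that by (auto intro!: sum.cong)
  moreover have "nem (l - 1) f x u' = nem (l - 1) f x u" "nem (l - 1) f' x' v' = nem (l - 1) f' x' v" if "l \<in> {2..k}" for l f x f' x'
    using eq that by (auto intro!: nem_cong)
  moreover have "l \<in> {1..k} \<and> l - 1 \<in> {1..k}" if "l \<in> {2..k}" for l using that by auto
  ultimately show ?thesis
    using S eq[OF one] unfolding state_evolution_l2_def Let_def
    by (simp add: eq split: update.splits)
qed

theorem theorem3p1:
  fixes u1 :: "real^'n::finite" and v1 :: "real^'d::finite"
    and upd :: "nat \<Rightarrow> ('n, 'd) update"
    and L \<mu> :: real and k :: nat
  assumes "\<mu> > 0"
    and "\<And>l. l \<ge> 2 \<Longrightarrow> admissible_update L \<mu> l (upd l)"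
    and "k \<ge> 1"
  shows "\<exists>!(P, Q). state_evolution_laws u1 v1 upd k P Q"
proof -
  define s where "s = sqrt (real CARD('n) / real CARD('d))"
  obtain u v where can: "canonical u1 v1 upd k u v"
    using canonical_exists[OF assms] by blast
  define G where "G l = (transport u l (u l) :: 'd l2)" for l
  define H where "H l = (transport v l (v l) :: 'n l2)" for l
  define Vh where "Vh l = s *\<^sub>R cotransport v l (u l)" for l
  define Uh where "Uh l = cotransport u l (v l)" for l
  have S: "state_evolution_l2 u1 v1 upd k G v Vh H u Uh"
    using canonical_state_evolution[OF can assms(3)] unfolding G_def[abs_def] H_def[abs_def] Vh_def[abs_def] Uh_def[abs_def] s_def .
  let ?P = "law3_l2 k G v Vh" and ?Q = "law3_l2 k H u Uh"
  have uniq: "P = ?P \<and> Q = ?Q" if PQ: "state_evolution_laws u1 v1 upd k P Q" for P Q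
  proof -
    obtain G' V' Vh' :: "nat \<Rightarrow> (nat \<Rightarrow> real^'d) \<Rightarrow> real^'d" and H' U' Uh' :: "nat \<Rightarrow> (nat \<Rightarrow> real^'n) \<Rightarrow> real^'n" where
      se: "state_evolution u1 v1 upd k (gaussian_space k) G' V' Vh' (gaussian_space k) H' U' Uh'"
      and PQ': "P = law3 k (gaussian_space k) G' V' Vh'" "Q = law3 k (gaussian_space k) H' U' Uh'"
      using PQ unfolding state_evolution_laws_def Let_def by blast
    have sq: "all_square_integrable k G'" "all_square_integrable k V'" "all_square_integrable k Vh'"
      "all_square_integrable k H'" "all_square_integrable k U'" "all_square_integrable k Uh'"
      using se unfolding state_evolution_def Let_def all_square_integrable_def by blast+
    note S' = iffD1[OF state_evolution_iff[OF assms(2,3) sq] se]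
    note c = state_evolution_coupled[OF assms(1,2) S' can assms(3) order_refl, folded s_def, folded G_def[abs_def] H_def[abs_def] Vh_def Uh_def]
    show ?thesis
      unfolding PQ' law3_emb[OF sq(1-3)] law3_emb[OF sq(4-6)]
      by (intro conjI law3_l2_eqI) (use c in blast)+
  qed
  have "\<exists>P Q. state_evolution_laws u1 v1 upd k P Q"
  proof -
    note C = can[unfolded canonical_def Let_def]
    have adk: "u i \<in> adapted coord k" "v i \<in> adapted coord k" if "i \<in> {1..k}" for i
      using C that adapted_mono[of i k coord] by auto
    have ad: "G l \<in> adapted coord k" "H l \<in> adapted coord k" "Vh l \<in> adapted coord k" "Uh l \<in> adapted coord k" if l: "l \<in> {1..k}" for l
    proof -
      have "l \<le> k" using l by simp
      note m = adapted_mono[OF this, of coord, THEN subsetD]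
      show "G l \<in> adapted coord k" "H l \<in> adapted coord k" unfolding G_def H_def by (rule m, rule transport_adapted)+
      have "u i \<in> adapted coord l" "v i \<in> adapted coord l" if "i \<in> {1..l}" for i
        using C that l by (auto intro: adapted_mono[THEN subsetD])
      then have "cotransport v l (u l) \<in> adapted coord l" "cotransport u l (v l) \<in> adapted coord l"
        by (auto intro: cotransport_adapted)
      then show "Vh l \<in> adapted coord k" "Uh l \<in> adapted coord k"
        unfolding Vh_def Uh_def by (auto intro!: subspace_scale[OF subspace_adapted] m)
    qed
    have choose: "\<exists>X. all_square_integrable k X \<and> (\<forall>i\<in>{1..k}. emb k (X i) = x i)" if "\<And>i. i \<in> {1..k} \<Longrightarrow> x i \<in> adapted coord k" for x :: "nat \<Rightarrow> 'c::finite l2"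
    proof -
      have "\<exists>X. \<forall>i\<in>{1..k}. square_integrable (gaussian_space k) (X i) \<and> emb k (X i) = x i"
        by (rule bchoice) (use that in \<open>blast elim: emb_surj\<close>)
      then show ?thesis unfolding all_square_integrable_def by blast
    qed
    from choose[of G] ad obtain G' where G': "all_square_integrable k G'" "\<And>i. i \<in> {1..k} \<Longrightarrow> emb k (G' i) = G i" by blast
    from choose[of v] adk obtain V' where V': "all_square_integrable k V'" "\<And>i. i \<in> {1..k} \<Longrightarrow> emb k (V' i) = v i" by blast
    from choose[of Vh] ad obtain Vh' where Vh': "all_square_integrable k Vh'" "\<And>i. i \<in> {1..k} \<Longrightarrow> emb k (Vh' i) = Vh i" by blast
    from choose[of H] ad obtain H' where H': "all_square_integrable k H'" "\<And>i. i \<in> {1..k} \<Longrightarrow> emb k (H' i) = H i" by blast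
    from choose[of u] adk obtain U' where U': "all_square_integrable k U'" "\<And>i. i \<in> {1..k} \<Longrightarrow> emb k (U' i) = u i" by blast
    from choose[of Uh] ad obtain Uh' where Uh': "all_square_integrable k Uh'" "\<And>i. i \<in> {1..k} \<Longrightarrow> emb k (Uh' i) = Uh i" by blast
    have "state_evolution u1 v1 upd k (gaussian_space k) G' V' Vh' (gaussian_space k) H' U' Uh'"
      by (rule iffD2[OF state_evolution_iff[OF assms(2,3) G'(1) V'(1) Vh'(1) H'(1) U'(1) Uh'(1)]])
        (assumption | rule state_evolution_l2_cong[OF S assms(3)] G'(2) V'(2) Vh'(2) H'(2) U'(2) Uh'(2))+
    then show ?thesis unfolding state_evolution_laws_def Let_def by blast
  qed
  \<comment> \<open>The laws realised by the chosen representatives need not be computed: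
    \<open>uniq\<close> says that any realised pair is \<open>(?P, ?Q)\<close>.\<close>
  then have "state_evolution_laws u1 v1 upd k ?P ?Q" using uniq by blast
  then have "case (?P, ?Q) of (P, Q) \<Rightarrow> state_evolution_laws u1 v1 upd k P Q"
    by simp
  then show ?thesis
  proof (rule ex1I)
    fix PQ assume "case PQ of (P, Q) \<Rightarrow> state_evolution_laws u1 v1 upd k P Q"
    then show "PQ = (?P, ?Q)"
      using uniq[of "fst PQ" "snd PQ"] by (simp add: case_prod_unfold prod_eq_iff)
  qed
qed

end
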